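(* Let $\mathcal{C}$ be a small category and let $R$ be a flat presheaf of commutative rings on $\mathcal{C}$. Then the category $\mathrm{Mod}_{\mathrm{cart}}(R)$ of cartesian $R$-modules is a Grothendieck category.
   Context: Let $\mathcal{C}$ be a small category. A presheaf of commutative rings $R$ on $\mathcal{C}$ is a functor from $\mathcal{C}^{op}$ to commutative rings; for a morphism $a:v\to w$ in $\mathcal{C}$ it gives a ring homomorphism $R(w)\to R(v)$. It is called flat if for every morphism $v\to w$ of $\mathcal{C}$ the ring $R(v)$ is a flat $R(w)$-module. An $R$-module $M$ is a contravariant functor on $\mathcal{C}$ with an $R(v)$-module $M(v)$ for each object $v$ and, for each morphism $a:v\to w$, an $R(w)$-linear map $M(a^{op}):M(w)\to M(v)$ (with $M(v)$ an $R(w)$-module via $R(w)\to R(v)$). $M$ is cartesian if for each morphism $a:v\to w$ the map $R(v)\otimes_{R(w)}M(w)\to M(v)$, $r\otimes m\mapsto r\,M(a^{op})(m)$, is an isomorphism of $R(v)$-modules. $\mathrm{Mod}_{\mathrm{cart}}(R)$ is the full subcategory of cartesian modules in the category of $R$-modules (morphisms are natural transformations that are $R(v)$-linear at each object $v$). A Grothendieck category is an abelian category with coproducts, exact direct limits and a generator. *)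

theory Defs
  imports "HOL-Algebra.Free_Abelian_Groups" "HOL-Algebra.Module"
begin

section \<open>Smallness\<close>

text \<open>
  HOL has no type of all sets, so ``large'' categories of modules are formed relative to a
  regular infinite cardinal \<open>\<kappa>\<close>, given as a cardinal order on a type \<open>'u\<close> that also supplies the
  elements of the modules. A set is small if its cardinality is less than \<open>\<kappa>\<close>; every small set
  has a copy inside \<open>'u\<close>. For inaccessible \<open>\<kappa>\<close> this is smallness with respect to a Grothendieck
  universe.
\<close>

definition universe :: "'u rel \<Rightarrow> bool" where
  "universe \<kappa> \<longleftrightarrow> Cinfinite \<kappa> \<and> regularCard \<kappa>"

definition small :: "'u rel \<Rightarrow> 'x set \<Rightarrow> bool" where
  "small \<kappa> A \<longleftrightarrow> |A| <o \<kappa>"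

text \<open>Every set is small, together with its power set, with respect to some universe.\<close>

lemma universe_exists:
  fixes A :: "'x set"
  assumes "infinite A"
  shows "\<exists>\<kappa> :: 'x set set rel. universe \<kappa> \<and> small \<kappa> (Pow A) \<and> small \<kappa> A"
proof -
  have inf: "Cinfinite |Pow A|"
    using assms by (simp add: cinfinite_def Field_card_of finite_Pow_iff)
  have "universe (cardSuc |Pow A| )"
    using Cinfinite_cardSuc[OF inf] regularCard_cardSuc[OF inf] by (simp add: universe_def)
  moreover have P: "small (cardSuc |Pow A| ) (Pow A)"
    unfolding small_def by (rule cardSuc_greater) (rule card_of_Card_order)
  moreover have "small (cardSuc |Pow A| ) A"
    using P ordLess_transitive[OF card_of_Pow] unfolding small_def by blast
  ultimately show ?thesis by blast
qed


section \<open>Categories\<close>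

record ('o, 'a) cat =
  Obj :: "'o set"
  Arr :: "'a set"
  Dom :: "'a \<Rightarrow> 'o"
  Cod :: "'a \<Rightarrow> 'o"
  Ident :: "'o \<Rightarrow> 'a"
  Comp :: "'a \<Rightarrow> 'a \<Rightarrow> 'a"

definition Hom :: "('o, 'a) cat \<Rightarrow> 'o \<Rightarrow> 'o \<Rightarrow> 'a set" where
  "Hom D x y = {f \<in> Arr D. Dom D f = x \<and> Cod D f = y}"

text \<open>\<open>Comp D g f\<close> is \<open>g\<close> after \<open>f\<close>.\<close>

locale category =
  fixes D :: "('o, 'a) cat"
  assumes Dom_Obj: "f \<in> Arr D \<Longrightarrow> Dom D f \<in> Obj D"
    and Cod_Obj: "f \<in> Arr D \<Longrightarrow> Cod D f \<in> Obj D"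
    and Ident_Hom: "x \<in> Obj D \<Longrightarrow> Ident D x \<in> Hom D x x"
    and Comp_Hom: "\<lbrakk>f \<in> Hom D x y; g \<in> Hom D y z\<rbrakk> \<Longrightarrow> Comp D g f \<in> Hom D x z"
    and Ident_left: "f \<in> Hom D x y \<Longrightarrow> Comp D (Ident D y) f = f"
    and Ident_right: "f \<in> Hom D x y \<Longrightarrow> Comp D f (Ident D x) = f"
    and Comp_assoc: "\<lbrakk>f \<in> Hom D w x; g \<in> Hom D x y; h \<in> Hom D y z\<rbrakk>
      \<Longrightarrow> Comp D (Comp D h g) f = Comp D h (Comp D g f)"

definition full_subcategory :: "('o, 'a) cat \<Rightarrow> ('o \<Rightarrow> bool) \<Rightarrow> ('o, 'a) cat" where
  "full_subcategory D P =
    D\<lparr>Obj := {x \<in> Obj D. P x}, Arr := {f \<in> Arr D. P (Dom D f) \<and> P (Cod D f)}\<rparr>"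

definition monic :: "('o, 'a) cat \<Rightarrow> 'a \<Rightarrow> bool" where
  "monic D f \<longleftrightarrow> f \<in> Arr D \<and>
    (\<forall>w \<in> Obj D. \<forall>g \<in> Hom D w (Dom D f). \<forall>h \<in> Hom D w (Dom D f).
      Comp D f g = Comp D f h \<longrightarrow> g = h)"

definition epic :: "('o, 'a) cat \<Rightarrow> 'a \<Rightarrow> bool" where
  "epic D f \<longleftrightarrow> f \<in> Arr D \<and>
    (\<forall>w \<in> Obj D. \<forall>g \<in> Hom D (Cod D f) w. \<forall>h \<in> Hom D (Cod D f) w.
      Comp D g f = Comp D h f \<longrightarrow> g = h)"

definition zero_object :: "('o, 'a) cat \<Rightarrow> 'o \<Rightarrow> bool" where
  "zero_object D z \<longleftrightarrow> z \<in> Obj D \<and>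
    (\<forall>x \<in> Obj D. (\<exists>!f. f \<in> Hom D x z) \<and> (\<exists>!f. f \<in> Hom D z x))"

definition zero_arrow :: "('o, 'a) cat \<Rightarrow> 'a \<Rightarrow> bool" where
  "zero_arrow D f \<longleftrightarrow> f \<in> Arr D \<and>
    (\<exists>z. zero_object D z \<and>
      (\<exists>g \<in> Hom D (Dom D f) z. \<exists>h \<in> Hom D z (Cod D f). f = Comp D h g))"

definition is_kernel :: "('o, 'a) cat \<Rightarrow> 'a \<Rightarrow> 'a \<Rightarrow> bool" where
  "is_kernel D f k \<longleftrightarrow>
    f \<in> Arr D \<and> k \<in> Arr D \<and> Cod D k = Dom D f \<and> zero_arrow D (Comp D f k) \<and>
    (\<forall>h \<in> Arr D. Cod D h = Dom D f \<and> zero_arrow D (Comp D f h) \<longrightarrow>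
      (\<exists>!u. u \<in> Hom D (Dom D h) (Dom D k) \<and> Comp D k u = h))"

definition is_cokernel :: "('o, 'a) cat \<Rightarrow> 'a \<Rightarrow> 'a \<Rightarrow> bool" where
  "is_cokernel D f q \<longleftrightarrow>
    f \<in> Arr D \<and> q \<in> Arr D \<and> Dom D q = Cod D f \<and> zero_arrow D (Comp D q f) \<and>
    (\<forall>h \<in> Arr D. Dom D h = Cod D f \<and> zero_arrow D (Comp D h f) \<longrightarrow>
      (\<exists>!u. u \<in> Hom D (Cod D q) (Cod D h) \<and> Comp D u q = h))"

text \<open>Exactness of \<open>0 \<rightarrow> x \<rightarrow> y \<rightarrow> z \<rightarrow> 0\<close>, the two middle arrows being \<open>f\<close> and \<open>g\<close>.\<close>

definition short_exact :: "('o, 'a) cat \<Rightarrow> 'a \<Rightarrow> 'a \<Rightarrow> bool" where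
  "short_exact D f g \<longleftrightarrow> is_kernel D g f \<and> is_cokernel D f g"


section \<open>Abelian categories\<close>

definition Hom_group ::
  "('o, 'a) cat \<Rightarrow> ('a \<Rightarrow> 'a \<Rightarrow> 'a) \<Rightarrow> ('o \<Rightarrow> 'o \<Rightarrow> 'a) \<Rightarrow> 'o \<Rightarrow> 'o \<Rightarrow> 'a monoid" where
  "Hom_group D hadd hzero x y = \<lparr>carrier = Hom D x y, monoid.mult = hadd, one = hzero x y\<rparr>"

locale preadditive_category = category D for D :: "('o, 'a) cat" +
  fixes hadd :: "'a \<Rightarrow> 'a \<Rightarrow> 'a" and hzero :: "'o \<Rightarrow> 'o \<Rightarrow> 'a"
  assumes Hom_comm_group: "\<lbrakk>x \<in> Obj D; y \<in> Obj D\<rbrakk> \<Longrightarrow> comm_group (Hom_group D hadd hzero x y)"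
    and Comp_plus_right: "\<lbrakk>f \<in> Hom D x y; f' \<in> Hom D x y; g \<in> Hom D y z\<rbrakk>
      \<Longrightarrow> Comp D g (hadd f f') = hadd (Comp D g f) (Comp D g f')"
    and Comp_plus_left: "\<lbrakk>f \<in> Hom D x y; g \<in> Hom D y z; g' \<in> Hom D y z\<rbrakk>
      \<Longrightarrow> Comp D (hadd g g') f = hadd (Comp D g f) (Comp D g' f)"

definition is_biproduct ::
  "('o, 'a) cat \<Rightarrow> ('a \<Rightarrow> 'a \<Rightarrow> 'a) \<Rightarrow> 'o \<Rightarrow> 'o \<Rightarrow> 'o \<Rightarrow> 'a \<Rightarrow> 'a \<Rightarrow> 'a \<Rightarrow> 'a \<Rightarrow> bool" where
  "is_biproduct D hadd x y b i1 i2 p1 p2 \<longleftrightarrow> b \<in> Obj D \<and>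
    i1 \<in> Hom D x b \<and> i2 \<in> Hom D y b \<and> p1 \<in> Hom D b x \<and> p2 \<in> Hom D b y \<and>
    Comp D p1 i1 = Ident D x \<and> Comp D p2 i2 = Ident D y \<and>
    hadd (Comp D i1 p1) (Comp D i2 p2) = Ident D b"

definition abelian_category :: "('o, 'a) cat \<Rightarrow> bool" where
  "abelian_category D \<longleftrightarrow>
    (\<exists>hadd hzero. preadditive_category D hadd hzero \<and>
      (\<forall>x \<in> Obj D. \<forall>y \<in> Obj D. \<exists>b i1 i2 p1 p2. is_biproduct D hadd x y b i1 i2 p1 p2)) \<and>
    (\<exists>z. zero_object D z) \<and>
    (\<forall>f \<in> Arr D. \<exists>k. is_kernel D f k) \<and>
    (\<forall>f \<in> Arr D. \<exists>q. is_cokernel D f q) \<and>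
    (\<forall>m. monic D m \<longrightarrow> (\<exists>f. is_kernel D f m)) \<and>
    (\<forall>e. epic D e \<longrightarrow> (\<exists>f. is_cokernel D f e))"


section \<open>Grothendieck categories\<close>

definition is_coproduct ::
  "('o, 'a) cat \<Rightarrow> 'i set \<Rightarrow> ('i \<Rightarrow> 'o) \<Rightarrow> 'o \<Rightarrow> ('i \<Rightarrow> 'a) \<Rightarrow> bool" where
  "is_coproduct D I X c \<iota> \<longleftrightarrow> c \<in> Obj D \<and> (\<forall>i \<in> I. \<iota> i \<in> Hom D (X i) c) \<and>
    (\<forall>y \<in> Obj D. \<forall>f. (\<forall>i \<in> I. f i \<in> Hom D (X i) y) \<longrightarrow>
      (\<exists>!u. u \<in> Hom D c y \<and> (\<forall>i \<in> I. Comp D u (\<iota> i) = f i)))"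

text \<open>
  Index sets are taken in \<open>'u\<close>, which contains a copy of every small set.
\<close>

definition has_coproducts :: "'u rel \<Rightarrow> ('o, 'a) cat \<Rightarrow> bool" where
  "has_coproducts \<kappa> D \<longleftrightarrow>
    (\<forall>(I :: 'u set) X. small \<kappa> I \<and> (\<forall>i \<in> I. X i \<in> Obj D) \<longrightarrow>
      (\<exists>c \<iota>. is_coproduct D I X c \<iota>))"

definition directed_set :: "'i set \<Rightarrow> 'i rel \<Rightarrow> bool" where
  "directed_set I r \<longleftrightarrow> I \<noteq> {} \<and> preorder_on I r \<and>
    (\<forall>i \<in> I. \<forall>j \<in> I. \<exists>k \<in> I. (i, k) \<in> r \<and> (j, k) \<in> r)"

definition direct_system ::
  "('o, 'a) cat \<Rightarrow> 'i set \<Rightarrow> 'i rel \<Rightarrow> ('i \<Rightarrow> 'o) \<Rightarrow> ('i \<Rightarrow> 'i \<Rightarrow> 'a) \<Rightarrow> bool" where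
  "direct_system D I r X \<phi> \<longleftrightarrow>
    (\<forall>i \<in> I. X i \<in> Obj D \<and> \<phi> i i = Ident D (X i)) \<and>
    (\<forall>i j. (i, j) \<in> r \<longrightarrow> \<phi> i j \<in> Hom D (X i) (X j)) \<and>
    (\<forall>i j k. (i, j) \<in> r \<and> (j, k) \<in> r \<longrightarrow> Comp D (\<phi> j k) (\<phi> i j) = \<phi> i k)"

definition direct_system_hom ::
  "('o, 'a) cat \<Rightarrow> 'i set \<Rightarrow> 'i rel \<Rightarrow> ('i \<Rightarrow> 'o) \<Rightarrow> ('i \<Rightarrow> 'i \<Rightarrow> 'a) \<Rightarrow>
    ('i \<Rightarrow> 'o) \<Rightarrow> ('i \<Rightarrow> 'i \<Rightarrow> 'a) \<Rightarrow> ('i \<Rightarrow> 'a) \<Rightarrow> bool" where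
  "direct_system_hom D I r X \<phi> Y \<psi> \<alpha> \<longleftrightarrow>
    (\<forall>i \<in> I. \<alpha> i \<in> Hom D (X i) (Y i)) \<and>
    (\<forall>i j. (i, j) \<in> r \<longrightarrow> Comp D (\<alpha> j) (\<phi> i j) = Comp D (\<psi> i j) (\<alpha> i))"

definition cocone ::
  "('o, 'a) cat \<Rightarrow> 'i set \<Rightarrow> 'i rel \<Rightarrow> ('i \<Rightarrow> 'o) \<Rightarrow> ('i \<Rightarrow> 'i \<Rightarrow> 'a) \<Rightarrow>
    'o \<Rightarrow> ('i \<Rightarrow> 'a) \<Rightarrow> bool" where
  "cocone D I r X \<phi> y f \<longleftrightarrow> y \<in> Obj D \<and> (\<forall>i \<in> I. f i \<in> Hom D (X i) y) \<and>
    (\<forall>i j. (i, j) \<in> r \<longrightarrow> Comp D (f j) (\<phi> i j) = f i)"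

definition is_direct_limit ::
  "('o, 'a) cat \<Rightarrow> 'i set \<Rightarrow> 'i rel \<Rightarrow> ('i \<Rightarrow> 'o) \<Rightarrow> ('i \<Rightarrow> 'i \<Rightarrow> 'a) \<Rightarrow>
    'o \<Rightarrow> ('i \<Rightarrow> 'a) \<Rightarrow> bool" where
  "is_direct_limit D I r X \<phi> l \<iota> \<longleftrightarrow> cocone D I r X \<phi> l \<iota> \<and>
    (\<forall>y f. cocone D I r X \<phi> y f \<longrightarrow>
      (\<exists>!u. u \<in> Hom D l y \<and> (\<forall>i \<in> I. Comp D u (\<iota> i) = f i)))"

definition has_direct_limits :: "'u rel \<Rightarrow> ('o, 'a) cat \<Rightarrow> bool" where
  "has_direct_limits \<kappa> D \<longleftrightarrow>
    (\<forall>(I :: 'u set) r X \<phi>. small \<kappa> I \<and> directed_set I r \<and> direct_system D I r X \<phi> \<longrightarrow>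
      (\<exists>l \<iota>. is_direct_limit D I r X \<phi> l \<iota>))"

text \<open>
  The arrows \<open>a\<close> and \<open>b\<close> below are the ones induced on the direct limits by the homomorphisms of
  direct systems \<open>\<alpha>\<close> and \<open>\<beta>\<close>.
\<close>

definition direct_limits_exact :: "'u rel \<Rightarrow> ('o, 'a) cat \<Rightarrow> bool" where
  "direct_limits_exact \<kappa> D \<longleftrightarrow>
    (\<forall>(I :: 'u set) r X \<phi> Y \<psi> Z \<chi> \<alpha> \<beta> x \<iota>x y \<iota>y z \<iota>z a b.
      small \<kappa> I \<and> directed_set I r \<and>
      direct_system D I r X \<phi> \<and> direct_system D I r Y \<psi> \<and> direct_system D I r Z \<chi> \<and>
      direct_system_hom D I r X \<phi> Y \<psi> \<alpha> \<and> direct_system_hom D I r Y \<psi> Z \<chi> \<beta> \<and>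
      (\<forall>i \<in> I. short_exact D (\<alpha> i) (\<beta> i)) \<and>
      is_direct_limit D I r X \<phi> x \<iota>x \<and> is_direct_limit D I r Y \<psi> y \<iota>y \<and>
      is_direct_limit D I r Z \<chi> z \<iota>z \<and>
      a \<in> Hom D x y \<and> (\<forall>i \<in> I. Comp D a (\<iota>x i) = Comp D (\<iota>y i) (\<alpha> i)) \<and>
      b \<in> Hom D y z \<and> (\<forall>i \<in> I. Comp D b (\<iota>y i) = Comp D (\<iota>z i) (\<beta> i))
      \<longrightarrow> short_exact D a b)"

definition is_generator :: "('o, 'a) cat \<Rightarrow> 'o \<Rightarrow> bool" where
  "is_generator D G \<longleftrightarrow> G \<in> Obj D \<and>
    (\<forall>x \<in> Obj D. \<forall>y \<in> Obj D. \<forall>f \<in> Hom D x y. \<forall>g \<in> Hom D x y. f \<noteq> g \<longrightarrow>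
      (\<exists>h \<in> Hom D G x. Comp D f h \<noteq> Comp D g h))"

definition grothendieck_category :: "'u rel \<Rightarrow> ('o, 'a) cat \<Rightarrow> bool" where
  "grothendieck_category \<kappa> D \<longleftrightarrow>
    abelian_category D \<and> has_coproducts \<kappa> D \<and>
    has_direct_limits \<kappa> D \<and> direct_limits_exact \<kappa> D \<and> (\<exists>G. is_generator D G)"


section \<open>Modules, tensor products and flatness\<close>

text \<open>
  Modules are records satisfying the library predicate \<^const>\<open>module\<close>; the multiplicative fields
  of that record carry no meaning.
\<close>

definition mod_hom ::
  "('r, 'x) ring_scheme \<Rightarrow> ('r, 'm) module \<Rightarrow> ('r, 'n) module \<Rightarrow> ('m \<Rightarrow> 'n) set" where
  "mod_hom A M N = {f \<in> carrier M \<rightarrow> carrier N.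
    (\<forall>x \<in> carrier M. \<forall>y \<in> carrier M. f (x \<oplus>\<^bsub>M\<^esub> y) = f x \<oplus>\<^bsub>N\<^esub> f y) \<and>
    (\<forall>r \<in> carrier A. \<forall>x \<in> carrier M. f (r \<odot>\<^bsub>M\<^esub> x) = r \<odot>\<^bsub>N\<^esub> f x)}"

definition mod_iso ::
  "('r, 'x) ring_scheme \<Rightarrow> ('r, 'm) module \<Rightarrow> ('r, 'n) module \<Rightarrow> ('m \<Rightarrow> 'n) set" where
  "mod_iso A M N = {f \<in> mod_hom A M N. bij_betw f (carrier M) (carrier N)}"

definition ring_as_module :: "'r ring \<Rightarrow> ('r, 'r) module" where
  "ring_as_module B = \<lparr>carrier = carrier B, monoid.mult = monoid.mult B, one = one B,
    zero = zero B, add = add B, smult = monoid.mult B\<rparr>"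

definition restrict_scalars :: "('r \<Rightarrow> 's) \<Rightarrow> ('s, 'm) module \<Rightarrow> ('r, 'm) module" where
  "restrict_scalars \<phi> M = \<lparr>carrier = carrier M, monoid.mult = monoid.mult M, one = one M,
    zero = zero M, add = add M, smult = (\<lambda>r x. smult M (\<phi> r) x)\<rparr>"

text \<open>
  The tensor product of two \<open>A\<close>-modules: the free abelian group on pairs modulo the bilinearity
  relations. Like the library's free abelian groups, it is written multiplicatively.
\<close>

definition tensor_rels ::
  "('r, 'x) ring_scheme \<Rightarrow> ('r, 'm) module \<Rightarrow> ('r, 'n) module \<Rightarrow> (('m \<times> 'n) \<Rightarrow>\<^sub>0 int) set" where
  "tensor_rels A M N =
    {frag_of (x \<oplus>\<^bsub>M\<^esub> x', y) - frag_of (x, y) - frag_of (x', y) |x x' y.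
       x \<in> carrier M \<and> x' \<in> carrier M \<and> y \<in> carrier N} \<union>
    {frag_of (x, y \<oplus>\<^bsub>N\<^esub> y') - frag_of (x, y) - frag_of (x, y') |x y y'.
       x \<in> carrier M \<and> y \<in> carrier N \<and> y' \<in> carrier N} \<union>
    {frag_of (r \<odot>\<^bsub>M\<^esub> x, y) - frag_of (x, r \<odot>\<^bsub>N\<^esub> y) |r x y.
       r \<in> carrier A \<and> x \<in> carrier M \<and> y \<in> carrier N}"

definition tensor_free ::
  "('r, 'm) module \<Rightarrow> ('r, 'n) module \<Rightarrow> (('m \<times> 'n) \<Rightarrow>\<^sub>0 int) monoid" where
  "tensor_free M N = free_Abelian_group (carrier M \<times> carrier N)"

definition tensor_rel_subgroup ::
  "('r, 'x) ring_scheme \<Rightarrow> ('r, 'm) module \<Rightarrow> ('r, 'n) module \<Rightarrow> (('m \<times> 'n) \<Rightarrow>\<^sub>0 int) set" where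
  "tensor_rel_subgroup A M N = generate (tensor_free M N) (tensor_rels A M N)"

definition tensor_group ::
  "('r, 'x) ring_scheme \<Rightarrow> ('r, 'm) module \<Rightarrow> ('r, 'n) module \<Rightarrow> (('m \<times> 'n) \<Rightarrow>\<^sub>0 int) set monoid"
  where
  "tensor_group A M N = tensor_free M N Mod tensor_rel_subgroup A M N"

definition pure_tensor ::
  "('r, 'x) ring_scheme \<Rightarrow> ('r, 'm) module \<Rightarrow> ('r, 'n) module \<Rightarrow> 'm \<Rightarrow> 'n
    \<Rightarrow> (('m \<times> 'n) \<Rightarrow>\<^sub>0 int) set" where
  "pure_tensor A M N x y = tensor_rel_subgroup A M N #>\<^bsub>tensor_free M N\<^esub> frag_of (x, y)"

text \<open>
  For a balanced biadditive map \<open>f\<close> into a commutative group \<open>G\<close>, the map on cosets induced by the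
  additive extension of \<open>f\<close> to the free abelian group, that is, the homomorphism from the tensor
  product determined by \<open>x \<otimes> y \<mapsto> f (x, y)\<close>.
\<close>

definition free_extend :: "('p, 'z) monoid_scheme \<Rightarrow> ('c \<Rightarrow> 'p) \<Rightarrow> ('c \<Rightarrow>\<^sub>0 int) \<Rightarrow> 'p" where
  "free_extend G f c =
    finprod G (\<lambda>p. f p [^]\<^bsub>G\<^esub> Poly_Mapping.lookup c p) (Poly_Mapping.keys c)"

definition tensor_lift :: "('p, 'z) monoid_scheme \<Rightarrow> ('c \<Rightarrow> 'p) \<Rightarrow> ('c \<Rightarrow>\<^sub>0 int) set \<Rightarrow> 'p" where
  "tensor_lift G f = (\<lambda>T. the_elem (free_extend G f ` T))"

text \<open>
  Flatness: tensoring preserves injectivity of linear maps. The test modules range over the small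
  modules with elements in \<open>'u\<close>. If \<open>A\<close> is small these include copies of \<open>A\<close> and of all its ideals,
  so that by the ideal criterion no generality is lost.
\<close>

definition flat_module ::
  "'u rel \<Rightarrow> ('r, 'x) ring_scheme \<Rightarrow> ('r, 'f) module \<Rightarrow> bool" where
  "flat_module \<kappa> A F \<longleftrightarrow> module A F \<and>
    (\<forall>(M :: ('r, 'u) module) (N :: ('r, 'u) module) f.
      module A M \<and> small \<kappa> (carrier M) \<and> module A N \<and> small \<kappa> (carrier N) \<and>
      f \<in> mod_hom A M N \<and> inj_on f (carrier M) \<longrightarrow>
      inj_on (tensor_lift (tensor_group A F N) (\<lambda>(x, m). pure_tensor A F N x (f m)))
        (carrier (tensor_group A F M)))"

text \<open>The \<open>B\<close>-module \<open>B \<otimes>\<^sub>A M\<close> for a ring homomorphism \<open>\<phi>\<close> from \<open>A\<close> to \<open>B\<close>.\<close>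

definition extend_scalars ::
  "'r ring \<Rightarrow> 'r ring \<Rightarrow> ('r \<Rightarrow> 'r) \<Rightarrow> ('r, 'm) module \<Rightarrow> ('r, (('r \<times> 'm) \<Rightarrow>\<^sub>0 int) set) module" where
  "extend_scalars A B \<phi> M =
    (let F = restrict_scalars \<phi> (ring_as_module B); T = tensor_group A F M in
     \<lparr>carrier = carrier T, monoid.mult = undefined, one = undefined,
      zero = one T, add = monoid.mult T,
      smult = (\<lambda>b. tensor_lift T (\<lambda>(x, m). pure_tensor A F M (b \<otimes>\<^bsub>B\<^esub> x) m))\<rparr>)"


section \<open>Presheaves of rings and their modules\<close>

record ('o, 'a, 'r) ring_psh =
  ring_at :: "'o \<Rightarrow> 'r ring"
  ring_res :: "'a \<Rightarrow> 'r \<Rightarrow> 'r"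

record ('o, 'a, 'r, 'u) mod_psh =
  mod_at :: "'o \<Rightarrow> ('r, 'u) module"
  mod_res :: "'a \<Rightarrow> 'u \<Rightarrow> 'u"

definition cring_presheaf :: "('o, 'a) cat \<Rightarrow> ('o, 'a, 'r) ring_psh \<Rightarrow> bool" where
  "cring_presheaf C R \<longleftrightarrow>
    (\<forall>v \<in> Obj C. cring (ring_at R v)) \<and>
    (\<forall>a \<in> Arr C. ring_res R a \<in> ring_hom (ring_at R (Cod C a)) (ring_at R (Dom C a))) \<and>
    (\<forall>v \<in> Obj C. \<forall>x \<in> carrier (ring_at R v). ring_res R (Ident C v) x = x) \<and>
    (\<forall>a \<in> Arr C. \<forall>b \<in> Arr C. Cod C a = Dom C b \<longrightarrow>
      (\<forall>x \<in> carrier (ring_at R (Cod C b)).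
        ring_res R (Comp C b a) x = ring_res R a (ring_res R b x)))"

definition flat_presheaf :: "'u rel \<Rightarrow> ('o, 'a) cat \<Rightarrow> ('o, 'a, 'r) ring_psh \<Rightarrow> bool" where
  "flat_presheaf \<kappa> C R \<longleftrightarrow>
    (\<forall>a \<in> Arr C. flat_module \<kappa> (ring_at R (Cod C a))
      (restrict_scalars (ring_res R a) (ring_as_module (ring_at R (Dom C a)))))"

definition presheaf_module ::
  "('o, 'a) cat \<Rightarrow> ('o, 'a, 'r) ring_psh \<Rightarrow> ('o, 'a, 'r, 'u) mod_psh \<Rightarrow> bool" where
  "presheaf_module C R M \<longleftrightarrow>
    (\<forall>v \<in> Obj C. module (ring_at R v) (mod_at M v)) \<and>
    (\<forall>a \<in> Arr C. mod_res M a \<in> mod_hom (ring_at R (Cod C a)) (mod_at M (Cod C a))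
      (restrict_scalars (ring_res R a) (mod_at M (Dom C a)))) \<and>
    (\<forall>v \<in> Obj C. \<forall>x \<in> carrier (mod_at M v). mod_res M (Ident C v) x = x) \<and>
    (\<forall>a \<in> Arr C. \<forall>b \<in> Arr C. Cod C a = Dom C b \<longrightarrow>
      (\<forall>x \<in> carrier (mod_at M (Cod C b)).
        mod_res M (Comp C b a) x = mod_res M a (mod_res M b x)))"

text \<open>
  Natural transformations. Their components take the value \<^const>\<open>undefined\<close> off the carriers, so that
  equality of arrows is pointwise equality on carriers.
\<close>

definition presheaf_module_hom ::
  "('o, 'a) cat \<Rightarrow> ('o, 'a, 'r) ring_psh \<Rightarrow> ('o, 'a, 'r, 'u) mod_psh \<Rightarrow> ('o, 'a, 'r, 'u) mod_psh
    \<Rightarrow> ('o \<Rightarrow> 'u \<Rightarrow> 'u) set" where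
  "presheaf_module_hom C R M N =
    {\<eta> \<in> (\<Pi>\<^sub>E v \<in> Obj C. mod_hom (ring_at R v) (mod_at M v) (mod_at N v) \<inter>
        extensional (carrier (mod_at M v))).
      \<forall>a \<in> Arr C. \<forall>x \<in> carrier (mod_at M (Cod C a)).
        \<eta> (Dom C a) (mod_res M a x) = mod_res N a (\<eta> (Cod C a) x)}"

definition Mod_objects ::
  "'u rel \<Rightarrow> ('o, 'a) cat \<Rightarrow> ('o, 'a, 'r) ring_psh \<Rightarrow> ('o, 'a, 'r, 'u) mod_psh set" where
  "Mod_objects \<kappa> C R =
    {M. presheaf_module C R M \<and> (\<forall>v \<in> Obj C. small \<kappa> (carrier (mod_at M v)))}"

definition Mod_all ::
  "'u rel \<Rightarrow> ('o, 'a) cat \<Rightarrow> ('o, 'a, 'r) ring_psh \<Rightarrow>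
    (('o, 'a, 'r, 'u) mod_psh,
     ('o, 'a, 'r, 'u) mod_psh \<times> ('o, 'a, 'r, 'u) mod_psh \<times> ('o \<Rightarrow> 'u \<Rightarrow> 'u)) cat" where
  "Mod_all \<kappa> C R =
    \<lparr>Obj = Mod_objects \<kappa> C R,
     Arr = {(M, N, \<eta>). M \<in> Mod_objects \<kappa> C R \<and> N \<in> Mod_objects \<kappa> C R \<and>
              \<eta> \<in> presheaf_module_hom C R M N},
     Dom = (\<lambda>(M, N, \<eta>). M),
     Cod = (\<lambda>(M, N, \<eta>). N),
     Ident = (\<lambda>M. (M, M, \<lambda>v \<in> Obj C. \<lambda>x \<in> carrier (mod_at M v). x)),
     Comp = (\<lambda>(N', P, \<theta>) (M, N, \<eta>).
       (M, P, \<lambda>v \<in> Obj C. \<lambda>x \<in> carrier (mod_at M v). \<theta> v (\<eta> v x)))\<rparr>"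

definition cartesian ::
  "('o, 'a) cat \<Rightarrow> ('o, 'a, 'r) ring_psh \<Rightarrow> ('o, 'a, 'r, 'u) mod_psh \<Rightarrow> bool" where
  "cartesian C R M \<longleftrightarrow>
    (\<forall>a \<in> Arr C.
      let v = Dom C a; w = Cod C a in
      tensor_lift (add_monoid (mod_at M v)) (\<lambda>(r, m). r \<odot>\<^bsub>mod_at M v\<^esub> mod_res M a m)
        \<in> mod_iso (ring_at R v)
            (extend_scalars (ring_at R w) (ring_at R v) (ring_res R a) (mod_at M w))
            (mod_at M v))"

definition Mod_cart ::
  "'u rel \<Rightarrow> ('o, 'a) cat \<Rightarrow> ('o, 'a, 'r) ring_psh \<Rightarrow>
    (('o, 'a, 'r, 'u) mod_psh,
     ('o, 'a, 'r, 'u) mod_psh \<times> ('o, 'a, 'r, 'u) mod_psh \<times> ('o \<Rightarrow> 'u \<Rightarrow> 'u)) cat" where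
  "Mod_cart \<kappa> C R = full_subcategory (Mod_all \<kappa> C R) (cartesian C R)"

text \<open>
  The size requirement on \<open>C\<close> and \<open>R\<close>: with \<open>\<lambda> = |Arr C| + \<Sum>|R(v)| + \<aleph>\<^sub>0\<close> one has \<open>2\<^sup>\<lambda> < \<kappa>\<close>. For
  inaccessible \<open>\<kappa>\<close> this just says that \<open>C\<close> and \<open>R\<close> are small; in general it bounds the number of
  isomorphism classes of modules with at most \<open>\<lambda>\<close> elements. The objects of a category
  embed into its arrows as identities, so they need no separate mention.
\<close>

definition small_data :: "'u rel \<Rightarrow> ('o, 'a) cat \<Rightarrow> ('o, 'a, 'r) ring_psh \<Rightarrow> bool" where
  "small_data \<kappa> C R \<longleftrightarrow>
    small \<kappa> (Pow (Arr C <+> (SIGMA v : Obj C. carrier (ring_at R v)) <+> (UNIV :: nat set)))"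

end

theory Submission
  imports Defs
begin

text \<open>
  Extension of scalars along \<open>\<phi> : A \<rightarrow> B\<close> is characterised by its universal property, so \<open>M\<close> is
  cartesian iff for every arrow \<open>a : v \<rightarrow> w\<close> an \<open>R(w)\<close>-linear map from \<open>M(w)\<close> to an \<open>R(v)\<close>-module extends
  uniquely along \<open>M(w) \<rightarrow> M(v)\<close> to an \<open>R(v)\<close>-linear one. Colimits formed objectwise inherit this
  property. By flatness \<open>R(v) \<otimes> X(w) \<rightarrow> M(v)\<close> is injective for \<open>X\<close> a submodule of a cartesian \<open>M\<close>, so \<open>X\<close> is
  cartesian as soon as the restrictions of \<open>X(w)\<close> span \<open>X(v)\<close>; this applies to kernels. Thus kernels,
  cokernels and direct limits are objectwise, which gives the abelian axioms and the exactness of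
  direct limits.

  Let \<open>\<lambda>\<close> be the size of the data. Closing an element of \<open>M\<close> under linear combinations, restrictions and
  chosen expressions as combinations of restrictions gives a cartesian submodule with at most \<open>\<lambda>\<close>
  elements. Up to isomorphism there are at most \<open>2\<^sup>\<lambda> < \<kappa>\<close> cartesian modules of that size, and their
  coproduct is a generator.
\<close>

section \<open>Modules and linear maps\<close>

text \<open>Two obstacles shape the development. Objects must have their elements in
  \<open>'u\<close>, whereas cosets, tensor products and direct sums live in other types. These are
  formed in their natural types and copied into \<open>'u\<close> by
  \<open>quotient_module_exists\<close>; the universal property of extension of scalars then needs
  testing only on small modules in \<open>'u\<close>, because the tensor product itself has a copy
  among them. The other obstacle is the surjectivity half of cartesianness. Spanning is never
  expressed by linear combinations but as membership in every submodule containing the restrictions,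
  or as vanishing of every linear map that vanishes on the restrictions. For kernels it is verified
  by mapping to a quotient, for colimits by the universal property of the modules in the diagram.
  Flatness enters only through \<open>adj_submodule_inj\<close>. Representable presheaves of modules
  are in general not cartesian and so offer no generator, which is why elements have to be captured
  inside a given module; the closure must go up along arrows, to elements whose restrictions span,
  as well as down.\<close>

lemma mod_hom_closed: "f \<in> mod_hom A M N \<Longrightarrow> x \<in> carrier M \<Longrightarrow> f x \<in> carrier N"
  by (auto simp: mod_hom_def)

lemma mod_hom_add:
  "f \<in> mod_hom A M N \<Longrightarrow> x \<in> carrier M \<Longrightarrow> y \<in> carrier M \<Longrightarrow> f (x \<oplus>\<^bsub>M\<^esub> y) = f x \<oplus>\<^bsub>N\<^esub> f y"
  by (auto simp: mod_hom_def)

lemma mod_hom_smult: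
  "f \<in> mod_hom A M N \<Longrightarrow> r \<in> carrier A \<Longrightarrow> x \<in> carrier M \<Longrightarrow> f (r \<odot>\<^bsub>M\<^esub> x) = r \<odot>\<^bsub>N\<^esub> f x"
  by (auto simp: mod_hom_def)

lemmas mod_hom_simps = mod_hom_closed mod_hom_add mod_hom_smult

lemma mod_homI:
  assumes "\<And>x. x \<in> carrier M \<Longrightarrow> f x \<in> carrier N"
    and "\<And>x y. x \<in> carrier M \<Longrightarrow> y \<in> carrier M \<Longrightarrow> f (x \<oplus>\<^bsub>M\<^esub> y) = f x \<oplus>\<^bsub>N\<^esub> f y"
    and "\<And>r x. r \<in> carrier A \<Longrightarrow> x \<in> carrier M \<Longrightarrow> f (r \<odot>\<^bsub>M\<^esub> x) = r \<odot>\<^bsub>N\<^esub> f x"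
  shows "f \<in> mod_hom A M N"
  using assms by (auto simp: mod_hom_def)

text \<open>Components of arrows are \<open>undefined\<close> off the carriers, so a linear map and
  its restriction to the carrier are different functions. Linearity passes between them because the
  module operations stay inside the carrier.\<close>

lemma mod_hom_cong:
  assumes "module A M" "f \<in> mod_hom A M N" "\<And>x. x \<in> carrier M \<Longrightarrow> g x = f x"
  shows "g \<in> mod_hom A M N"
proof -
  interpret M: module A M by fact
  show ?thesis
    using assms(2,3) by (intro mod_homI) (auto simp: mod_hom_simps)
qed

lemma mod_hom_comp: "f \<in> mod_hom A M N \<Longrightarrow> g \<in> mod_hom A N P \<Longrightarrow> (\<lambda>x. g (f x)) \<in> mod_hom A M P"
  by (intro mod_homI) (auto simp: mod_hom_simps)

lemma mod_hom_id: "(\<lambda>x. x) \<in> mod_hom A M M"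
  by (intro mod_homI) auto

lemma mod_hom_group_hom:
  assumes "module A M" "module A N" "f \<in> mod_hom A M N"
  shows "group_hom (add_monoid M) (add_monoid N) f"
proof -
  interpret M: module A M by fact
  interpret N: module A N by fact
  show ?thesis
    by (unfold_locales, intro homI) (use assms(3) in \<open>auto simp: mod_hom_simps\<close>)
qed

lemma mod_hom_zero:
  assumes "module A M" "module A N" "f \<in> mod_hom A M N"
  shows "f \<zero>\<^bsub>M\<^esub> = \<zero>\<^bsub>N\<^esub>"
  using group_hom.hom_one[OF mod_hom_group_hom[OF assms]] by simp

lemma mod_hom_neg:
  assumes "module A M" "module A N" "f \<in> mod_hom A M N" "x \<in> carrier M"
  shows "f (\<ominus>\<^bsub>M\<^esub> x) = \<ominus>\<^bsub>N\<^esub> f x"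
  using group_hom.hom_inv[OF mod_hom_group_hom[OF assms(1-3)], of x] assms(4)
  by (simp add: a_inv_def)

lemma mod_hom_diff:
  assumes "module A M" "module A N" "f \<in> mod_hom A M N" "x \<in> carrier M" "y \<in> carrier M"
  shows "f (x \<ominus>\<^bsub>M\<^esub> y) = f x \<ominus>\<^bsub>N\<^esub> f y"
proof -
  interpret M: module A M by fact
  interpret N: module A N by fact
  show ?thesis
    using assms(3-5) by (simp add: a_minus_def mod_hom_add mod_hom_neg[OF assms(1-4)]
        mod_hom_neg[OF assms(1-3)])
qed

lemma module_diff_zero_iff:
  assumes "module A M" "x \<in> carrier M" "y \<in> carrier M"
  shows "x \<ominus>\<^bsub>M\<^esub> y = \<zero>\<^bsub>M\<^esub> \<longleftrightarrow> x = y"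
proof -
  interpret M: module A M by fact
  show ?thesis using assms(2,3) M.add.inv_solve_right'[of "\<zero>\<^bsub>M\<^esub>" x y]
    by (auto simp: a_minus_def M.r_neg a_inv_def)
qed

lemma mod_hom_inj_iff:
  assumes "module A M" "module A N" "f \<in> mod_hom A M N"
  shows "inj_on f (carrier M) \<longleftrightarrow> (\<forall>x \<in> carrier M. f x = \<zero>\<^bsub>N\<^esub> \<longrightarrow> x = \<zero>\<^bsub>M\<^esub>)"
  using group_hom.inj_on_one_iff[OF mod_hom_group_hom[OF assms]] by (simp add: Ball_def)

lemma mod_hom_inv:
  assumes M: "module A M" and f: "f \<in> mod_hom A M N"
    and bij: "bij_betw f (carrier M) (carrier N)"
  shows "inv_into (carrier M) f \<in> mod_hom A N M"
proof -
  interpret M: module A M by fact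
  have inv: "inv_into (carrier M) f y \<in> carrier M" "f (inv_into (carrier M) f y) = y"
    if "y \<in> carrier N" for y
    using bij that by (auto simp: bij_betw_def inv_into_into f_inv_into_f)
  have eqI: "inv_into (carrier M) f y = x" if "x \<in> carrier M" "f x = y" for x y
    using bij that by (auto simp: bij_betw_def)
  show ?thesis
    by (intro mod_homI) (auto simp: inv mod_hom_simps[OF f] intro!: eqI)
qed

text \<open>Linearity can be tested after applying the injective \<open>k\<close>, where both sides
  become values of \<open>h\<close>.\<close>

lemma mod_hom_factor_inj:
  assumes K: "module A K" and L: "module A L"
    and k: "k \<in> mod_hom A K M" "inj_on k (carrier K)"
    and h: "h \<in> mod_hom A L M" "h ` carrier L \<subseteq> k ` carrier K"
  shows "(\<lambda>x. inv_into (carrier K) k (h x)) \<in> mod_hom A L K"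
proof -
  interpret K: module A K by fact
  interpret L: module A L by fact
  have inv: "inv_into (carrier K) k (h x) \<in> carrier K" "k (inv_into (carrier K) k (h x)) = h x"
    if "x \<in> carrier L" for x
  proof -
    have "h x \<in> k ` carrier K" by (rule subsetD[OF h(2) imageI[OF that]])
    then show "inv_into (carrier K) k (h x) \<in> carrier K" "k (inv_into (carrier K) k (h x)) = h x"
      by (simp_all add: inv_into_into f_inv_into_f)
  qed
  have eqI: "inv_into (carrier K) k y = x" if "x \<in> carrier K" "k x = y" for x y
    using inv_into_f_eq[OF k(2) that] .
  show ?thesis
  proof (rule mod_homI)
    fix x y assume "x \<in> carrier L" "y \<in> carrier L"
    then show "inv_into (carrier K) k (h (x \<oplus>\<^bsub>L\<^esub> y)) =
      inv_into (carrier K) k (h x) \<oplus>\<^bsub>K\<^esub> inv_into (carrier K) k (h y)"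
      using inv by (intro eqI) (simp_all add: mod_hom_add[OF h(1)] mod_hom_add[OF k(1)])
  next
    fix r x assume "r \<in> carrier A" "x \<in> carrier L"
    then show "inv_into (carrier K) k (h (r \<odot>\<^bsub>L\<^esub> x)) = r \<odot>\<^bsub>K\<^esub> inv_into (carrier K) k (h x)"
      using inv by (intro eqI) (simp_all add: mod_hom_smult[OF h(1)] mod_hom_smult[OF k(1)])
  qed (rule inv(1))
qed

text \<open>The universal property of a quotient without cosets: any linear surjection
  \<open>q\<close> serves. Besides genuine quotients it is applied below to a map regarded as a
  surjection onto its image.\<close>

lemma mod_hom_factor_surj:
  assumes M: "module A M" and Q: "module A Q" and L: "module A L"
    and q: "q \<in> mod_hom A M Q" "q ` carrier M = carrier Q"
    and h: "h \<in> mod_hom A M L"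
    and ker: "\<And>x. x \<in> carrier M \<Longrightarrow> q x = \<zero>\<^bsub>Q\<^esub> \<Longrightarrow> h x = \<zero>\<^bsub>L\<^esub>"
  obtains u where "u \<in> mod_hom A Q L" "\<And>x. x \<in> carrier M \<Longrightarrow> u (q x) = h x"
proof -
  interpret M: module A M by fact
  interpret L: module A L by fact
  \<comment> \<open>Two points of one fibre of \<open>q\<close> differ by an element of its kernel,
    so the choice of preimage in \<open>u\<close> is immaterial.\<close>
  have eq: "h x = h y" if "x \<in> carrier M" "y \<in> carrier M" "q x = q y" for x y
  proof -
    have "q (x \<ominus>\<^bsub>M\<^esub> y) = \<zero>\<^bsub>Q\<^esub>"
      using that mod_hom_diff[OF M Q q(1)] module_diff_zero_iff[OF Q] mod_hom_closed[OF q(1)] by simp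
    then have "h x \<ominus>\<^bsub>L\<^esub> h y = \<zero>\<^bsub>L\<^esub>"
      using ker[of "x \<ominus>\<^bsub>M\<^esub> y"] that mod_hom_diff[OF M L h] by simp
    then show ?thesis using module_diff_zero_iff[OF L] mod_hom_closed[OF h] that by simp
  qed
  define u where "u y = h (inv_into (carrier M) q y)" for y
  have u: "u (q x) = h x" if "x \<in> carrier M" for x
    unfolding u_def by (rule eq) (use that in \<open>auto simp: inv_into_into f_inv_into_f\<close>)
  have ex: "\<exists>x \<in> carrier M. y = q x" if "y \<in> carrier Q" for y
    using that unfolding q(2)[symmetric] by auto
  have "u \<in> mod_hom A Q L"
  proof (rule mod_homI)
    fix y y' assume "y \<in> carrier Q" "y' \<in> carrier Q"
    then obtain x x' where x: "x \<in> carrier M" "y = q x" "x' \<in> carrier M" "y' = q x'"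
      using ex by meson
    then have "u (q (x \<oplus>\<^bsub>M\<^esub> x')) = u (q x) \<oplus>\<^bsub>L\<^esub> u (q x')"
      by (simp add: u mod_hom_add[OF h])
    then show "u (y \<oplus>\<^bsub>Q\<^esub> y') = u y \<oplus>\<^bsub>L\<^esub> u y'" using x by (simp add: mod_hom_add[OF q(1)])
  next
    fix r y assume r: "r \<in> carrier A" and "y \<in> carrier Q"
    then obtain x where x: "x \<in> carrier M" "y = q x" using ex by meson
    then have "u (q (r \<odot>\<^bsub>M\<^esub> x)) = r \<odot>\<^bsub>L\<^esub> u (q x)"
      using r by (simp add: u mod_hom_smult[OF h])
    then show "u (r \<odot>\<^bsub>Q\<^esub> y) = r \<odot>\<^bsub>L\<^esub> u y" using x r by (simp add: mod_hom_smult[OF q(1)])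
  next
    fix y assume "y \<in> carrier Q"
    then obtain x where "x \<in> carrier M" "y = q x" using ex by meson
    then show "u y \<in> carrier L" by (simp add: u mod_hom_closed[OF h])
  qed
  then show thesis using that u by blast
qed

lemma mod_hom_const_zero:
  assumes "module A N"
  shows "(\<lambda>x. \<zero>\<^bsub>N\<^esub>) \<in> mod_hom A M N"
proof -
  interpret N: module A N by fact
  show ?thesis by (intro mod_homI) auto
qed

lemma mod_hom_plus:
  assumes "module A M" "module A N" "f \<in> mod_hom A M N" "g \<in> mod_hom A M N"
  shows "(\<lambda>x. f x \<oplus>\<^bsub>N\<^esub> g x) \<in> mod_hom A M N"
proof -
  interpret M: module A M by fact
  interpret N: module A N by fact
  show ?thesis
    using assms(3,4)
    by (intro mod_homI) (auto simp: mod_hom_simps N.smult_r_distr N.a_ac)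
qed

lemma mod_hom_uminus:
  assumes "module A M" "module A N" "f \<in> mod_hom A M N"
  shows "(\<lambda>x. \<ominus>\<^bsub>N\<^esub> f x) \<in> mod_hom A M N"
proof -
  interpret M: module A M by fact
  interpret N: module A N by fact
  show ?thesis
    using assms(3)
    by (intro mod_homI) (auto simp: mod_hom_simps N.smult_r_minus N.minus_add)
qed

section \<open>Kernels and images of linear maps\<close>

lemma submodule_kernel:
  assumes "module A M" "module A N" "f \<in> mod_hom A M N"
  shows "submodule {x \<in> carrier M. f x = \<zero>\<^bsub>N\<^esub>} A M"
proof -
  interpret M: module A M by fact
  interpret N: module A N by fact
  show ?thesis
    using assms(3)
    by (intro M.submoduleI)
      (auto simp: mod_hom_simps mod_hom_zero[OF assms] mod_hom_neg[OF assms])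
qed

lemma submodule_image:
  assumes "module A M" "module A N" "f \<in> mod_hom A M N"
  shows "submodule (f ` carrier M) A N"
proof -
  interpret M: module A M by fact
  interpret N: module A N by fact
  show ?thesis
  proof (intro N.submoduleI)
    show "\<zero>\<^bsub>N\<^esub> \<in> f ` carrier M" using mod_hom_zero[OF assms] by force
    show "\<ominus>\<^bsub>N\<^esub> a \<in> f ` carrier M" if "a \<in> f ` carrier M" for a
      using that mod_hom_neg[OF assms] by (auto intro!: rev_image_eqI[OF M.a_inv_closed])
    show "a \<oplus>\<^bsub>N\<^esub> b \<in> f ` carrier M" if "a \<in> f ` carrier M" "b \<in> f ` carrier M" for a b
      using that by (auto simp: image_iff simp flip: mod_hom_add[OF assms(3)])
    show "r \<odot>\<^bsub>N\<^esub> b \<in> f ` carrier M" if "r \<in> carrier A" "b \<in> f ` carrier M" for r b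
      using that mod_hom_smult[OF assms(3)] by (auto intro!: rev_image_eqI[OF M.smult_closed])
  qed (use assms(3) in \<open>auto simp: mod_hom_closed\<close>)
qed

section \<open>Restriction of scalars\<close>

lemma restrict_scalars_simps [simp]:
  "carrier (restrict_scalars \<phi> M) = carrier M"
  "zero (restrict_scalars \<phi> M) = zero M"
  "add (restrict_scalars \<phi> M) = add M"
  "smult (restrict_scalars \<phi> M) = (\<lambda>r x. smult M (\<phi> r) x)"
  by (simp_all add: restrict_scalars_def)

lemma restrict_scalars_a_inv [simp]: "a_inv (restrict_scalars \<phi> M) = a_inv M"
  by (simp add: a_inv_def m_inv_def fun_eq_iff)

lemma mod_hom_restrict_scalars:
  assumes "\<phi> \<in> ring_hom A B" "h \<in> mod_hom B M N"
  shows "h \<in> mod_hom A (restrict_scalars \<phi> M) (restrict_scalars \<phi> N)"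
  using assms(2) ring_hom_closed[OF assms(1)] by (auto simp: mod_hom_def)

lemma ring_as_module_simps [simp]:
  "carrier (ring_as_module B) = carrier B"
  "zero (ring_as_module B) = zero B"
  "add (ring_as_module B) = add B"
  "smult (ring_as_module B) = monoid.mult B"
  by (simp_all add: ring_as_module_def)

lemma abelian_group_transfer:
  assumes "abelian_group M" "carrier N = carrier M" "zero N = zero M" "add N = add M"
  shows "abelian_group N"
proof -
  interpret M: abelian_group M by fact
  show ?thesis
    using assms(2-4)
    by (intro abelian_groupI) (auto simp: M.a_ac intro: M.l_neg bexI[OF _ M.a_inv_closed])
qed

lemma module_restrict_scalars:
  assumes "cring A" "\<phi> \<in> ring_hom A B" "module B M"
  shows "module A (restrict_scalars \<phi> M)"
proof -
  interpret A: cring A by fact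
  interpret M: module B M by fact
  show ?thesis
  proof (rule moduleI)
    show "abelian_group (restrict_scalars \<phi> M)"
      by (rule abelian_group_transfer[OF M.abelian_group_axioms]) auto
  qed (use assms(1,2) in \<open>auto simp: ring_hom_closed ring_hom_add ring_hom_mult ring_hom_one
        M.smult_l_distr M.smult_r_distr M.smult_assoc1\<close>)
qed

lemma module_ring_as_module:
  assumes "cring B"
  shows "module B (ring_as_module B)"
proof -
  interpret B: cring B by fact
  show ?thesis
  proof (rule moduleI)
    show "abelian_group (ring_as_module B)"
      by (rule abelian_group_transfer[OF B.abelian_group_axioms]) auto
  qed (use assms in \<open>auto simp: B.l_distr B.r_distr B.m_assoc\<close>)
qed

text \<open>The module axioms are equations and the existence of negatives, so they pass along a
  surjection that respects the operations. This spares direct computations with representatives in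
  the quotient.\<close>

lemma module_surj_image:
  assumes P: "module A P" and surj: "q ` carrier P = carrier Q"
    and add: "\<And>x y. x \<in> carrier P \<Longrightarrow> y \<in> carrier P \<Longrightarrow> q (x \<oplus>\<^bsub>P\<^esub> y) = q x \<oplus>\<^bsub>Q\<^esub> q y"
    and smult: "\<And>r x. r \<in> carrier A \<Longrightarrow> x \<in> carrier P \<Longrightarrow> q (r \<odot>\<^bsub>P\<^esub> x) = r \<odot>\<^bsub>Q\<^esub> q x"
    and zero: "q \<zero>\<^bsub>P\<^esub> = \<zero>\<^bsub>Q\<^esub>"
  shows "module A Q"
proof -
  interpret P: module A P by fact
  have ex: "\<exists>x' \<in> carrier P. x = q x'" if "x \<in> carrier Q" for x
    using that surj by auto
  have cl: "q x \<in> carrier Q" if "x \<in> carrier P" for x using that surj by auto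
  have ab: "abelian_group Q"
  proof (rule abelian_groupI)
    fix x assume "x \<in> carrier Q"
    then obtain x' where x: "x' \<in> carrier P" "x = q x'" using ex by blast
    show "\<exists>y\<in>carrier Q. y \<oplus>\<^bsub>Q\<^esub> x = \<zero>\<^bsub>Q\<^esub>"
      using x by (intro bexI[of _ "q (\<ominus>\<^bsub>P\<^esub> x')"]) (auto simp: zero cl P.l_neg simp flip: add)
    show "\<zero>\<^bsub>Q\<^esub> \<oplus>\<^bsub>Q\<^esub> x = x"
      using x by (simp flip: zero add)
  next
    fix x y assume "x \<in> carrier Q" "y \<in> carrier Q"
    then obtain x' y' where x: "x' \<in> carrier P" "x = q x'" "y' \<in> carrier P" "y = q y'" using ex by meson
    show "x \<oplus>\<^bsub>Q\<^esub> y \<in> carrier Q" using x by (auto simp: cl simp flip: add)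
    show "x \<oplus>\<^bsub>Q\<^esub> y = y \<oplus>\<^bsub>Q\<^esub> x" using x by (simp add: P.a_comm flip: add)
    fix z assume "z \<in> carrier Q"
    then obtain z' where "z' \<in> carrier P" "z = q z'" using ex by blast
    then show "x \<oplus>\<^bsub>Q\<^esub> y \<oplus>\<^bsub>Q\<^esub> z = x \<oplus>\<^bsub>Q\<^esub> (y \<oplus>\<^bsub>Q\<^esub> z)"
      using x by (simp add: P.a_assoc flip: add)
  next
    show "\<zero>\<^bsub>Q\<^esub> \<in> carrier Q" using cl zero by force
  qed
  show ?thesis
  proof (rule moduleI[OF P.is_cring ab])
    fix x a b assume x: "x \<in> carrier Q" and a: "a \<in> carrier A"
    then obtain x' where x: "x' \<in> carrier P" "x = q x'" using ex by blast
    show "a \<odot>\<^bsub>Q\<^esub> x \<in> carrier Q" using x a by (auto simp: cl simp flip: smult)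
    { fix y assume "y \<in> carrier Q"
      then obtain y' where "y' \<in> carrier P" "y = q y'" using ex by blast
      then show "a \<odot>\<^bsub>Q\<^esub> (x \<oplus>\<^bsub>Q\<^esub> y) = a \<odot>\<^bsub>Q\<^esub> x \<oplus>\<^bsub>Q\<^esub> a \<odot>\<^bsub>Q\<^esub> y"
        using x a by (simp add: P.smult_r_distr flip: add smult) }
    assume b: "b \<in> carrier A"
    show "(a \<oplus>\<^bsub>A\<^esub> b) \<odot>\<^bsub>Q\<^esub> x = a \<odot>\<^bsub>Q\<^esub> x \<oplus>\<^bsub>Q\<^esub> b \<odot>\<^bsub>Q\<^esub> x"
      using x a b by (simp add: P.smult_l_distr flip: add smult)
    show "(a \<otimes>\<^bsub>A\<^esub> b) \<odot>\<^bsub>Q\<^esub> x = a \<odot>\<^bsub>Q\<^esub> (b \<odot>\<^bsub>Q\<^esub> x)"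
      using x a b by (simp add: P.smult_assoc1 flip: smult)
  next
    fix x assume "x \<in> carrier Q"
    then obtain x' where "x' \<in> carrier P" "x = q x'" using ex by blast
    then show "\<one>\<^bsub>A\<^esub> \<odot>\<^bsub>Q\<^esub> x = x" by (simp flip: smult)
  qed
qed

text \<open>The quotient is realised inside the type \<^typ>\<open>'u\<close> of the universe.\<close>

lemma quotient_module_exists:
  fixes P :: "('r, 'm) module" and \<kappa> :: "'u rel"
  assumes P: "module A P" and Z: "submodule Z A P"
    and small: "small \<kappa> (carrier P)" and card: "Card_order \<kappa>"
  obtains Q :: "('r, 'u) module" and q where "module A Q" "small \<kappa> (carrier Q)"
    "q \<in> mod_hom A P Q" "q ` carrier P = carrier Q"
    "\<And>x. x \<in> carrier P \<Longrightarrow> q x = \<zero>\<^bsub>Q\<^esub> \<longleftrightarrow> x \<in> Z"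
proof -
  interpret P: module A P by fact
  note ZE = P.submoduleE[OF Z]
  define c where "c x = {y \<in> carrier P. y \<ominus>\<^bsub>P\<^esub> x \<in> Z}" for x
  \<comment> \<open>Smallness provides names for the cosets: there are at most as many as elements
    of \<open>P\<close>, hence fewer than \<kappa>, and \<kappa> is carried by a subset of
    \<open>'u\<close>.\<close>
  have "|c ` carrier P| \<le>o |UNIV :: 'u set|"
  proof -
    have "|c ` carrier P| \<le>o |carrier P|" by (rule card_of_image)
    also have "|carrier P| \<le>o \<kappa>" using small by (simp add: small_def ordLess_imp_ordLeq)
    also have "\<kappa> =o |Field \<kappa>|" using card by (simp add: card_of_Field_ordIso ordIso_symmetric)
    also have "|Field \<kappa>| \<le>o |UNIV :: 'u set|" by (rule card_of_mono1) simp
    finally show ?thesis .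
  qed
  then obtain e :: "'m set \<Rightarrow> 'u" where e: "inj_on e (c ` carrier P)"
    by (auto simp flip: card_of_ordLeq)
  define q where "q x = e (c x)" for x
  \<comment> \<open>A section of \<open>q\<close>. Operations on names are those of the chosen
    representatives, and \<open>s_diff\<close> shows that the choice changes results only by
    elements of \<open>Z\<close>.\<close>
  define s where "s = inv_into (carrier P) q"
  define Q :: "('r, 'u) module" where "Q = \<lparr>carrier = q ` carrier P, monoid.mult = undefined,
    one = undefined, zero = q \<zero>\<^bsub>P\<^esub>, add = (\<lambda>a b. q (s a \<oplus>\<^bsub>P\<^esub> s b)),
    smult = (\<lambda>r a. q (r \<odot>\<^bsub>P\<^esub> s a))\<rparr>"
  have zeroZ: "\<zero>\<^bsub>P\<^esub> \<in> Z" using ZE(1,2,3,5) by (metis P.r_neg equals0I subsetD)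
  have c_eq: "c x = c y" if "x \<in> carrier P" "y \<in> carrier P" "x \<ominus>\<^bsub>P\<^esub> y \<in> Z" for x y
  proof -
    have "z \<ominus>\<^bsub>P\<^esub> x \<in> Z \<longleftrightarrow> z \<ominus>\<^bsub>P\<^esub> y \<in> Z" if z: "z \<in> carrier P" for z
    proof
      have "z \<ominus>\<^bsub>P\<^esub> y = (z \<ominus>\<^bsub>P\<^esub> x) \<oplus>\<^bsub>P\<^esub> (x \<ominus>\<^bsub>P\<^esub> y)"
        using that \<open>x \<in> _\<close> \<open>y \<in> _\<close>
        by (simp add: a_minus_def P.a_assoc P.r_neg1)
      then show "z \<ominus>\<^bsub>P\<^esub> x \<in> Z \<Longrightarrow> z \<ominus>\<^bsub>P\<^esub> y \<in> Z" using ZE(5) \<open>x \<ominus>\<^bsub>P\<^esub> y \<in> Z\<close> by auto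
      have "z \<ominus>\<^bsub>P\<^esub> x = (z \<ominus>\<^bsub>P\<^esub> y) \<oplus>\<^bsub>P\<^esub> \<ominus>\<^bsub>P\<^esub> (x \<ominus>\<^bsub>P\<^esub> y)"
        using that \<open>x \<in> _\<close> \<open>y \<in> _\<close>
        by (simp add: a_minus_def P.a_assoc P.minus_add P.a_comm[of "\<ominus>\<^bsub>P\<^esub> x" y] P.minus_minus P.r_neg1)
      then show "z \<ominus>\<^bsub>P\<^esub> y \<in> Z \<Longrightarrow> z \<ominus>\<^bsub>P\<^esub> x \<in> Z"
        using ZE(5) ZE(3)[OF \<open>x \<ominus>\<^bsub>P\<^esub> y \<in> Z\<close>] by auto
    qed
    then show ?thesis by (auto simp: c_def)
  qed
  have q_eq: "q x = q y \<longleftrightarrow> x \<ominus>\<^bsub>P\<^esub> y \<in> Z" if xy: "x \<in> carrier P" "y \<in> carrier P" for x y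
  proof
    assume "q x = q y"
    then have "c x = c y" using e xy by (auto simp: q_def inj_on_def)
    moreover have "x \<in> c x" using xy zeroZ by (simp add: c_def a_minus_def P.r_neg)
    ultimately show "x \<ominus>\<^bsub>P\<^esub> y \<in> Z" by (simp add: c_def)
  qed (use c_eq xy in \<open>simp add: q_def\<close>)
  have s: "s (q x) \<in> carrier P" "q (s (q x)) = q x" if "x \<in> carrier P" for x
    using that by (auto simp: s_def inv_into_into f_inv_into_f)
  have s_diff: "x \<ominus>\<^bsub>P\<^esub> s (q x) \<in> Z" if "x \<in> carrier P" for x
    using q_eq[of x "s (q x)"] s[OF that] that by simp
  have add: "q (x \<oplus>\<^bsub>P\<^esub> y) = q x \<oplus>\<^bsub>Q\<^esub> q y" if xy: "x \<in> carrier P" "y \<in> carrier P" for x y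
  proof -
    have "(x \<oplus>\<^bsub>P\<^esub> y) \<ominus>\<^bsub>P\<^esub> (s (q x) \<oplus>\<^bsub>P\<^esub> s (q y)) = (x \<ominus>\<^bsub>P\<^esub> s (q x)) \<oplus>\<^bsub>P\<^esub> (y \<ominus>\<^bsub>P\<^esub> s (q y))"
      using xy s by (simp add: a_minus_def P.minus_add P.a_ac)
    then have "(x \<oplus>\<^bsub>P\<^esub> y) \<ominus>\<^bsub>P\<^esub> (s (q x) \<oplus>\<^bsub>P\<^esub> s (q y)) \<in> Z"
      using ZE(5) s_diff xy by simp
    then show ?thesis using xy s by (simp add: Q_def q_eq)
  qed
  have smult: "q (r \<odot>\<^bsub>P\<^esub> x) = r \<odot>\<^bsub>Q\<^esub> q x" if rx: "r \<in> carrier A" "x \<in> carrier P" for r x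
  proof -
    have "(r \<odot>\<^bsub>P\<^esub> x) \<ominus>\<^bsub>P\<^esub> (r \<odot>\<^bsub>P\<^esub> s (q x)) = r \<odot>\<^bsub>P\<^esub> (x \<ominus>\<^bsub>P\<^esub> s (q x))"
      using rx s by (simp add: a_minus_def P.smult_r_distr P.smult_r_minus)
    then have "(r \<odot>\<^bsub>P\<^esub> x) \<ominus>\<^bsub>P\<^esub> (r \<odot>\<^bsub>P\<^esub> s (q x)) \<in> Z"
      using ZE(4) s_diff rx by simp
    then show ?thesis using rx s by (simp add: Q_def q_eq)
  qed
  have cQ: "q ` carrier P = carrier Q" and zQ: "q \<zero>\<^bsub>P\<^esub> = \<zero>\<^bsub>Q\<^esub>" by (simp_all add: Q_def)
  show thesis
  proof
    show "module A Q" by (rule module_surj_image[OF P cQ add smult zQ])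
    show "q ` carrier P = carrier Q" by fact
    show "small \<kappa> (carrier Q)"
      using small card_of_image[of q "carrier P"] unfolding small_def
      by (metis cQ ordLeq_ordLess_trans)
    show "q \<in> mod_hom A P Q"
      by (rule mod_homI) (use cQ add smult in auto)
    show "q x = \<zero>\<^bsub>Q\<^esub> \<longleftrightarrow> x \<in> Z" if "x \<in> carrier P" for x
      using that q_eq[of x "\<zero>\<^bsub>P\<^esub>"] P.minus_equality[of "\<zero>\<^bsub>P\<^esub>" "\<zero>\<^bsub>P\<^esub>"]
      by (simp add: a_minus_def flip: zQ)
  qed
qed

section \<open>Tensor products\<close>

lemma (in comm_group) free_extend_hom:
  assumes f: "\<And>p. p \<in> S \<Longrightarrow> f p \<in> carrier G"
  shows "free_extend G f \<in> hom (free_Abelian_group S) G"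
proof (rule homI)
  fix c assume "c \<in> carrier (free_Abelian_group S)"
  then show "free_extend G f c \<in> carrier G"
    using f by (auto simp: free_extend_def intro!: finprod_closed)
next
  fix c d assume c: "c \<in> carrier (free_Abelian_group S)" and d: "d \<in> carrier (free_Abelian_group S)"
  \<comment> \<open>A common finite index set for \<open>c\<close>, \<open>d\<close> and
    \<open>c + d\<close>; enlarging a support only adds factors with exponent 0.\<close>
  define U where "U = Poly_Mapping.keys c \<union> Poly_Mapping.keys d"
  have U: "finite U" "U \<subseteq> S" using c d by (auto simp: U_def)
  have ext: "free_extend G f e = finprod G (\<lambda>p. f p [^] Poly_Mapping.lookup e p) U"
    if "Poly_Mapping.keys e \<subseteq> U" for e
    unfolding free_extend_def
  proof (rule finprod_mono_neutral_cong_left[OF U(1) that])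
    show "(\<lambda>p. f p [^] poly_mapping.lookup e p) \<in> U \<rightarrow> carrier G"
      using U f by (auto intro!: int_pow_closed)
    show "f p [^] poly_mapping.lookup e p = \<one>" if "p \<in> U - Poly_Mapping.keys e" for p
      using that by (simp add: in_keys_iff)
  qed (use U f in auto)
  have "free_extend G f (c + d) = finprod G (\<lambda>p. f p [^] Poly_Mapping.lookup (c + d) p) U"
    by (rule ext) (use keys_add[of c d] in \<open>auto simp: U_def\<close>)
  also have "\<dots> = finprod G (\<lambda>p. f p [^] Poly_Mapping.lookup c p \<otimes> f p [^] Poly_Mapping.lookup d p) U"
    using U f by (intro finprod_cong') (auto simp: lookup_add int_pow_mult intro!: m_closed int_pow_closed)
  also have "\<dots> = free_extend G f c \<otimes> free_extend G f d"
    using U f by (subst finprod_multf) (auto simp: ext U_def)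
  finally show "free_extend G f (c \<otimes>\<^bsub>free_Abelian_group S\<^esub> d) = free_extend G f c \<otimes> free_extend G f d"
    by simp
qed

lemma (in comm_group) free_extend_frag_of:
  "f p \<in> carrier G \<Longrightarrow> free_extend G f (frag_of p) = f p"
  by (simp add: free_extend_def)

text \<open>These are the conditions under which the extension of \<open>f\<close> to the free
  abelian group kills \<open>tensor_rels\<close>. The target is written multiplicatively, as the
  tensor product is.\<close>

definition balanced ::
  "('r, 'x) ring_scheme \<Rightarrow> ('r, 'm) module \<Rightarrow> ('r, 'n) module \<Rightarrow> ('p, 'z) monoid_scheme
    \<Rightarrow> ('m \<times> 'n \<Rightarrow> 'p) \<Rightarrow> bool" where
  "balanced A M N G f \<longleftrightarrow>
    (\<forall>x \<in> carrier M. \<forall>y \<in> carrier N. f (x, y) \<in> carrier G) \<and>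
    (\<forall>x \<in> carrier M. \<forall>x' \<in> carrier M. \<forall>y \<in> carrier N.
      f (x \<oplus>\<^bsub>M\<^esub> x', y) = f (x, y) \<otimes>\<^bsub>G\<^esub> f (x', y)) \<and>
    (\<forall>x \<in> carrier M. \<forall>y \<in> carrier N. \<forall>y' \<in> carrier N.
      f (x, y \<oplus>\<^bsub>N\<^esub> y') = f (x, y) \<otimes>\<^bsub>G\<^esub> f (x, y')) \<and>
    (\<forall>r \<in> carrier A. \<forall>x \<in> carrier M. \<forall>y \<in> carrier N.
      f (r \<odot>\<^bsub>M\<^esub> x, y) = f (x, r \<odot>\<^bsub>N\<^esub> y))"

locale tensor_product = M: module A M + N: module A N
  for A :: "('r, 'x) ring_scheme" (structure) and M :: "('r, 'm) module" and N :: "('r, 'n) module"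
begin

abbreviation "FF \<equiv> tensor_free M N"
abbreviation "TT \<equiv> tensor_group A M N"
abbreviation "KK \<equiv> tensor_rel_subgroup A M N"
abbreviation pure (infixl \<open>\<otimes>p\<close> 75) where "x \<otimes>p y \<equiv> pure_tensor A M N x y"

sublocale F: comm_group FF
  by (simp add: tensor_free_def abelian_free_Abelian_group)

lemma carrier_F: "carrier FF = {c. Poly_Mapping.keys c \<subseteq> carrier M \<times> carrier N}"
  by (auto simp: tensor_free_def)

lemma mult_F: "x \<otimes>\<^bsub>FF\<^esub> y = x + y"
  by (simp add: tensor_free_def)

lemma frag_of_F: "x \<in> carrier M \<Longrightarrow> y \<in> carrier N \<Longrightarrow> frag_of (x, y) \<in> carrier FF"
  by (simp add: carrier_F)

lemma diff_F: "a \<in> carrier FF \<Longrightarrow> b \<in> carrier FF \<Longrightarrow> a - b \<in> carrier FF"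
  using keys_diff[of a b] by (auto simp: carrier_F)

lemma rels_subset: "tensor_rels A M N \<subseteq> carrier FF"
  unfolding tensor_rels_def by (auto intro!: diff_F frag_of_F simp del: carrier_free_Abelian_group_iff)

lemma K_subgroup: "subgroup KK FF"
  unfolding tensor_rel_subgroup_def by (rule F.generate_is_subgroup[OF rels_subset])

lemma K_normal: "KK \<lhd> FF"
  using K_subgroup F.normal_iff_subgroup by blast

sublocale T: comm_group TT
  unfolding tensor_group_def by (rule F.abelian_FactGroup[OF K_subgroup])

lemma coset_hom: "(\<lambda>a. KK #>\<^bsub>FF\<^esub> a) \<in> hom FF TT"
  unfolding tensor_group_def by (rule normal.r_coset_hom_Mod[OF K_normal])

lemma coset_rel:
  assumes "a - b \<in> tensor_rels A M N" "a \<in> carrier FF" "b \<in> carrier FF"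
  shows "KK #>\<^bsub>FF\<^esub> a = KK #>\<^bsub>FF\<^esub> b"
proof -
  have K: "a - b \<in> KK"
    unfolding tensor_rel_subgroup_def using assms(1) by (rule generate.incl)
  have "KK #>\<^bsub>FF\<^esub> a = KK #>\<^bsub>FF\<^esub> ((a - b) \<otimes>\<^bsub>FF\<^esub> b)"
    by (simp add: mult_F)
  also have "\<dots> = (KK #>\<^bsub>FF\<^esub> (a - b)) \<otimes>\<^bsub>TT\<^esub> (KK #>\<^bsub>FF\<^esub> b)"
    using hom_mult[OF coset_hom diff_F[OF assms(2,3)] assms(3)] .
  also have "KK #>\<^bsub>FF\<^esub> (a - b) = \<one>\<^bsub>TT\<^esub>"
    using F.coset_join2[OF _ K_subgroup K] assms(2,3) diff_F
    by (simp add: tensor_group_def)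
  also have "\<one>\<^bsub>TT\<^esub> \<otimes>\<^bsub>TT\<^esub> (KK #>\<^bsub>FF\<^esub> b) = KK #>\<^bsub>FF\<^esub> b"
    using hom_in_carrier[OF coset_hom assms(3)] by simp
  finally show ?thesis .
qed

lemma pure_closed [simp, intro]: "x \<in> carrier M \<Longrightarrow> y \<in> carrier N \<Longrightarrow> x \<otimes>p y \<in> carrier TT"
  unfolding pure_tensor_def by (rule hom_in_carrier[OF coset_hom frag_of_F])

lemma pure_add_left:
  assumes "x \<in> carrier M" "x' \<in> carrier M" "y \<in> carrier N"
  shows "(x \<oplus>\<^bsub>M\<^esub> x') \<otimes>p y = (x \<otimes>p y) \<otimes>\<^bsub>TT\<^esub> (x' \<otimes>p y)"
proof -
  have "(x \<oplus>\<^bsub>M\<^esub> x') \<otimes>p y = KK #>\<^bsub>FF\<^esub> (frag_of (x, y) \<otimes>\<^bsub>FF\<^esub> frag_of (x', y))"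
    unfolding pure_tensor_def
  proof (rule coset_rel)
    have "frag_of (x \<oplus>\<^bsub>M\<^esub> x', y) - frag_of (x, y) - frag_of (x', y) \<in> tensor_rels A M N"
      unfolding tensor_rels_def using assms by blast
    then show "frag_of (x \<oplus>\<^bsub>M\<^esub> x', y) - frag_of (x, y) \<otimes>\<^bsub>FF\<^esub> frag_of (x', y) \<in> tensor_rels A M N"
      by (simp add: mult_F algebra_simps)
  qed (use assms in \<open>auto intro!: frag_of_F F.m_closed\<close>)
  also have "\<dots> = (x \<otimes>p y) \<otimes>\<^bsub>TT\<^esub> (x' \<otimes>p y)"
    unfolding pure_tensor_def by (rule hom_mult[OF coset_hom]) (use assms in \<open>auto intro!: frag_of_F\<close>)
  finally show ?thesis .
qed

lemma pure_add_right:
  assumes "x \<in> carrier M" "y \<in> carrier N" "y' \<in> carrier N"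
  shows "x \<otimes>p (y \<oplus>\<^bsub>N\<^esub> y') = (x \<otimes>p y) \<otimes>\<^bsub>TT\<^esub> (x \<otimes>p y')"
proof -
  have "x \<otimes>p (y \<oplus>\<^bsub>N\<^esub> y') = KK #>\<^bsub>FF\<^esub> (frag_of (x, y) \<otimes>\<^bsub>FF\<^esub> frag_of (x, y'))"
    unfolding pure_tensor_def
  proof (rule coset_rel)
    have "frag_of (x, y \<oplus>\<^bsub>N\<^esub> y') - frag_of (x, y) - frag_of (x, y') \<in> tensor_rels A M N"
      unfolding tensor_rels_def using assms by blast
    then show "frag_of (x, y \<oplus>\<^bsub>N\<^esub> y') - frag_of (x, y) \<otimes>\<^bsub>FF\<^esub> frag_of (x, y') \<in> tensor_rels A M N"
      by (simp add: mult_F algebra_simps)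
  qed (use assms in \<open>auto intro!: frag_of_F F.m_closed\<close>)
  also have "\<dots> = (x \<otimes>p y) \<otimes>\<^bsub>TT\<^esub> (x \<otimes>p y')"
    unfolding pure_tensor_def by (rule hom_mult[OF coset_hom]) (use assms in \<open>auto intro!: frag_of_F\<close>)
  finally show ?thesis .
qed

lemma pure_smult:
  assumes "r \<in> carrier A" "x \<in> carrier M" "y \<in> carrier N"
  shows "(r \<odot>\<^bsub>M\<^esub> x) \<otimes>p y = x \<otimes>p (r \<odot>\<^bsub>N\<^esub> y)"
  unfolding pure_tensor_def
  by (rule coset_rel) (use assms in \<open>auto intro!: frag_of_F simp: tensor_rels_def\<close>)

lemma pure_balanced: "balanced A M N TT (\<lambda>(x, y). x \<otimes>p y)"
  by (simp add: balanced_def pure_add_left pure_add_right pure_smult)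

text \<open>Inverses of pure tensors are again pure, so sums of pure tensors already exhaust the
  tensor product; this lets \<open>tensor_induct\<close> do without a case for inverses.\<close>

lemma inv_pure:
  assumes "x \<in> carrier M" "y \<in> carrier N"
  shows "inv\<^bsub>TT\<^esub> (x \<otimes>p y) = (\<ominus>\<^bsub>M\<^esub> x) \<otimes>p y"
proof (rule T.inv_equality)
  have "(\<zero>\<^bsub>M\<^esub> \<otimes>p y) \<otimes>\<^bsub>TT\<^esub> (\<zero>\<^bsub>M\<^esub> \<otimes>p y) = \<zero>\<^bsub>M\<^esub> \<otimes>p y"
    using pure_add_left[of "\<zero>\<^bsub>M\<^esub>" "\<zero>\<^bsub>M\<^esub>" y] assms by simp
  then have "\<zero>\<^bsub>M\<^esub> \<otimes>p y = \<one>\<^bsub>TT\<^esub>"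
    using assms T.l_cancel_one' pure_closed M.zero_closed by metis
  then show "(\<ominus>\<^bsub>M\<^esub> x) \<otimes>p y \<otimes>\<^bsub>TT\<^esub> (x \<otimes>p y) = \<one>\<^bsub>TT\<^esub>"
    using assms by (simp add: M.l_neg flip: pure_add_left)
qed (use assms in auto)

lemma tensor_induct [consumes 1, case_names pure add]:
  assumes t: "t \<in> carrier TT"
    and pure: "\<And>x y. x \<in> carrier M \<Longrightarrow> y \<in> carrier N \<Longrightarrow> P (x \<otimes>p y)"
    and add: "\<And>s t. s \<in> carrier TT \<Longrightarrow> t \<in> carrier TT \<Longrightarrow> P s \<Longrightarrow> P t \<Longrightarrow> P (s \<otimes>\<^bsub>TT\<^esub> t)"
  shows "P t"
proof -
  interpret h: group_hom FF TT "\<lambda>a. KK #>\<^bsub>FF\<^esub> a"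
    by unfold_locales (rule coset_hom)
  \<comment> \<open>The neutral element is itself a sum of two pure tensors, so it needs no case of
    its own.\<close>
  have one: "P \<one>\<^bsub>TT\<^esub>"
  proof -
    have "P ((\<zero>\<^bsub>M\<^esub> \<otimes>p \<zero>\<^bsub>N\<^esub>) \<otimes>\<^bsub>TT\<^esub> inv\<^bsub>TT\<^esub> (\<zero>\<^bsub>M\<^esub> \<otimes>p \<zero>\<^bsub>N\<^esub>))"
      by (rule add) (auto intro!: pure simp: inv_pure)
    then show ?thesis by simp
  qed
  obtain c where c: "Poly_Mapping.keys c \<subseteq> carrier M \<times> carrier N" "t = KK #>\<^bsub>FF\<^esub> c"
    using t by (auto simp: tensor_group_def carrier_FactGroup carrier_F)
  \<comment> \<open>Induction over the free abelian group runs through differences, so the claim is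
    carried along together with its version for inverses.\<close>
  let ?Q = "\<lambda>c. P (KK #>\<^bsub>FF\<^esub> c) \<and> P (inv\<^bsub>TT\<^esub> (KK #>\<^bsub>FF\<^esub> c))"
  from c(1) have "?Q c"
  proof (induction c rule: free_Abelian_group_induct[consumes 1])
    case 1
    then show ?case using one h.hom_one by (simp add: tensor_free_def)
  next
    case (2 c d)
    have cd: "c \<in> carrier FF" "d \<in> carrier FF" using 2 by (auto simp: carrier_F)
    have "inv\<^bsub>FF\<^esub> d = - d" using 2 by (simp add: tensor_free_def)
    then have eq: "c - d = c \<otimes>\<^bsub>FF\<^esub> inv\<^bsub>FF\<^esub> d" by (simp add: mult_F)
    show ?case
      unfolding eq using cd 2
      by (auto simp: T.inv_mult intro!: add)
  next
    case (3 p)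
    then show ?case
      using pure inv_pure unfolding pure_tensor_def by (cases p) auto
  qed
  then show ?thesis using c(2) by simp
qed

text \<open>\<open>tensor_lift\<close> takes \<open>the_elem\<close> of the image of a coset. This
  is meaningful once the relations lie in the kernel of the free extension, since the image of a
  coset is then a single point.\<close>

lemma tensor_lift:
  assumes G: "comm_group G" and f: "balanced A M N G f"
  shows tensor_lift_hom: "tensor_lift G f \<in> hom TT G"
    and tensor_lift_pure: "\<And>x y. x \<in> carrier M \<Longrightarrow> y \<in> carrier N \<Longrightarrow> tensor_lift G f (x \<otimes>p y) = f (x, y)"
proof -
  interpret G: comm_group G by fact
  have fcl: "f p \<in> carrier G" if "p \<in> carrier M \<times> carrier N" for p
    using f that by (auto simp: balanced_def)
  have h: "free_extend G f \<in> hom FF G"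
    unfolding tensor_free_def by (rule G.free_extend_hom[OF fcl])
  interpret h: group_hom FF G "free_extend G f"
    by unfold_locales (rule h)
  have frag: "free_extend G f (frag_of (x, y)) = f (x, y)" if "x \<in> carrier M" "y \<in> carrier N" for x y
    using that fcl by (intro G.free_extend_frag_of) auto
  have diff: "free_extend G f (a - b) = free_extend G f a \<otimes>\<^bsub>G\<^esub> inv\<^bsub>G\<^esub> free_extend G f b"
    if "a \<in> carrier FF" "b \<in> carrier FF" for a b
  proof -
    have "inv\<^bsub>FF\<^esub> b = - b" using that by (simp add: tensor_free_def)
    then have "a - b = a \<otimes>\<^bsub>FF\<^esub> inv\<^bsub>FF\<^esub> b" by (simp add: mult_F)
    then show ?thesis using that by simp
  qed
  have comm: "a \<otimes>\<^bsub>G\<^esub> b \<otimes>\<^bsub>G\<^esub> inv\<^bsub>G\<^esub> a \<otimes>\<^bsub>G\<^esub> inv\<^bsub>G\<^esub> b = \<one>\<^bsub>G\<^esub>"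
    if "a \<in> carrier G" "b \<in> carrier G" for a b
    using that by (simp add: G.m_comm[of a b] G.m_assoc)
  have "tensor_rels A M N \<subseteq> kernel FF G (free_extend G f)"
  proof
    fix c assume c: "c \<in> tensor_rels A M N"
    then have "free_extend G f c = \<one>\<^bsub>G\<^esub>"
      unfolding tensor_rels_def using f
      by (auto simp: diff frag diff_F frag_of_F balanced_def comm)
    then show "c \<in> kernel FF G (free_extend G f)"
      using c rels_subset by (auto simp: kernel_def)
  qed
  then have K: "KK \<subseteq> kernel FF G (free_extend G f)"
    unfolding tensor_rel_subgroup_def
    by (rule F.generate_subgroup_incl[OF _ h.subgroup_kernel])
  have coset: "tensor_lift G f (KK #>\<^bsub>FF\<^esub> c) = free_extend G f c" if c: "c \<in> carrier FF" for c
  proof -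
    have "free_extend G f ` (KK #>\<^bsub>FF\<^esub> c) = {free_extend G f c}"
    proof -
      have "free_extend G f (k \<otimes>\<^bsub>FF\<^esub> c) = free_extend G f c" if "k \<in> KK" for k
        using that K c by (subst h.hom_mult) (auto simp: kernel_def)
      then show ?thesis using subgroup.one_closed[OF K_subgroup] by (force simp: r_coset_def image_UN)
    qed
    then show ?thesis by (simp add: tensor_lift_def)
  qed
  show "tensor_lift G f (x \<otimes>p y) = f (x, y)" if "x \<in> carrier M" "y \<in> carrier N" for x y
    using that by (simp add: pure_tensor_def coset frag_of_F frag)
  interpret c: group_hom FF TT "\<lambda>a. KK #>\<^bsub>FF\<^esub> a"
    by unfold_locales (rule coset_hom)
  have ex: "\<exists>c \<in> carrier FF. t = KK #>\<^bsub>FF\<^esub> c" if "t \<in> carrier TT" for t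
    using that by (auto simp: tensor_group_def carrier_FactGroup)
  show "tensor_lift G f \<in> hom TT G"
  proof (rule homI)
    fix s t assume "s \<in> carrier TT" "t \<in> carrier TT"
    then obtain a b where "a \<in> carrier FF" "s = KK #>\<^bsub>FF\<^esub> a" "b \<in> carrier FF" "t = KK #>\<^bsub>FF\<^esub> b"
      using ex by meson
    then show "tensor_lift G f (s \<otimes>\<^bsub>TT\<^esub> t) = tensor_lift G f s \<otimes>\<^bsub>G\<^esub> tensor_lift G f t"
      by (simp add: coset flip: c.hom_mult)
  qed (use ex coset in fastforce)
qed

end

section \<open>Small sets\<close>

text \<open>One family of binary operations is enough: a unary operation ignores an argument, and
  constants are put into the starting set. The same closure measures tensor products, direct sums
  and the submodules behind the generator.\<close>

inductive_set op_closure :: "'k set \<Rightarrow> ('k \<Rightarrow> 'e \<Rightarrow> 'e \<Rightarrow> 'e) \<Rightarrow> 'e set \<Rightarrow> 'e set"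
  for K f S where
  base: "s \<in> S \<Longrightarrow> s \<in> op_closure K f S"
| op: "k \<in> K \<Longrightarrow> x \<in> op_closure K f S \<Longrightarrow> y \<in> op_closure K f S \<Longrightarrow> f k x y \<in> op_closure K f S"

text \<open>The closure is exhausted by countably many stages, and an infinite \<open>L\<close>
  absorbs products, binary unions and countable unions.\<close>

lemma card_of_op_closure:
  assumes inf: "infinite L" and S: "|S| \<le>o |L|" and K: "|K| \<le>o |L|"
  shows "|op_closure K f S| \<le>o |L|"
proof -
  define st where "st = rec_nat S (\<lambda>_ X. X \<union> (\<lambda>(k, x, y). f k x y) ` (K \<times> X \<times> X))"
  have st_0: "st 0 = S" and st_Suc: "st (Suc n) = st n \<union> (\<lambda>(k, x, y). f k x y) ` (K \<times> st n \<times> st n)" for n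
    by (simp_all add: st_def)
  have mono: "st m \<subseteq> st n" if "m \<le> n" for m n
    using that by (induction rule: dec_induct) (auto simp: st_Suc)
  have card: "|st n| \<le>o |L|" for n
  proof (induction n)
    case 0
    then show ?case using S by (simp add: st_0)
  next
    case (Suc n)
    have times: "|X \<times> Y| \<le>o |L|" if "|X| \<le>o |L|" "|Y| \<le>o |L|" for X :: "'x set" and Y :: "'y set"
      using card_of_Sigma_ordLeq_infinite[OF inf that(1), of "\<lambda>_. Y"] that(2) by simp
    have "|K \<times> st n \<times> st n| \<le>o |L|"
      by (intro times K Suc)
    then have "|(\<lambda>(k, x, y). f k x y) ` (K \<times> st n \<times> st n)| \<le>o |L|"
      using card_of_image ordLeq_transitive by blast
    then show ?case
      unfolding st_Suc using Suc inf card_of_Un_ordLeq_infinite_Field[of "|L|"]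
      by (simp add: Field_card_of card_of_card_order_on)
  qed
  have "op_closure K f S \<subseteq> (\<Union>n. st n)"
  proof
    fix x assume "x \<in> op_closure K f S"
    then show "x \<in> (\<Union>n. st n)"
    proof induction
      case (base s)
      then show ?case using st_0 by blast
    next
      case (op k x y)
      then obtain m n where "x \<in> st m" "y \<in> st n" by blast
      then have "x \<in> st (max m n)" "y \<in> st (max m n)" using mono[of m "max m n"] mono[of n "max m n"] by auto
      then have "f k x y \<in> st (Suc (max m n))" using op(1) by (force simp: st_Suc)
      then show ?case by blast
    qed
  qed
  then have "|op_closure K f S| \<le>o |\<Union>n. st n|" by (rule card_of_mono1)
  also have "|\<Union>n. st n| \<le>o |L|"
    using card inf by (intro card_of_UNION_ordLeq_infinite) (auto simp: infinite_iff_card_of_nat)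
  finally show ?thesis .
qed

lemma small_surj: "small \<kappa> A \<Longrightarrow> B \<subseteq> f ` A \<Longrightarrow> small \<kappa> B"
  unfolding small_def using surj_imp_ordLeq ordLeq_ordLess_trans by blast

lemma small_ordLeq: "small \<kappa> A \<Longrightarrow> |B| \<le>o |A| \<Longrightarrow> small \<kappa> B"
  unfolding small_def using ordLeq_ordLess_trans by blast

lemma small_subset: "small \<kappa> A \<Longrightarrow> B \<subseteq> A \<Longrightarrow> small \<kappa> B"
  using small_surj[of \<kappa> A B "\<lambda>x. x"] by simp

text \<open>Regularity of \<kappa> enters here.\<close>

lemma small_UNION:
  assumes "universe \<kappa>" "small \<kappa> I" "\<And>i. i \<in> I \<Longrightarrow> small \<kappa> (A i)"
  shows "small \<kappa> (\<Union>i\<in>I. A i)"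
  using assms unfolding small_def universe_def
  by (intro card_of_UNION_ordLess_infinite_Field_regularCard) auto

lemma small_Sigma:
  assumes "universe \<kappa>" "small \<kappa> I" "\<And>i. i \<in> I \<Longrightarrow> small \<kappa> (A i)"
  shows "small \<kappa> (SIGMA i:I. A i)"
proof -
  have eq: "(SIGMA i:I. A i) = (\<Union>i\<in>I. Pair i ` A i)" by auto
  show ?thesis
    unfolding eq using assms(1,2)
    by (rule small_UNION) (rule small_surj[OF assms(3) order_refl])
qed

lemma small_Un:
  assumes "universe \<kappa>" "small \<kappa> A" "small \<kappa> B"
  shows "small \<kappa> (A \<union> B)"
  using assms unfolding small_def universe_def
  by (intro card_of_Un_ordLess_infinite_Field) (auto simp: cinfinite_def)

lemma small_singleton:
  assumes "universe \<kappa>"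
  shows "small \<kappa> {x}"
proof -
  have "\<not> |Field \<kappa>| \<le>o |{x}|"
    using assms card_of_ordLeq_finite by (auto simp: universe_def cinfinite_def)
  then have "|{x}| <o |Field \<kappa>|" by (simp add: not_ordLeq_iff_ordLess card_of_Well_order)
  moreover have "|Field \<kappa>| =o \<kappa>" using assms by (simp add: universe_def card_of_Field_ordIso)
  ultimately show ?thesis unfolding small_def by (rule ordLess_ordIso_trans)
qed

text \<open>\<open>card_of_op_closure\<close> asks for one infinite set above both generators and
  operations. A disjoint union with the natural numbers provides it, and it remains small because
  \<kappa> is uncountable, which is what the hypothesis \<open>nat\<close> expresses.\<close>

lemma small_op_closure:
  fixes S :: "'e set" and K :: "'k set"
  assumes univ: "universe \<kappa>" and nat: "small \<kappa> (UNIV :: nat set)" and S: "small \<kappa> S" and K: "small \<kappa> K"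
  shows "small \<kappa> (op_closure K f S)"
proof -
  define L where "L = (Inl ` Inl ` S \<union> Inl ` Inr ` K \<union> range Inr :: (('e + 'k) + nat) set)"
  have "small \<kappa> L"
    unfolding L_def using assms
    by (intro small_Un small_surj[OF S, of _ "\<lambda>x. Inl (Inl x)"] small_surj[OF K, of _ "\<lambda>x. Inl (Inr x)"]
        small_surj[OF nat, of _ Inr]) auto
  moreover have "|op_closure K f S| \<le>o |L|"
  proof (rule card_of_op_closure)
    show "infinite L" unfolding L_def by (simp add: finite_image_iff)
    show "|S| \<le>o |L|" by (rule card_of_ordLeqI[of "\<lambda>x. Inl (Inl x)"]) (auto simp: inj_on_def L_def)
    show "|K| \<le>o |L|" by (rule card_of_ordLeqI[of "\<lambda>x. Inl (Inr x)"]) (auto simp: inj_on_def L_def)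
  qed
  ultimately show ?thesis by (rule small_ordLeq)
qed

section \<open>Extension of scalars\<close>

locale scalar_extension = A: cring A + B: cring B + module A M
  for A :: "'r ring" and B :: "'r ring" and \<phi> :: "'r \<Rightarrow> 'r" and M :: "('r, 'm) module" +
  assumes hom: "\<phi> \<in> ring_hom A B"
begin

sublocale tensor_product A "restrict_scalars \<phi> (ring_as_module B)" M
  by (intro tensor_product.intro module_restrict_scalars[OF A.is_cring hom]
      module_ring_as_module B.is_cring module_axioms)

abbreviation pure_extension (infixl \<open>\<otimes>p\<close> 75) where
  "x \<otimes>p m \<equiv> pure_tensor A (restrict_scalars \<phi> (ring_as_module B)) M x m"

abbreviation "E \<equiv> extend_scalars A B \<phi> M"

lemma extend_simps:
  "carrier E = carrier TT" "zero E = one TT" "add E = monoid.mult TT"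
  "smult E b = tensor_lift TT (\<lambda>(x, m). (b \<otimes>\<^bsub>B\<^esub> x) \<otimes>p m)"
  by (simp_all add: extend_scalars_def Let_def)

lemma phi_closed [simp]: "r \<in> carrier A \<Longrightarrow> \<phi> r \<in> carrier B"
  using hom by (rule ring_hom_closed)

lemma balancedI:
  assumes "\<And>x m. x \<in> carrier B \<Longrightarrow> m \<in> carrier M \<Longrightarrow> f (x, m) \<in> carrier G"
    and "\<And>x x' m. x \<in> carrier B \<Longrightarrow> x' \<in> carrier B \<Longrightarrow> m \<in> carrier M \<Longrightarrow>
      f (x \<oplus>\<^bsub>B\<^esub> x', m) = f (x, m) \<otimes>\<^bsub>G\<^esub> f (x', m)"
    and "\<And>x m m'. x \<in> carrier B \<Longrightarrow> m \<in> carrier M \<Longrightarrow> m' \<in> carrier M \<Longrightarrow>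
      f (x, m \<oplus>\<^bsub>M\<^esub> m') = f (x, m) \<otimes>\<^bsub>G\<^esub> f (x, m')"
    and "\<And>r x m. r \<in> carrier A \<Longrightarrow> x \<in> carrier B \<Longrightarrow> m \<in> carrier M \<Longrightarrow>
      f (\<phi> r \<otimes>\<^bsub>B\<^esub> x, m) = f (x, r \<odot>\<^bsub>M\<^esub> m)"
  shows "balanced A (restrict_scalars \<phi> (ring_as_module B)) M G f"
  using assms by (simp add: balanced_def)

lemma ext_add_left: "x \<in> carrier B \<Longrightarrow> x' \<in> carrier B \<Longrightarrow> m \<in> carrier M \<Longrightarrow>
    (x \<oplus>\<^bsub>B\<^esub> x') \<otimes>p m = x \<otimes>p m \<otimes>\<^bsub>TT\<^esub> (x' \<otimes>p m)"
  using pure_add_left[of x x' m] by simp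

lemma ext_smult: "r \<in> carrier A \<Longrightarrow> x \<in> carrier B \<Longrightarrow> m \<in> carrier M \<Longrightarrow>
    (\<phi> r \<otimes>\<^bsub>B\<^esub> x) \<otimes>p m = x \<otimes>p (r \<odot>\<^bsub>M\<^esub> m)"
  using pure_smult[of r x m] by simp

lemma ext_closed [simp]: "x \<in> carrier B \<Longrightarrow> m \<in> carrier M \<Longrightarrow> x \<otimes>p m \<in> carrier TT"
  using pure_closed[of x m] by simp

lemma ext_add_right: "x \<in> carrier B \<Longrightarrow> m \<in> carrier M \<Longrightarrow> m' \<in> carrier M \<Longrightarrow>
    x \<otimes>p (m \<oplus>\<^bsub>M\<^esub> m') = x \<otimes>p m \<otimes>\<^bsub>TT\<^esub> (x \<otimes>p m')"
  using pure_add_right[of x m m'] by simp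

lemma ext_induct [consumes 1, case_names pure add]:
  assumes "t \<in> carrier TT"
    and "\<And>x m. x \<in> carrier B \<Longrightarrow> m \<in> carrier M \<Longrightarrow> P (x \<otimes>p m)"
    and "\<And>s t. s \<in> carrier TT \<Longrightarrow> t \<in> carrier TT \<Longrightarrow> P s \<Longrightarrow> P t \<Longrightarrow> P (s \<otimes>\<^bsub>TT\<^esub> t)"
  shows "P t"
  using tensor_induct[of t P] assms by simp

text \<open>Multiplication on the left factor commutes with the action of \<open>A\<close> because
  \<open>B\<close> is commutative; hence it descends to the tensor product and gives the
  \<open>B\<close>-action.\<close>

lemma smult_balanced:
  assumes "b \<in> carrier B"
  shows "balanced A (restrict_scalars \<phi> (ring_as_module B)) M TT (\<lambda>(x, m). (b \<otimes>\<^bsub>B\<^esub> x) \<otimes>p m)"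
  by (rule balancedI)
    (use assms in \<open>simp_all add: B.r_distr ext_add_left ext_add_right B.m_lcomm flip: ext_smult\<close>)

lemma smult_pure: "b \<in> carrier B \<Longrightarrow> x \<in> carrier B \<Longrightarrow> m \<in> carrier M \<Longrightarrow>
    b \<odot>\<^bsub>E\<^esub> (x \<otimes>p m) = (b \<otimes>\<^bsub>B\<^esub> x) \<otimes>p m"
  using tensor_lift_pure[OF T.comm_group_axioms smult_balanced, of b x m] by (simp add: extend_simps)

lemma smult_add: "b \<in> carrier B \<Longrightarrow> s \<in> carrier TT \<Longrightarrow> t \<in> carrier TT \<Longrightarrow>
    b \<odot>\<^bsub>E\<^esub> (s \<otimes>\<^bsub>TT\<^esub> t) = (b \<odot>\<^bsub>E\<^esub> s) \<otimes>\<^bsub>TT\<^esub> (b \<odot>\<^bsub>E\<^esub> t)"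
  using hom_mult[OF tensor_lift_hom[OF T.comm_group_axioms smult_balanced]] by (simp add: extend_simps)

lemma smult_TT: "b \<in> carrier B \<Longrightarrow> t \<in> carrier TT \<Longrightarrow> b \<odot>\<^bsub>E\<^esub> t \<in> carrier TT"
  using hom_in_carrier[OF tensor_lift_hom[OF T.comm_group_axioms smult_balanced]]
  by (simp add: extend_simps)

lemma module_extend_scalars: "module B E"
proof (rule moduleI[OF B.is_cring])
  show "abelian_group E"
  proof (rule abelian_groupI)
    show "\<exists>y\<in>carrier E. y \<oplus>\<^bsub>E\<^esub> x = \<zero>\<^bsub>E\<^esub>" if "x \<in> carrier E" for x
      using that by (intro bexI[of _ "inv\<^bsub>TT\<^esub> x"]) (auto simp: extend_simps)
  qed (simp_all add: extend_simps T.m_ac)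
next
  fix a x assume a: "a \<in> carrier B" and x: "x \<in> carrier E"
  show "a \<odot>\<^bsub>E\<^esub> x \<in> carrier E" using a x by (simp add: smult_TT extend_simps(1))
  { fix y assume "y \<in> carrier E"
    then show "a \<odot>\<^bsub>E\<^esub> (x \<oplus>\<^bsub>E\<^esub> y) = a \<odot>\<^bsub>E\<^esub> x \<oplus>\<^bsub>E\<^esub> a \<odot>\<^bsub>E\<^esub> y"
      using a x by (simp add: smult_add extend_simps(1,3)) }
  { fix b assume b: "b \<in> carrier B"
    show "(a \<oplus>\<^bsub>B\<^esub> b) \<odot>\<^bsub>E\<^esub> x = a \<odot>\<^bsub>E\<^esub> x \<oplus>\<^bsub>E\<^esub> b \<odot>\<^bsub>E\<^esub> x"
      using x[unfolded extend_simps(1)] unfolding extend_simps(3)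
      by (induction x rule: ext_induct)
        (use a b in \<open>auto simp: smult_pure smult_add smult_TT B.l_distr ext_add_left T.m_ac\<close>)
    show "(a \<otimes>\<^bsub>B\<^esub> b) \<odot>\<^bsub>E\<^esub> x = a \<odot>\<^bsub>E\<^esub> (b \<odot>\<^bsub>E\<^esub> x)"
      using x[unfolded extend_simps(1)]
      by (induction x rule: ext_induct)
        (use a b in \<open>auto simp: smult_pure smult_add smult_TT B.m_assoc\<close>) }
next
  fix x assume x: "x \<in> carrier E"
  show "\<one>\<^bsub>B\<^esub> \<odot>\<^bsub>E\<^esub> x = x"
    using x[unfolded extend_simps(1)]
    by (induction x rule: ext_induct) (auto simp: smult_pure smult_add)
qed

lemma unit_hom: "(\<lambda>m. \<one>\<^bsub>B\<^esub> \<otimes>p m) \<in> mod_hom A M (restrict_scalars \<phi> E)"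
  by (intro mod_homI)
    (auto simp: extend_simps(1,3) ext_add_right smult_pure B.m_comm simp flip: ext_smult)

text \<open>The transpose of an \<open>A\<close>-linear \<open>j\<close> from \<open>M\<close> to
  \<open>N\<close> under the adjunction between extension and restriction of scalars. For a
  restriction map of a presheaf module it is the comparison map that \<open>cartesian\<close>
  requires to be an isomorphism. Its definition involves only \<open>N\<close> and \<open>j\<close>,
  so one function acts on the tensor products of different modules.\<close>

definition adjoint where
  "adjoint N j = tensor_lift (add_monoid N) (\<lambda>(r, m). r \<odot>\<^bsub>N\<^esub> j m)"

context
  fixes N :: "('r, 'n) module" and j
  assumes N: "module B N" and j: "j \<in> mod_hom A M (restrict_scalars \<phi> N)"
begin

interpretation N: module B N by (rule N)

lemma adjoint_balanced:
  "balanced A (restrict_scalars \<phi> (ring_as_module B)) M (add_monoid N) (\<lambda>(r, m). r \<odot>\<^bsub>N\<^esub> j m)"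
proof (rule balancedI)
  fix r x m assume rxm: "r \<in> carrier A" "x \<in> carrier B" "m \<in> carrier M"
  then have "j m \<in> carrier N" "j (r \<odot>\<^bsub>M\<^esub> m) = \<phi> r \<odot>\<^bsub>N\<^esub> j m" using j by (auto simp: mod_hom_def)
  then show "(case (\<phi> r \<otimes>\<^bsub>B\<^esub> x, m) of (r, m) \<Rightarrow> r \<odot>\<^bsub>N\<^esub> j m) =
    (case (x, r \<odot>\<^bsub>M\<^esub> m) of (r, m) \<Rightarrow> r \<odot>\<^bsub>N\<^esub> j m)"
    using rxm B.m_comm[of "\<phi> r" x] by (simp add: N.smult_assoc1)
qed (use j in \<open>auto simp: mod_hom_def N.smult_l_distr N.smult_r_distr Pi_iff\<close>)

lemma adjoint_pure: "r \<in> carrier B \<Longrightarrow> m \<in> carrier M \<Longrightarrow> adjoint N j (r \<otimes>p m) = r \<odot>\<^bsub>N\<^esub> j m"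
  unfolding adjoint_def using tensor_lift_pure[OF N.a_comm_group adjoint_balanced, of r m] by simp

lemma adjoint_add: "s \<in> carrier TT \<Longrightarrow> t \<in> carrier TT \<Longrightarrow>
    adjoint N j (s \<otimes>\<^bsub>TT\<^esub> t) = adjoint N j s \<oplus>\<^bsub>N\<^esub> adjoint N j t"
  using hom_mult[OF tensor_lift_hom[OF N.a_comm_group adjoint_balanced]]
  by (simp add: adjoint_def)

lemma adjoint_closed: "t \<in> carrier TT \<Longrightarrow> adjoint N j t \<in> carrier N"
  using hom_in_carrier[OF tensor_lift_hom[OF N.a_comm_group adjoint_balanced]]
  by (simp add: adjoint_def)

lemma adjoint_hom: "adjoint N j \<in> mod_hom B E N"
proof (rule mod_homI)
  fix r t assume r: "r \<in> carrier B" and t: "t \<in> carrier E"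
  show "adjoint N j (r \<odot>\<^bsub>E\<^esub> t) = r \<odot>\<^bsub>N\<^esub> adjoint N j t"
    using t[unfolded extend_simps(1)]
    by (induction t rule: ext_induct)
      (use r j in \<open>auto simp: smult_pure adjoint_pure smult_add adjoint_add smult_TT adjoint_closed
        N.smult_assoc1 N.smult_r_distr mod_hom_def Pi_iff\<close>)
qed (auto simp: extend_simps(1,3) adjoint_closed adjoint_add)

lemma adjoint_iso_iff:
  "adjoint N j \<in> mod_iso B E N \<longleftrightarrow> bij_betw (adjoint N j) (carrier TT) (carrier N)"
  using adjoint_hom by (simp add: mod_iso_def extend_simps(1))

text \<open>If \<open>N\<close> is the extension of scalars of \<open>M\<close> via \<open>j\<close>, a \<open>B\<close>-linear map on \<open>N\<close> is the same as an
  \<open>A\<close>-linear map on \<open>M\<close>.\<close>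

lemma extension_unique:
  assumes surj: "carrier N \<subseteq> adjoint N j ` carrier TT"
    and h: "h \<in> mod_hom B N P" and h': "h' \<in> mod_hom B N P"
    and eq: "\<And>m. m \<in> carrier M \<Longrightarrow> h (j m) = h' (j m)" and n: "n \<in> carrier N"
  shows "h n = h' n"
proof -
  obtain t where t: "t \<in> carrier TT" "n = adjoint N j t" using surj n by auto
  have jcl: "j m \<in> carrier N" if "m \<in> carrier M" for m using j that by (auto simp: mod_hom_def)
  have "h (adjoint N j t) = h' (adjoint N j t)"
    using t(1)
    by (induction t rule: ext_induct)
      (use eq jcl in \<open>auto simp: adjoint_pure adjoint_add adjoint_closed mod_hom_add[OF h] mod_hom_add[OF h']
        mod_hom_smult[OF h] mod_hom_smult[OF h'] mod_hom_closed\<close>)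
  then show ?thesis using t(2) by simp
qed

end

text \<open>The extension is the transpose of \<open>g\<close> after the inverse of the transpose of
  \<open>j\<close>.\<close>

lemma extension_exists:
  fixes N :: "('r, 'n) module" and P :: "('r, 'p) module"
  assumes N: "module B N" and j: "j \<in> mod_hom A M (restrict_scalars \<phi> N)"
    and bij: "bij_betw (adjoint N j) (carrier TT) (carrier N)"
    and P: "module B P" and g: "g \<in> mod_hom A M (restrict_scalars \<phi> P)"
  shows "\<exists>h \<in> mod_hom B N P. \<forall>m \<in> carrier M. h (j m) = g m"
proof -
  interpret N: module B N by (rule N)
  interpret P: module B P by (rule P)
  interpret E: module B E by (rule module_extend_scalars)
  define i where "i = inv_into (carrier TT) (adjoint N j)"
  have i': "i (adjoint N j t) = t" if "t \<in> carrier TT" for t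
    using bij that by (auto simp: i_def bij_betw_def)
  have ih: "i \<in> mod_hom B N E"
    unfolding i_def using mod_hom_inv[OF module_extend_scalars adjoint_hom[OF N j]] bij
    by (simp add: extend_simps(1))
  show ?thesis
  proof (intro bexI ballI)
    show "(\<lambda>n. adjoint P g (i n)) \<in> mod_hom B N P"
      using ih adjoint_hom[OF P g] by (rule mod_hom_comp)
    fix m assume m: "m \<in> carrier M"
    have "j m \<in> carrier N" using j m by (auto simp: mod_hom_def)
    then have "j m = adjoint N j (\<one>\<^bsub>B\<^esub> \<otimes>p m)" using m by (simp add: adjoint_pure[OF N j])
    moreover have "g m \<in> carrier P" using g m by (auto simp: mod_hom_def)
    ultimately show "adjoint P g (i (j m)) = g m" using m by (simp add: i' adjoint_pure[OF P g])
  qed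
qed

text \<open>By \<open>ext_induct\<close> the pure tensors generate under addition alone, so
  everything lies in the closure of a small set under one operation.\<close>

lemma small_tensor:
  assumes "universe \<kappa>" "small \<kappa> (UNIV :: nat set)" "small \<kappa> (carrier B)" "small \<kappa> (carrier M)"
  shows "small \<kappa> (carrier TT)"
proof -
  define S where "S = (\<lambda>(x, m). x \<otimes>p m) ` (carrier B \<times> carrier M)"
  have "small \<kappa> (carrier B \<times> carrier M)" by (rule small_Sigma) (use assms in auto)
  then have "small \<kappa> S" unfolding S_def by (rule small_surj[OF _ order_refl])
  then have "small \<kappa> (op_closure {()} (\<lambda>_. monoid.mult TT) S)"
    by (intro small_op_closure small_singleton assms(1,2))
  moreover have "carrier TT \<subseteq> op_closure {()} (\<lambda>_. monoid.mult TT) S"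
  proof
    fix t assume "t \<in> carrier TT"
    then show "t \<in> op_closure {()} (\<lambda>_. monoid.mult TT) S"
    proof (induction t rule: ext_induct)
      case (pure x m)
      then show ?case by (auto intro!: op_closure.base simp: S_def)
    next
      case (add s t)
      then show ?case using op_closure.op[of "()" "{()}" s "\<lambda>_. monoid.mult TT" S t] by simp
    qed
  qed
  ultimately show ?thesis by (rule small_subset)
qed

text \<open>A converse to the two extension lemmas. The decisive test object is the tensor product
  itself, which has the wrong type; its copy in \<open>'u\<close> is small by
  \<open>small_tensor\<close>. Extending the unit to this copy gives a left inverse of the
  transpose, and uniqueness, applied to an endomorphism of \<open>N\<close>, shows that it is a
  right inverse too.\<close>

lemma extension_bijI:
  fixes N :: "('r, 'u) module" and \<kappa> :: "'u rel"
  assumes univ: "universe \<kappa>" "small \<kappa> (UNIV :: nat set)" "small \<kappa> (carrier B)" "small \<kappa> (carrier M)"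
    and N: "module B N" and j: "j \<in> mod_hom A M (restrict_scalars \<phi> N)"
    and ex: "\<And>(P :: ('r, 'u) module) g. module B P \<Longrightarrow> small \<kappa> (carrier P) \<Longrightarrow>
      g \<in> mod_hom A M (restrict_scalars \<phi> P) \<Longrightarrow> \<exists>h \<in> mod_hom B N P. \<forall>m \<in> carrier M. h (j m) = g m"
    and uniq: "\<And>h n. h \<in> mod_hom B N N \<Longrightarrow> \<forall>m \<in> carrier M. h (j m) = j m \<Longrightarrow> n \<in> carrier N \<Longrightarrow> h n = n"
  shows "bij_betw (adjoint N j) (carrier TT) (carrier N)"
proof -
  interpret N: module B N by (rule N)
  have E: "module B E" by (rule module_extend_scalars)
  interpret E: module B E by (rule E)
  have "small \<kappa> (carrier E)" using small_tensor[OF univ] by (simp add: extend_simps(1))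
  moreover have "Card_order \<kappa>" using univ(1) by (simp add: universe_def)
  moreover have "submodule {\<zero>\<^bsub>E\<^esub>} B E"
    by (rule E.submoduleI) auto
  \<comment> \<open>Dividing by the zero submodule serves purely to move \<open>E\<close> into the
    type \<open>'u\<close>.\<close>
  ultimately obtain Q :: "('r, 'u) module" and q where Q: "module B Q" "small \<kappa> (carrier Q)"
    and q: "q \<in> mod_hom B E Q" "\<And>x. x \<in> carrier E \<Longrightarrow> q x = \<zero>\<^bsub>Q\<^esub> \<longleftrightarrow> x \<in> {\<zero>\<^bsub>E\<^esub>}"
      "q ` carrier E = carrier Q"
    using quotient_module_exists[OF E, of "{\<zero>\<^bsub>E\<^esub>}" \<kappa>] by metis
  have inj: "inj_on q (carrier E)" using mod_hom_inj_iff[OF E Q(1) q(1)] q(2) by simp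
  have q': "q \<in> mod_hom A (restrict_scalars \<phi> E) (restrict_scalars \<phi> Q)"
    using q(1) by (auto simp: mod_hom_def)
  obtain h where h: "h \<in> mod_hom B N Q" "\<And>m. m \<in> carrier M \<Longrightarrow> h (j m) = q (\<one>\<^bsub>B\<^esub> \<otimes>p m)"
    using ex[OF Q mod_hom_comp[OF unit_hom q']] by blast
  have jcl: "j m \<in> carrier N" if "m \<in> carrier M" for m using j that by (auto simp: mod_hom_def)
  have hq: "h (adjoint N j t) = q t" if "t \<in> carrier TT" for t
    using that
  proof (induction t rule: ext_induct)
    case (pure x m)
    have "q (x \<otimes>p m) = q (x \<odot>\<^bsub>E\<^esub> (\<one>\<^bsub>B\<^esub> \<otimes>p m))" using pure by (simp add: smult_pure)
    also have "\<dots> = x \<odot>\<^bsub>Q\<^esub> q (\<one>\<^bsub>B\<^esub> \<otimes>p m)"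
      using pure by (intro mod_hom_smult[OF q(1)]) (auto simp: extend_simps(1))
    finally show ?case
      using pure by (simp add: adjoint_pure[OF N j] mod_hom_smult[OF h(1)] h(2) jcl)
  next
    case (add s t)
    then show ?case
      using mod_hom_add[OF q(1), of s t]
      by (simp add: adjoint_add[OF N j] mod_hom_add[OF h(1)] adjoint_closed[OF N j] extend_simps(1,3))
  qed
  have bij_q: "bij_betw q (carrier E) (carrier Q)" using inj q(3) by (simp add: bij_betw_def)
  define i where "i = inv_into (carrier E) q"
  have i: "i \<in> mod_hom B Q E" unfolding i_def by (rule mod_hom_inv[OF E q(1) bij_q])
  have iq: "i (q t) = t" if "t \<in> carrier TT" for t
    using that inj by (simp add: i_def extend_simps(1))
  \<comment> \<open>\<open>k\<close> is the transpose after its candidate inverse. It fixes the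
    image of \<open>j\<close>, so \<open>uniq\<close> makes it the identity, which gives
    surjectivity.\<close>
  define k where "k n = adjoint N j (i (h n))" for n
  have k: "k n = n" if "n \<in> carrier N" for n
  proof (rule uniq[OF _ _ that])
    show "k \<in> mod_hom B N N"
      unfolding k_def using mod_hom_comp[OF mod_hom_comp[OF h(1) i] adjoint_hom[OF N j]] .
    show "\<forall>m\<in>carrier M. k (j m) = j m"
      using jcl by (simp add: k_def h(2) iq adjoint_pure[OF N j])
  qed
  show ?thesis
  proof (rule bij_betwI')
    fix s t assume "s \<in> carrier TT" "t \<in> carrier TT"
    then show "(adjoint N j s = adjoint N j t) = (s = t)"
      using hq iq by metis
  next
    fix t assume "t \<in> carrier TT"
    then show "adjoint N j t \<in> carrier N" by (rule adjoint_closed[OF N j])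
  next
    fix n assume n: "n \<in> carrier N"
    then have "i (h n) \<in> carrier TT"
      using mod_hom_closed[OF i mod_hom_closed[OF h(1)]] by (simp add: extend_simps(1))
    then show "\<exists>t\<in>carrier TT. n = adjoint N j t" using k[OF n] by (metis k_def)
  qed
qed

end

section \<open>Cartesian modules\<close>

definition sub_psh :: "('o, 'a, 'r, 'u) mod_psh \<Rightarrow> ('o \<Rightarrow> 'u set) \<Rightarrow> ('o, 'a, 'r, 'u) mod_psh" where
  "sub_psh M H = \<lparr>mod_at = (\<lambda>v. (mod_at M v)\<lparr>carrier := H v\<rparr>), mod_res = mod_res M\<rparr>"

lemma sub_psh_simps [simp]:
  "mod_at (sub_psh M H) v = (mod_at M v)\<lparr>carrier := H v\<rparr>" "mod_res (sub_psh M H) = mod_res M"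
  by (simp_all add: sub_psh_def)

locale flat_presheaf_data =
  fixes \<kappa> :: "'u rel" and C :: "('o, 'a) cat" and R :: "('o, 'a, 'r) ring_psh"
  assumes univ: "universe \<kappa>" and cat: "category C" and psh: "cring_presheaf C R"
    and small_data: "small_data \<kappa> C R" and flat: "flat_presheaf \<kappa> C R"
begin

sublocale C: category C by (rule cat)

abbreviation "data_set \<equiv> Arr C <+> (SIGMA v : Obj C. carrier (ring_at R v)) <+> (UNIV :: nat set)"

lemma small_data_set: "small \<kappa> data_set"
  using small_data card_of_Pow ordLess_transitive unfolding small_data_def small_def by blast

text \<open>Uncountability of \<kappa>, which keeps closures under operations small.\<close>

lemma small_nat: "small \<kappa> (UNIV :: nat set)"
  by (rule small_surj[OF small_data_set, of _ "\<lambda>x. projr (projr x)"])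
    (auto intro!: image_eqI[of _ _ "Inr (Inr _)"])

lemma small_ring:
  assumes "v \<in> Obj C"
  shows "small \<kappa> (carrier (ring_at R v))"
  by (rule small_surj[OF small_data_set, of _ "\<lambda>x. snd (projl (projr x))"])
    (use assms in \<open>auto intro!: image_eqI[of _ _ "Inr (Inl (v, _))"]\<close>)

lemma Card_order: "Card_order \<kappa>"
  using univ by (simp add: universe_def)

lemma cring_at: "v \<in> Obj C \<Longrightarrow> cring (ring_at R v)"
  using psh by (simp add: cring_presheaf_def)

lemma ring_res_hom: "a \<in> Arr C \<Longrightarrow> ring_res R a \<in> ring_hom (ring_at R (Cod C a)) (ring_at R (Dom C a))"
  using psh by (simp add: cring_presheaf_def)

lemmas Dom_Obj [simp] = C.Dom_Obj and Cod_Obj [simp] = C.Cod_Obj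

abbreviation "psh_mod M \<equiv> M \<in> Mod_objects \<kappa> C R"
abbreviation "cart_mod M \<equiv> M \<in> Mod_objects \<kappa> C R \<and> cartesian C R M"

lemma psh_modD:
  assumes "psh_mod M"
  shows module_at: "\<And>v. v \<in> Obj C \<Longrightarrow> module (ring_at R v) (mod_at M v)"
    and small_at: "\<And>v. v \<in> Obj C \<Longrightarrow> small \<kappa> (carrier (mod_at M v))"
    and res_hom: "\<And>a. a \<in> Arr C \<Longrightarrow> mod_res M a \<in> mod_hom (ring_at R (Cod C a)) (mod_at M (Cod C a))
      (restrict_scalars (ring_res R a) (mod_at M (Dom C a)))"
    and res_Ident: "\<And>v x. v \<in> Obj C \<Longrightarrow> x \<in> carrier (mod_at M v) \<Longrightarrow> mod_res M (Ident C v) x = x"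
    and res_Comp: "\<And>a b x. a \<in> Arr C \<Longrightarrow> b \<in> Arr C \<Longrightarrow> Cod C a = Dom C b \<Longrightarrow>
      x \<in> carrier (mod_at M (Cod C b)) \<Longrightarrow> mod_res M (Comp C b a) x = mod_res M a (mod_res M b x)"
  using assms by (auto simp: Mod_objects_def presheaf_module_def)

lemma psh_modI:
  assumes "\<And>v. v \<in> Obj C \<Longrightarrow> module (ring_at R v) (mod_at M v)"
    and "\<And>v. v \<in> Obj C \<Longrightarrow> small \<kappa> (carrier (mod_at M v))"
    and "\<And>a. a \<in> Arr C \<Longrightarrow> mod_res M a \<in> mod_hom (ring_at R (Cod C a)) (mod_at M (Cod C a))
      (restrict_scalars (ring_res R a) (mod_at M (Dom C a)))"
    and "\<And>v x. v \<in> Obj C \<Longrightarrow> x \<in> carrier (mod_at M v) \<Longrightarrow> mod_res M (Ident C v) x = x"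
    and "\<And>a b x. a \<in> Arr C \<Longrightarrow> b \<in> Arr C \<Longrightarrow> Cod C a = Dom C b \<Longrightarrow>
      x \<in> carrier (mod_at M (Cod C b)) \<Longrightarrow> mod_res M (Comp C b a) x = mod_res M a (mod_res M b x)"
  shows "psh_mod M"
  using assms by (simp add: Mod_objects_def presheaf_module_def)

lemma
  assumes M: "psh_mod M" and a: "a \<in> Arr C"
  shows res_closed: "x \<in> carrier (mod_at M (Cod C a)) \<Longrightarrow> mod_res M a x \<in> carrier (mod_at M (Dom C a))"
    and res_add: "x \<in> carrier (mod_at M (Cod C a)) \<Longrightarrow> y \<in> carrier (mod_at M (Cod C a)) \<Longrightarrow>
      mod_res M a (x \<oplus>\<^bsub>mod_at M (Cod C a)\<^esub> y) = mod_res M a x \<oplus>\<^bsub>mod_at M (Dom C a)\<^esub> mod_res M a y"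
    and res_smult: "r \<in> carrier (ring_at R (Cod C a)) \<Longrightarrow> x \<in> carrier (mod_at M (Cod C a)) \<Longrightarrow>
      mod_res M a (r \<odot>\<^bsub>mod_at M (Cod C a)\<^esub> x) = ring_res R a r \<odot>\<^bsub>mod_at M (Dom C a)\<^esub> mod_res M a x"
  using res_hom[OF M a] by (auto simp: mod_hom_def)

lemma res_zero:
  assumes M: "psh_mod M" and a: "a \<in> Arr C"
  shows "mod_res M a \<zero>\<^bsub>mod_at M (Cod C a)\<^esub> = \<zero>\<^bsub>mod_at M (Dom C a)\<^esub>"
  using mod_hom_zero[OF module_at[OF M] module_restrict_scalars[OF cring_at ring_res_hom module_at[OF M]]
      res_hom[OF M]] a by simp

lemma scalar_extension_at:
  assumes "a \<in> Arr C" "module (ring_at R (Cod C a)) X"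
  shows "scalar_extension (ring_at R (Cod C a)) (ring_at R (Dom C a)) (ring_res R a) X"
  using assms by (intro scalar_extension.intro scalar_extension_axioms.intro cring_at ring_res_hom) auto

abbreviation "tensor_at a X \<equiv> tensor_group (ring_at R (Cod C a))
  (restrict_scalars (ring_res R a) (ring_as_module (ring_at R (Dom C a)))) X"

abbreviation "pure_at a X \<equiv> pure_tensor (ring_at R (Cod C a))
  (restrict_scalars (ring_res R a) (ring_as_module (ring_at R (Dom C a)))) X"

abbreviation "adj N j \<equiv> scalar_extension.adjoint N j"

text \<open>Transposes are linear by \<open>adjoint_hom\<close>, so only bijectivity is left of the
  isomorphism condition.\<close>

lemma cartesian_iff:
  assumes M: "psh_mod M"
  shows "cartesian C R M \<longleftrightarrow> (\<forall>a \<in> Arr C. bij_betw (adj (mod_at M (Dom C a)) (mod_res M a))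
    (carrier (tensor_at a (mod_at M (Cod C a)))) (carrier (mod_at M (Dom C a))))"
proof -
  have "tensor_lift (add_monoid (mod_at M (Dom C a)))
        (\<lambda>(r, m). r \<odot>\<^bsub>mod_at M (Dom C a)\<^esub> mod_res M a m)
      \<in> mod_iso (ring_at R (Dom C a))
          (extend_scalars (ring_at R (Cod C a)) (ring_at R (Dom C a)) (ring_res R a) (mod_at M (Cod C a)))
          (mod_at M (Dom C a)) \<longleftrightarrow>
    bij_betw (adj (mod_at M (Dom C a)) (mod_res M a))
      (carrier (tensor_at a (mod_at M (Cod C a)))) (carrier (mod_at M (Dom C a)))" if a: "a \<in> Arr C" for a
  proof -
    interpret scalar_extension "ring_at R (Cod C a)" "ring_at R (Dom C a)" "ring_res R a" "mod_at M (Cod C a)"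
      by (rule scalar_extension_at[OF a module_at[OF M]]) (use a in auto)
    show ?thesis
      using adjoint_iso_iff[OF module_at[OF M] res_hom[OF M a]] a by (simp add: adjoint_def)
  qed
  then show ?thesis by (simp add: cartesian_def Let_def)
qed

lemma cartesian_extension_unique:
  assumes M: "cart_mod M" and a: "a \<in> Arr C"
    and h: "h \<in> mod_hom (ring_at R (Dom C a)) (mod_at M (Dom C a)) P"
    and h': "h' \<in> mod_hom (ring_at R (Dom C a)) (mod_at M (Dom C a)) P"
    and eq: "\<And>m. m \<in> carrier (mod_at M (Cod C a)) \<Longrightarrow> h (mod_res M a m) = h' (mod_res M a m)"
    and n: "n \<in> carrier (mod_at M (Dom C a))"
  shows "h n = h' n"
proof -
  interpret scalar_extension "ring_at R (Cod C a)" "ring_at R (Dom C a)" "ring_res R a" "mod_at M (Cod C a)"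
    by (rule scalar_extension_at[OF a module_at]) (use M a in auto)
  have "bij_betw (adjoint (mod_at M (Dom C a)) (mod_res M a)) (carrier TT) (carrier (mod_at M (Dom C a)))"
    using M a cartesian_iff by auto
  then show ?thesis
    using M a h h' eq n
    by (intro extension_unique[of "mod_at M (Dom C a)" "mod_res M a" h P h' n])
      (auto simp: bij_betw_def module_at res_hom)
qed

lemma cartesian_extension_exists:
  assumes M: "cart_mod M" and a: "a \<in> Arr C"
    and P: "module (ring_at R (Dom C a)) P"
    and g: "g \<in> mod_hom (ring_at R (Cod C a)) (mod_at M (Cod C a)) (restrict_scalars (ring_res R a) P)"
  shows "\<exists>h \<in> mod_hom (ring_at R (Dom C a)) (mod_at M (Dom C a)) P.
    \<forall>m \<in> carrier (mod_at M (Cod C a)). h (mod_res M a m) = g m"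
proof -
  interpret scalar_extension "ring_at R (Cod C a)" "ring_at R (Dom C a)" "ring_res R a" "mod_at M (Cod C a)"
    by (rule scalar_extension_at[OF a module_at]) (use M a in auto)
  show ?thesis
    by (rule extension_exists[OF module_at res_hom _ P g]) (use M a cartesian_iff in auto)
qed

text \<open>The form in which cartesianness of colimits is proved. Maps out of an objectwise colimit
  are compatible families of maps, so both conditions can be inherited from the members of the
  diagram, and the tensor product with a colimit never has to be computed.\<close>

lemma cartesianI:
  fixes M :: "('o, 'a, 'r, 'u) mod_psh"
  assumes M: "psh_mod M"
    and ex: "\<And>a (P :: ('r, 'u) module) g. a \<in> Arr C \<Longrightarrow> module (ring_at R (Dom C a)) P \<Longrightarrow>
      small \<kappa> (carrier P) \<Longrightarrow>
      g \<in> mod_hom (ring_at R (Cod C a)) (mod_at M (Cod C a)) (restrict_scalars (ring_res R a) P) \<Longrightarrow>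
      \<exists>h \<in> mod_hom (ring_at R (Dom C a)) (mod_at M (Dom C a)) P.
        \<forall>m \<in> carrier (mod_at M (Cod C a)). h (mod_res M a m) = g m"
    and uniq: "\<And>a h n. a \<in> Arr C \<Longrightarrow>
      h \<in> mod_hom (ring_at R (Dom C a)) (mod_at M (Dom C a)) (mod_at M (Dom C a)) \<Longrightarrow>
      (\<And>m. m \<in> carrier (mod_at M (Cod C a)) \<Longrightarrow> h (mod_res M a m) = mod_res M a m) \<Longrightarrow>
      n \<in> carrier (mod_at M (Dom C a)) \<Longrightarrow> h n = n"
  shows "cartesian C R M"
  unfolding cartesian_iff[OF M]
proof
  fix a assume a: "a \<in> Arr C"
  interpret scalar_extension "ring_at R (Cod C a)" "ring_at R (Dom C a)" "ring_res R a" "mod_at M (Cod C a)"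
    by (rule scalar_extension_at[OF a module_at[OF M]]) (use a in auto)
  show "bij_betw (adj (mod_at M (Dom C a)) (mod_res M a))
    (carrier (tensor_at a (mod_at M (Cod C a)))) (carrier (mod_at M (Dom C a)))"
  proof (rule extension_bijI[OF univ small_nat])
    show "\<exists>h\<in>mod_hom (ring_at R (Dom C a)) (mod_at M (Dom C a)) P.
        \<forall>m\<in>carrier (mod_at M (Cod C a)). h (mod_res M a m) = g m"
      if "module (ring_at R (Dom C a)) P" "small \<kappa> (carrier P)"
        "g \<in> mod_hom (ring_at R (Cod C a)) (mod_at M (Cod C a)) (restrict_scalars (ring_res R a) P)"
      for P :: "('r, 'u) module" and g
      using ex[OF a that] .
    show "h n = n" if "h \<in> mod_hom (ring_at R (Dom C a)) (mod_at M (Dom C a)) (mod_at M (Dom C a))"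
      "\<forall>m\<in>carrier (mod_at M (Cod C a)). h (mod_res M a m) = mod_res M a m"
      "n \<in> carrier (mod_at M (Dom C a))" for h n
      using uniq[OF a that(1) _ that(3)] that(2) by blast
  qed (use a M in \<open>simp_all add: small_ring small_at module_at res_hom\<close>)
qed

text \<open>The map factors as \<open>R(v) \<otimes> I \<rightarrow> R(v) \<otimes> N(w)
  \<rightarrow> N(v)\<close>. The first arrow is injective because \<open>R(v)\<close> is flat over
  \<open>R(w)\<close>, the second because \<open>N\<close> is cartesian.\<close>

lemma adj_submodule_inj:
  assumes N: "cart_mod N" and a: "a \<in> Arr C"
    and I: "submodule I (ring_at R (Cod C a)) (mod_at N (Cod C a))"
  shows "inj_on (adj (mod_at N (Dom C a)) (mod_res N a))
    (carrier (tensor_at a ((mod_at N (Cod C a))\<lparr>carrier := I\<rparr>)))"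
proof -
  let ?A = "ring_at R (Cod C a)" and ?B = "ring_at R (Dom C a)"
  let ?F = "restrict_scalars (ring_res R a) (ring_as_module ?B)"
  let ?N = "mod_at N (Cod C a)" and ?Nv = "mod_at N (Dom C a)" and ?j = "mod_res N a"
  let ?I = "?N\<lparr>carrier := I\<rparr>"
  have N': "psh_mod N" using N by simp
  have Nw: "module ?A ?N" and Nv: "module ?B ?Nv" using module_at[OF N'] a by auto
  have Im: "module ?A ?I" by (rule submodule.submodule_is_module[OF I Nw])
  have IN: "I \<subseteq> carrier ?N" using module.submoduleE(1)[OF Nw I] .
  interpret SN: scalar_extension ?A ?B "ring_res R a" ?N by (rule scalar_extension_at[OF a Nw])
  interpret SI: scalar_extension ?A ?B "ring_res R a" ?I by (rule scalar_extension_at[OF a Im])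
  interpret Nv: module ?B ?Nv by (rule Nv)
  \<comment> \<open>The map induced by the inclusion of \<open>I\<close>, in the shape that
    \<open>flat_module\<close> has when its injective map is the identity function.\<close>
  let ?\<iota> = "tensor_lift (tensor_at a ?N) (\<lambda>(x, m). pure_at a ?N x m)"
  have inj1: "inj_on ?\<iota> (carrier (tensor_at a ?I))"
  proof -
    have "(\<lambda>m. m) \<in> mod_hom ?A ?I ?N" using IN by (auto simp: mod_hom_def)
    moreover have "small \<kappa> (carrier ?N)" using small_at[OF N'] a by simp
    moreover have "small \<kappa> (carrier ?I)" using small_subset[OF calculation(2) IN] by simp
    ultimately show ?thesis
      using flat a Nw Im unfolding flat_presheaf_def flat_module_def by fastforce
  qed
  have bal: "balanced ?A ?F ?I (tensor_at a ?N) (\<lambda>(x, m). pure_at a ?N x m)"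
    using SN.pure_balanced IN unfolding balanced_def by (simp add: subset_iff)
  have j: "?j \<in> mod_hom ?A ?N (restrict_scalars (ring_res R a) ?Nv)" by (rule res_hom[OF N' a])
  then have jI: "?j \<in> mod_hom ?A ?I (restrict_scalars (ring_res R a) ?Nv)"
    using IN by (auto simp: mod_hom_def subset_iff)
  note \<iota> = SI.tensor_lift[OF SN.T.comm_group_axioms bal]
  have eq: "adj ?Nv ?j (?\<iota> t) = adj ?Nv ?j t" if t: "t \<in> carrier (tensor_at a ?I)" for t
    using t
  proof (induction t rule: SI.ext_induct)
    case (pure x m)
    then show ?case
      using IN \<iota>(2)[of x m] by (auto simp: SI.adjoint_pure[OF Nv jI] SN.adjoint_pure[OF Nv j])
  next
    case (add s t)
    then show ?case
      by (simp add: hom_mult[OF \<iota>(1)] hom_in_carrier[OF \<iota>(1)] SI.adjoint_add[OF Nv jI]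
          SN.adjoint_add[OF Nv j])
  qed
  have inj2: "inj_on (adj ?Nv ?j) (carrier (tensor_at a ?N))"
    using N a cartesian_iff[OF N'] by (auto simp: bij_betw_def)
  show ?thesis
  proof (rule inj_onI)
    fix s t assume st: "s \<in> carrier (tensor_at a ?I)" "t \<in> carrier (tensor_at a ?I)"
      "adj ?Nv ?j s = adj ?Nv ?j t"
    then have "?\<iota> s = ?\<iota> t"
      using inj2 eq hom_in_carrier[OF \<iota>(1)] by (metis inj_onD)
    then show "s = t" using inj1 st by (auto dest: inj_onD)
  qed
qed

lemma sub_psh_mod:
  assumes M: "psh_mod M"
    and H: "\<And>v. v \<in> Obj C \<Longrightarrow> submodule (H v) (ring_at R v) (mod_at M v)"
    and res: "\<And>a m. a \<in> Arr C \<Longrightarrow> m \<in> H (Cod C a) \<Longrightarrow> mod_res M a m \<in> H (Dom C a)"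
  shows "psh_mod (sub_psh M H)"
proof -
  have HM: "H v \<subseteq> carrier (mod_at M v)" if "v \<in> Obj C" for v
    using module.submoduleE(1)[OF module_at[OF M that] H[OF that]] .
  show ?thesis
  proof (rule psh_modI)
    fix v assume "v \<in> Obj C"
    then show "module (ring_at R v) (mod_at (sub_psh M H) v)"
      using submodule.submodule_is_module[OF H module_at[OF M]] by simp
    show "small \<kappa> (carrier (mod_at (sub_psh M H) v))"
      using small_subset[OF small_at[OF M] HM] \<open>v \<in> Obj C\<close> by simp
  next
    fix a assume a: "a \<in> Arr C"
    then have "x \<in> carrier (mod_at M (Cod C a))" if "x \<in> H (Cod C a)" for x
      using HM[of "Cod C a"] that by auto
    then show "mod_res (sub_psh M H) a \<in> mod_hom (ring_at R (Cod C a)) (mod_at (sub_psh M H) (Cod C a))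
      (restrict_scalars (ring_res R a) (mod_at (sub_psh M H) (Dom C a)))"
      using res[OF a] by (intro mod_homI) (simp_all add: res_add[OF M a] res_smult[OF M a])
  next
    fix v x assume "v \<in> Obj C" "x \<in> carrier (mod_at (sub_psh M H) v)"
    then show "mod_res (sub_psh M H) (Ident C v) x = x"
      using HM[of v] res_Ident[OF M, of v x] by auto
  next
    fix a b x assume "a \<in> Arr C" "b \<in> Arr C" "Cod C a = Dom C b"
      "x \<in> carrier (mod_at (sub_psh M H) (Cod C b))"
    then show "mod_res (sub_psh M H) (Comp C b a) x = mod_res (sub_psh M H) a (mod_res (sub_psh M H) b x)"
      using HM[of "Cod C b"] res_Comp[OF M, of a b x] by auto
  qed
qed

text \<open>Flatness gives injectivity of the comparison map and \<open>span\<close> gives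
  surjectivity. Quantifying over the submodules \<open>Z\<close> avoids linear combinations, since
  the image of the comparison map is itself such a \<open>Z\<close>.\<close>

lemma sub_psh_cartesian:
  assumes M: "cart_mod M"
    and H: "\<And>v. v \<in> Obj C \<Longrightarrow> submodule (H v) (ring_at R v) (mod_at M v)"
    and res: "\<And>a m. a \<in> Arr C \<Longrightarrow> m \<in> H (Cod C a) \<Longrightarrow> mod_res M a m \<in> H (Dom C a)"
    and span: "\<And>a y Z. a \<in> Arr C \<Longrightarrow> y \<in> H (Dom C a) \<Longrightarrow>
      submodule Z (ring_at R (Dom C a)) (mod_at M (Dom C a)) \<Longrightarrow> mod_res M a ` H (Cod C a) \<subseteq> Z \<Longrightarrow> y \<in> Z"
  shows "cart_mod (sub_psh M H)"
proof -
  have M': "psh_mod M" using M by simp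
  have X: "psh_mod (sub_psh M H)" by (rule sub_psh_mod[OF M' H res])
  have HM: "H v \<subseteq> carrier (mod_at M v)" if "v \<in> Obj C" for v
    using module.submoduleE(1)[OF module_at[OF M' that] H[OF that]] .
  have "cartesian C R (sub_psh M H)"
    unfolding cartesian_iff[OF X]
  proof
    fix a assume a: "a \<in> Arr C"
    let ?A = "ring_at R (Cod C a)" and ?B = "ring_at R (Dom C a)"
    let ?M = "mod_at M (Dom C a)" and ?X = "mod_at (sub_psh M H) (Dom C a)" and ?j = "mod_res M a"
    let ?I = "mod_at (sub_psh M H) (Cod C a)"
    have Im: "module ?A ?I" and Xm: "module ?B ?X" and Mm: "module ?B ?M"
      using module_at[OF X] module_at[OF M'] a Cod_Obj Dom_Obj by blast+
    interpret S: scalar_extension ?A ?B "ring_res R a" ?I by (rule scalar_extension_at[OF a Im])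
    interpret Mm: module ?B ?M by (rule Mm)
    have jX: "?j \<in> mod_hom ?A ?I (restrict_scalars (ring_res R a) ?X)"
      using res_hom[OF X a] by simp
    have jM: "?j \<in> mod_hom ?A ?I (restrict_scalars (ring_res R a) ?M)"
      using jX HM[of "Dom C a"] a by (auto simp: mod_hom_def)
    have eq: "adj ?X ?j t = adj ?M ?j t" if "t \<in> carrier (tensor_at a ?I)" for t
      using that
    proof (induction t rule: S.ext_induct)
      case (pure x m)
      then show ?case by (simp only: S.adjoint_pure[OF Xm jX] S.adjoint_pure[OF Mm jM]) simp
    next
      case (add s t)
      then show ?case by (simp only: S.adjoint_add[OF Xm jX] S.adjoint_add[OF Mm jM]) simp
    qed
    have "inj_on (adj ?M ?j) (carrier (tensor_at a ?I))"
      using adj_submodule_inj[OF M a H] a by simp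
    then have inj: "inj_on (adj ?X ?j) (carrier (tensor_at a ?I))"
      using inj_on_cong[of "carrier (tensor_at a ?I)" "adj ?X ?j" "adj ?M ?j"] eq by blast
    have sub: "submodule (adj ?M ?j ` carrier (tensor_at a ?I)) ?B ?M"
      using submodule_image[OF S.module_extend_scalars Mm S.adjoint_hom[OF Mm jM]]
      by (simp only: S.extend_simps(1))
    have "carrier ?X \<subseteq> adj ?X ?j ` carrier (tensor_at a ?I)"
    proof
      fix y assume "y \<in> carrier ?X"
      then have y: "y \<in> H (Dom C a)" by simp
      \<comment> \<open>\<open>span\<close> is applied with the image of the comparison map as
        \<open>Z\<close>; it contains the restriction of \<open>m\<close> as its value at
        \<open>1 \<otimes> m\<close>.\<close>
      have "y \<in> adj ?M ?j ` carrier (tensor_at a ?I)"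
      proof (rule span[OF a y sub], rule image_subsetI)
        fix m assume m: "m \<in> H (Cod C a)"
        then have "mod_res M a m \<in> carrier ?M" using jM by (auto simp: mod_hom_def)
        then have "mod_res M a m = adj ?M ?j (pure_at a ?I \<one>\<^bsub>?B\<^esub> m)"
          using m by (subst S.adjoint_pure[OF Mm jM]) auto
        then show "mod_res M a m \<in> adj ?M ?j ` carrier (tensor_at a ?I)"
          using m S.ext_closed[of "\<one>\<^bsub>?B\<^esub>" m] by (auto intro!: image_eqI)
      qed
      then show "y \<in> adj ?X ?j ` carrier (tensor_at a ?I)" using eq by auto
    qed
    moreover have "adj ?X ?j ` carrier (tensor_at a ?I) \<subseteq> carrier ?X"
      using S.adjoint_closed[OF Xm jX] by blast
    ultimately show "bij_betw (adj ?X (mod_res (sub_psh M H) a)) (carrier (tensor_at a ?I)) (carrier ?X)"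
      using inj by (simp add: bij_betw_def subset_antisym)
  qed
  then show ?thesis using X by simp
qed

text \<open>To show that a kernel element \<open>y\<close> over \<open>v\<close> lies in
  \<open>Z\<close>, write it as the image of a tensor over \<open>M(w)\<close> and push this tensor
  to \<open>R(v) \<otimes> f(M(w))\<close>. In \<open>N(v)\<close> the result becomes
  \<open>f y = 0\<close>, so it vanishes by flatness; but the class of \<open>y\<close> modulo
  \<open>Z\<close> is determined by it. This replaces tensoring the exact sequence of the
  kernel.\<close>

lemma kernel_cartesian:
  assumes M: "cart_mod M" and N: "cart_mod N"
    and f: "\<And>v. v \<in> Obj C \<Longrightarrow> f v \<in> mod_hom (ring_at R v) (mod_at M v) (mod_at N v)"
    and nat: "\<And>a x. a \<in> Arr C \<Longrightarrow> x \<in> carrier (mod_at M (Cod C a)) \<Longrightarrow>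
      f (Dom C a) (mod_res M a x) = mod_res N a (f (Cod C a) x)"
  shows "cart_mod (sub_psh M (\<lambda>v. {x \<in> carrier (mod_at M v). f v x = \<zero>\<^bsub>mod_at N v\<^esub>}))"
proof (rule sub_psh_cartesian[OF M])
  have M': "psh_mod M" and N': "psh_mod N" using M N by auto
  show "submodule {x \<in> carrier (mod_at M v). f v x = \<zero>\<^bsub>mod_at N v\<^esub>} (ring_at R v) (mod_at M v)"
    if "v \<in> Obj C" for v
    by (rule submodule_kernel[OF module_at[OF M'] module_at[OF N'] f]) (use that in auto)
  show "mod_res M a m \<in> {x \<in> carrier (mod_at M (Dom C a)). f (Dom C a) x = \<zero>\<^bsub>mod_at N (Dom C a)\<^esub>}"
    if "a \<in> Arr C" "m \<in> {x \<in> carrier (mod_at M (Cod C a)). f (Cod C a) x = \<zero>\<^bsub>mod_at N (Cod C a)\<^esub>}" for a m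
    using that by (simp add: nat res_closed[OF M'] res_zero[OF N'])
  fix a y Z assume a: "a \<in> Arr C"
    and "y \<in> {x \<in> carrier (mod_at M (Dom C a)). f (Dom C a) x = \<zero>\<^bsub>mod_at N (Dom C a)\<^esub>}"
    and Z: "submodule Z (ring_at R (Dom C a)) (mod_at M (Dom C a))"
    and KZ: "mod_res M a ` {x \<in> carrier (mod_at M (Cod C a)). f (Cod C a) x = \<zero>\<^bsub>mod_at N (Cod C a)\<^esub>} \<subseteq> Z"
  then have y: "y \<in> carrier (mod_at M (Dom C a))" and fy: "f (Dom C a) y = \<zero>\<^bsub>mod_at N (Dom C a)\<^esub>" by auto
  let ?v = "Dom C a" and ?w = "Cod C a"
  let ?A = "ring_at R ?w" and ?B = "ring_at R ?v"
  have v: "?v \<in> Obj C" and w: "?w \<in> Obj C" using a by auto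
  note Mv = module_at[OF M' v] and Mw = module_at[OF M' w]
    and Nv = module_at[OF N' v] and Nw = module_at[OF N' w]
  interpret Mv: module ?B "mod_at M ?v" by (rule Mv)
  interpret Mw: module ?A "mod_at M ?w" by (rule Mw)
  interpret Nv: module ?B "mod_at N ?v" by (rule Nv)
  interpret Nw: module ?A "mod_at N ?w" by (rule Nw)
  \<comment> \<open>Membership in \<open>Z\<close> is detected by the quotient of
    \<open>M(v)\<close> by \<open>Z\<close>.\<close>
  obtain Q :: "('r, 'u) module" and q where Q: "module ?B Q"
    and q: "q \<in> mod_hom ?B (mod_at M ?v) Q"
      "\<And>x. x \<in> carrier (mod_at M ?v) \<Longrightarrow> q x = \<zero>\<^bsub>Q\<^esub> \<longleftrightarrow> x \<in> Z"
    by (rule quotient_module_exists[OF Mv Z small_at[OF M' v] Card_order]) blast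
  interpret Q: module ?B Q by (rule Q)
  let ?I = "(mod_at N ?w)\<lparr>carrier := f ?w ` carrier (mod_at M ?w)\<rparr>"
  have I: "submodule (f ?w ` carrier (mod_at M ?w)) ?A (mod_at N ?w)"
    by (rule submodule_image[OF Mw Nw f[OF w]])
  have Im: "module ?A ?I" by (rule submodule.submodule_is_module[OF I Nw])
  note QA = module_restrict_scalars[OF cring_at[OF w] ring_res_hom[OF a] Q]
  note qA = mod_hom_restrict_scalars[OF ring_res_hom[OF a] q(1)]
  have fI: "f ?w \<in> mod_hom ?A (mod_at M ?w) ?I"
    using f[OF w] by (auto simp: mod_hom_def)
  \<comment> \<open>Restriction followed by \<open>q\<close> kills the kernel of \<open>f\<close>
    over \<open>w\<close>, by \<open>KZ\<close>, and therefore factors through the image of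
    \<open>f\<close>.\<close>
  obtain g where g_hom: "g \<in> mod_hom ?A ?I (restrict_scalars (ring_res R a) Q)"
    and g: "\<And>m. m \<in> carrier (mod_at M ?w) \<Longrightarrow> g (f ?w m) = q (mod_res M a m)"
  proof (rule mod_hom_factor_surj[OF Mw Im QA fI _ mod_hom_comp[OF res_hom[OF M' a] qA]])
    fix m assume m: "m \<in> carrier (mod_at M ?w)" "f ?w m = \<zero>\<^bsub>?I\<^esub>"
    then have "mod_res M a m \<in> Z" using KZ by auto
    then show "q (mod_res M a m) = \<zero>\<^bsub>restrict_scalars (ring_res R a) Q\<^esub>"
      using q(2) m a by (simp add: res_closed[OF M'])
  qed auto
  interpret SM: scalar_extension ?A ?B "ring_res R a" "mod_at M ?w" by (rule scalar_extension_at[OF a Mw])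
  interpret SI: scalar_extension ?A ?B "ring_res R a" ?I by (rule scalar_extension_at[OF a Im])
  note jM = res_hom[OF M' a]
  have jI: "mod_res N a \<in> mod_hom ?A ?I (restrict_scalars (ring_res R a) (mod_at N ?v))"
    using res_hom[OF N' a] Nw.submoduleE(1)[OF I] by (auto simp: mod_hom_def subset_iff)
  \<comment> \<open>\<open>u\<close> is the image of \<open>t\<close> under \<open>f\<close> on the
    right factor. Asserting only its existence spares the definition of an induced map of tensor
    products, as the two equations are all that is used.\<close>
  have key: "\<exists>u \<in> carrier (tensor_at a ?I).
      f ?v (adj (mod_at M ?v) (mod_res M a) t) = adj (mod_at N ?v) (mod_res N a) u \<and>
      q (adj (mod_at M ?v) (mod_res M a) t) = adj Q g u" if "t \<in> carrier (tensor_at a (mod_at M ?w))" for t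
    using that
  proof (induction t rule: SM.ext_induct)
    case (pure x m)
    then have "pure_at a ?I x (f ?w m) \<in> carrier (tensor_at a ?I)" by (intro SI.ext_closed) auto
    moreover have "f ?v (adj (mod_at M ?v) (mod_res M a) (pure_at a (mod_at M ?w) x m)) =
        adj (mod_at N ?v) (mod_res N a) (pure_at a ?I x (f ?w m))"
      using pure a by (simp add: SM.adjoint_pure[OF Mv jM] SI.adjoint_pure[OF Nv jI] res_closed[OF M' a]
          mod_hom_smult[OF f[OF v]] nat)
    moreover have "q (adj (mod_at M ?v) (mod_res M a) (pure_at a (mod_at M ?w) x m)) =
        adj Q g (pure_at a ?I x (f ?w m))"
      using pure a by (simp add: SM.adjoint_pure[OF Mv jM] SI.adjoint_pure[OF Q g_hom] res_closed[OF M' a]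
          mod_hom_smult[OF q(1)] g)
    ultimately show ?case by blast
  next
    case (add s t)
    then obtain u u' where u: "u \<in> carrier (tensor_at a ?I)" "u' \<in> carrier (tensor_at a ?I)"
      "f ?v (adj (mod_at M ?v) (mod_res M a) s) = adj (mod_at N ?v) (mod_res N a) u"
      "q (adj (mod_at M ?v) (mod_res M a) s) = adj Q g u"
      "f ?v (adj (mod_at M ?v) (mod_res M a) t) = adj (mod_at N ?v) (mod_res N a) u'"
      "q (adj (mod_at M ?v) (mod_res M a) t) = adj Q g u'" by metis
    then show ?case
      using add by (intro bexI[of _ "u \<otimes>\<^bsub>tensor_at a ?I\<^esub> u'"])
        (auto simp: SM.adjoint_add[OF Mv jM] SI.adjoint_add[OF Nv jI] SI.adjoint_add[OF Q g_hom]
          SM.adjoint_closed[OF Mv jM] mod_hom_add[OF f[OF v]] mod_hom_add[OF q(1)])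
  qed
  obtain t where t: "t \<in> carrier (tensor_at a (mod_at M ?w))" "y = adj (mod_at M ?v) (mod_res M a) t"
  proof -
    have "adj (mod_at M ?v) (mod_res M a) ` carrier (tensor_at a (mod_at M ?w)) = carrier (mod_at M ?v)"
      using M a cartesian_iff[OF M'] by (auto simp: bij_betw_def)
    then show thesis using y that by blast
  qed
  then obtain u where u: "u \<in> carrier (tensor_at a ?I)" "f ?v y = adj (mod_at N ?v) (mod_res N a) u"
    "q y = adj Q g u" using key by metis
  have one: "adj N' j \<one>\<^bsub>tensor_at a ?I\<^esub> = \<zero>\<^bsub>N'\<^esub>"
    if "module ?B N'" "j \<in> mod_hom ?A ?I (restrict_scalars (ring_res R a) N')" for N' :: "('r, 'u) module" and j
    using mod_hom_zero[OF SI.module_extend_scalars that(1) SI.adjoint_hom[OF that]]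
    by (simp add: SI.extend_simps)
  \<comment> \<open>The transpose of \<open>u\<close> is \<open>f y = 0\<close>, and on tensors over
    the submodule \<open>f(M(w))\<close> of \<open>N(w)\<close> the transpose is injective.\<close>
  have "u = \<one>\<^bsub>tensor_at a ?I\<^esub>"
    using adj_submodule_inj[OF N a I] u(1,2) fy one[OF Nv jI] SI.T.one_closed
    by (metis inj_onD)
  then have "q y = \<zero>\<^bsub>Q\<^esub>" using u(3) one[OF Q g_hom] by simp
  then show "y \<in> Z" using q(2) y by simp
qed

end

section \<open>Direct sums\<close>

definition dsum :: "'i set \<Rightarrow> ('i \<Rightarrow> ('r, 'm) module) \<Rightarrow> ('r, 'i \<Rightarrow> 'm) module" where
  "dsum I X = \<lparr>carrier = {\<xi> \<in> (\<Pi>\<^sub>E i\<in>I. carrier (X i)). finite {i \<in> I. \<xi> i \<noteq> \<zero>\<^bsub>X i\<^esub>}},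
    monoid.mult = undefined, one = undefined, zero = (\<lambda>i\<in>I. \<zero>\<^bsub>X i\<^esub>),
    add = (\<lambda>\<xi> \<eta>. \<lambda>i\<in>I. \<xi> i \<oplus>\<^bsub>X i\<^esub> \<eta> i), smult = (\<lambda>r \<xi>. \<lambda>i\<in>I. r \<odot>\<^bsub>X i\<^esub> \<xi> i)\<rparr>"

definition dsum_in :: "'i set \<Rightarrow> ('i \<Rightarrow> ('r, 'm) module) \<Rightarrow> 'i \<Rightarrow> 'm \<Rightarrow> 'i \<Rightarrow> 'm" where
  "dsum_in I X i x = (\<lambda>k\<in>I. if k = i then x else \<zero>\<^bsub>X k\<^esub>)"

text \<open>The map out of the direct sum with components \<open>h i\<close>. The sum runs over the
  support because \<open>finsum\<close> is meaningful on finite sets only.\<close>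

definition dsum_lift ::
  "'i set \<Rightarrow> ('i \<Rightarrow> ('r, 'm) module) \<Rightarrow> ('r, 'n) module \<Rightarrow> ('i \<Rightarrow> 'm \<Rightarrow> 'n) \<Rightarrow> ('i \<Rightarrow> 'm) \<Rightarrow> 'n" where
  "dsum_lift I X P h \<xi> = finsum P (\<lambda>i. h i (\<xi> i)) {i \<in> I. \<xi> i \<noteq> \<zero>\<^bsub>X i\<^esub>}"

lemma dsum_simps:
  "carrier (dsum I X) = {\<xi> \<in> (\<Pi>\<^sub>E i\<in>I. carrier (X i)). finite {i \<in> I. \<xi> i \<noteq> \<zero>\<^bsub>X i\<^esub>}}"
  "zero (dsum I X) = (\<lambda>i\<in>I. \<zero>\<^bsub>X i\<^esub>)"
  "add (dsum I X) = (\<lambda>\<xi> \<eta>. \<lambda>i\<in>I. \<xi> i \<oplus>\<^bsub>X i\<^esub> \<eta> i)"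
  "smult (dsum I X) = (\<lambda>r \<xi>. \<lambda>i\<in>I. r \<odot>\<^bsub>X i\<^esub> \<xi> i)"
  by (simp_all add: dsum_def)

locale module_family =
  fixes A :: "('r, 'x) ring_scheme" and I :: "'i set" and X :: "'i \<Rightarrow> ('r, 'm) module"
  assumes cring: "cring A" and module_X: "\<And>i. i \<in> I \<Longrightarrow> module A (X i)"
begin

abbreviation "S \<equiv> dsum I X"

lemma X_simps:
  assumes "i \<in> I"
  shows "\<zero>\<^bsub>X i\<^esub> \<in> carrier (X i)"
    and "x \<in> carrier (X i) \<Longrightarrow> y \<in> carrier (X i) \<Longrightarrow> x \<oplus>\<^bsub>X i\<^esub> y \<in> carrier (X i)"
    and "r \<in> carrier A \<Longrightarrow> x \<in> carrier (X i) \<Longrightarrow> r \<odot>\<^bsub>X i\<^esub> x \<in> carrier (X i)"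
    and "x \<in> carrier (X i) \<Longrightarrow> \<zero>\<^bsub>X i\<^esub> \<oplus>\<^bsub>X i\<^esub> x = x"
    and "x \<in> carrier (X i) \<Longrightarrow> x \<oplus>\<^bsub>X i\<^esub> \<zero>\<^bsub>X i\<^esub> = x"
    and "r \<in> carrier A \<Longrightarrow> r \<odot>\<^bsub>X i\<^esub> \<zero>\<^bsub>X i\<^esub> = \<zero>\<^bsub>X i\<^esub>"
proof -
  interpret module A "X i" by (rule module_X[OF assms])
  show "\<zero>\<^bsub>X i\<^esub> \<in> carrier (X i)"
    "x \<in> carrier (X i) \<Longrightarrow> y \<in> carrier (X i) \<Longrightarrow> x \<oplus>\<^bsub>X i\<^esub> y \<in> carrier (X i)"
    "r \<in> carrier A \<Longrightarrow> x \<in> carrier (X i) \<Longrightarrow> r \<odot>\<^bsub>X i\<^esub> x \<in> carrier (X i)"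
    "x \<in> carrier (X i) \<Longrightarrow> \<zero>\<^bsub>X i\<^esub> \<oplus>\<^bsub>X i\<^esub> x = x"
    "x \<in> carrier (X i) \<Longrightarrow> x \<oplus>\<^bsub>X i\<^esub> \<zero>\<^bsub>X i\<^esub> = x"
    "r \<in> carrier A \<Longrightarrow> r \<odot>\<^bsub>X i\<^esub> \<zero>\<^bsub>X i\<^esub> = \<zero>\<^bsub>X i\<^esub>"
    by simp_all
qed

lemma dsum_memI:
  assumes "\<And>i. i \<in> I \<Longrightarrow> f i \<in> carrier (X i)" "finite F" "\<And>i. i \<in> I \<Longrightarrow> i \<notin> F \<Longrightarrow> f i = \<zero>\<^bsub>X i\<^esub>"
  shows "restrict f I \<in> carrier S"
proof -
  have "{i \<in> I. restrict f I i \<noteq> \<zero>\<^bsub>X i\<^esub>} \<subseteq> F" using assms(3) by auto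
  then show ?thesis using assms(1,2) by (simp add: dsum_simps finite_subset)
qed

lemma dsum_comp: "\<xi> \<in> carrier S \<Longrightarrow> i \<in> I \<Longrightarrow> \<xi> i \<in> carrier (X i)"
  by (auto simp: dsum_simps)

lemma dsum_finite: "\<xi> \<in> carrier S \<Longrightarrow> finite {i \<in> I. \<xi> i \<noteq> \<zero>\<^bsub>X i\<^esub>}"
  by (simp add: dsum_simps)

lemma dsum_eqI: "\<xi> \<in> carrier S \<Longrightarrow> \<eta> \<in> carrier S \<Longrightarrow> (\<And>i. i \<in> I \<Longrightarrow> \<xi> i = \<eta> i) \<Longrightarrow> \<xi> = \<eta>"
  by (rule extensionalityI[of _ I]) (auto simp: dsum_simps PiE_def)

lemma dsum_add_closed: "\<xi> \<in> carrier S \<Longrightarrow> \<eta> \<in> carrier S \<Longrightarrow> \<xi> \<oplus>\<^bsub>S\<^esub> \<eta> \<in> carrier S"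
  unfolding dsum_simps(3)
  by (rule dsum_memI[of _ "{i \<in> I. \<xi> i \<noteq> \<zero>\<^bsub>X i\<^esub>} \<union> {i \<in> I. \<eta> i \<noteq> \<zero>\<^bsub>X i\<^esub>}"])
    (auto simp: X_simps dsum_comp dsum_finite)

lemma dsum_smult_closed: "r \<in> carrier A \<Longrightarrow> \<xi> \<in> carrier S \<Longrightarrow> r \<odot>\<^bsub>S\<^esub> \<xi> \<in> carrier S"
  unfolding dsum_simps(4)
  by (rule dsum_memI[of _ "{i \<in> I. \<xi> i \<noteq> \<zero>\<^bsub>X i\<^esub>}"])
    (auto simp: X_simps dsum_comp dsum_finite)

lemma dsum_zero_closed: "\<zero>\<^bsub>S\<^esub> \<in> carrier S"
  unfolding dsum_simps(2) by (rule dsum_memI[of _ "{}"]) (auto simp: X_simps)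

lemma dsum_in_closed: "i \<in> I \<Longrightarrow> x \<in> carrier (X i) \<Longrightarrow> dsum_in I X i x \<in> carrier S"
  unfolding dsum_in_def by (rule dsum_memI[of _ "{i}"]) (auto simp: X_simps)

lemma dsum_neg_closed:
  assumes "\<xi> \<in> carrier S"
  shows "(\<lambda>i\<in>I. \<ominus>\<^bsub>X i\<^esub> \<xi> i) \<in> carrier S"
    and "(\<lambda>i\<in>I. \<ominus>\<^bsub>X i\<^esub> \<xi> i) \<oplus>\<^bsub>S\<^esub> \<xi> = \<zero>\<^bsub>S\<^esub>"
proof -
  have *: "\<ominus>\<^bsub>X i\<^esub> \<xi> i \<in> carrier (X i)" "\<ominus>\<^bsub>X i\<^esub> \<xi> i \<oplus>\<^bsub>X i\<^esub> \<xi> i = \<zero>\<^bsub>X i\<^esub>"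
    "\<ominus>\<^bsub>X i\<^esub> \<zero>\<^bsub>X i\<^esub> = \<zero>\<^bsub>X i\<^esub>" if "i \<in> I" for i
  proof -
    interpret module A "X i" by (rule module_X[OF that])
    have "\<xi> i \<in> carrier (X i)" by (rule dsum_comp[OF assms that])
    then show "\<ominus>\<^bsub>X i\<^esub> \<xi> i \<in> carrier (X i)" "\<ominus>\<^bsub>X i\<^esub> \<xi> i \<oplus>\<^bsub>X i\<^esub> \<xi> i = \<zero>\<^bsub>X i\<^esub>"
      "\<ominus>\<^bsub>X i\<^esub> \<zero>\<^bsub>X i\<^esub> = \<zero>\<^bsub>X i\<^esub>"
      using M.minus_equality[of "\<zero>\<^bsub>X i\<^esub>" "\<zero>\<^bsub>X i\<^esub>"] by (simp_all add: M.l_neg)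
  qed
  show neg: "(\<lambda>i\<in>I. \<ominus>\<^bsub>X i\<^esub> \<xi> i) \<in> carrier S"
    by (rule dsum_memI[of _ "{i \<in> I. \<xi> i \<noteq> \<zero>\<^bsub>X i\<^esub>}"]) (use assms in \<open>auto simp: * dsum_finite\<close>)
  show "(\<lambda>i\<in>I. \<ominus>\<^bsub>X i\<^esub> \<xi> i) \<oplus>\<^bsub>S\<^esub> \<xi> = \<zero>\<^bsub>S\<^esub>"
    by (rule dsum_eqI[OF dsum_add_closed[OF neg assms] dsum_zero_closed]) (simp add: dsum_simps *)
qed

lemma module_dsum: "module A S"
proof (rule moduleI[OF cring])
  show "abelian_group S"
  proof (rule abelian_groupI)
    fix \<xi> \<eta> \<zeta> assume *: "\<xi> \<in> carrier S" "\<eta> \<in> carrier S" "\<zeta> \<in> carrier S"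
    show "\<xi> \<oplus>\<^bsub>S\<^esub> \<eta> \<oplus>\<^bsub>S\<^esub> \<zeta> = \<xi> \<oplus>\<^bsub>S\<^esub> (\<eta> \<oplus>\<^bsub>S\<^esub> \<zeta>)"
    proof (rule dsum_eqI)
      fix i assume i: "i \<in> I"
      interpret module A "X i" by (rule module_X[OF i])
      show "(\<xi> \<oplus>\<^bsub>S\<^esub> \<eta> \<oplus>\<^bsub>S\<^esub> \<zeta>) i = (\<xi> \<oplus>\<^bsub>S\<^esub> (\<eta> \<oplus>\<^bsub>S\<^esub> \<zeta>)) i"
        using i * by (simp add: dsum_simps(2-) M.a_assoc dsum_comp)
    qed (use * dsum_add_closed in auto)
  next
    fix \<xi> \<eta> assume *: "\<xi> \<in> carrier S" "\<eta> \<in> carrier S"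
    show "\<xi> \<oplus>\<^bsub>S\<^esub> \<eta> = \<eta> \<oplus>\<^bsub>S\<^esub> \<xi>"
    proof (rule dsum_eqI)
      fix i assume i: "i \<in> I"
      interpret module A "X i" by (rule module_X[OF i])
      show "(\<xi> \<oplus>\<^bsub>S\<^esub> \<eta>) i = (\<eta> \<oplus>\<^bsub>S\<^esub> \<xi>) i"
        using i * by (simp add: dsum_simps(2-) M.a_comm dsum_comp)
    qed (use * dsum_add_closed in auto)
  next
    fix \<xi> assume *: "\<xi> \<in> carrier S"
    show "\<zero>\<^bsub>S\<^esub> \<oplus>\<^bsub>S\<^esub> \<xi> = \<xi>"
      by (rule dsum_eqI[OF dsum_add_closed[OF dsum_zero_closed *] *])
        (use * in \<open>simp add: dsum_simps(2-) X_simps dsum_comp\<close>)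
    show "\<exists>\<eta>\<in>carrier S. \<eta> \<oplus>\<^bsub>S\<^esub> \<xi> = \<zero>\<^bsub>S\<^esub>"
      using dsum_neg_closed[OF *] by blast
  qed (auto simp: dsum_zero_closed dsum_add_closed)
next
  fix r s \<xi> \<eta> assume *: "r \<in> carrier A" "s \<in> carrier A" "\<xi> \<in> carrier S"
  interpret A: cring A by (rule cring)
  show "(r \<oplus>\<^bsub>A\<^esub> s) \<odot>\<^bsub>S\<^esub> \<xi> = r \<odot>\<^bsub>S\<^esub> \<xi> \<oplus>\<^bsub>S\<^esub> s \<odot>\<^bsub>S\<^esub> \<xi>"
  proof (rule dsum_eqI)
    fix i assume i: "i \<in> I"
    interpret module A "X i" by (rule module_X[OF i])
    show "((r \<oplus>\<^bsub>A\<^esub> s) \<odot>\<^bsub>S\<^esub> \<xi>) i = (r \<odot>\<^bsub>S\<^esub> \<xi> \<oplus>\<^bsub>S\<^esub> s \<odot>\<^bsub>S\<^esub> \<xi>) i"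
      using i * by (simp add: dsum_simps(2-) smult_l_distr dsum_comp)
  qed (use * in \<open>auto intro!: dsum_add_closed dsum_smult_closed\<close>)
  show "(r \<otimes>\<^bsub>A\<^esub> s) \<odot>\<^bsub>S\<^esub> \<xi> = r \<odot>\<^bsub>S\<^esub> (s \<odot>\<^bsub>S\<^esub> \<xi>)"
  proof (rule dsum_eqI)
    fix i assume i: "i \<in> I"
    interpret module A "X i" by (rule module_X[OF i])
    show "((r \<otimes>\<^bsub>A\<^esub> s) \<odot>\<^bsub>S\<^esub> \<xi>) i = (r \<odot>\<^bsub>S\<^esub> (s \<odot>\<^bsub>S\<^esub> \<xi>)) i"
      using i * by (simp add: dsum_simps(2-) smult_assoc1 dsum_comp)
  qed (use * in \<open>auto intro!: dsum_smult_closed\<close>)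
next
  fix r \<xi> \<eta> assume *: "r \<in> carrier A" "\<xi> \<in> carrier S" "\<eta> \<in> carrier S"
  show "r \<odot>\<^bsub>S\<^esub> (\<xi> \<oplus>\<^bsub>S\<^esub> \<eta>) = r \<odot>\<^bsub>S\<^esub> \<xi> \<oplus>\<^bsub>S\<^esub> r \<odot>\<^bsub>S\<^esub> \<eta>"
  proof (rule dsum_eqI)
    fix i assume i: "i \<in> I"
    interpret module A "X i" by (rule module_X[OF i])
    show "(r \<odot>\<^bsub>S\<^esub> (\<xi> \<oplus>\<^bsub>S\<^esub> \<eta>)) i = (r \<odot>\<^bsub>S\<^esub> \<xi> \<oplus>\<^bsub>S\<^esub> r \<odot>\<^bsub>S\<^esub> \<eta>) i"
      using i * by (simp add: dsum_simps(2-) smult_r_distr dsum_comp)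
  qed (use * in \<open>auto intro!: dsum_add_closed dsum_smult_closed\<close>)
next
  fix \<xi> assume *: "\<xi> \<in> carrier S"
  interpret A: cring A by (rule cring)
  show "\<one>\<^bsub>A\<^esub> \<odot>\<^bsub>S\<^esub> \<xi> = \<xi>"
  proof (rule dsum_eqI)
    fix i assume i: "i \<in> I"
    interpret module A "X i" by (rule module_X[OF i])
    show "(\<one>\<^bsub>A\<^esub> \<odot>\<^bsub>S\<^esub> \<xi>) i = \<xi> i"
      using i * by (simp add: dsum_simps(2-) dsum_comp)
  qed (use * in \<open>auto intro!: dsum_smult_closed\<close>)
qed (auto intro!: dsum_smult_closed)

lemma dsum_in_hom: "i \<in> I \<Longrightarrow> dsum_in I X i \<in> mod_hom A (X i) S"
  by (rule mod_homI) (simp_all add: dsum_in_closed, auto simp: dsum_in_def dsum_simps X_simps fun_eq_iff)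

lemma dsum_induct [consumes 1, case_names zero inj add]:
  assumes \<xi>: "\<xi> \<in> carrier S" and zero: "P \<zero>\<^bsub>S\<^esub>"
    and inj: "\<And>i x. i \<in> I \<Longrightarrow> x \<in> carrier (X i) \<Longrightarrow> P (dsum_in I X i x)"
    and add: "\<And>\<xi> \<eta>. \<xi> \<in> carrier S \<Longrightarrow> \<eta> \<in> carrier S \<Longrightarrow> P \<xi> \<Longrightarrow> P \<eta> \<Longrightarrow> P (\<xi> \<oplus>\<^bsub>S\<^esub> \<eta>)"
  shows "P \<xi>"
proof -
  \<comment> \<open>The induction is over a finite set containing the support rather than the
    support itself: the inclusion is what survives the removal of one coordinate.\<close>
  have "P \<xi>" if "finite F" "\<xi> \<in> carrier S" "{i \<in> I. \<xi> i \<noteq> \<zero>\<^bsub>X i\<^esub>} \<subseteq> F" for F \<xi>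
    using that
  proof (induction F arbitrary: \<xi> rule: finite_induct)
    case empty
    then have "\<xi> = \<zero>\<^bsub>S\<^esub>"
      by (intro dsum_eqI[OF _ dsum_zero_closed]) (auto simp: dsum_simps)
    then show ?case using zero by simp
  next
    case (insert k F)
    show ?case
    proof (cases "k \<in> I")
      case False
      then have "{i \<in> I. \<xi> i \<noteq> \<zero>\<^bsub>X i\<^esub>} \<subseteq> F" using insert.prems(2) by auto
      then show ?thesis using insert by simp
    next
      case k: True
      define \<eta> where "\<eta> = (\<lambda>i\<in>I. if i = k then \<zero>\<^bsub>X i\<^esub> else \<xi> i)"
      have \<eta>: "\<eta> \<in> carrier S" unfolding \<eta>_def
        by (rule dsum_memI[of _ "{i \<in> I. \<xi> i \<noteq> \<zero>\<^bsub>X i\<^esub>}"])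
          (use insert.prems(1) in \<open>auto simp: X_simps dsum_comp dsum_finite\<close>)
      have "{i \<in> I. \<eta> i \<noteq> \<zero>\<^bsub>X i\<^esub>} \<subseteq> F" using insert.prems(2) by (auto simp: \<eta>_def)
      then have P: "P \<eta>" using insert.IH \<eta> by simp
      have \<xi>k: "\<xi> k \<in> carrier (X k)" using insert.prems(1) k by (rule dsum_comp)
      have "\<xi> = dsum_in I X k (\<xi> k) \<oplus>\<^bsub>S\<^esub> \<eta>"
        by (rule dsum_eqI[OF insert.prems(1) dsum_add_closed[OF dsum_in_closed[OF k \<xi>k] \<eta>]])
          (use insert.prems(1) k \<xi>k in \<open>auto simp: dsum_simps(3) dsum_in_def \<eta>_def X_simps dsum_comp\<close>)
      then show ?thesis using add[OF dsum_in_closed[OF k \<xi>k] \<eta> inj[OF k \<xi>k] P] by simp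
    qed
  qed
  then show ?thesis using dsum_finite[OF \<xi>] \<xi> by blast
qed

text \<open>Nearly every identity between maps out of a direct sum is reduced below to the summands
  in this way.\<close>

lemma dsum_hom_eqI:
  assumes "\<xi> \<in> carrier S" and P: "module A P" and f: "f \<in> mod_hom A S P" and g: "g \<in> mod_hom A S P"
    and "\<And>i x. i \<in> I \<Longrightarrow> x \<in> carrier (X i) \<Longrightarrow> f (dsum_in I X i x) = g (dsum_in I X i x)"
  shows "f \<xi> = g \<xi>"
  using assms(1) by (induction rule: dsum_induct)
    (simp_all add: assms(5) mod_hom_add[OF f] mod_hom_add[OF g] mod_hom_zero[OF module_dsum P f]
      mod_hom_zero[OF module_dsum P g])

context
  fixes P :: "('r, 'n) module" and h :: "'i \<Rightarrow> 'm \<Rightarrow> 'n"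
  assumes P: "module A P" and h: "\<And>i. i \<in> I \<Longrightarrow> h i \<in> mod_hom A (X i) P"
begin

interpretation P: module A P by (rule P)

text \<open>The support varies with the family, so additivity and homogeneity need sums over a
  common larger index set; the added terms are values of linear maps at zero.\<close>

lemma dsum_lift_superset:
  assumes "\<xi> \<in> carrier S" "finite F" "F \<subseteq> I" "{i \<in> I. \<xi> i \<noteq> \<zero>\<^bsub>X i\<^esub>} \<subseteq> F"
  shows "dsum_lift I X P h \<xi> = finsum P (\<lambda>i. h i (\<xi> i)) F"
  unfolding dsum_lift_def
proof (rule P.add.finprod_mono_neutral_cong_left[OF assms(2,4)])
  show "h i (\<xi> i) = \<zero>\<^bsub>P\<^esub>" if "i \<in> F - {i \<in> I. \<xi> i \<noteq> \<zero>\<^bsub>X i\<^esub>}" for i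
    using that assms(3) mod_hom_zero[OF module_X P h] by auto
  show "(\<lambda>i. h i (\<xi> i)) \<in> F \<rightarrow> carrier P"
    using assms(1,3) by (auto intro!: mod_hom_closed[OF h] dsum_comp)
qed simp

lemma dsum_lift_hom: "dsum_lift I X P h \<in> mod_hom A S P"
proof (rule mod_homI)
  fix \<xi> assume \<xi>: "\<xi> \<in> carrier S"
  then show "dsum_lift I X P h \<xi> \<in> carrier P"
    unfolding dsum_lift_def by (intro P.finsum_closed) (auto intro!: mod_hom_closed[OF h] dsum_comp)
  fix r assume r: "r \<in> carrier A"
  let ?F = "{i \<in> I. \<xi> i \<noteq> \<zero>\<^bsub>X i\<^esub>}"
  have "dsum_lift I X P h (r \<odot>\<^bsub>S\<^esub> \<xi>) = finsum P (\<lambda>i. h i ((r \<odot>\<^bsub>S\<^esub> \<xi>) i)) ?F"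
    by (rule dsum_lift_superset[OF dsum_smult_closed[OF r \<xi>] dsum_finite[OF \<xi>]])
      (use r in \<open>auto simp: dsum_simps(4) X_simps\<close>)
  also have "\<dots> = finsum P (\<lambda>i. r \<odot>\<^bsub>P\<^esub> h i (\<xi> i)) ?F"
    by (rule P.finsum_cong') (use r \<xi> in \<open>auto simp: dsum_simps(4) mod_hom_smult[OF h] dsum_comp
      mod_hom_closed[OF h]\<close>)
  also have "\<dots> = r \<odot>\<^bsub>P\<^esub> dsum_lift I X P h \<xi>"
    unfolding dsum_lift_def by (rule P.finsum_smult_ldistr[symmetric])
      (use r \<xi> in \<open>auto simp: dsum_comp mod_hom_closed[OF h] dsum_finite\<close>)
  finally show "dsum_lift I X P h (r \<odot>\<^bsub>S\<^esub> \<xi>) = r \<odot>\<^bsub>P\<^esub> dsum_lift I X P h \<xi>" .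
next
  fix \<xi> \<eta> assume \<xi>: "\<xi> \<in> carrier S" and \<eta>: "\<eta> \<in> carrier S"
  let ?F = "{i \<in> I. \<xi> i \<noteq> \<zero>\<^bsub>X i\<^esub>} \<union> {i \<in> I. \<eta> i \<noteq> \<zero>\<^bsub>X i\<^esub>}"
  have "dsum_lift I X P h (\<xi> \<oplus>\<^bsub>S\<^esub> \<eta>) = finsum P (\<lambda>i. h i ((\<xi> \<oplus>\<^bsub>S\<^esub> \<eta>) i)) ?F"
    by (rule dsum_lift_superset[OF dsum_add_closed[OF \<xi> \<eta>]])
      (use \<eta> \<xi> in \<open>auto simp: dsum_finite dsum_simps(3) X_simps\<close>)
  also have "\<dots> = finsum P (\<lambda>i. h i (\<xi> i) \<oplus>\<^bsub>P\<^esub> h i (\<eta> i)) ?F"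
    by (rule P.finsum_cong') (use \<eta> \<xi> in \<open>auto simp: dsum_simps(3) mod_hom_add[OF h] dsum_comp
      mod_hom_closed[OF h]\<close>)
  also have "\<dots> = finsum P (\<lambda>i. h i (\<xi> i)) ?F \<oplus>\<^bsub>P\<^esub> finsum P (\<lambda>i. h i (\<eta> i)) ?F"
    by (rule P.finsum_addf) (use \<eta> \<xi> in \<open>auto simp: dsum_comp mod_hom_closed[OF h]\<close>)
  also have "\<dots> = dsum_lift I X P h \<xi> \<oplus>\<^bsub>P\<^esub> dsum_lift I X P h \<eta>"
    using \<xi> \<eta> by (subst (1 2) dsum_lift_superset[of _ ?F]) (auto simp: dsum_finite)
  finally show "dsum_lift I X P h (\<xi> \<oplus>\<^bsub>S\<^esub> \<eta>) = dsum_lift I X P h \<xi> \<oplus>\<^bsub>P\<^esub> dsum_lift I X P h \<eta>" .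
qed

lemma dsum_lift_in:
  assumes i: "i \<in> I" and x: "x \<in> carrier (X i)"
  shows "dsum_lift I X P h (dsum_in I X i x) = h i x"
proof -
  have "dsum_lift I X P h (dsum_in I X i x) = finsum P (\<lambda>k. h k (dsum_in I X i x k)) {i}"
    by (rule dsum_lift_superset[OF dsum_in_closed[OF assms]]) (use assms in \<open>auto simp: dsum_in_def\<close>)
  then show ?thesis using assms by (simp add: dsum_in_def mod_hom_closed[OF h])
qed

end

text \<open>\<open>g\<close> relates the two families only at indices in \<open>J\<close>, so the
  sides cannot be compared on the whole sum. Setting both families to zero off \<open>J\<close>
  changes nothing at \<xi>, which is supported in \<open>J\<close>, and makes them comparable
  summand by summand. For direct limits \<open>J\<close> is the set of indices below a
  stage.\<close>

lemma dsum_lift_factor: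
  fixes N :: "('r, 'k) module" and P :: "('r, 'n) module"
  assumes P: "module A P" and h: "\<And>i. i \<in> I \<Longrightarrow> h i \<in> mod_hom A (X i) P"
    and N: "module A N" and g: "g \<in> mod_hom A N P" and t: "\<And>i. i \<in> J \<Longrightarrow> t i \<in> mod_hom A (X i) N"
    and gt: "\<And>i x. i \<in> J \<Longrightarrow> x \<in> carrier (X i) \<Longrightarrow> g (t i x) = h i x"
    and J: "J \<subseteq> I" and \<xi>: "\<xi> \<in> carrier S" and supp: "{i \<in> I. \<xi> i \<noteq> \<zero>\<^bsub>X i\<^esub>} \<subseteq> J"
  shows "dsum_lift I X P h \<xi> = g (dsum_lift I X N (\<lambda>i. if i \<in> J then t i else (\<lambda>_. \<zero>\<^bsub>N\<^esub>)) \<xi>)"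
proof -
  interpret P: module A P by (rule P)
  let ?t = "\<lambda>i. if i \<in> J then t i else (\<lambda>_. \<zero>\<^bsub>N\<^esub>)" and ?h = "\<lambda>i. if i \<in> J then h i else (\<lambda>_. \<zero>\<^bsub>P\<^esub>)"
  have th: "?t i \<in> mod_hom A (X i) N" for i
    using t mod_hom_const_zero[OF N, of "X i"] by simp
  have hh: "?h i \<in> mod_hom A (X i) P" if "i \<in> I" for i
    using h[OF that] mod_hom_const_zero[OF P, of "X i"] by simp
  have "dsum_lift I X P h \<xi> = dsum_lift I X P ?h \<xi>"
    unfolding dsum_lift_def
    by (rule P.finsum_cong') (use supp in \<open>auto intro!: mod_hom_closed[OF h] dsum_comp[OF \<xi>]\<close>)
  also have "\<dots> = g (dsum_lift I X N ?t \<xi>)"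
    by (rule dsum_hom_eqI[OF \<xi> P dsum_lift_hom[OF P hh] mod_hom_comp[OF dsum_lift_hom[OF N th] g]])
      (auto simp: dsum_lift_in[OF P hh] dsum_lift_in[OF N th] gt mod_hom_zero[OF N P g])
  finally show ?thesis .
qed

lemma small_dsum:
  assumes "universe \<kappa>" "small \<kappa> (UNIV :: nat set)" "small \<kappa> I" "\<And>i. i \<in> I \<Longrightarrow> small \<kappa> (carrier (X i))"
  shows "small \<kappa> (carrier S)"
proof -
  \<comment> \<open>The zero family is added separately because \<open>I\<close> may be
    empty.\<close>
  define G where "G = insert \<zero>\<^bsub>S\<^esub> ((\<lambda>(i, x). dsum_in I X i x) ` (SIGMA i:I. carrier (X i)))"
  have "small \<kappa> (SIGMA i:I. carrier (X i))" by (rule small_Sigma) (use assms in auto)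
  then have "small \<kappa> ((\<lambda>(i, x). dsum_in I X i x) ` (SIGMA i:I. carrier (X i)))"
    by (rule small_surj[OF _ order_refl])
  then have "small \<kappa> ({\<zero>\<^bsub>S\<^esub>} \<union> ((\<lambda>(i, x). dsum_in I X i x) ` (SIGMA i:I. carrier (X i))))"
    by (intro small_Un small_singleton assms(1))
  then have "small \<kappa> G" by (simp add: G_def)
  then have "small \<kappa> (op_closure {()} (\<lambda>_. add S) G)"
    by (intro small_op_closure small_singleton assms(1,2))
  moreover have "carrier S \<subseteq> op_closure {()} (\<lambda>_. add S) G"
  proof
    fix \<xi> assume "\<xi> \<in> carrier S"
    then show "\<xi> \<in> op_closure {()} (\<lambda>_. add S) G"
    proof (induction rule: dsum_induct)
      case (add \<xi> \<eta>)
      then show ?case using op_closure.op[of "()" "{()}" \<xi> "\<lambda>_. add S" G \<eta>] by simp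
    qed (auto intro!: op_closure.base simp: G_def)
  qed
  ultimately show ?thesis by (rule small_subset)
qed

end

section \<open>The category of cartesian modules\<close>

abbreviation cmp :: "'x \<times> 'y \<times> ('o \<Rightarrow> 'u \<Rightarrow> 'u) \<Rightarrow> 'o \<Rightarrow> 'u \<Rightarrow> 'u" where
  "cmp f \<equiv> snd (snd f)"

context flat_presheaf_data
begin

abbreviation "D \<equiv> Mod_cart \<kappa> C R"

text \<open>Morphisms without the extensionality of \<open>presheaf_module_hom\<close>, so that they
  can be given by plain functions; \<open>arrow\<close> restores it by restricting to objects and
  carriers.\<close>

definition nat_hom where
  "nat_hom M N \<eta> \<longleftrightarrow>
    (\<forall>v \<in> Obj C. \<eta> v \<in> mod_hom (ring_at R v) (mod_at M v) (mod_at N v)) \<and>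
    (\<forall>a \<in> Arr C. \<forall>x \<in> carrier (mod_at M (Cod C a)).
      \<eta> (Dom C a) (mod_res M a x) = mod_res N a (\<eta> (Cod C a) x))"

definition arrow where
  "arrow M N \<eta> = (M, N, \<lambda>v \<in> Obj C. \<lambda>x \<in> carrier (mod_at M v). \<eta> v x)"

lemma D_simps:
  "Obj D = {M. cart_mod M}"
  "Dom D f = fst f" "Cod D f = fst (snd f)"
  "Ident D M = arrow M M (\<lambda>v x. x)"
  "Comp D g f = arrow (fst f) (fst (snd g)) (\<lambda>v x. cmp g v (cmp f v x))"
  by (auto simp: Mod_cart_def full_subcategory_def Mod_all_def arrow_def split: prod.splits)

lemma nat_homI:
  assumes "\<And>v. v \<in> Obj C \<Longrightarrow> \<eta> v \<in> mod_hom (ring_at R v) (mod_at M v) (mod_at N v)"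
    and "\<And>a x. a \<in> Arr C \<Longrightarrow> x \<in> carrier (mod_at M (Cod C a)) \<Longrightarrow>
      \<eta> (Dom C a) (mod_res M a x) = mod_res N a (\<eta> (Cod C a) x)"
  shows "nat_hom M N \<eta>"
  using assms by (simp add: nat_hom_def)

lemma Arr_D_iff: "f \<in> Arr D \<longleftrightarrow> f \<in> Hom D (fst f) (fst (snd f))"
  by (simp add: Hom_def D_simps)

text \<open>The equation \<open>f = arrow M N (cmp f)\<close> carries both the endpoints of
  \<open>f\<close> and the extensionality of its components.\<close>

lemma Hom_D_iff:
  "f \<in> Hom D M N \<longleftrightarrow> cart_mod M \<and> cart_mod N \<and> nat_hom M N (cmp f) \<and> f = arrow M N (cmp f)"
proof -
  obtain M' N' \<eta> where f: "f = (M', N', \<eta>)" by (cases f) auto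
  have "\<eta> \<in> presheaf_module_hom C R M N \<longleftrightarrow>
      nat_hom M N \<eta> \<and> \<eta> = (\<lambda>v \<in> Obj C. \<lambda>x \<in> carrier (mod_at M v). \<eta> v x)"
  proof
    assume "\<eta> \<in> presheaf_module_hom C R M N"
    then have "nat_hom M N \<eta>" and exts: "\<eta> \<in> extensional (Obj C)"
      "\<And>v. v \<in> Obj C \<Longrightarrow> \<eta> v \<in> extensional (carrier (mod_at M v))"
      by (auto simp: presheaf_module_hom_def nat_hom_def PiE_iff)
    moreover have "\<eta> = (\<lambda>v \<in> Obj C. \<lambda>x \<in> carrier (mod_at M v). \<eta> v x)"
      using exts by (intro ext) (auto simp: restrict_def extensional_def)
    ultimately show "nat_hom M N \<eta> \<and> \<eta> = (\<lambda>v \<in> Obj C. \<lambda>x \<in> carrier (mod_at M v). \<eta> v x)" by blast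
  next
    assume *: "nat_hom M N \<eta> \<and> \<eta> = (\<lambda>v \<in> Obj C. \<lambda>x \<in> carrier (mod_at M v). \<eta> v x)"
    have "\<eta> \<in> extensional (Obj C)" by (subst *[THEN conjunct2]) (rule restrict_extensional)
    moreover have "\<eta> v \<in> extensional (carrier (mod_at M v))" if "v \<in> Obj C" for v
      by (subst *[THEN conjunct2]) (use that in simp)
    ultimately show "\<eta> \<in> presheaf_module_hom C R M N"
      using * unfolding presheaf_module_hom_def nat_hom_def by (simp add: PiE_iff)
  qed
  then show ?thesis
    by (auto simp: f Hom_def Mod_cart_def full_subcategory_def Mod_all_def arrow_def)
qed

lemma cmp_arrow [simp]: "v \<in> Obj C \<Longrightarrow> x \<in> carrier (mod_at M v) \<Longrightarrow> cmp (arrow M N \<eta>) v x = \<eta> v x"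
  by (simp add: arrow_def)

lemma arrow_cong:
  "(\<And>v x. v \<in> Obj C \<Longrightarrow> x \<in> carrier (mod_at M v) \<Longrightarrow> \<eta> v x = \<eta>' v x) \<Longrightarrow> arrow M N \<eta> = arrow M N \<eta>'"
  by (auto simp: arrow_def intro!: restrict_ext)

lemma HomD:
  assumes "f \<in> Hom D M N"
  shows Hom_cart: "cart_mod M" "cart_mod N"
    and Hom_eq: "f = arrow M N (cmp f)"
    and Hom_fst: "fst f = M" "fst (snd f) = N"
    and cmp_hom: "\<And>v. v \<in> Obj C \<Longrightarrow> cmp f v \<in> mod_hom (ring_at R v) (mod_at M v) (mod_at N v)"
    and cmp_nat: "\<And>a x. a \<in> Arr C \<Longrightarrow> x \<in> carrier (mod_at M (Cod C a)) \<Longrightarrow>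
      cmp f (Dom C a) (mod_res M a x) = mod_res N a (cmp f (Cod C a) x)"
proof -
  have *: "cart_mod M \<and> cart_mod N \<and> nat_hom M N (cmp f) \<and> f = arrow M N (cmp f)"
    using assms Hom_D_iff by blast
  then show "cart_mod M" "cart_mod N" "f = arrow M N (cmp f)"
    "\<And>v. v \<in> Obj C \<Longrightarrow> cmp f v \<in> mod_hom (ring_at R v) (mod_at M v) (mod_at N v)"
    "\<And>a x. a \<in> Arr C \<Longrightarrow> x \<in> carrier (mod_at M (Cod C a)) \<Longrightarrow>
      cmp f (Dom C a) (mod_res M a x) = mod_res N a (cmp f (Cod C a) x)"
    by (auto simp: nat_hom_def)
  show "fst f = M" "fst (snd f) = N" using assms by (auto simp: Hom_def D_simps)
qed

lemma cmp_closed: "f \<in> Hom D M N \<Longrightarrow> v \<in> Obj C \<Longrightarrow> x \<in> carrier (mod_at M v) \<Longrightarrow> cmp f v x \<in> carrier (mod_at N v)"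
  by (rule mod_hom_closed[OF cmp_hom])

lemma cmp_zero: "f \<in> Hom D M N \<Longrightarrow> v \<in> Obj C \<Longrightarrow> cmp f v \<zero>\<^bsub>mod_at M v\<^esub> = \<zero>\<^bsub>mod_at N v\<^esub>"
  by (rule mod_hom_zero[OF module_at module_at cmp_hom]) (use Hom_cart in auto)

lemma arrow_Hom:
  assumes "cart_mod M" "cart_mod N" "nat_hom M N \<eta>"
  shows "arrow M N \<eta> \<in> Hom D M N"
proof -
  have M: "psh_mod M" using assms by simp
  have "nat_hom M N (cmp (arrow M N \<eta>))"
  proof (rule nat_homI)
    show "cmp (arrow M N \<eta>) v \<in> mod_hom (ring_at R v) (mod_at M v) (mod_at N v)" if v: "v \<in> Obj C" for v
      by (rule mod_hom_cong[OF module_at[OF M v], of "\<eta> v"]) (use assms(3) v in \<open>auto simp: nat_hom_def\<close>)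
    show "cmp (arrow M N \<eta>) (Dom C a) (mod_res M a x) = mod_res N a (cmp (arrow M N \<eta>) (Cod C a) x)"
      if "a \<in> Arr C" "x \<in> carrier (mod_at M (Cod C a))" for a x
      using that assms(3) by (simp add: res_closed[OF M] nat_hom_def)
  qed
  moreover have "arrow M N \<eta> = arrow M N (cmp (arrow M N \<eta>))"
    by (rule arrow_cong) simp
  ultimately show ?thesis using assms Hom_D_iff by blast
qed

lemma Hom_eqI:
  assumes "f \<in> Hom D M N" "g \<in> Hom D M N"
    and "\<And>v x. v \<in> Obj C \<Longrightarrow> x \<in> carrier (mod_at M v) \<Longrightarrow> cmp f v x = cmp g v x"
  shows "f = g"
proof -
  have "f = arrow M N (cmp f)" by (rule Hom_eq[OF assms(1)])
  also have "\<dots> = arrow M N (cmp g)" by (rule arrow_cong) (rule assms(3))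
  also have "\<dots> = g" by (rule Hom_eq[OF assms(2), symmetric])
  finally show ?thesis .
qed

lemma cmp_Comp:
  assumes "f \<in> Hom D L M" "v \<in> Obj C" "x \<in> carrier (mod_at L v)"
  shows "cmp (Comp D g f) v x = cmp g v (cmp f v x)"
  using assms Hom_fst(1)[OF assms(1)] by (simp add: D_simps)

lemma cmp_Ident: "v \<in> Obj C \<Longrightarrow> x \<in> carrier (mod_at M v) \<Longrightarrow> cmp (Ident D M) v x = x"
  by (simp add: D_simps)

lemma Comp_in_Hom:
  assumes f: "f \<in> Hom D L M" and g: "g \<in> Hom D M N"
  shows "Comp D g f \<in> Hom D L N"
proof -
  have L: "psh_mod L" using Hom_cart[OF f] by simp
  have "nat_hom L N (\<lambda>v x. cmp g v (cmp f v x))"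
    by (rule nat_homI) (auto intro: mod_hom_comp cmp_hom[OF f] cmp_hom[OF g]
        simp: cmp_nat[OF f] cmp_nat[OF g] cmp_closed[OF f])
  then show ?thesis
    using arrow_Hom Hom_cart[OF f] Hom_cart[OF g] by (simp add: D_simps Hom_fst[OF f] Hom_fst[OF g])
qed

lemma Ident_in_Hom: "cart_mod M \<Longrightarrow> Ident D M \<in> Hom D M M"
  unfolding D_simps by (rule arrow_Hom) (auto intro!: nat_homI mod_hom_id)

lemma category_D: "category D"
proof
  show "Dom D f \<in> Obj D" "Cod D f \<in> Obj D" if "f \<in> Arr D" for f
    using that Hom_cart[of f "fst f" "fst (snd f)"] unfolding Arr_D_iff by (simp_all add: D_simps)
  show "Ident D M \<in> Hom D M M" if "M \<in> Obj D" for M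
    using that Ident_in_Hom by (simp add: D_simps(1))
  show "Comp D g f \<in> Hom D x z" if "f \<in> Hom D x y" "g \<in> Hom D y z" for f g x y z
    using that by (rule Comp_in_Hom)
  show "Comp D (Ident D y) f = f" if f: "f \<in> Hom D x y" for f x y
    by (rule Hom_eqI[OF Comp_in_Hom[OF f Ident_in_Hom[OF Hom_cart(2)[OF f]]] f])
      (simp add: cmp_Comp[OF f] cmp_Ident cmp_closed[OF f])
  show "Comp D f (Ident D x) = f" if f: "f \<in> Hom D x y" for f x y
    by (rule Hom_eqI[OF Comp_in_Hom[OF Ident_in_Hom[OF Hom_cart(1)[OF f]] f] f])
      (simp add: cmp_Comp[OF Ident_in_Hom[OF Hom_cart(1)[OF f]]] cmp_Ident)
  show "Comp D (Comp D h g) f = Comp D h (Comp D g f)"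
    if f: "f \<in> Hom D w x" and g: "g \<in> Hom D x y" and h: "h \<in> Hom D y z" for f g h w x y z
    by (rule Hom_eqI[OF Comp_in_Hom[OF f Comp_in_Hom[OF g h]] Comp_in_Hom[OF Comp_in_Hom[OF f g] h]])
      (simp add: cmp_Comp[OF f] cmp_Comp[OF g] cmp_Comp[OF Comp_in_Hom[OF f g]] cmp_closed[OF f])
qed

section \<open>The additive structure on the hom sets\<close>

definition hadd where
  "hadd f g = arrow (fst f) (fst (snd f)) (\<lambda>v x. cmp f v x \<oplus>\<^bsub>mod_at (fst (snd f)) v\<^esub> cmp g v x)"

definition hzero where
  "hzero M N = arrow M N (\<lambda>v x. \<zero>\<^bsub>mod_at N v\<^esub>)"

lemma hadd_Hom:
  assumes f: "f \<in> Hom D M N" and g: "g \<in> Hom D M N"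
  shows "hadd f g \<in> Hom D M N"
    and cmp_hadd: "\<And>v x. v \<in> Obj C \<Longrightarrow> x \<in> carrier (mod_at M v) \<Longrightarrow>
      cmp (hadd f g) v x = cmp f v x \<oplus>\<^bsub>mod_at N v\<^esub> cmp g v x"
proof -
  have M: "psh_mod M" and N: "psh_mod N" using Hom_cart[OF f] by auto
  have "nat_hom M N (\<lambda>v x. cmp f v x \<oplus>\<^bsub>mod_at N v\<^esub> cmp g v x)"
  proof (rule nat_homI)
    show "(\<lambda>x. cmp f v x \<oplus>\<^bsub>mod_at N v\<^esub> cmp g v x) \<in> mod_hom (ring_at R v) (mod_at M v) (mod_at N v)"
      if "v \<in> Obj C" for v
      by (rule mod_hom_plus[OF module_at[OF M] module_at[OF N] cmp_hom[OF f] cmp_hom[OF g]])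
        (use that in auto)
  qed (simp add: cmp_nat[OF f] cmp_nat[OF g] res_add[OF N] cmp_closed[OF f] cmp_closed[OF g])
  then show "hadd f g \<in> Hom D M N"
    using arrow_Hom Hom_cart[OF f] by (simp add: hadd_def Hom_fst[OF f])
  show "cmp (hadd f g) v x = cmp f v x \<oplus>\<^bsub>mod_at N v\<^esub> cmp g v x"
    if "v \<in> Obj C" "x \<in> carrier (mod_at M v)" for v x
    using that by (simp add: hadd_def Hom_fst[OF f])
qed

lemma hzero_Hom:
  assumes "cart_mod M" "cart_mod N"
  shows "hzero M N \<in> Hom D M N"
  unfolding hzero_def
  by (rule arrow_Hom) (use assms in \<open>auto intro!: nat_homI mod_hom_const_zero module_at simp: res_zero\<close>)

lemma cmp_hzero: "v \<in> Obj C \<Longrightarrow> x \<in> carrier (mod_at M v) \<Longrightarrow> cmp (hzero M N) v x = \<zero>\<^bsub>mod_at N v\<^esub>"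
  by (simp add: hzero_def)

lemma preadditive_D: "preadditive_category D hadd hzero"
proof (intro preadditive_category.intro category_D preadditive_category_axioms.intro)
  fix M N assume "M \<in> Obj D" "N \<in> Obj D"
  then have M: "cart_mod M" and N: "cart_mod N" by (auto simp: D_simps)
  then have M': "psh_mod M" and N': "psh_mod N" by auto
  note mN = module_at[OF N']
  note [simp] = cmp_hadd cmp_hzero cmp_closed hadd_Hom(1) hzero_Hom[OF M N]
  show "comm_group (Hom_group D hadd hzero M N)"
    unfolding Hom_group_def
  proof (rule comm_groupI, simp_all only: partial_object.select_convs monoid.select_convs)
    fix f g assume f: "f \<in> Hom D M N" and g: "g \<in> Hom D M N"
    show "hadd f g \<in> Hom D M N" by (rule hadd_Hom[OF f g])
    show "hadd f g = hadd g f"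
    proof (rule Hom_eqI[OF hadd_Hom(1)[OF f g] hadd_Hom(1)[OF g f]])
      fix v x assume v: "v \<in> Obj C" and x: "x \<in> carrier (mod_at M v)"
      interpret module "ring_at R v" "mod_at N v" by (rule mN[OF v])
      show "cmp (hadd f g) v x = cmp (hadd g f) v x"
        using f g v x by (simp add: cmp_hadd[OF f g] cmp_hadd[OF g f] M.a_comm cmp_closed[OF f] cmp_closed[OF g])
    qed
    fix h assume h: "h \<in> Hom D M N"
    show "hadd (hadd f g) h = hadd f (hadd g h)"
    proof (rule Hom_eqI[OF hadd_Hom(1)[OF hadd_Hom(1)[OF f g] h] hadd_Hom(1)[OF f hadd_Hom(1)[OF g h]]])
      fix v x assume v: "v \<in> Obj C" and x: "x \<in> carrier (mod_at M v)"
      interpret module "ring_at R v" "mod_at N v" by (rule mN[OF v])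
      show "cmp (hadd (hadd f g) h) v x = cmp (hadd f (hadd g h)) v x"
        using f g h v x
        by (simp add: cmp_hadd[OF hadd_Hom(1)[OF f g] h] cmp_hadd[OF f hadd_Hom(1)[OF g h]] cmp_hadd[OF f g]
            cmp_hadd[OF g h] M.a_assoc cmp_closed[OF f] cmp_closed[OF g] cmp_closed[OF h])
    qed
  next
    fix f assume f: "f \<in> Hom D M N"
    note z = hzero_Hom[OF M N]
    show "hadd (hzero M N) f = f"
    proof (rule Hom_eqI[OF hadd_Hom(1)[OF z f] f])
      fix v x assume v: "v \<in> Obj C" and x: "x \<in> carrier (mod_at M v)"
      interpret module "ring_at R v" "mod_at N v" by (rule mN[OF v])
      show "cmp (hadd (hzero M N) f) v x = cmp f v x"
        using f v x by (simp add: cmp_hadd[OF z f] cmp_hzero cmp_closed[OF f])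
    qed
    define g where "g = arrow M N (\<lambda>v x. \<ominus>\<^bsub>mod_at N v\<^esub> cmp f v x)"
    have "nat_hom M N (\<lambda>v x. \<ominus>\<^bsub>mod_at N v\<^esub> cmp f v x)"
    proof (rule nat_homI)
      show "(\<lambda>x. \<ominus>\<^bsub>mod_at N v\<^esub> cmp f v x) \<in> mod_hom (ring_at R v) (mod_at M v) (mod_at N v)"
        if "v \<in> Obj C" for v
        using mod_hom_uminus[OF module_at[OF M' that] mN[OF that] cmp_hom[OF f that]] .
      show "\<ominus>\<^bsub>mod_at N (Dom C a)\<^esub> cmp f (Dom C a) (mod_res M a x) =
        mod_res N a (\<ominus>\<^bsub>mod_at N (Cod C a)\<^esub> cmp f (Cod C a) x)"
        if a: "a \<in> Arr C" and x: "x \<in> carrier (mod_at M (Cod C a))" for a x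
      proof -
        have r: "module (ring_at R (Cod C a)) (restrict_scalars (ring_res R a) (mod_at N (Dom C a)))"
          using a by (intro module_restrict_scalars[OF cring_at ring_res_hom mN]) auto
        have "mod_res N a (\<ominus>\<^bsub>mod_at N (Cod C a)\<^esub> cmp f (Cod C a) x) =
          \<ominus>\<^bsub>restrict_scalars (ring_res R a) (mod_at N (Dom C a))\<^esub> mod_res N a (cmp f (Cod C a) x)"
          using a x by (intro mod_hom_neg[OF mN r res_hom[OF N']]) (auto simp: cmp_closed[OF f])
        then show ?thesis
          using cmp_nat[OF f a x] by simp
      qed
    qed
    then have g: "g \<in> Hom D M N" unfolding g_def by (rule arrow_Hom[OF M N])
    show "\<exists>g\<in>Hom D M N. hadd g f = hzero M N"
    proof (rule bexI[OF _ g], rule Hom_eqI[OF hadd_Hom(1)[OF g f] z])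
      fix v x assume v: "v \<in> Obj C" and x: "x \<in> carrier (mod_at M v)"
      interpret module "ring_at R v" "mod_at N v" by (rule mN[OF v])
      have "cmp g v x = \<ominus>\<^bsub>mod_at N v\<^esub> cmp f v x" using v x by (simp add: g_def)
      then show "cmp (hadd g f) v x = cmp (hzero M N) v x"
        using v x by (simp add: cmp_hadd[OF g f] cmp_hzero M.l_neg cmp_closed[OF f])
    qed
  qed (rule hzero_Hom[OF M N])
next
  fix f f' g x y z assume f: "f \<in> Hom D x y" and f': "f' \<in> Hom D x y" and g: "g \<in> Hom D y z"
  show "Comp D g (hadd f f') = hadd (Comp D g f) (Comp D g f')"
    by (rule Hom_eqI[OF Comp_in_Hom[OF hadd_Hom(1)[OF f f'] g]
          hadd_Hom(1)[OF Comp_in_Hom[OF f g] Comp_in_Hom[OF f' g]]])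
      (simp add: cmp_Comp[OF hadd_Hom(1)[OF f f']] cmp_Comp[OF f] cmp_Comp[OF f'] cmp_hadd[OF f f']
        cmp_hadd[OF Comp_in_Hom[OF f g] Comp_in_Hom[OF f' g]] mod_hom_add[OF cmp_hom[OF g]]
        cmp_closed[OF f] cmp_closed[OF f'])
next
  fix f g g' x y z assume f: "f \<in> Hom D x y" and g: "g \<in> Hom D y z" and g': "g' \<in> Hom D y z"
  show "Comp D (hadd g g') f = hadd (Comp D g f) (Comp D g' f)"
    by (rule Hom_eqI[OF Comp_in_Hom[OF f hadd_Hom(1)[OF g g']]
          hadd_Hom(1)[OF Comp_in_Hom[OF f g] Comp_in_Hom[OF f g']]])
      (simp add: cmp_Comp[OF f] cmp_hadd[OF g g'] cmp_closed[OF f]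
        cmp_hadd[OF Comp_in_Hom[OF f g] Comp_in_Hom[OF f g']])
qed

subsection \<open>Zero objects and zero arrows\<close>

definition zero_psh :: "('o, 'a, 'r, 'u) mod_psh" where
  "zero_psh = \<lparr>mod_at = (\<lambda>v. \<lparr>carrier = {undefined}, monoid.mult = undefined, one = undefined,
      zero = undefined, add = (\<lambda>x y. undefined), smult = (\<lambda>r x. undefined)\<rparr>),
    mod_res = (\<lambda>a x. undefined)\<rparr>"

lemma zero_psh_simps [simp]: "carrier (mod_at zero_psh v) = {\<zero>\<^bsub>mod_at zero_psh v\<^esub>}"
  by (simp add: zero_psh_def)

lemma cart_zero_psh: "cart_mod zero_psh"
proof -
  have mod: "module (ring_at R v) (mod_at zero_psh v)" if "v \<in> Obj C" for v
    by (rule moduleI[OF cring_at[OF that]])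
      (auto simp: zero_psh_def intro!: abelian_groupI)
  have Z: "psh_mod zero_psh"
    by (rule psh_modI) (simp_all add: mod small_singleton[OF univ], simp_all add: zero_psh_def mod_hom_def)
  have "cartesian C R zero_psh"
  proof (rule cartesianI[OF Z])
    fix a and P :: "('r, 'u) module" and g
    assume a: "a \<in> Arr C" and P: "module (ring_at R (Dom C a)) P"
      and g: "g \<in> mod_hom (ring_at R (Cod C a)) (mod_at zero_psh (Cod C a)) (restrict_scalars (ring_res R a) P)"
    have r: "module (ring_at R (Cod C a)) (restrict_scalars (ring_res R a) P)"
      using a P by (intro module_restrict_scalars[OF cring_at ring_res_hom]) auto
    have "g \<zero>\<^bsub>mod_at zero_psh (Cod C a)\<^esub> = \<zero>\<^bsub>P\<^esub>"
      using mod_hom_zero[OF mod r g] a by simp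
    then show "\<exists>h\<in>mod_hom (ring_at R (Dom C a)) (mod_at zero_psh (Dom C a)) P.
        \<forall>m\<in>carrier (mod_at zero_psh (Cod C a)). h (mod_res zero_psh a m) = g m"
      by (intro bexI[OF _ mod_hom_const_zero[OF P]]) simp
  next
    fix a h n assume a: "a \<in> Arr C"
      and h: "h \<in> mod_hom (ring_at R (Dom C a)) (mod_at zero_psh (Dom C a)) (mod_at zero_psh (Dom C a))"
      and n: "n \<in> carrier (mod_at zero_psh (Dom C a))"
    then show "h n = n" using mod_hom_closed[OF h n] by simp
  qed
  then show ?thesis using Z by simp
qed

lemma zero_object_zero_psh: "zero_object D zero_psh"
proof -
  have "(\<exists>!f. f \<in> Hom D M zero_psh) \<and> (\<exists>!f. f \<in> Hom D zero_psh M)" if M: "cart_mod M" for M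
  proof
    have "f = hzero M zero_psh" if f: "f \<in> Hom D M zero_psh" for f
      by (rule Hom_eqI[OF f hzero_Hom[OF M cart_zero_psh]]) (use cmp_closed[OF f] in \<open>simp add: cmp_hzero\<close>)
    then show "\<exists>!f. f \<in> Hom D M zero_psh" using hzero_Hom[OF M cart_zero_psh] by blast
    have "f = hzero zero_psh M" if f: "f \<in> Hom D zero_psh M" for f
      by (rule Hom_eqI[OF f hzero_Hom[OF cart_zero_psh M]]) (use cmp_zero[OF f] in \<open>simp add: cmp_hzero\<close>)
    then show "\<exists>!f. f \<in> Hom D zero_psh M" using hzero_Hom[OF cart_zero_psh M] by blast
  qed
  then show ?thesis using cart_zero_psh by (simp add: zero_object_def D_simps(1))
qed

text \<open>A zero arrow may factor through any zero object, not just \<open>zero_psh\<close>. On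
  such an object the identity and the zero endomorphism coincide, so all its modules are
  trivial.\<close>

lemma zero_arrow_iff:
  assumes f: "f \<in> Hom D M N"
  shows "zero_arrow D f \<longleftrightarrow> (\<forall>v \<in> Obj C. \<forall>x \<in> carrier (mod_at M v). cmp f v x = \<zero>\<^bsub>mod_at N v\<^esub>)"
proof
  assume "zero_arrow D f"
  then obtain z g h where z: "zero_object D z" and g: "g \<in> Hom D M z" and h: "h \<in> Hom D z N"
    and fgh: "f = Comp D h g"
    using Hom_fst[OF f] by (auto simp: zero_arrow_def D_simps(2,3))
  have zc: "cart_mod z" using z by (auto simp: zero_object_def D_simps(1))
  have "Ident D z = hzero z z"
    using z Ident_in_Hom[OF zc] hzero_Hom[OF zc zc] unfolding zero_object_def by blast
  then have idz: "x = \<zero>\<^bsub>mod_at z v\<^esub>" if "v \<in> Obj C" "x \<in> carrier (mod_at z v)" for v x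
    using cmp_Ident[OF that] cmp_hzero[OF that] by metis
  show "\<forall>v \<in> Obj C. \<forall>x \<in> carrier (mod_at M v). cmp f v x = \<zero>\<^bsub>mod_at N v\<^esub>"
  proof (intro ballI)
    fix v x assume v: "v \<in> Obj C" and x: "x \<in> carrier (mod_at M v)"
    have "cmp g v x = \<zero>\<^bsub>mod_at z v\<^esub>" by (rule idz[OF v cmp_closed[OF g v x]])
    then show "cmp f v x = \<zero>\<^bsub>mod_at N v\<^esub>"
      using cmp_zero[OF h v] by (simp add: fgh cmp_Comp[OF g v x])
  qed
next
  assume zero: "\<forall>v \<in> Obj C. \<forall>x \<in> carrier (mod_at M v). cmp f v x = \<zero>\<^bsub>mod_at N v\<^esub>"
  note M = Hom_cart(1)[OF f] and N = Hom_cart(2)[OF f]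
  note g = hzero_Hom[OF M cart_zero_psh] and h = hzero_Hom[OF cart_zero_psh N]
  have "f = Comp D (hzero zero_psh N) (hzero M zero_psh)"
    by (rule Hom_eqI[OF f Comp_in_Hom[OF g h]])
      (use zero in \<open>simp add: cmp_Comp[OF g] cmp_hzero\<close>)
  moreover have "f \<in> Arr D" using f by (simp add: Hom_def)
  ultimately show "zero_arrow D f"
    unfolding zero_arrow_def D_simps(2,3) Hom_fst[OF f]
    using zero_object_zero_psh g h by blast
qed

subsection \<open>Kernels and cokernels\<close>

definition ker_at where
  "ker_at f v = {x \<in> carrier (mod_at (fst f) v). cmp f v x = \<zero>\<^bsub>mod_at (fst (snd f)) v\<^esub>}"

definition img_at where
  "img_at f v = cmp f v ` carrier (mod_at (fst f) v)"

text \<open>The factorisation exists objectwise; that it is natural and unique is tested after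
  applying the injective \<open>k\<close>.\<close>

lemma factor_inj:
  assumes k: "k \<in> Hom D K M" and inj: "\<And>v. v \<in> Obj C \<Longrightarrow> inj_on (cmp k v) (carrier (mod_at K v))"
    and h: "h \<in> Hom D L M"
    and im: "\<And>v x. v \<in> Obj C \<Longrightarrow> x \<in> carrier (mod_at L v) \<Longrightarrow> cmp h v x \<in> img_at k v"
  shows "\<exists>!u. u \<in> Hom D L K \<and> Comp D k u = h"
proof -
  have K: "psh_mod K" and L: "psh_mod L" using Hom_cart[OF k] Hom_cart[OF h] by auto
  define \<eta> where "\<eta> v x = inv_into (carrier (mod_at K v)) (cmp k v) (cmp h v x)" for v x
  have \<eta>: "\<eta> v x \<in> carrier (mod_at K v)" "cmp k v (\<eta> v x) = cmp h v x"
    if "v \<in> Obj C" "x \<in> carrier (mod_at L v)" for v x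
    using im[OF that] by (simp_all add: \<eta>_def img_at_def Hom_fst[OF k] inv_into_into f_inv_into_f)
  have \<eta>_eq: "\<eta> v x = y" if "v \<in> Obj C" "y \<in> carrier (mod_at K v)" "cmp k v y = cmp h v x" for v x y
    unfolding \<eta>_def using inv_into_f_eq[OF inj[OF that(1)] that(2,3)] .
  have "nat_hom L K \<eta>"
  proof (rule nat_homI)
    fix v assume v: "v \<in> Obj C"
    show "\<eta> v \<in> mod_hom (ring_at R v) (mod_at L v) (mod_at K v)"
      unfolding \<eta>_def
    proof (rule mod_hom_factor_inj[OF module_at[OF K v] module_at[OF L v] cmp_hom[OF k v] inj[OF v] cmp_hom[OF h v]])
      show "cmp h v ` carrier (mod_at L v) \<subseteq> cmp k v ` carrier (mod_at K v)"
        using im[OF v] by (auto simp: img_at_def Hom_fst[OF k])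
    qed
  next
    fix a x assume a: "a \<in> Arr C" and x: "x \<in> carrier (mod_at L (Cod C a))"
    show "\<eta> (Dom C a) (mod_res L a x) = mod_res K a (\<eta> (Cod C a) x)"
      using a x by (intro \<eta>_eq) (simp_all add: res_closed[OF K] \<eta> cmp_nat[OF k] cmp_nat[OF h])
  qed
  then have u: "arrow L K \<eta> \<in> Hom D L K" using arrow_Hom Hom_cart[OF k] Hom_cart[OF h] by blast
  show ?thesis
  proof (rule ex1I[of _ "arrow L K \<eta>"], intro conjI u)
    show "Comp D k (arrow L K \<eta>) = h"
      by (rule Hom_eqI[OF Comp_in_Hom[OF u k] h]) (simp add: cmp_Comp[OF u] \<eta>)
    fix u' assume u': "u' \<in> Hom D L K \<and> Comp D k u' = h"
    then have u'H: "u' \<in> Hom D L K" by simp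
    show "u' = arrow L K \<eta>"
    proof (rule Hom_eqI[OF u'H u])
      fix v x assume vx: "v \<in> Obj C" "x \<in> carrier (mod_at L v)"
      have "\<eta> v x = cmp u' v x"
        using vx u' cmp_Comp[OF u'H vx, of k] by (intro \<eta>_eq) (auto simp: cmp_closed[OF u'H])
      then show "cmp u' v x = cmp (arrow L K \<eta>) v x" using vx by simp
    qed
  qed
qed

text \<open>Dual to \<open>factor_inj\<close>: naturality and uniqueness are tested on values of
  \<open>q\<close>, and these are all elements.\<close>

lemma factor_surj:
  assumes q: "q \<in> Hom D M Q" and surj: "\<And>v. v \<in> Obj C \<Longrightarrow> img_at q v = carrier (mod_at Q v)"
    and h: "h \<in> Hom D M L"
    and ker: "\<And>v x. v \<in> Obj C \<Longrightarrow> x \<in> ker_at q v \<Longrightarrow> cmp h v x = \<zero>\<^bsub>mod_at L v\<^esub>"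
  shows "\<exists>!u. u \<in> Hom D Q L \<and> Comp D u q = h"
proof -
  have M: "psh_mod M" and Q: "psh_mod Q" and L: "psh_mod L" using Hom_cart[OF q] Hom_cart[OF h] by auto
  have surj': "cmp q v ` carrier (mod_at M v) = carrier (mod_at Q v)" if "v \<in> Obj C" for v
    using surj[OF that] by (simp add: img_at_def Hom_fst[OF q])
  have ex: "\<exists>x \<in> carrier (mod_at M v). y = cmp q v x" if "v \<in> Obj C" "y \<in> carrier (mod_at Q v)" for v y
    using that(2) unfolding surj'[OF that(1), symmetric] by auto
  have "\<exists>u. u \<in> mod_hom (ring_at R v) (mod_at Q v) (mod_at L v) \<and>
      (\<forall>x \<in> carrier (mod_at M v). u (cmp q v x) = cmp h v x)" if v: "v \<in> Obj C" for v
    by (rule mod_hom_factor_surj[OF module_at[OF M v] module_at[OF Q v] module_at[OF L v]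
          cmp_hom[OF q v] surj'[OF v] cmp_hom[OF h v]])
      (use ker[OF v] in \<open>auto simp: ker_at_def Hom_fst[OF q]\<close>)
  then obtain \<eta> where \<eta>: "\<And>v. v \<in> Obj C \<Longrightarrow> \<eta> v \<in> mod_hom (ring_at R v) (mod_at Q v) (mod_at L v)"
    "\<And>v x. v \<in> Obj C \<Longrightarrow> x \<in> carrier (mod_at M v) \<Longrightarrow> \<eta> v (cmp q v x) = cmp h v x"
    by metis
  have "nat_hom Q L \<eta>"
  proof (rule nat_homI)
    fix a y assume a: "a \<in> Arr C" and "y \<in> carrier (mod_at Q (Cod C a))"
    then obtain x where "x \<in> carrier (mod_at M (Cod C a))" "y = cmp q (Cod C a) x" using ex by force
    then show "\<eta> (Dom C a) (mod_res Q a y) = mod_res L a (\<eta> (Cod C a) y)"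
      using a by (simp add: \<eta> cmp_nat[OF h] res_closed[OF M] flip: cmp_nat[OF q])
  qed (use \<eta> in auto)
  then have u: "arrow Q L \<eta> \<in> Hom D Q L" using arrow_Hom Hom_cart[OF q] Hom_cart[OF h] by blast
  show ?thesis
  proof (rule ex1I[of _ "arrow Q L \<eta>"], intro conjI u)
    show "Comp D (arrow Q L \<eta>) q = h"
      by (rule Hom_eqI[OF Comp_in_Hom[OF q u] h]) (simp add: cmp_Comp[OF q] \<eta> cmp_closed[OF q])
    fix u' assume u': "u' \<in> Hom D Q L \<and> Comp D u' q = h"
    then have u'H: "u' \<in> Hom D Q L" by simp
    show "u' = arrow Q L \<eta>"
    proof (rule Hom_eqI[OF u'H u])
      fix v y assume v: "v \<in> Obj C" and y: "y \<in> carrier (mod_at Q v)"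
      then obtain x where x: "x \<in> carrier (mod_at M v)" "y = cmp q v x" using ex by blast
      then show "cmp u' v y = cmp (arrow Q L \<eta>) v y"
        using v y u' cmp_Comp[OF q v x(1), of u'] by (auto simp: \<eta>)
    qed
  qed
qed

end

context flat_presheaf_data
begin

lemma is_kernelI:
  assumes g: "g \<in> Hom D M N" and k: "k \<in> Hom D K M"
    and inj: "\<And>v. v \<in> Obj C \<Longrightarrow> inj_on (cmp k v) (carrier (mod_at K v))"
    and img: "\<And>v. v \<in> Obj C \<Longrightarrow> img_at k v = ker_at g v"
  shows "is_kernel D g k"
  unfolding is_kernel_def
proof (intro conjI ballI impI)
  show "g \<in> Arr D" "k \<in> Arr D" "Cod D k = Dom D g" using g k by (auto simp: Hom_def)
  have "cmp g v (cmp k v x) = \<zero>\<^bsub>mod_at N v\<^esub>" if "v \<in> Obj C" "x \<in> carrier (mod_at K v)" for v x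
  proof -
    have "cmp k v x \<in> img_at k v" using that by (simp add: img_at_def Hom_fst[OF k])
    then show ?thesis using img[OF that(1)] by (simp add: ker_at_def Hom_fst[OF g])
  qed
  then show "zero_arrow D (Comp D g k)"
    unfolding zero_arrow_iff[OF Comp_in_Hom[OF k g]] by (simp add: cmp_Comp[OF k])
  fix h assume h': "h \<in> Arr D" and "Cod D h = Dom D g \<and> zero_arrow D (Comp D g h)"
  then have h: "h \<in> Hom D (Dom D h) M" and zero: "zero_arrow D (Comp D g h)"
    using g by (auto simp: Hom_def)
  show "\<exists>!u. u \<in> Hom D (Dom D h) (Dom D k) \<and> Comp D k u = h"
    unfolding D_simps(2)[of k] Hom_fst(1)[OF k]
  proof (rule factor_inj[OF k inj h])
    fix v x assume v: "v \<in> Obj C" and x: "x \<in> carrier (mod_at (Dom D h) v)"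
    then have "cmp g v (cmp h v x) = \<zero>\<^bsub>mod_at N v\<^esub>"
      using zero unfolding zero_arrow_iff[OF Comp_in_Hom[OF h g]] by (simp add: cmp_Comp[OF h])
    then show "cmp h v x \<in> img_at k v"
      using v x by (simp add: img ker_at_def Hom_fst[OF g] cmp_closed[OF h])
  qed
qed

lemma is_cokernelI:
  assumes f: "f \<in> Hom D L M" and q: "q \<in> Hom D M Q"
    and surj: "\<And>v. v \<in> Obj C \<Longrightarrow> img_at q v = carrier (mod_at Q v)"
    and ker: "\<And>v. v \<in> Obj C \<Longrightarrow> ker_at q v = img_at f v"
  shows "is_cokernel D f q"
  unfolding is_cokernel_def
proof (intro conjI ballI impI)
  show "f \<in> Arr D" "q \<in> Arr D" "Dom D q = Cod D f" using f q by (auto simp: Hom_def)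
  have "cmp q v (cmp f v x) = \<zero>\<^bsub>mod_at Q v\<^esub>" if "v \<in> Obj C" "x \<in> carrier (mod_at L v)" for v x
  proof -
    have "cmp f v x \<in> img_at f v" using that by (simp add: img_at_def Hom_fst[OF f])
    then show ?thesis unfolding ker[OF that(1), symmetric] by (simp add: ker_at_def Hom_fst[OF q])
  qed
  then show "zero_arrow D (Comp D q f)"
    unfolding zero_arrow_iff[OF Comp_in_Hom[OF f q]] by (simp add: cmp_Comp[OF f])
  fix h assume h': "h \<in> Arr D" and "Dom D h = Cod D f \<and> zero_arrow D (Comp D h f)"
  then have h: "h \<in> Hom D M (Cod D h)" and zero: "zero_arrow D (Comp D h f)"
    using f by (auto simp: Hom_def)
  show "\<exists>!u. u \<in> Hom D (Cod D q) (Cod D h) \<and> Comp D u q = h"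
    unfolding D_simps(3)[of q] Hom_fst(2)[OF q]
  proof (rule factor_surj[OF q surj h])
    fix v x assume v: "v \<in> Obj C" and "x \<in> ker_at q v"
    then obtain y where y: "y \<in> carrier (mod_at L v)" "x = cmp f v y"
      by (auto simp: ker img_at_def Hom_fst[OF f])
    then show "cmp h v x = \<zero>\<^bsub>mod_at (Cod D h) v\<^esub>"
      using v zero unfolding zero_arrow_iff[OF Comp_in_Hom[OF f h]] by (simp add: cmp_Comp[OF f])
  qed
qed

text \<open>Flatness reaches the abelian axioms here, through
  \<open>kernel_cartesian\<close>.\<close>

lemma pointwise_kernel:
  assumes g: "g \<in> Hom D M N"
  obtains K k where "k \<in> Hom D K M" "\<And>v. v \<in> Obj C \<Longrightarrow> inj_on (cmp k v) (carrier (mod_at K v))"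
    "\<And>v. v \<in> Obj C \<Longrightarrow> img_at k v = ker_at g v"
proof -
  define K where "K = sub_psh M (\<lambda>v. {x \<in> carrier (mod_at M v). cmp g v x = \<zero>\<^bsub>mod_at N v\<^esub>})"
  have K: "cart_mod K"
    unfolding K_def
    by (rule kernel_cartesian)
      (rule Hom_cart[OF g] | erule cmp_hom[OF g] | erule (1) cmp_nat[OF g])+
  have KM: "carrier (mod_at K v) = ker_at g v" for v
    by (simp add: K_def ker_at_def Hom_fst[OF g])
  have "nat_hom K M (\<lambda>v x. x)"
    by (rule nat_homI) (auto simp: K_def mod_hom_def)
  then have k: "arrow K M (\<lambda>v x. x) \<in> Hom D K M"
    by (rule arrow_Hom[OF K Hom_cart(1)[OF g]])
  show thesis
  proof (rule that[OF k])
    fix v assume v: "v \<in> Obj C"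
    then show "inj_on (cmp (arrow K M (\<lambda>v x. x)) v) (carrier (mod_at K v))"
      by (auto intro!: inj_onI)
    show "img_at (arrow K M (\<lambda>v x. x)) v = ker_at g v"
      using v unfolding img_at_def Hom_fst[OF k] by (simp add: KM[symmetric])
  qed
qed

text \<open>Kernels are unique up to isomorphism, so every categorical kernel inherits the
  objectwise description of the one constructed in \<open>pointwise_kernel\<close>.\<close>

lemma is_kernelD:
  assumes ker: "is_kernel D g k" and g: "g \<in> Hom D M N"
  shows is_kernel_Hom: "k \<in> Hom D (fst k) M"
    and is_kernel_inj: "\<And>v. v \<in> Obj C \<Longrightarrow> inj_on (cmp k v) (carrier (mod_at (fst k) v))"
    and is_kernel_img: "\<And>v. v \<in> Obj C \<Longrightarrow> img_at k v = ker_at g v"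
proof -
  show k: "k \<in> Hom D (fst k) M"
    using ker g unfolding is_kernel_def Hom_def D_simps(2,3) by simp
  obtain K' k' where k': "k' \<in> Hom D K' M" "\<And>v. v \<in> Obj C \<Longrightarrow> inj_on (cmp k' v) (carrier (mod_at K' v))"
    "\<And>v. v \<in> Obj C \<Longrightarrow> img_at k' v = ker_at g v" by (rule pointwise_kernel[OF g]) (rule that)
  have ker': "is_kernel D g k'" by (rule is_kernelI[OF g k'])
  have fac: "\<exists>u. u \<in> Hom D (fst b) (fst a) \<and> Comp D a u = b"
    if "is_kernel D g a" "is_kernel D g b" for a b
  proof -
    have "b \<in> Arr D" "Cod D b = Dom D g" "zero_arrow D (Comp D g b)"
      using that(2) by (auto simp: is_kernel_def)
    then have "\<exists>!u. u \<in> Hom D (Dom D b) (Dom D a) \<and> Comp D a u = b"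
      using that(1) by (simp add: is_kernel_def)
    then show ?thesis by (auto simp: D_simps(2))
  qed
  obtain u where u: "u \<in> Hom D (fst k) K'" "Comp D k' u = k"
    using fac[OF ker' ker] Hom_fst(1)[OF k'(1)] by auto
  obtain u' where u': "u' \<in> Hom D K' (fst k)" "Comp D k u' = k'"
    using fac[OF ker ker'] Hom_fst(1)[OF k'(1)] by auto
  have kc: "cart_mod (fst k)" by (rule Hom_cart(1)[OF k])
  \<comment> \<open>This composite and the identity both factor \<open>k\<close> through itself, so
    they agree. The one-sided inverse makes \<open>u\<close> injective; equality of the images needs
    only the two factorisations.\<close>
  have "Comp D u' u = Ident D (fst k)"
  proof -
    have "\<exists>!w. w \<in> Hom D (Dom D k) (Dom D k) \<and> Comp D k w = k"
      using ker unfolding is_kernel_def by (metis (no_types, lifting))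
    moreover have "Comp D u' u \<in> Hom D (fst k) (fst k)" by (rule Comp_in_Hom[OF u(1) u'(1)])
    moreover have "Comp D k (Comp D u' u) = k"
      using category.Comp_assoc[OF category_D u(1) u'(1) k] u(2) u'(2) by simp
    moreover have "Comp D k (Ident D (fst k)) = k"
      by (rule category.Ident_right[OF category_D k])
    ultimately show ?thesis using Ident_in_Hom[OF kc] unfolding D_simps(2) by metis
  qed
  then have u'u: "cmp u' v (cmp u v x) = x" if "v \<in> Obj C" "x \<in> carrier (mod_at (fst k) v)" for v x
    using cmp_Comp[OF u(1) that, of u'] cmp_Ident[OF that] by simp
  fix v assume v: "v \<in> Obj C"
  have k_eq: "cmp k v x = cmp k' v (cmp u v x)" if "x \<in> carrier (mod_at (fst k) v)" for x
    using cmp_Comp[OF u(1) v that, of k'] u(2) by simp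
  have k'_eq: "cmp k' v x = cmp k v (cmp u' v x)" if "x \<in> carrier (mod_at K' v)" for x
    using cmp_Comp[OF u'(1) v that, of k] u'(2) by simp
  show "inj_on (cmp k v) (carrier (mod_at (fst k) v))"
  proof (rule inj_onI)
    fix x y assume xy: "x \<in> carrier (mod_at (fst k) v)" "y \<in> carrier (mod_at (fst k) v)" "cmp k v x = cmp k v y"
    then have "cmp u v x = cmp u v y"
      using inj_onD[OF k'(2)[OF v]] by (simp add: k_eq cmp_closed[OF u(1) v])
    then show "x = y" using u'u[OF v] xy by metis
  qed
  have "img_at k v = img_at k' v"
    unfolding img_at_def Hom_fst[OF k'(1)]
  proof safe
    fix x assume "x \<in> carrier (mod_at (fst k) v)"
    then show "cmp k v x \<in> cmp k' v ` carrier (mod_at K' v)"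
      by (simp add: k_eq cmp_closed[OF u(1) v])
  next
    fix x assume "x \<in> carrier (mod_at K' v)"
    then show "cmp k' v x \<in> cmp k v ` carrier (mod_at (fst k) v)"
      by (simp add: k'_eq cmp_closed[OF u'(1) v])
  qed
  then show "img_at k v = ker_at g v" using k'(3)[OF v] by simp
qed

section \<open>Colimits\<close>

text \<open>The elements of \<open>S\<close> may have any type, later that of families, while those
  of \<open>L\<close> lie in \<open>'u\<close>. The quotients are chosen object by object without
  any relation between the choices; surjectivity of the projections then forces the restriction maps
  and their functoriality.\<close>

lemma presheaf_quotient:
  fixes S :: "('o, 'a, 'r, 'm) mod_psh"
  assumes S: "presheaf_module C R S" and small: "\<And>v. v \<in> Obj C \<Longrightarrow> small \<kappa> (carrier (mod_at S v))"
    and Z: "\<And>v. v \<in> Obj C \<Longrightarrow> submodule (Z v) (ring_at R v) (mod_at S v)"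
    and res: "\<And>a \<xi>. a \<in> Arr C \<Longrightarrow> \<xi> \<in> Z (Cod C a) \<Longrightarrow> mod_res S a \<xi> \<in> Z (Dom C a)"
  obtains L q where "psh_mod L"
    "\<And>v. v \<in> Obj C \<Longrightarrow> q v \<in> mod_hom (ring_at R v) (mod_at S v) (mod_at L v)"
    "\<And>v. v \<in> Obj C \<Longrightarrow> q v ` carrier (mod_at S v) = carrier (mod_at L v)"
    "\<And>v \<xi>. v \<in> Obj C \<Longrightarrow> \<xi> \<in> carrier (mod_at S v) \<Longrightarrow> q v \<xi> = \<zero>\<^bsub>mod_at L v\<^esub> \<longleftrightarrow> \<xi> \<in> Z v"
    "\<And>a \<xi>. a \<in> Arr C \<Longrightarrow> \<xi> \<in> carrier (mod_at S (Cod C a)) \<Longrightarrow>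
      q (Dom C a) (mod_res S a \<xi>) = mod_res L a (q (Cod C a) \<xi>)"
proof -
  have mS: "module (ring_at R v) (mod_at S v)" if "v \<in> Obj C" for v
    using S that by (simp add: presheaf_module_def)
  have rS: "mod_res S a \<in> mod_hom (ring_at R (Cod C a)) (mod_at S (Cod C a))
      (restrict_scalars (ring_res R a) (mod_at S (Dom C a)))" if "a \<in> Arr C" for a
    using S that by (simp add: presheaf_module_def)
  have rS_cl: "mod_res S a x \<in> carrier (mod_at S (Dom C a))"
    if "a \<in> Arr C" "x \<in> carrier (mod_at S (Cod C a))" for a x
    using mod_hom_closed[OF rS[OF that(1)] that(2)] by simp
  \<comment> \<open>Module and projection are packed into a pair so that one application of choice
    over the objects selects both.\<close>
  define quot where "quot v p \<longleftrightarrow> module (ring_at R v) (fst p) \<and> small \<kappa> (carrier (fst p)) \<and>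
      snd p \<in> mod_hom (ring_at R v) (mod_at S v) (fst p) \<and> snd p ` carrier (mod_at S v) = carrier (fst p) \<and>
      (\<forall>\<xi> \<in> carrier (mod_at S v). snd p \<xi> = \<zero>\<^bsub>fst p\<^esub> \<longleftrightarrow> \<xi> \<in> Z v)"
    for v and p :: "('r, 'u) module \<times> ('m \<Rightarrow> 'u)"
  have "\<forall>v \<in> Obj C. \<exists>p. quot v p"
  proof
    fix v assume v: "v \<in> Obj C"
    obtain Q :: "('r, 'u) module" and q where "module (ring_at R v) Q" "small \<kappa> (carrier Q)"
      "q \<in> mod_hom (ring_at R v) (mod_at S v) Q" "q ` carrier (mod_at S v) = carrier Q"
      "\<And>x. x \<in> carrier (mod_at S v) \<Longrightarrow> q x = \<zero>\<^bsub>Q\<^esub> \<longleftrightarrow> x \<in> Z v"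
      by (rule quotient_module_exists[OF mS[OF v] Z[OF v] small[OF v] Card_order]) blast
    then have "quot v (Q, q)" by (simp add: quot_def)
    then show "\<exists>p. quot v p" ..
  qed
  then obtain p where p: "\<forall>v \<in> Obj C. quot v (p v)" by (rule bchoice[THEN exE])
  define Q where "Q v = fst (p v)" for v
  define q where "q v = snd (p v)" for v
  have Q: "module (ring_at R v) (Q v)" "small \<kappa> (carrier (Q v))"
    and q: "q v \<in> mod_hom (ring_at R v) (mod_at S v) (Q v)" "q v ` carrier (mod_at S v) = carrier (Q v)"
    and qz: "\<And>\<xi>. \<xi> \<in> carrier (mod_at S v) \<Longrightarrow> q v \<xi> = \<zero>\<^bsub>Q v\<^esub> \<longleftrightarrow> \<xi> \<in> Z v" if "v \<in> Obj C" for v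
    using p that by (auto simp: Q_def q_def quot_def)
  have ex: "\<exists>\<xi> \<in> carrier (mod_at S v). y = q v \<xi>" if "v \<in> Obj C" "y \<in> carrier (Q v)" for v y
    using that(2) unfolding q(2)[OF that(1), symmetric] by auto
  have "\<forall>a \<in> Arr C. \<exists>\<rho>.
      \<rho> \<in> mod_hom (ring_at R (Cod C a)) (Q (Cod C a)) (restrict_scalars (ring_res R a) (Q (Dom C a))) \<and>
      (\<forall>\<xi> \<in> carrier (mod_at S (Cod C a)). \<rho> (q (Cod C a) \<xi>) = q (Dom C a) (mod_res S a \<xi>))"
  proof
    fix a assume a: "a \<in> Arr C"
    have v: "Dom C a \<in> Obj C" and w: "Cod C a \<in> Obj C" using a by auto
    have rQ: "module (ring_at R (Cod C a)) (restrict_scalars (ring_res R a) (Q (Dom C a)))"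
      by (rule module_restrict_scalars[OF cring_at[OF w] ring_res_hom[OF a] Q(1)[OF v]])
    have "(\<lambda>\<xi>. q (Dom C a) (mod_res S a \<xi>)) \<in> mod_hom (ring_at R (Cod C a)) (mod_at S (Cod C a))
        (restrict_scalars (ring_res R a) (Q (Dom C a)))"
      using q(1)[OF v] ring_hom_closed[OF ring_res_hom[OF a]]
      by (intro mod_hom_comp[OF rS[OF a]]) (auto simp: mod_hom_def)
    then show "\<exists>\<rho>.
      \<rho> \<in> mod_hom (ring_at R (Cod C a)) (Q (Cod C a)) (restrict_scalars (ring_res R a) (Q (Dom C a))) \<and>
      (\<forall>\<xi> \<in> carrier (mod_at S (Cod C a)). \<rho> (q (Cod C a) \<xi>) = q (Dom C a) (mod_res S a \<xi>))"
    proof (rule mod_hom_factor_surj[OF mS[OF w] Q(1)[OF w] rQ q(1)[OF w] q(2)[OF w]])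
      fix x assume "x \<in> carrier (mod_at S (Cod C a))" "q (Cod C a) x = \<zero>\<^bsub>Q (Cod C a)\<^esub>"
      then show "q (Dom C a) (mod_res S a x) = \<zero>\<^bsub>restrict_scalars (ring_res R a) (Q (Dom C a))\<^esub>"
        using a qz[OF v, of "mod_res S a x"] qz[OF w, of x] res[OF a, of x] by (simp add: rS_cl)
    qed blast
  qed
  from bchoice[OF this] obtain \<rho> where \<rho>: "\<And>a. a \<in> Arr C \<Longrightarrow>
      \<rho> a \<in> mod_hom (ring_at R (Cod C a)) (Q (Cod C a)) (restrict_scalars (ring_res R a) (Q (Dom C a)))"
    "\<And>a \<xi>. a \<in> Arr C \<Longrightarrow> \<xi> \<in> carrier (mod_at S (Cod C a)) \<Longrightarrow>
      \<rho> a (q (Cod C a) \<xi>) = q (Dom C a) (mod_res S a \<xi>)"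
    by blast
  define L where "L = \<lparr>mod_at = Q, mod_res = \<rho>\<rparr>"
  have L: "psh_mod L"
  proof (rule psh_modI)
    fix v x assume v: "v \<in> Obj C" and "x \<in> carrier (mod_at L v)"
    then obtain \<xi> where \<xi>: "\<xi> \<in> carrier (mod_at S v)" "x = q v \<xi>" using ex by (auto simp: L_def)
    have "Ident C v \<in> Arr C" "Dom C (Ident C v) = v" "Cod C (Ident C v) = v"
      using C.Ident_Hom[OF v] by (auto simp: Hom_def)
    moreover have "mod_res S (Ident C v) \<xi> = \<xi>" using S v \<xi> by (simp add: presheaf_module_def)
    ultimately show "mod_res L (Ident C v) x = x"
      using \<rho>(2)[of "Ident C v" \<xi>] \<xi> by (simp add: L_def)
  next
    fix a b x assume a: "a \<in> Arr C" and b: "b \<in> Arr C" and ab: "Cod C a = Dom C b"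
      and "x \<in> carrier (mod_at L (Cod C b))"
    then obtain \<xi> where \<xi>: "\<xi> \<in> carrier (mod_at S (Cod C b))" "x = q (Cod C b) \<xi>"
      using ex[of "Cod C b" x] by (auto simp: L_def)
    have c: "Comp C b a \<in> Arr C" "Dom C (Comp C b a) = Dom C a" "Cod C (Comp C b a) = Cod C b"
      using C.Comp_Hom[of a "Dom C a" "Dom C b" b "Cod C b"] a b ab by (auto simp: Hom_def)
    have "mod_res S (Comp C b a) \<xi> = mod_res S a (mod_res S b \<xi>)"
      using S a b ab \<xi>(1) by (simp add: presheaf_module_def)
    then show "mod_res L (Comp C b a) x = mod_res L a (mod_res L b x)"
      using \<rho>(2)[OF c(1), of \<xi>] \<rho>(2)[OF b \<xi>(1)] \<rho>(2)[OF a, of "mod_res S b \<xi>"] rS_cl[OF b \<xi>(1)] \<xi> ab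
      by (simp add: c L_def)
  qed (simp_all add: L_def Q \<rho>(1))
  show thesis
    by (rule that[OF L, of q]) (simp_all add: L_def q qz \<rho>(2))
qed

section \<open>Colimits as quotients of direct sums\<close>

definition dsum_psh :: "'i set \<Rightarrow> ('i \<Rightarrow> ('o, 'a, 'r, 'u) mod_psh) \<Rightarrow> ('o, 'a, 'r, 'i \<Rightarrow> 'u) mod_psh" where
  "dsum_psh I X = \<lparr>mod_at = (\<lambda>v. dsum I (\<lambda>i. mod_at (X i) v)),
    mod_res = (\<lambda>a \<xi>. \<lambda>i\<in>I. mod_res (X i) a (\<xi> i))\<rparr>"

abbreviation "dsum_at I X v \<equiv> dsum I (\<lambda>i. mod_at (X i) v)"
abbreviation "dsum_in_at I X v \<equiv> dsum_in I (\<lambda>i. mod_at (X i) v)"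
abbreviation "dsum_lift_at I X v \<equiv> dsum_lift I (\<lambda>i. mod_at (X i) v)"

lemma module_family_at:
  assumes "\<And>i. i \<in> I \<Longrightarrow> psh_mod (X i)" "v \<in> Obj C"
  shows "module_family (ring_at R v) I (\<lambda>i. mod_at (X i) v)"
  using assms by (intro module_family.intro cring_at module_at)

lemma
  assumes X: "\<And>i. i \<in> I \<Longrightarrow> psh_mod (X i)"
  shows presheaf_dsum: "presheaf_module C R (dsum_psh I X)"
    and dsum_res_in: "\<And>a i x. a \<in> Arr C \<Longrightarrow> i \<in> I \<Longrightarrow> x \<in> carrier (mod_at (X i) (Cod C a)) \<Longrightarrow>
      (\<lambda>k\<in>I. mod_res (X k) a (dsum_in_at I X (Cod C a) i x k)) = dsum_in_at I X (Dom C a) i (mod_res (X i) a x)"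
proof -
  show "presheaf_module C R (dsum_psh I X)"
    unfolding presheaf_module_def
  proof (intro conjI ballI impI)
    fix v assume v: "v \<in> Obj C"
    interpret module_family "ring_at R v" I "\<lambda>i. mod_at (X i) v" by (rule module_family_at[OF X v])
    show "module (ring_at R v) (mod_at (dsum_psh I X) v)" by (simp add: dsum_psh_def module_dsum)
    fix \<xi> assume \<xi>: "\<xi> \<in> carrier (mod_at (dsum_psh I X) v)"
    have "(\<lambda>i\<in>I. mod_res (X i) (Ident C v) (\<xi> i)) = (\<lambda>i\<in>I. \<xi> i)"
      by (rule restrict_ext) (use \<xi> in \<open>simp add: dsum_psh_def res_Ident[OF X v] dsum_comp\<close>)
    also have "\<dots> = \<xi>" 
      by (rule PiE_restrict[of _ _ "\<lambda>i. carrier (mod_at (X i) v)"]) (use \<xi> in \<open>simp add: dsum_psh_def dsum_simps(1)\<close>)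
    finally show "mod_res (dsum_psh I X) (Ident C v) \<xi> = \<xi>" by (simp add: dsum_psh_def)
  next
    fix a assume a: "a \<in> Arr C"
    interpret V: module_family "ring_at R (Dom C a)" I "\<lambda>i. mod_at (X i) (Dom C a)"
      by (rule module_family_at[OF X]) (use a in auto)
    interpret W: module_family "ring_at R (Cod C a)" I "\<lambda>i. mod_at (X i) (Cod C a)"
      by (rule module_family_at[OF X]) (use a in auto)
    have cl: "(\<lambda>i\<in>I. mod_res (X i) a (\<xi> i)) \<in> carrier V.S" if \<xi>: "\<xi> \<in> carrier W.S" for \<xi>
      by (rule V.dsum_memI[OF _ W.dsum_finite[OF \<xi>]])
        (use \<xi> a in \<open>auto simp: W.dsum_comp res_closed[OF X] res_zero[OF X]\<close>)
    have "(\<lambda>\<xi>. \<lambda>i\<in>I. mod_res (X i) a (\<xi> i)) \<in> mod_hom (ring_at R (Cod C a)) W.S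
      (restrict_scalars (ring_res R a) V.S)"
      by (rule mod_homI)
        (auto simp: cl dsum_simps(3,4) res_add[OF X a] res_smult[OF X a] W.dsum_comp intro!: restrict_ext)
    then show "mod_res (dsum_psh I X) a \<in> mod_hom (ring_at R (Cod C a)) (mod_at (dsum_psh I X) (Cod C a))
        (restrict_scalars (ring_res R a) (mod_at (dsum_psh I X) (Dom C a)))"
      by (simp add: dsum_psh_def)
  next
    fix a b \<xi> assume a: "a \<in> Arr C" and b: "b \<in> Arr C" and ab: "Cod C a = Dom C b"
      and \<xi>: "\<xi> \<in> carrier (mod_at (dsum_psh I X) (Cod C b))"
    interpret W: module_family "ring_at R (Cod C b)" I "\<lambda>i. mod_at (X i) (Cod C b)"
      by (rule module_family_at[OF X]) (use b in auto)
    show "mod_res (dsum_psh I X) (Comp C b a) \<xi> = mod_res (dsum_psh I X) a (mod_res (dsum_psh I X) b \<xi>)"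
      using \<xi> by (auto simp: dsum_psh_def res_Comp[OF X a b ab] W.dsum_comp intro!: restrict_ext)
  qed
  fix a i x assume "a \<in> Arr C" "i \<in> I" "x \<in> carrier (mod_at (X i) (Cod C a))"
  then show "(\<lambda>k\<in>I. mod_res (X k) a (dsum_in_at I X (Cod C a) i x k)) = dsum_in_at I X (Dom C a) i (mod_res (X i) a x)"
    by (auto simp: dsum_in_def res_zero[OF X] intro!: restrict_ext)
qed

lemma dsum_res_hom:
  assumes "\<And>i. i \<in> I \<Longrightarrow> psh_mod (X i)" and a: "a \<in> Arr C"
  shows "(\<lambda>\<xi>. \<lambda>i\<in>I. mod_res (X i) a (\<xi> i)) \<in> mod_hom (ring_at R (Cod C a)) (dsum_at I X (Cod C a))
    (restrict_scalars (ring_res R a) (dsum_at I X (Dom C a)))"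
proof -
  have "presheaf_module C R (dsum_psh I X)" by (rule presheaf_dsum[OF assms(1)])
  then have "\<forall>a\<in>Arr C. mod_res (dsum_psh I X) a \<in> mod_hom (ring_at R (Cod C a)) (mod_at (dsum_psh I X) (Cod C a))
      (restrict_scalars (ring_res R a) (mod_at (dsum_psh I X) (Dom C a)))"
    unfolding presheaf_module_def by (elim conjE)
  from this[rule_format, OF a] show ?thesis by (simp add: dsum_psh_def)
qed

text \<open>
  The last hypothesis says that \<open>Z\<close> is spanned by restrictions, in the form that can be checked with
  the universal property of the cartesian modules \<open>X i\<close>.
\<close>

lemma colimit_exists:
  fixes X :: "'i \<Rightarrow> ('o, 'a, 'r, 'u) mod_psh"
  assumes I: "small \<kappa> I" and X: "\<And>i. i \<in> I \<Longrightarrow> cart_mod (X i)"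
    and Z: "\<And>v. v \<in> Obj C \<Longrightarrow> submodule (Z v) (ring_at R v) (dsum_at I X v)"
    and res: "\<And>a \<xi>. a \<in> Arr C \<Longrightarrow> \<xi> \<in> Z (Cod C a) \<Longrightarrow> (\<lambda>i\<in>I. mod_res (X i) a (\<xi> i)) \<in> Z (Dom C a)"
    and span: "\<And>a (P :: ('r, 'u) module) h \<xi>. a \<in> Arr C \<Longrightarrow> module (ring_at R (Dom C a)) P \<Longrightarrow>
      (\<And>i. i \<in> I \<Longrightarrow> h i \<in> mod_hom (ring_at R (Dom C a)) (mod_at (X i) (Dom C a)) P) \<Longrightarrow>
      (\<And>\<xi>. \<xi> \<in> Z (Cod C a) \<Longrightarrow>
        dsum_lift_at I X (Dom C a) P h (\<lambda>i\<in>I. mod_res (X i) a (\<xi> i)) = \<zero>\<^bsub>P\<^esub>) \<Longrightarrow>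
      \<xi> \<in> Z (Dom C a) \<Longrightarrow> dsum_lift_at I X (Dom C a) P h \<xi> = \<zero>\<^bsub>P\<^esub>"
  obtains L \<iota> where "cart_mod L" "\<And>i. i \<in> I \<Longrightarrow> \<iota> i \<in> Hom D (X i) L"
    "\<And>v. v \<in> Obj C \<Longrightarrow>
      dsum_lift_at I X v (mod_at L v) (\<lambda>i. cmp (\<iota> i) v) ` carrier (dsum_at I X v) = carrier (mod_at L v)"
    "\<And>v \<xi>. v \<in> Obj C \<Longrightarrow> \<xi> \<in> carrier (dsum_at I X v) \<Longrightarrow>
      dsum_lift_at I X v (mod_at L v) (\<lambda>i. cmp (\<iota> i) v) \<xi> = \<zero>\<^bsub>mod_at L v\<^esub> \<longleftrightarrow> \<xi> \<in> Z v"
proof -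
  have X': "psh_mod (X i)" if "i \<in> I" for i using X[OF that] by simp
  have S: "mod_at (dsum_psh I X) v = dsum_at I X v" "mod_res (dsum_psh I X) = (\<lambda>a \<xi>. \<lambda>i\<in>I. mod_res (X i) a (\<xi> i))" for v
    by (simp_all add: dsum_psh_def)
  have fam: "module_family (ring_at R v) I (\<lambda>i. mod_at (X i) v)" if "v \<in> Obj C" for v
    by (rule module_family_at[OF X' that])
  have small: "small \<kappa> (carrier (mod_at (dsum_psh I X) v))" if v: "v \<in> Obj C" for v
    unfolding S by (rule module_family.small_dsum[OF fam[OF v] univ small_nat I small_at[OF X' v]])
  obtain L q where L: "psh_mod L"
    and q: "\<And>v. v \<in> Obj C \<Longrightarrow> q v \<in> mod_hom (ring_at R v) (dsum_at I X v) (mod_at L v)"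
      "\<And>v. v \<in> Obj C \<Longrightarrow> q v ` carrier (dsum_at I X v) = carrier (mod_at L v)"
      "\<And>v \<xi>. v \<in> Obj C \<Longrightarrow> \<xi> \<in> carrier (dsum_at I X v) \<Longrightarrow> q v \<xi> = \<zero>\<^bsub>mod_at L v\<^esub> \<longleftrightarrow> \<xi> \<in> Z v"
    and qnat: "\<And>a \<xi>. a \<in> Arr C \<Longrightarrow> \<xi> \<in> carrier (dsum_at I X (Cod C a)) \<Longrightarrow>
      q (Dom C a) (\<lambda>i\<in>I. mod_res (X i) a (\<xi> i)) = mod_res L a (q (Cod C a) \<xi>)"
    by (rule presheaf_quotient[OF presheaf_dsum[OF X'] small, of Z, unfolded S])
      (assumption | erule Z | erule (1) res | rule that)+
  have mL: "module (ring_at R v) (mod_at L v)" if "v \<in> Obj C" for v by (rule module_at[OF L that])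
  define \<eta> where "\<eta> i v x = q v (dsum_in_at I X v i x)" for i v x
  have \<eta>_hom: "\<eta> i v \<in> mod_hom (ring_at R v) (mod_at (X i) v) (mod_at L v)" if "i \<in> I" "v \<in> Obj C" for i v
    unfolding \<eta>_def by (rule mod_hom_comp[OF module_family.dsum_in_hom[OF fam[OF that(2)] that(1)] q(1)[OF that(2)]])
  have \<eta>_nat: "\<eta> i (Dom C a) (mod_res (X i) a x) = mod_res L a (\<eta> i (Cod C a) x)"
    if "i \<in> I" "a \<in> Arr C" "x \<in> carrier (mod_at (X i) (Cod C a))" for i a x
    using that qnat[OF that(2) module_family.dsum_in_closed[OF fam, of "Cod C a" i x]]
    by (simp add: \<eta>_def dsum_res_in[OF X'])
  have lift_q: "dsum_lift_at I X v (mod_at L v) (\<lambda>i. \<eta> i v) \<xi> = q v \<xi>"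
    if v: "v \<in> Obj C" and \<xi>: "\<xi> \<in> carrier (dsum_at I X v)" for v \<xi>
  proof -
    interpret module_family "ring_at R v" I "\<lambda>i. mod_at (X i) v" by (rule fam[OF v])
    show ?thesis
      by (rule dsum_hom_eqI[OF \<xi> mL[OF v] dsum_lift_hom[OF mL[OF v]] q(1)[OF v]])
        (simp_all add: \<eta>_hom v dsum_lift_in[OF mL[OF v]], simp add: \<eta>_def)
  qed
  have "cartesian C R L"
  proof (rule cartesianI[OF L])
    fix a and P :: "('r, 'u) module" and g
    assume a: "a \<in> Arr C" and P: "module (ring_at R (Dom C a)) P"
      and g: "g \<in> mod_hom (ring_at R (Cod C a)) (mod_at L (Cod C a)) (restrict_scalars (ring_res R a) P)"
    have v: "Dom C a \<in> Obj C" and w: "Cod C a \<in> Obj C" using a by auto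
    interpret V: module_family "ring_at R (Dom C a)" I "\<lambda>i. mod_at (X i) (Dom C a)" by (rule fam[OF v])
    interpret W: module_family "ring_at R (Cod C a)" I "\<lambda>i. mod_at (X i) (Cod C a)" by (rule fam[OF w])
    have rP: "module (ring_at R (Cod C a)) (restrict_scalars (ring_res R a) P)"
      by (rule module_restrict_scalars[OF cring_at[OF w] ring_res_hom[OF a] P])
    \<comment> \<open>Each \<open>X i\<close> is cartesian, so the part of \<open>g\<close> that
      comes from \<open>X i\<close> extends over the domain of \<open>a\<close>; together the
      extensions define \<open>?h\<close> on the direct sum.\<close>
    have "\<forall>i \<in> I. \<exists>h. h \<in> mod_hom (ring_at R (Dom C a)) (mod_at (X i) (Dom C a)) P \<and>
        (\<forall>m \<in> carrier (mod_at (X i) (Cod C a)). h (mod_res (X i) a m) = g (\<eta> i (Cod C a) m))"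
    proof
      fix i assume i: "i \<in> I"
      show "\<exists>h. h \<in> mod_hom (ring_at R (Dom C a)) (mod_at (X i) (Dom C a)) P \<and>
        (\<forall>m \<in> carrier (mod_at (X i) (Cod C a)). h (mod_res (X i) a m) = g (\<eta> i (Cod C a) m))"
        using cartesian_extension_exists[OF X[OF i] a P mod_hom_comp[OF \<eta>_hom[OF i w] g]] unfolding Bex_def .
    qed
    from bchoice[OF this] obtain h where h: "\<And>i. i \<in> I \<Longrightarrow> h i \<in> mod_hom (ring_at R (Dom C a)) (mod_at (X i) (Dom C a)) P"
      and hg: "\<And>i m. i \<in> I \<Longrightarrow> m \<in> carrier (mod_at (X i) (Cod C a)) \<Longrightarrow>
        h i (mod_res (X i) a m) = g (\<eta> i (Cod C a) m)" by blast
    let ?h = "dsum_lift_at I X (Dom C a) P h"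
    have hh: "?h \<in> mod_hom (ring_at R (Dom C a)) V.S P" by (rule V.dsum_lift_hom[OF P h])
    note rS = dsum_res_hom[OF X' a]
    note hhA = mod_hom_restrict_scalars[OF ring_res_hom[OF a] hh]
    have key: "?h (\<lambda>i\<in>I. mod_res (X i) a (\<xi> i)) = g (q (Cod C a) \<xi>)" if \<xi>: "\<xi> \<in> carrier W.S" for \<xi>
    proof (rule W.dsum_hom_eqI[OF \<xi> rP mod_hom_comp[OF rS hhA] mod_hom_comp[OF q(1)[OF w] g]])
      fix i x assume ix: "i \<in> I" "x \<in> carrier (mod_at (X i) (Cod C a))"
      show "?h (\<lambda>k\<in>I. mod_res (X k) a (dsum_in_at I X (Cod C a) i x k)) = g (q (Cod C a) (dsum_in_at I X (Cod C a) i x))"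
        using ix a hg[OF ix]
        by (simp add: dsum_res_in[OF X'] V.dsum_lift_in[OF P h] res_closed[OF X'] \<eta>_def)
    qed
    \<comment> \<open>By \<open>span\<close> it is enough to treat restrictions of elements of
      \<open>Z (Cod C a)\<close>; there \<open>?h\<close> equals \<open>g\<close> after the quotient
      map, by \<open>key\<close>.\<close>
    have kill: "?h \<xi> = \<zero>\<^bsub>P\<^esub>" if "\<xi> \<in> Z (Dom C a)" for \<xi>
    proof (rule span[OF a P h _ that])
      fix \<zeta> assume "\<zeta> \<in> Z (Cod C a)"
      then have \<zeta>: "\<zeta> \<in> carrier W.S" "q (Cod C a) \<zeta> = \<zero>\<^bsub>mod_at L (Cod C a)\<^esub>"
        using module.submoduleE(1)[OF W.module_dsum Z[OF w]] q(3)[OF w] by auto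
      then show "?h (\<lambda>i\<in>I. mod_res (X i) a (\<zeta> i)) = \<zero>\<^bsub>P\<^esub>"
        using key[OF \<zeta>(1)] mod_hom_zero[OF mL[OF w] rP g] by simp
    qed
    obtain u where u: "u \<in> mod_hom (ring_at R (Dom C a)) (mod_at L (Dom C a)) P"
      "\<And>\<xi>. \<xi> \<in> carrier V.S \<Longrightarrow> u (q (Dom C a) \<xi>) = ?h \<xi>"
      by (rule mod_hom_factor_surj[OF V.module_dsum mL[OF v] P q(1)[OF v] q(2)[OF v] hh])
        (use kill q(3)[OF v] in auto)
    show "\<exists>h\<in>mod_hom (ring_at R (Dom C a)) (mod_at L (Dom C a)) P.
        \<forall>m\<in>carrier (mod_at L (Cod C a)). h (mod_res L a m) = g m"
    proof (intro bexI[OF _ u(1)] ballI)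
      fix m assume "m \<in> carrier (mod_at L (Cod C a))"
      then obtain \<xi> where \<xi>: "\<xi> \<in> carrier W.S" "m = q (Cod C a) \<xi>"
        unfolding q(2)[OF w, symmetric] by auto
      have "(\<lambda>i\<in>I. mod_res (X i) a (\<xi> i)) \<in> carrier V.S" using mod_hom_closed[OF rS \<xi>(1)] by simp
      then show "u (mod_res L a m) = g m"
        using \<xi> key[OF \<xi>(1)] u(2) by (simp flip: qnat[OF a \<xi>(1)])
    qed
  next
    fix a h n assume a: "a \<in> Arr C"
      and h: "h \<in> mod_hom (ring_at R (Dom C a)) (mod_at L (Dom C a)) (mod_at L (Dom C a))"
      and hr: "\<And>m. m \<in> carrier (mod_at L (Cod C a)) \<Longrightarrow> h (mod_res L a m) = mod_res L a m"
      and n: "n \<in> carrier (mod_at L (Dom C a))"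
    have v: "Dom C a \<in> Obj C" and w: "Cod C a \<in> Obj C" using a by auto
    interpret V: module_family "ring_at R (Dom C a)" I "\<lambda>i. mod_at (X i) (Dom C a)" by (rule fam[OF v])
    obtain \<xi> where \<xi>: "\<xi> \<in> carrier V.S" "n = q (Dom C a) \<xi>"
      using n unfolding q(2)[OF v, symmetric] by auto
    \<comment> \<open>\<open>h\<close> is compared with the identity on each summand, and there only
      on restrictions, where \<open>hr\<close> applies.\<close>
    have "h (q (Dom C a) \<xi>) = q (Dom C a) \<xi>"
    proof (rule V.dsum_hom_eqI[OF \<xi>(1) mL[OF v] mod_hom_comp[OF q(1)[OF v] h] q(1)[OF v]])
      fix i x assume i: "i \<in> I" and x: "x \<in> carrier (mod_at (X i) (Dom C a))"
      have "h (\<eta> i (Dom C a) x) = \<eta> i (Dom C a) x"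
      proof (rule cartesian_extension_unique[OF X[OF i] a mod_hom_comp[OF \<eta>_hom[OF i v] h] \<eta>_hom[OF i v] _ x])
        fix m assume m: "m \<in> carrier (mod_at (X i) (Cod C a))"
        then show "h (\<eta> i (Dom C a) (mod_res (X i) a m)) = \<eta> i (Dom C a) (mod_res (X i) a m)"
          using hr mod_hom_closed[OF \<eta>_hom[OF i w] m] by (simp add: \<eta>_nat[OF i a])
      qed
      then show "h (q (Dom C a) (dsum_in_at I X (Dom C a) i x)) = q (Dom C a) (dsum_in_at I X (Dom C a) i x)"
        by (simp add: \<eta>_def)
    qed
    then show "h n = n" using \<xi>(2) by simp
  qed
  then have Lc: "cart_mod L" using L by simp
  define \<iota> where "\<iota> i = arrow (X i) L (\<eta> i)" for i
  have \<iota>: "\<iota> i \<in> Hom D (X i) L" if "i \<in> I" for i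
    unfolding \<iota>_def by (rule arrow_Hom[OF X[OF that] Lc])
      (rule nat_homI, simp_all add: \<eta>_hom \<eta>_nat that)
  have lift: "dsum_lift_at I X v (mod_at L v) (\<lambda>i. cmp (\<iota> i) v) \<xi> = q v \<xi>"
    if v: "v \<in> Obj C" and \<xi>: "\<xi> \<in> carrier (dsum_at I X v)" for v \<xi>
  proof -
    interpret module_family "ring_at R v" I "\<lambda>i. mod_at (X i) v" by (rule fam[OF v])
    show ?thesis
      by (rule dsum_hom_eqI[OF \<xi> mL[OF v] dsum_lift_hom[OF mL[OF v]] q(1)[OF v]])
        (simp_all add: v cmp_hom[OF \<iota>] dsum_lift_in[OF mL[OF v]], simp add: \<iota>_def \<eta>_def v)
  qed
  show thesis
  proof (rule that[OF Lc \<iota>])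
    fix v assume v: "v \<in> Obj C"
    show "dsum_lift_at I X v (mod_at L v) (\<lambda>i. cmp (\<iota> i) v) ` carrier (dsum_at I X v) = carrier (mod_at L v)"
      unfolding q(2)[OF v, symmetric] by (rule image_cong[OF refl lift[OF v]])
    fix \<xi> assume "\<xi> \<in> carrier (dsum_at I X v)"
    then show "dsum_lift_at I X v (mod_at L v) (\<lambda>i. cmp (\<iota> i) v) \<xi> = \<zero>\<^bsub>mod_at L v\<^esub> \<longleftrightarrow> \<xi> \<in> Z v"
      using q(3) v lift by simp
  qed
qed

text \<open>Common to coproducts and direct limits: \<open>L\<close> is generated by the images of
  the \<open>X i\<close>, and \<open>kill\<close> says that the map given by the \<open>f i\<close>
  on the direct sum respects the relations of \<open>L\<close>.\<close>

lemma colimit_universal: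
  fixes X :: "'i \<Rightarrow> ('o, 'a, 'r, 'u) mod_psh"
  assumes X: "\<And>i. i \<in> I \<Longrightarrow> cart_mod (X i)" and L: "cart_mod L"
    and \<iota>: "\<And>i. i \<in> I \<Longrightarrow> \<iota> i \<in> Hom D (X i) L"
    and surj: "\<And>v. v \<in> Obj C \<Longrightarrow>
      dsum_lift_at I X v (mod_at L v) (\<lambda>i. cmp (\<iota> i) v) ` carrier (dsum_at I X v) = carrier (mod_at L v)"
    and Y: "cart_mod Y" and f: "\<And>i. i \<in> I \<Longrightarrow> f i \<in> Hom D (X i) Y"
    and kill: "\<And>v \<xi>. v \<in> Obj C \<Longrightarrow> \<xi> \<in> carrier (dsum_at I X v) \<Longrightarrow>
      dsum_lift_at I X v (mod_at L v) (\<lambda>i. cmp (\<iota> i) v) \<xi> = \<zero>\<^bsub>mod_at L v\<^esub> \<Longrightarrow>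
      dsum_lift_at I X v (mod_at Y v) (\<lambda>i. cmp (f i) v) \<xi> = \<zero>\<^bsub>mod_at Y v\<^esub>"
  shows "\<exists>!u. u \<in> Hom D L Y \<and> (\<forall>i \<in> I. Comp D u (\<iota> i) = f i)"
proof -
  have X': "psh_mod (X i)" if "i \<in> I" for i using X[OF that] by simp
  have L': "psh_mod L" and Y': "psh_mod Y" using L Y by auto
  have fam: "module_family (ring_at R v) I (\<lambda>i. mod_at (X i) v)" if "v \<in> Obj C" for v
    by (rule module_family_at[OF X' that])
  note mL = module_at[OF L'] and mY = module_at[OF Y']
  let ?q = "\<lambda>v. dsum_lift_at I X v (mod_at L v) (\<lambda>i. cmp (\<iota> i) v)"
  let ?g = "\<lambda>v. dsum_lift_at I X v (mod_at Y v) (\<lambda>i. cmp (f i) v)"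
  have q: "?q v \<in> mod_hom (ring_at R v) (dsum_at I X v) (mod_at L v)" if v: "v \<in> Obj C" for v
    by (rule module_family.dsum_lift_hom[OF fam[OF v] mL[OF v] cmp_hom[OF \<iota> v]])
  have g: "?g v \<in> mod_hom (ring_at R v) (dsum_at I X v) (mod_at Y v)" if v: "v \<in> Obj C" for v
    by (rule module_family.dsum_lift_hom[OF fam[OF v] mY[OF v] cmp_hom[OF f v]])
  \<comment> \<open>The direct sum maps onto \<open>L\<close>, so maps out of \<open>L\<close> are
    determined by their composites with the coprojections. This yields naturality of the
    factorisation as well as its uniqueness.\<close>
  have eqI: "h x = h' x" if v: "v \<in> Obj C" and h: "h \<in> mod_hom A (mod_at L v) P" "h' \<in> mod_hom A (mod_at L v) P"
    and P: "module A P" and A: "A = ring_at R v"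
    and eq: "\<And>i y. i \<in> I \<Longrightarrow> y \<in> carrier (mod_at (X i) v) \<Longrightarrow> h (cmp (\<iota> i) v y) = h' (cmp (\<iota> i) v y)"
    and x: "x \<in> carrier (mod_at L v)" for v h h' x A and P :: "('r, 'u) module"
  proof -
    interpret module_family "ring_at R v" I "\<lambda>i. mod_at (X i) v" by (rule fam[OF v])
    obtain \<xi> where \<xi>: "\<xi> \<in> carrier S" "x = ?q v \<xi>" using x unfolding surj[OF v, symmetric] by auto
    have "h (?q v \<xi>) = h' (?q v \<xi>)"
      by (rule dsum_hom_eqI[OF \<xi>(1) P[unfolded A] mod_hom_comp[OF q[OF v] h(1)[unfolded A]]
            mod_hom_comp[OF q[OF v] h(2)[unfolded A]]])
        (use eq in \<open>simp add: dsum_lift_in[OF mL[OF v] cmp_hom[OF \<iota> v]]\<close>)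
    then show ?thesis using \<xi> by simp
  qed
  have "\<forall>v \<in> Obj C. \<exists>u. u \<in> mod_hom (ring_at R v) (mod_at L v) (mod_at Y v) \<and>
      (\<forall>\<xi> \<in> carrier (dsum_at I X v). u (?q v \<xi>) = ?g v \<xi>)"
  proof
    fix v assume v: "v \<in> Obj C"
    show "\<exists>u. u \<in> mod_hom (ring_at R v) (mod_at L v) (mod_at Y v) \<and>
      (\<forall>\<xi> \<in> carrier (dsum_at I X v). u (?q v \<xi>) = ?g v \<xi>)"
      by (rule mod_hom_factor_surj[OF module_family.module_dsum[OF fam[OF v]] mL[OF v] mY[OF v] q[OF v]
            surj[OF v] g[OF v] kill[OF v]]) blast+
  qed
  from bchoice[OF this] obtain \<eta> where \<eta>: "\<And>v. v \<in> Obj C \<Longrightarrow> \<eta> v \<in> mod_hom (ring_at R v) (mod_at L v) (mod_at Y v)"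
    and \<eta>g: "\<And>v \<xi>. v \<in> Obj C \<Longrightarrow> \<xi> \<in> carrier (dsum_at I X v) \<Longrightarrow> \<eta> v (?q v \<xi>) = ?g v \<xi>"
    by blast
  have \<eta>\<iota>: "\<eta> v (cmp (\<iota> i) v x) = cmp (f i) v x"
    if v: "v \<in> Obj C" and i: "i \<in> I" and x: "x \<in> carrier (mod_at (X i) v)" for v i x
  proof -
    interpret module_family "ring_at R v" I "\<lambda>i. mod_at (X i) v" by (rule fam[OF v])
    show ?thesis
      using \<eta>g[OF v dsum_in_closed[OF i x]]
      by (simp add: dsum_lift_in[OF mL[OF v] cmp_hom[OF \<iota> v] i x] dsum_lift_in[OF mY[OF v] cmp_hom[OF f v] i x])
  qed
  have "nat_hom L Y \<eta>"
  proof (rule nat_homI)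
    fix a x assume a: "a \<in> Arr C" and x: "x \<in> carrier (mod_at L (Cod C a))"
    have v: "Dom C a \<in> Obj C" and w: "Cod C a \<in> Obj C" using a by auto
    have rY: "module (ring_at R (Cod C a)) (restrict_scalars (ring_res R a) (mod_at Y (Dom C a)))"
      by (rule module_restrict_scalars[OF cring_at[OF w] ring_res_hom[OF a] mY[OF v]])
    note \<eta>A = mod_hom_restrict_scalars[OF ring_res_hom[OF a] \<eta>[OF v]]
    show "\<eta> (Dom C a) (mod_res L a x) = mod_res Y a (\<eta> (Cod C a) x)"
    proof (rule eqI[OF w mod_hom_comp[OF res_hom[OF L' a] \<eta>A] mod_hom_comp[OF \<eta>[OF w] res_hom[OF Y' a]]
          rY refl _ x])
      fix i y assume i: "i \<in> I" and y: "y \<in> carrier (mod_at (X i) (Cod C a))"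
      then show "\<eta> (Dom C a) (mod_res L a (cmp (\<iota> i) (Cod C a) y)) = mod_res Y a (\<eta> (Cod C a) (cmp (\<iota> i) (Cod C a) y))"
        using \<eta>\<iota>[OF v i res_closed[OF X'[OF i] a y]] \<eta>\<iota>[OF w i y] cmp_nat[OF \<iota>[OF i] a y] cmp_nat[OF f[OF i] a y]
        by simp
    qed
  qed (use \<eta> in auto)
  then have u: "arrow L Y \<eta> \<in> Hom D L Y" by (rule arrow_Hom[OF L Y])
  show ?thesis
  proof (rule ex1I[of _ "arrow L Y \<eta>"], intro conjI ballI u)
    show "Comp D (arrow L Y \<eta>) (\<iota> i) = f i" if i: "i \<in> I" for i
      by (rule Hom_eqI[OF Comp_in_Hom[OF \<iota>[OF i] u] f[OF i]])
        (simp add: cmp_Comp[OF \<iota>[OF i]] cmp_closed[OF \<iota>[OF i]] \<eta>\<iota> i)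
    fix u' assume u': "u' \<in> Hom D L Y \<and> (\<forall>i\<in>I. Comp D u' (\<iota> i) = f i)"
    then have u'H: "u' \<in> Hom D L Y" by simp
    show "u' = arrow L Y \<eta>"
    proof (rule Hom_eqI[OF u'H u])
      fix v x assume v: "v \<in> Obj C" and x: "x \<in> carrier (mod_at L v)"
      show "cmp u' v x = cmp (arrow L Y \<eta>) v x"
      proof (rule eqI[OF v cmp_hom[OF u'H v] cmp_hom[OF u v] mY[OF v] refl _ x])
        fix i y assume i: "i \<in> I" and y: "y \<in> carrier (mod_at (X i) v)"
        have "cmp u' v (cmp (\<iota> i) v y) = cmp (f i) v y"
          using u' i cmp_Comp[OF \<iota>[OF i] v y, of u'] by auto
        then show "cmp u' v (cmp (\<iota> i) v y) = cmp (arrow L Y \<eta>) v (cmp (\<iota> i) v y)"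
          using \<eta>\<iota>[OF v i y] v y by (simp add: cmp_closed[OF \<iota>[OF i]])
      qed
    qed
  qed
qed

end

context flat_presheaf_data
begin

subsection \<open>Coproducts\<close>

text \<open>The colimit construction without relations, for which the span condition concerns only
  the zero family. The index type is left open since \<open>bool\<close> and the type of codes are
  used besides \<open>'u\<close>.\<close>

lemma coproduct_exists:
  fixes X :: "'i \<Rightarrow> ('o, 'a, 'r, 'u) mod_psh"
  assumes I: "small \<kappa> I" and X: "\<And>i. i \<in> I \<Longrightarrow> cart_mod (X i)"
  shows "\<exists>c \<iota>. is_coproduct D I X c \<iota>"
proof -
  have X': "psh_mod (X i)" if "i \<in> I" for i using X[OF that] by simp
  define Z where "Z v = {\<zero>\<^bsub>dsum_at I X v\<^esub>}" for v
  have fam: "module_family (ring_at R v) I (\<lambda>i. mod_at (X i) v)" if "v \<in> Obj C" for v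
    by (rule module_family_at[OF X' that])
  have res: "(\<lambda>i\<in>I. mod_res (X i) a (\<xi> i)) \<in> Z (Dom C a)" if "a \<in> Arr C" "\<xi> \<in> Z (Cod C a)" for a \<xi>
    using that res_zero[OF X' that(1)] by (auto simp: Z_def dsum_simps(2) intro!: restrict_ext)
  have sub: "submodule (Z v) (ring_at R v) (dsum_at I X v)" if v: "v \<in> Obj C" for v
  proof -
    interpret module "ring_at R v" "dsum_at I X v" by (rule module_family.module_dsum[OF fam[OF v]])
    show ?thesis unfolding Z_def by (rule submoduleI) auto
  qed
  obtain L \<iota> where L: "cart_mod L" and \<iota>: "\<And>i. i \<in> I \<Longrightarrow> \<iota> i \<in> Hom D (X i) L"
    and surj: "\<And>v. v \<in> Obj C \<Longrightarrow>
      dsum_lift_at I X v (mod_at L v) (\<lambda>i. cmp (\<iota> i) v) ` carrier (dsum_at I X v) = carrier (mod_at L v)"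
    and ker: "\<And>v \<xi>. v \<in> Obj C \<Longrightarrow> \<xi> \<in> carrier (dsum_at I X v) \<Longrightarrow>
      dsum_lift_at I X v (mod_at L v) (\<lambda>i. cmp (\<iota> i) v) \<xi> = \<zero>\<^bsub>mod_at L v\<^esub> \<longleftrightarrow> \<xi> \<in> Z v"
  proof (rule colimit_exists[OF I X sub res])
    fix a h \<xi> and P :: "('r, 'u) module"
    assume a: "a \<in> Arr C" and P: "module (ring_at R (Dom C a)) P"
      and h: "\<And>i. i \<in> I \<Longrightarrow> h i \<in> mod_hom (ring_at R (Dom C a)) (mod_at (X i) (Dom C a)) P"
      and \<xi>: "\<xi> \<in> Z (Dom C a)"
    have v: "Dom C a \<in> Obj C" using a by simp
    show "dsum_lift_at I X (Dom C a) P h \<xi> = \<zero>\<^bsub>P\<^esub>"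
      using \<xi> mod_hom_zero[OF module_family.module_dsum[OF fam[OF v]] P module_family.dsum_lift_hom[OF fam[OF v] P h]]
      by (simp add: Z_def)
  qed (assumption | rule that)+
  have "is_coproduct D I X L \<iota>"
    unfolding is_coproduct_def
  proof (intro conjI ballI allI impI)
    show "L \<in> Obj D" using L by (simp add: D_simps(1))
    show "\<iota> i \<in> Hom D (X i) L" if "i \<in> I" for i by (rule \<iota>[OF that])
    fix Y f assume "Y \<in> Obj D" and f: "\<forall>i\<in>I. f i \<in> Hom D (X i) Y"
    then have Y: "cart_mod Y" by (simp add: D_simps(1))
    then have Y': "psh_mod Y" by simp
    have f': "f i \<in> Hom D (X i) Y" if "i \<in> I" for i using f that by blast
    show "\<exists>!u. u \<in> Hom D L Y \<and> (\<forall>i\<in>I. Comp D u (\<iota> i) = f i)"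
    proof (rule colimit_universal[OF X L \<iota> surj Y f'])
      fix v \<xi> assume v: "v \<in> Obj C" and \<xi>: "\<xi> \<in> carrier (dsum_at I X v)"
        and "dsum_lift_at I X v (mod_at L v) (\<lambda>i. cmp (\<iota> i) v) \<xi> = \<zero>\<^bsub>mod_at L v\<^esub>"
      then have "\<xi> \<in> Z v" using ker[OF v \<xi>] by simp
      then show "dsum_lift_at I X v (mod_at Y v) (\<lambda>i. cmp (f i) v) \<xi> = \<zero>\<^bsub>mod_at Y v\<^esub>"
        using mod_hom_zero[OF module_family.module_dsum[OF fam[OF v]] module_at[OF Y' v]
          module_family.dsum_lift_hom[OF fam[OF v] module_at[OF Y' v] cmp_hom[OF f' v]]]
        by (simp add: Z_def)
    qed
  qed
  then show ?thesis by blast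
qed

lemma has_coproducts_D: "has_coproducts \<kappa> D"
  unfolding has_coproducts_def
proof (intro allI impI)
  fix I :: "'u set" and X assume *: "small \<kappa> I \<and> (\<forall>i \<in> I. X i \<in> Obj D)"
  show "\<exists>c \<iota>. is_coproduct D I X c \<iota>"
    by (rule coproduct_exists) (use * in \<open>auto simp: D_simps(1)\<close>)
qed

subsection \<open>Cokernels\<close>

text \<open>A cokernel is the colimit over a single index with the image of \<open>f\<close> as
  relations; with index type \<open>unit\<close>, families and elements are interchangeable.\<close>

lemma pointwise_cokernel:
  assumes f: "f \<in> Hom D M N"
  obtains Q q where "q \<in> Hom D N Q" "\<And>v. v \<in> Obj C \<Longrightarrow> img_at q v = carrier (mod_at Q v)"
    "\<And>v. v \<in> Obj C \<Longrightarrow> ker_at q v = img_at f v"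
proof -
  define I :: "unit set" where "I = UNIV"
  let ?X = "\<lambda>_ :: unit. N"
  note M = Hom_cart(1)[OF f] and N = Hom_cart(2)[OF f]
  have M': "psh_mod M" and N': "psh_mod N" using M N by auto
  have I: "small \<kappa> I" using small_singleton[OF univ, of "()"] by (simp add: I_def UNIV_unit)
  have fam: "module_family (ring_at R v) I (\<lambda>i. mod_at N v)" if "v \<in> Obj C" for v
    by (rule module_family_at[OF _ that]) (rule N')
  have car: "\<xi> \<in> carrier (dsum_at I ?X v) \<longleftrightarrow> \<xi> () \<in> carrier (mod_at N v)" for v \<xi>
    by (auto simp: dsum_simps I_def PiE_def)
  have dsum: "\<xi> = dsum_in_at I ?X v () (\<xi> ())" for v \<xi>
    by (rule ext) (simp add: dsum_in_def I_def)
  have lift: "dsum_lift_at I ?X v P h \<xi> = h () (\<xi> ())"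
    if "v \<in> Obj C" "\<xi> () \<in> carrier (mod_at N v)" "module (ring_at R v) P"
      "h () \<in> mod_hom (ring_at R v) (mod_at N v) P" for v h \<xi> and P :: "('r, 'u) module"
    using module_family.dsum_lift_in[OF fam[OF that(1)] that(3), of h "()" "\<xi> ()"] that(2,4)
    by (subst dsum[of \<xi> v]) (simp add: I_def)
  define Z where "Z v = {\<xi>. \<xi> () \<in> img_at f v}" for v
  have img_sub: "submodule (img_at f v) (ring_at R v) (mod_at N v)" if v: "v \<in> Obj C" for v
    unfolding img_at_def Hom_fst[OF f]
    by (rule submodule_image[OF module_at[OF M' v] module_at[OF N' v] cmp_hom[OF f v]])
  have img_N: "img_at f v \<subseteq> carrier (mod_at N v)" if v: "v \<in> Obj C" for v
    using module.submoduleE(1)[OF module_at[OF N' v] img_sub[OF v]] .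
  have sub: "submodule (Z v) (ring_at R v) (dsum_at I ?X v)" if v: "v \<in> Obj C" for v
  proof -
    interpret S: module "ring_at R v" "dsum_at I ?X v" by (rule module_family.module_dsum[OF fam[OF v]])
    note E = module.submoduleE[OF module_at[OF N' v] img_sub[OF v]]
    interpret NV: module "ring_at R v" "mod_at N v" by (rule module_at[OF N' v])
    have op: "\<xi> \<oplus>\<^bsub>dsum_at I ?X v\<^esub> \<eta> = (\<lambda>_. \<xi> () \<oplus>\<^bsub>mod_at N v\<^esub> \<eta> ())"
      "r \<odot>\<^bsub>dsum_at I ?X v\<^esub> \<xi> = (\<lambda>_. r \<odot>\<^bsub>mod_at N v\<^esub> \<xi> ())"
      "\<zero>\<^bsub>dsum_at I ?X v\<^esub> = (\<lambda>_. \<zero>\<^bsub>mod_at N v\<^esub>)" for \<xi> \<eta> r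
      by (auto simp: dsum_simps I_def)
    have z: "\<zero>\<^bsub>mod_at N v\<^esub> \<in> img_at f v"
      using E(2,3,5) img_N[OF v] by (metis NV.M.r_neg ex_in_conv subsetD)
    \<comment> \<open>Negatives in a direct sum are not componentwise by definition, whereas scalar
      multiples are; so negation is written as multiplication by -1.\<close>
    have neg: "(\<ominus>\<^bsub>dsum_at I ?X v\<^esub> \<xi>) () = \<ominus>\<^bsub>mod_at N v\<^esub> \<xi> ()" if \<xi>: "\<xi> \<in> carrier (dsum_at I ?X v)" for \<xi>
    proof -
      have "\<ominus>\<^bsub>dsum_at I ?X v\<^esub> \<xi> = (\<ominus>\<^bsub>ring_at R v\<^esub> \<one>\<^bsub>ring_at R v\<^esub>) \<odot>\<^bsub>dsum_at I ?X v\<^esub> \<xi>"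
        using S.smult_l_minus[OF S.R.one_closed \<xi>] S.smult_one[OF \<xi>] by simp
      moreover have "\<xi> () \<in> carrier (mod_at N v)" using \<xi> by (simp only: car)
      ultimately show ?thesis using NV.smult_l_minus[OF S.R.one_closed, of "\<xi> ()"] by (simp only: op(2) NV.smult_one)
    qed
    show ?thesis
      by (rule S.submoduleI)
        (use E img_N[OF v] z in \<open>auto simp: Z_def car op neg subset_iff\<close>)
  qed
  have res: "(\<lambda>i\<in>I. mod_res N a (\<xi> i)) \<in> Z (Dom C a)" if a: "a \<in> Arr C" and \<xi>: "\<xi> \<in> Z (Cod C a)" for a \<xi>
  proof -
    obtain x where x: "x \<in> carrier (mod_at M (Cod C a))" "\<xi> () = cmp f (Cod C a) x"
      using \<xi> by (auto simp: Z_def img_at_def Hom_fst[OF f])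
    then have "mod_res N a (\<xi> ()) = cmp f (Dom C a) (mod_res M a x)" by (simp add: cmp_nat[OF f a])
    then show ?thesis using res_closed[OF M' a x(1)] by (simp add: Z_def I_def img_at_def Hom_fst[OF f])
  qed
  obtain Q \<iota> where Q: "cart_mod Q" and \<iota>: "\<And>i. i \<in> I \<Longrightarrow> \<iota> i \<in> Hom D N Q"
    and surj: "\<And>v. v \<in> Obj C \<Longrightarrow>
      dsum_lift_at I ?X v (mod_at Q v) (\<lambda>i. cmp (\<iota> i) v) ` carrier (dsum_at I ?X v) = carrier (mod_at Q v)"
    and ker: "\<And>v \<xi>. v \<in> Obj C \<Longrightarrow> \<xi> \<in> carrier (dsum_at I ?X v) \<Longrightarrow>
      dsum_lift_at I ?X v (mod_at Q v) (\<lambda>i. cmp (\<iota> i) v) \<xi> = \<zero>\<^bsub>mod_at Q v\<^esub> \<longleftrightarrow> \<xi> \<in> Z v"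
  proof (rule colimit_exists[OF I N sub res])
    fix a h \<xi> and P :: "('r, 'u) module"
    assume a: "a \<in> Arr C" and P: "module (ring_at R (Dom C a)) P"
      and h: "\<And>i. i \<in> I \<Longrightarrow> h i \<in> mod_hom (ring_at R (Dom C a)) (mod_at N (Dom C a)) P"
      and kill: "\<And>\<xi>. \<xi> \<in> Z (Cod C a) \<Longrightarrow>
        dsum_lift_at I ?X (Dom C a) P h (\<lambda>i\<in>I. mod_res N a (\<xi> i)) = \<zero>\<^bsub>P\<^esub>"
      and \<xi>: "\<xi> \<in> Z (Dom C a)"
    have v: "Dom C a \<in> Obj C" and w: "Cod C a \<in> Obj C" using a by auto
    have h': "h () \<in> mod_hom (ring_at R (Dom C a)) (mod_at N (Dom C a)) P"
      using h[of "()"] by (simp add: I_def)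
    obtain x where x: "x \<in> carrier (mod_at M (Dom C a))" "\<xi> () = cmp f (Dom C a) x"
      using \<xi> by (auto simp: Z_def img_at_def Hom_fst[OF f])
    \<comment> \<open>The image of \<open>f\<close> is spanned by restrictions because
      \<open>M\<close> is cartesian: \<open>h ()\<close> after \<open>f\<close> agrees with zero on
      restrictions, hence everywhere.\<close>
    have "h () (cmp f (Dom C a) x) = \<zero>\<^bsub>P\<^esub>"
    proof (rule cartesian_extension_unique[OF M a mod_hom_comp[OF cmp_hom[OF f v] h'] mod_hom_const_zero[OF P] _ x(1)])
      fix m assume m: "m \<in> carrier (mod_at M (Cod C a))"
      have "(\<lambda>_. cmp f (Cod C a) m) \<in> Z (Cod C a)" using m by (simp add: Z_def img_at_def Hom_fst[OF f])
      from kill[OF this] have "h () (mod_res N a (cmp f (Cod C a) m)) = \<zero>\<^bsub>P\<^esub>"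
        using lift[of "Dom C a" "\<lambda>i\<in>I. mod_res N a (cmp f (Cod C a) m)" P h] v P h'
          res_closed[OF N' a cmp_closed[OF f w m]] by (simp add: I_def)
      then show "h () (cmp f (Dom C a) (mod_res M a m)) = \<zero>\<^bsub>P\<^esub>" by (simp add: cmp_nat[OF f a m])
    qed
    then show "dsum_lift_at I ?X (Dom C a) P h \<xi> = \<zero>\<^bsub>P\<^esub>"
      using lift[of "Dom C a" \<xi> P h] v P h' x cmp_closed[OF f v x(1)] by simp
  qed (assumption | rule that)+
  have q: "\<iota> () \<in> Hom D N Q" using \<iota>[of "()"] by (simp add: I_def)
  have Q': "psh_mod Q" using Q by simp
  have lift': "dsum_lift_at I ?X v (mod_at Q v) (\<lambda>i. cmp (\<iota> i) v) \<xi> = cmp (\<iota> ()) v (\<xi> ())"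
    if v: "v \<in> Obj C" and "\<xi> () \<in> carrier (mod_at N v)" for v \<xi>
    using lift[of v \<xi> "mod_at Q v" "\<lambda>i. cmp (\<iota> i) v"] that module_at[OF Q' v] cmp_hom[OF q v] by simp
  show thesis
  proof (rule that[OF q])
    fix v assume v: "v \<in> Obj C"
    show "img_at (\<iota> ()) v = carrier (mod_at Q v)"
    proof -
      have "carrier (mod_at Q v) \<subseteq> img_at (\<iota> ()) v"
      proof
        fix y assume "y \<in> carrier (mod_at Q v)"
        then obtain \<xi> where \<xi>: "\<xi> \<in> carrier (dsum_at I ?X v)"
          "y = dsum_lift_at I ?X v (mod_at Q v) (\<lambda>i. cmp (\<iota> i) v) \<xi>"
          unfolding surj[OF v, symmetric] by auto
        have x: "\<xi> () \<in> carrier (mod_at N v)" using \<xi>(1) by (simp only: car)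
        have "y = cmp (\<iota> ()) v (\<xi> ())" using \<xi>(2) lift'[of v \<xi>, OF v x] by (rule trans)
        then show "y \<in> img_at (\<iota> ()) v" using x by (simp add: img_at_def Hom_fst[OF q])
      qed
      moreover have "img_at (\<iota> ()) v \<subseteq> carrier (mod_at Q v)"
        using cmp_closed[OF q v] by (auto simp: img_at_def Hom_fst[OF q])
      ultimately show ?thesis by (rule subset_antisym[rotated])
    qed
    have "cmp (\<iota> ()) v x = \<zero>\<^bsub>mod_at Q v\<^esub> \<longleftrightarrow> x \<in> img_at f v" if x: "x \<in> carrier (mod_at N v)" for x
      using ker[OF v, of "\<lambda>_. x"] lift'[OF v, of "\<lambda>_. x"] x by (simp add: car Z_def)
    then show "ker_at (\<iota> ()) v = img_at f v"
      using img_N[OF v] by (auto simp: ker_at_def Hom_fst[OF q])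
  qed
qed

text \<open>The counterpart of \<open>is_kernel_img\<close>. Surjectivity is all that has to be
  transferred, since exactness in the middle is read off from the kernel half of
  \<open>short_exact\<close>.\<close>

lemma is_cokernel_img:
  assumes cok: "is_cokernel D f q" and f: "f \<in> Hom D L M"
    and v: "v \<in> Obj C"
  shows "img_at q v = carrier (mod_at (fst (snd q)) v)"
proof -
  have q: "q \<in> Hom D M (fst (snd q))"
    using cok f unfolding is_cokernel_def Hom_def D_simps(2,3) by simp
  obtain Q' q' where q': "q' \<in> Hom D M Q'" "\<And>v. v \<in> Obj C \<Longrightarrow> img_at q' v = carrier (mod_at Q' v)"
    "\<And>v. v \<in> Obj C \<Longrightarrow> ker_at q' v = img_at f v" by (rule pointwise_cokernel[OF f]) (rule that)
  have cok': "is_cokernel D f q'" by (rule is_cokernelI[OF f q'])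
  have fac: "\<exists>u. u \<in> Hom D (fst (snd a)) (fst (snd b)) \<and> Comp D u a = b"
    if "is_cokernel D f a" "is_cokernel D f b" for a b
  proof -
    have "b \<in> Arr D" "Dom D b = Cod D f" "zero_arrow D (Comp D b f)"
      using that(2) by (auto simp: is_cokernel_def)
    then have "\<exists>!u. u \<in> Hom D (Cod D a) (Cod D b) \<and> Comp D u a = b"
      using that(1) by (simp add: is_cokernel_def)
    then show ?thesis by (auto simp: D_simps(3))
  qed
  obtain u where u: "u \<in> Hom D (fst (snd q)) Q'" "Comp D u q = q'"
    using fac[OF cok cok'] Hom_fst(2)[OF q'(1)] by auto
  obtain u' where u': "u' \<in> Hom D Q' (fst (snd q))" "Comp D u' q' = q"
    using fac[OF cok' cok] Hom_fst(2)[OF q'(1)] by auto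
  have qc: "cart_mod (fst (snd q))" by (rule Hom_cart(2)[OF q])
  have "Comp D u' u = Ident D (fst (snd q))"
  proof -
    have "\<exists>!w. w \<in> Hom D (Cod D q) (Cod D q) \<and> Comp D w q = q"
      using cok unfolding is_cokernel_def by (metis (no_types, lifting))
    moreover have "Comp D u' u \<in> Hom D (fst (snd q)) (fst (snd q))" by (rule Comp_in_Hom[OF u(1) u'(1)])
    moreover have "Comp D (Comp D u' u) q = q"
      using category.Comp_assoc[OF category_D q u(1) u'(1)] u(2) u'(2) by simp
    moreover have "Comp D (Ident D (fst (snd q))) q = q"
      by (rule category.Ident_left[OF category_D q])
    ultimately show ?thesis using Ident_in_Hom[OF qc] unfolding D_simps(3) by metis
  qed
  then have u'u: "cmp u' v (cmp u v x) = x" if "v \<in> Obj C" "x \<in> carrier (mod_at (fst (snd q)) v)" for v x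
    using cmp_Comp[OF u(1) that, of u'] cmp_Ident[OF that] by simp
  have q_eq: "cmp q v x = cmp u' v (cmp q' v x)" if "x \<in> carrier (mod_at M v)" for x
    using cmp_Comp[OF q'(1) v that, of u'] u'(2) by simp
  have "carrier (mod_at (fst (snd q)) v) \<subseteq> img_at q v"
  proof
    fix y assume y: "y \<in> carrier (mod_at (fst (snd q)) v)"
    then have "cmp u v y \<in> img_at q' v" using cmp_closed[OF u(1) v] q'(2)[OF v] by simp
    then obtain x where x: "x \<in> carrier (mod_at M v)" "cmp u v y = cmp q' v x"
      by (auto simp: img_at_def Hom_fst[OF q'(1)])
    then have "y = cmp q v x" using q_eq[OF x(1)] u'u[OF v y] by simp
    then show "y \<in> img_at q v" using x(1) by (simp add: img_at_def Hom_fst(1)[OF q])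
  qed
  moreover have "img_at q v \<subseteq> carrier (mod_at (fst (snd q)) v)"
    using cmp_closed[OF q v] by (auto simp: img_at_def Hom_fst(1)[OF q])
  ultimately show "img_at q v = carrier (mod_at (fst (snd q)) v)" by (rule subset_antisym[rotated])
qed

text \<open>With this, exactness becomes a statement about the modules at single objects and can be
  checked by chasing elements.\<close>

lemma short_exact_iff:
  assumes f: "f \<in> Hom D L M" and g: "g \<in> Hom D M N"
  shows "short_exact D f g \<longleftrightarrow> (\<forall>v \<in> Obj C. inj_on (cmp f v) (carrier (mod_at L v)) \<and>
    img_at f v = ker_at g v \<and> img_at g v = carrier (mod_at N v))"
proof
  assume "short_exact D f g"
  then have k: "is_kernel D g f" and c: "is_cokernel D f g" by (auto simp: short_exact_def)
  show "\<forall>v \<in> Obj C. inj_on (cmp f v) (carrier (mod_at L v)) \<and>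
    img_at f v = ker_at g v \<and> img_at g v = carrier (mod_at N v)"
    using is_kernel_inj[OF k g] is_kernel_img[OF k g] is_cokernel_img[OF c f] Hom_fst[OF f] Hom_fst[OF g]
    by simp
next
  assume *: "\<forall>v \<in> Obj C. inj_on (cmp f v) (carrier (mod_at L v)) \<and>
    img_at f v = ker_at g v \<and> img_at g v = carrier (mod_at N v)"
  have "is_kernel D g f" by (rule is_kernelI[OF g f]) (use * in auto)
  moreover have "is_cokernel D f g" by (rule is_cokernelI[OF f g]) (use * in auto)
  ultimately show "short_exact D f g" by (simp add: short_exact_def)
qed

text \<open>The inclusion of the kernel and the zero map have the same composite with
  \<open>f\<close>; for monic \<open>f\<close> they are therefore equal, and the kernel
  vanishes.\<close>

lemma monic_inj:
  assumes m: "monic D f" and f: "f \<in> Hom D M N" and v: "v \<in> Obj C"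
  shows "inj_on (cmp f v) (carrier (mod_at M v))"
proof -
  have M': "psh_mod M" and N': "psh_mod N" using Hom_cart[OF f] by auto
  obtain K k where k: "k \<in> Hom D K M" "\<And>v. v \<in> Obj C \<Longrightarrow> inj_on (cmp k v) (carrier (mod_at K v))"
    "\<And>v. v \<in> Obj C \<Longrightarrow> img_at k v = ker_at f v" by (rule pointwise_kernel[OF f]) (rule that)
  note z = hzero_Hom[OF Hom_cart[OF k(1)]]
  have "Comp D f k = Comp D f (hzero K M)"
  proof (rule Hom_eqI[OF Comp_in_Hom[OF k(1) f] Comp_in_Hom[OF z f]])
    fix v x assume v: "v \<in> Obj C" and x: "x \<in> carrier (mod_at K v)"
    have "cmp k v x \<in> img_at k v" using x by (simp add: img_at_def Hom_fst[OF k(1)])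
    then have "cmp f v (cmp k v x) = \<zero>\<^bsub>mod_at N v\<^esub>"
      using k(3)[OF v] by (simp add: ker_at_def Hom_fst[OF f])
    then show "cmp (Comp D f k) v x = cmp (Comp D f (hzero K M)) v x"
      using v x by (simp add: cmp_Comp[OF k(1)] cmp_Comp[OF z] cmp_hzero cmp_zero[OF f])
  qed
  then have eq: "k = hzero K M"
    using m k(1) z Hom_cart(1)[OF k(1)] Hom_fst(1)[OF f]
    unfolding monic_def D_simps(1,2) by blast
  show ?thesis
    unfolding mod_hom_inj_iff[OF module_at[OF M' v] module_at[OF N' v] cmp_hom[OF f v]]
  proof (intro ballI impI)
    fix x assume x: "x \<in> carrier (mod_at M v)" "cmp f v x = \<zero>\<^bsub>mod_at N v\<^esub>"
    then have "x \<in> img_at k v" using k(3)[OF v] by (simp add: ker_at_def Hom_fst[OF f])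
    then obtain y where "y \<in> carrier (mod_at K v)" "x = cmp k v y"
      by (auto simp: img_at_def Hom_fst[OF k(1)])
    then show "x = \<zero>\<^bsub>mod_at M v\<^esub>" using v by (simp add: eq cmp_hzero)
  qed
qed

text \<open>The projection to the cokernel and the zero map agree after composition with
  \<open>f\<close>; for epic \<open>f\<close> they are therefore equal, and the kernel of the
  projection, which is the image of \<open>f\<close>, is everything.\<close>

lemma epic_surj:
  assumes e: "epic D f" and f: "f \<in> Hom D M N" and v: "v \<in> Obj C"
  shows "img_at f v = carrier (mod_at N v)"
proof -
  obtain Q q where q: "q \<in> Hom D N Q" "\<And>v. v \<in> Obj C \<Longrightarrow> img_at q v = carrier (mod_at Q v)"
    "\<And>v. v \<in> Obj C \<Longrightarrow> ker_at q v = img_at f v" by (rule pointwise_cokernel[OF f]) (rule that)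
  note z = hzero_Hom[OF Hom_cart[OF q(1)]]
  have "Comp D q f = Comp D (hzero N Q) f"
  proof (rule Hom_eqI[OF Comp_in_Hom[OF f q(1)] Comp_in_Hom[OF f z]])
    fix v x assume v: "v \<in> Obj C" and x: "x \<in> carrier (mod_at M v)"
    have "cmp f v x \<in> img_at f v" using x by (simp add: img_at_def Hom_fst[OF f])
    then have "cmp q v (cmp f v x) = \<zero>\<^bsub>mod_at Q v\<^esub>"
      unfolding q(3)[OF v, symmetric] by (simp add: ker_at_def Hom_fst[OF q(1)])
    then show "cmp (Comp D q f) v x = cmp (Comp D (hzero N Q) f) v x"
      using v x by (simp add: cmp_Comp[OF f] cmp_hzero cmp_closed[OF f])
  qed
  then have eq: "q = hzero N Q"
    using e q(1) z Hom_cart(2)[OF q(1)] Hom_fst(2)[OF f]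
    unfolding epic_def D_simps(1,3) by blast
  have "ker_at q v = carrier (mod_at N v)"
    using v unfolding ker_at_def Hom_fst[OF q(1)] by (auto simp: eq cmp_hzero)
  then show ?thesis using q(3)[OF v] by simp
qed

text \<open>The coproduct over \<open>bool\<close> is already the biproduct. Its universal property
  supplies the projections, and the sum of the two composites is the identity because both
  endomorphisms leave the coprojections unchanged.\<close>

lemma biproduct_exists:
  assumes M: "cart_mod M" and N: "cart_mod N"
  shows "\<exists>b i1 i2 p1 p2. is_biproduct D hadd M N b i1 i2 p1 p2"
proof -
  interpret pre: preadditive_category D hadd hzero by (rule preadditive_D)
  define X where "X i = (if i then M else N)" for i :: bool
  have X: "cart_mod (X i)" for i using M N by (simp add: X_def)
  have "small \<kappa> ({True} \<union> {False})" by (intro small_Un small_singleton univ)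
  then have "small \<kappa> (UNIV :: bool set)" by (simp add: UNIV_bool Un_commute insert_commute)
  from coproduct_exists[where X = X, OF this X] obtain b \<iota> where cop: "is_coproduct D UNIV X b \<iota>" by (elim exE)
  have b: "cart_mod b" using cop by (simp add: is_coproduct_def D_simps(1))
  have i1: "\<iota> True \<in> Hom D M b" and i2: "\<iota> False \<in> Hom D N b"
    using cop by (simp_all add: is_coproduct_def X_def all_bool_eq)
  have univ_b: "\<exists>!u. u \<in> Hom D b y \<and> Comp D u (\<iota> True) = f \<and> Comp D u (\<iota> False) = g"
    if "cart_mod y" "f \<in> Hom D M y" "g \<in> Hom D N y" for y f g
  proof -
    have fg: "\<forall>i \<in> UNIV. (if i then f else g) \<in> Hom D (X i) y" using that by (simp add: X_def)
    have y: "y \<in> Obj D" using that(1) by (simp add: D_simps(1))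
    have "\<forall>y \<in> Obj D. \<forall>f. (\<forall>i \<in> UNIV. f i \<in> Hom D (X i) y) \<longrightarrow>
      (\<exists>!u. u \<in> Hom D b y \<and> (\<forall>i \<in> UNIV. Comp D u (\<iota> i) = f i))"
      using cop unfolding is_coproduct_def by (elim conjE)
    from spec[OF bspec[OF this y], of "\<lambda>i. if i then f else g", THEN mp, OF fg]
    have "\<exists>!u. u \<in> Hom D b y \<and> (\<forall>i \<in> UNIV. Comp D u (\<iota> i) = (if i then f else g))" .
    then show ?thesis by (simp add: all_bool_eq)
  qed
  obtain p1 where p1: "p1 \<in> Hom D b M" "Comp D p1 (\<iota> True) = Ident D M" "Comp D p1 (\<iota> False) = hzero N M"
    using univ_b[OF M Ident_in_Hom[OF M] hzero_Hom[OF N M]] by blast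
  obtain p2 where p2: "p2 \<in> Hom D b N" "Comp D p2 (\<iota> True) = hzero M N" "Comp D p2 (\<iota> False) = Ident D N"
    using univ_b[OF N hzero_Hom[OF M N] Ident_in_Hom[OF N]] by blast
  have b': "psh_mod b" using b by simp
  note c1 = Comp_in_Hom[OF p1(1) i1] and c2 = Comp_in_Hom[OF p2(1) i2]
  define s where "s = hadd (Comp D (\<iota> True) p1) (Comp D (\<iota> False) p2)"
  have s: "s \<in> Hom D b b" unfolding s_def by (rule hadd_Hom(1)[OF c1 c2])
  have s_cmp: "cmp s v x = cmp (\<iota> True) v (cmp p1 v x) \<oplus>\<^bsub>mod_at b v\<^esub> cmp (\<iota> False) v (cmp p2 v x)"
    if "v \<in> Obj C" "x \<in> carrier (mod_at b v)" for v x
    using that unfolding s_def by (simp add: cmp_hadd[OF c1 c2] cmp_Comp[OF p1(1)] cmp_Comp[OF p2(1)])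
  have p1_eq: "cmp p1 v (cmp (\<iota> True) v x) = x" "cmp p2 v (cmp (\<iota> True) v x) = \<zero>\<^bsub>mod_at N v\<^esub>"
    if "v \<in> Obj C" "x \<in> carrier (mod_at M v)" for v x
    using cmp_Comp[OF i1 that, of p1] cmp_Comp[OF i1 that, of p2] p1(2) p2(2) that
    by (simp_all add: cmp_Ident cmp_hzero)
  have p2_eq: "cmp p2 v (cmp (\<iota> False) v x) = x" "cmp p1 v (cmp (\<iota> False) v x) = \<zero>\<^bsub>mod_at M v\<^esub>"
    if "v \<in> Obj C" "x \<in> carrier (mod_at N v)" for v x
    using cmp_Comp[OF i2 that, of p1] cmp_Comp[OF i2 that, of p2] p1(3) p2(3) that
    by (simp_all add: cmp_Ident cmp_hzero)
  have "Comp D s (\<iota> True) = \<iota> True"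
  proof (rule Hom_eqI[OF Comp_in_Hom[OF i1 s] i1])
    fix v x assume v: "v \<in> Obj C" and x: "x \<in> carrier (mod_at M v)"
    interpret bm: module "ring_at R v" "mod_at b v" by (rule module_at[OF b' v])
    show "cmp (Comp D s (\<iota> True)) v x = cmp (\<iota> True) v x"
      using v x by (simp add: cmp_Comp[OF i1] s_cmp cmp_closed[OF i1] p1_eq cmp_zero[OF i2])
  qed
  moreover have "Comp D s (\<iota> False) = \<iota> False"
  proof (rule Hom_eqI[OF Comp_in_Hom[OF i2 s] i2])
    fix v x assume v: "v \<in> Obj C" and x: "x \<in> carrier (mod_at N v)"
    interpret bm: module "ring_at R v" "mod_at b v" by (rule module_at[OF b' v])
    show "cmp (Comp D s (\<iota> False)) v x = cmp (\<iota> False) v x"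
      using v x by (simp add: cmp_Comp[OF i2] s_cmp cmp_closed[OF i2] p2_eq cmp_zero[OF i1])
  qed
  moreover have "Comp D (Ident D b) (\<iota> i) = \<iota> i" for i
    by (cases i) (use pre.Ident_left[OF i1] pre.Ident_left[OF i2] in auto)
  ultimately have "s = Ident D b"
    using univ_b[OF b i1 i2] s Ident_in_Hom[OF b] by blast
  then have "is_biproduct D hadd M N b (\<iota> True) (\<iota> False) p1 p2"
    using b i1 i2 p1 p2 by (simp add: is_biproduct_def D_simps(1) s_def)
  then show ?thesis by blast
qed

lemma abelian_D: "abelian_category D"
  unfolding abelian_category_def
proof (intro conjI ballI allI impI)
  show "\<exists>hadd hzero. preadditive_category D hadd hzero \<and>
      (\<forall>x \<in> Obj D. \<forall>y \<in> Obj D. \<exists>b i1 i2 p1 p2. is_biproduct D hadd x y b i1 i2 p1 p2)"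
    using preadditive_D biproduct_exists unfolding D_simps(1) by blast
  show "\<exists>z. zero_object D z" using zero_object_zero_psh by blast
  fix f assume "f \<in> Arr D"
  then have f: "f \<in> Hom D (fst f) (fst (snd f))" by (simp only: Arr_D_iff)
  show "\<exists>k. is_kernel D f k" by (rule pointwise_kernel[OF f]) (rule exI, rule is_kernelI[OF f])
  show "\<exists>q. is_cokernel D f q" by (rule pointwise_cokernel[OF f]) (rule exI, rule is_cokernelI[OF f])
next
  fix m assume m: "monic D m"
  then have m': "m \<in> Hom D (fst m) (fst (snd m))" by (simp add: monic_def flip: Arr_D_iff)
  \<comment> \<open>An objectwise injective arrow is the kernel of its cokernel, because the latter
    has the image of \<open>m\<close> as its kernel at every object.\<close>
  obtain Q q where q: "q \<in> Hom D (fst (snd m)) Q" "\<And>v. v \<in> Obj C \<Longrightarrow> img_at q v = carrier (mod_at Q v)"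
    "\<And>v. v \<in> Obj C \<Longrightarrow> ker_at q v = img_at m v" by (rule pointwise_cokernel[OF m']) (rule that)
  have "is_kernel D q m"
    by (rule is_kernelI[OF q(1) m' monic_inj[OF m m']]) (simp_all add: q(3))
  then show "\<exists>f. is_kernel D f m" by blast
next
  fix e assume e: "epic D e"
  then have e': "e \<in> Hom D (fst e) (fst (snd e))" by (simp add: epic_def flip: Arr_D_iff)
  \<comment> \<open>Dually, an objectwise surjective arrow is the cokernel of its kernel.\<close>
  obtain K k where k: "k \<in> Hom D K (fst e)" "\<And>v. v \<in> Obj C \<Longrightarrow> inj_on (cmp k v) (carrier (mod_at K v))"
    "\<And>v. v \<in> Obj C \<Longrightarrow> img_at k v = ker_at e v" by (rule pointwise_kernel[OF e']) (rule that)
  have "is_cokernel D k e"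
    by (rule is_cokernelI[OF k(1) e' epic_surj[OF e e']]) (simp_all add: k(3))
  then show "\<exists>f. is_cokernel D f e" by blast
qed

end

subsection \<open>Direct limits\<close>

lemma directed_finite_bound:
  assumes dir: "directed_set I r" and "finite F" "F \<subseteq> I"
  shows "\<exists>k \<in> I. \<forall>i \<in> F. (i, k) \<in> r"
  using assms(2,3)
proof (induction F rule: finite_induct)
  case empty
  then show ?case using dir by (auto simp: directed_set_def)
next
  case (insert j F)
  then obtain k where k: "k \<in> I" "\<forall>i \<in> F. (i, k) \<in> r" by auto
  obtain l where l: "l \<in> I" "(j, l) \<in> r" "(k, l) \<in> r"
    using dir insert.prems k(1) by (fastforce simp: directed_set_def)
  have "trans r" using dir by (simp add: directed_set_def preorder_on_def)
  then show ?case using k l by (auto intro!: bexI[of _ l] dest: transD)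
qed

locale cartesian_direct_system = flat_presheaf_data \<kappa> C R
  for \<kappa> :: "'u rel" and C :: "('o, 'a) cat" and R :: "('o, 'a, 'r) ring_psh" +
  fixes I :: "'i set" and r :: "'i rel" and X :: "'i \<Rightarrow> ('o, 'a, 'r, 'u) mod_psh"
    and \<phi> :: "'i \<Rightarrow> 'i \<Rightarrow>
      ('o, 'a, 'r, 'u) mod_psh \<times> ('o, 'a, 'r, 'u) mod_psh \<times> ('o \<Rightarrow> 'u \<Rightarrow> 'u)"
  assumes small_I: "small \<kappa> I" and dir: "directed_set I r"
    and sys: "direct_system (Mod_cart \<kappa> C R) I r X \<phi>"
begin

lemma r_sub: "(i, j) \<in> r \<Longrightarrow> i \<in> I \<and> j \<in> I"
  and r_refl: "i \<in> I \<Longrightarrow> (i, i) \<in> r"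
  and r_trans: "(i, j) \<in> r \<Longrightarrow> (j, k) \<in> r \<Longrightarrow> (i, k) \<in> r"
  using dir by (auto simp: directed_set_def preorder_on_def refl_on_def dest: transD)

lemma r_bound: "i \<in> I \<Longrightarrow> j \<in> I \<Longrightarrow> \<exists>k \<in> I. (i, k) \<in> r \<and> (j, k) \<in> r"
  using dir by (simp add: directed_set_def)

lemma X: "i \<in> I \<Longrightarrow> cart_mod (X i)"
  using sys by (simp add: direct_system_def D_simps(1))

lemma X': "i \<in> I \<Longrightarrow> psh_mod (X i)"
  using X by simp

lemma \<phi>: "(i, j) \<in> r \<Longrightarrow> \<phi> i j \<in> Hom D (X i) (X j)"
  using sys by (simp add: direct_system_def)

lemma \<phi>_refl: "i \<in> I \<Longrightarrow> v \<in> Obj C \<Longrightarrow> x \<in> carrier (mod_at (X i) v) \<Longrightarrow> cmp (\<phi> i i) v x = x"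
  using sys by (simp add: direct_system_def cmp_Ident)

lemma \<phi>_comp:
  assumes "(i, j) \<in> r" "(j, k) \<in> r" "v \<in> Obj C" "x \<in> carrier (mod_at (X i) v)"
  shows "cmp (\<phi> j k) v (cmp (\<phi> i j) v x) = cmp (\<phi> i k) v x"
proof -
  have "Comp D (\<phi> j k) (\<phi> i j) = \<phi> i k" using sys assms(1,2) by (auto simp: direct_system_def)
  then show ?thesis using cmp_Comp[OF \<phi>[OF assms(1)] assms(3,4), of "\<phi> j k"] by simp
qed

lemma fam: "v \<in> Obj C \<Longrightarrow> module_family (ring_at R v) I (\<lambda>i. mod_at (X i) v)"
  by (rule module_family_at[OF X'])

lemma res_in:
  assumes "a \<in> Arr C" "i \<in> I" "x \<in> carrier (mod_at (X i) (Cod C a))"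
  shows "(\<lambda>k\<in>I. mod_res (X k) a (dsum_in_at I X (Cod C a) i x k)) = dsum_in_at I X (Dom C a) i (mod_res (X i) a x)"
  by (rule dsum_res_in) (use assms X' in auto)

text \<open>
  The direct limit is the direct sum modulo \<open>rel\<close>, the families that some \<open>push v k\<close>, the addition in
  \<open>X k\<close> of a family supported below \<open>k\<close>, sends to zero. With this explicit form an element of \<open>X i\<close>
  vanishes in the limit only if it vanishes at a later stage.
\<close>

definition below :: "'i \<Rightarrow> 'i set" where "below k = {i. (i, k) \<in> r}"

definition push :: "'o \<Rightarrow> 'i \<Rightarrow> ('i \<Rightarrow> 'u) \<Rightarrow> 'u" where
  "push v k = dsum_lift_at I X v (mod_at (X k) v)
    (\<lambda>i. if i \<in> below k then cmp (\<phi> i k) v else (\<lambda>_. \<zero>\<^bsub>mod_at (X k) v\<^esub>))"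

definition supp_below :: "'o \<Rightarrow> 'i \<Rightarrow> ('i \<Rightarrow> 'u) \<Rightarrow> bool" where
  "supp_below v k \<xi> \<longleftrightarrow> {i \<in> I. \<xi> i \<noteq> \<zero>\<^bsub>mod_at (X i) v\<^esub>} \<subseteq> below k"

lemma below_sub: "below k \<subseteq> I"
  using r_sub by (auto simp: below_def)

lemma push_fam:
  assumes "k \<in> I" "v \<in> Obj C"
  shows "(if i \<in> below k then cmp (\<phi> i k) v else (\<lambda>_. \<zero>\<^bsub>mod_at (X k) v\<^esub>))
    \<in> mod_hom (ring_at R v) (mod_at (X i) v) (mod_at (X k) v)"
  using cmp_hom[OF \<phi>, of i k v] mod_hom_const_zero[OF module_at[OF X'[OF assms(1)] assms(2)], of "mod_at (X i) v"] assms
  by (auto simp: below_def)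

lemma push_hom:
  assumes "k \<in> I" "v \<in> Obj C"
  shows "push v k \<in> mod_hom (ring_at R v) (dsum_at I X v) (mod_at (X k) v)"
  unfolding push_def
  by (rule module_family.dsum_lift_hom[OF fam[OF assms(2)] module_at[OF X'[OF assms(1)] assms(2)] push_fam[OF assms]])

lemma push_in:
  assumes "k \<in> I" "v \<in> Obj C" "i \<in> I" "x \<in> carrier (mod_at (X i) v)"
  shows "push v k (dsum_in_at I X v i x) = (if (i, k) \<in> r then cmp (\<phi> i k) v x else \<zero>\<^bsub>mod_at (X k) v\<^esub>)"
  unfolding push_def
    module_family.dsum_lift_in[OF fam[OF assms(2)] module_at[OF X'[OF assms(1)] assms(2)] push_fam[OF assms(1,2)] assms(3,4)]
  by (simp add: below_def)

text \<open>For compatible maps \<open>h\<close>, each \<open>h i\<close> with \<open>i\<close>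
  below \<open>k\<close> is \<open>h k\<close> after the transition map; on families supported there
  the sum may be formed in \<open>X k\<close> first.\<close>

lemma lift_push:
  assumes v: "v \<in> Obj C" and P: "module (ring_at R v) P" and k: "k \<in> I"
    and h: "\<And>i. i \<in> I \<Longrightarrow> h i \<in> mod_hom (ring_at R v) (mod_at (X i) v) P"
    and compat: "\<And>i x. (i, k) \<in> r \<Longrightarrow> x \<in> carrier (mod_at (X i) v) \<Longrightarrow> h k (cmp (\<phi> i k) v x) = h i x"
    and \<xi>: "\<xi> \<in> carrier (dsum_at I X v)" "supp_below v k \<xi>"
  shows "dsum_lift_at I X v P h \<xi> = h k (push v k \<xi>)"
  unfolding push_def
  by (rule module_family.dsum_lift_factor[OF fam[OF v] P h module_at[OF X'[OF k] v] h[OF k] _ _ below_sub \<xi>(1)])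
    (use \<xi>(2) v compat cmp_hom[OF \<phi>] in \<open>simp_all add: supp_below_def below_def\<close>)

definition rel :: "'o \<Rightarrow> ('i \<Rightarrow> 'u) set" where
  "rel v = {\<xi> \<in> carrier (dsum_at I X v). \<exists>k \<in> I. supp_below v k \<xi> \<and> push v k \<xi> = \<zero>\<^bsub>mod_at (X k) v\<^esub>}"

lemma supp_below_mono: "supp_below v k \<xi> \<Longrightarrow> (k, l) \<in> r \<Longrightarrow> supp_below v l \<xi>"
  using r_trans by (auto simp: supp_below_def below_def)

text \<open>The case of \<open>lift_push\<close> whose target is the later stage \<open>l\<close>
  and whose maps are the transitions to it. In particular a family that has become zero at
  \<open>k\<close> stays zero.\<close>

lemma push_push:
  assumes v: "v \<in> Obj C" and kl: "(k, l) \<in> r" and \<xi>: "\<xi> \<in> carrier (dsum_at I X v)" "supp_below v k \<xi>"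
  shows "push v l \<xi> = cmp (\<phi> k l) v (push v k \<xi>)"
proof -
  have k: "k \<in> I" and l: "l \<in> I" using r_sub[OF kl] by auto
  have "push v l \<xi> = (if k \<in> below l then cmp (\<phi> k l) v else (\<lambda>_. \<zero>\<^bsub>mod_at (X l) v\<^esub>)) (push v k \<xi>)"
    unfolding push_def[of v l]
  proof (rule lift_push[OF v module_at[OF X'[OF l] v] k push_fam[OF l v] _ \<xi>])
    fix i x assume "(i, k) \<in> r" "x \<in> carrier (mod_at (X i) v)"
    then show "(if k \<in> below l then cmp (\<phi> k l) v else (\<lambda>_. \<zero>\<^bsub>mod_at (X l) v\<^esub>)) (cmp (\<phi> i k) v x) =
        (if i \<in> below l then cmp (\<phi> i l) v else (\<lambda>_. \<zero>\<^bsub>mod_at (X l) v\<^esub>)) x"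
      using kl r_trans[of i k l] \<phi>_comp[of i k l v x] v by (simp add: below_def)
  qed
  then show ?thesis using kl by (simp add: below_def)
qed

lemma rel_submodule:
  assumes v: "v \<in> Obj C"
  shows "submodule (rel v) (ring_at R v) (dsum_at I X v)"
proof -
  interpret F: module_family "ring_at R v" I "\<lambda>i. mod_at (X i) v" by (rule fam[OF v])
  interpret S: module "ring_at R v" F.S by (rule F.module_dsum)
  have smult: "t \<odot>\<^bsub>F.S\<^esub> \<xi> \<in> rel v" if t: "t \<in> carrier (ring_at R v)" and "\<xi> \<in> rel v" for t \<xi>
  proof -
    obtain k where k: "\<xi> \<in> carrier F.S" "k \<in> I" "supp_below v k \<xi>" "push v k \<xi> = \<zero>\<^bsub>mod_at (X k) v\<^esub>"
      using \<open>\<xi> \<in> rel v\<close> by (auto simp: rel_def)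
    have "supp_below v k (t \<odot>\<^bsub>F.S\<^esub> \<xi>)"
      using k(3) t by (auto simp: supp_below_def dsum_simps(4) F.X_simps)
    moreover have "push v k (t \<odot>\<^bsub>F.S\<^esub> \<xi>) = \<zero>\<^bsub>mod_at (X k) v\<^esub>"
      using mod_hom_smult[OF push_hom[OF k(2) v] t k(1)] k(4) F.X_simps(6)[OF k(2) t] by simp
    ultimately show ?thesis using k(2) S.smult_closed[OF t k(1)] by (auto simp: rel_def)
  qed
  show ?thesis
  proof (rule S.submoduleI)
    show "rel v \<subseteq> carrier F.S" by (auto simp: rel_def)
    obtain k where k: "k \<in> I" using dir by (auto simp: directed_set_def)
    have "supp_below v k \<zero>\<^bsub>F.S\<^esub>" by (auto simp: supp_below_def dsum_simps(2))
    moreover have "push v k \<zero>\<^bsub>F.S\<^esub> = \<zero>\<^bsub>mod_at (X k) v\<^esub>"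
      by (rule mod_hom_zero[OF F.module_dsum F.module_X[OF k] push_hom[OF k v]])
    ultimately show "\<zero>\<^bsub>F.S\<^esub> \<in> rel v" using k S.zero_closed by (auto simp: rel_def)
    show "\<ominus>\<^bsub>F.S\<^esub> \<xi> \<in> rel v" if \<xi>: "\<xi> \<in> rel v" for \<xi>
    proof -
      have \<xi>c: "\<xi> \<in> carrier F.S" using \<xi> by (simp add: rel_def)
      have "(\<ominus>\<^bsub>ring_at R v\<^esub> \<one>\<^bsub>ring_at R v\<^esub>) \<odot>\<^bsub>F.S\<^esub> \<xi> = \<ominus>\<^bsub>F.S\<^esub> \<xi>"
        using S.smult_l_minus[OF S.R.one_closed \<xi>c] S.smult_one[OF \<xi>c] by simp
      then show ?thesis using smult[OF _ \<xi>, of "\<ominus>\<^bsub>ring_at R v\<^esub> \<one>\<^bsub>ring_at R v\<^esub>"] by simp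
    qed
    show "\<xi> \<oplus>\<^bsub>F.S\<^esub> \<eta> \<in> rel v" if \<xi>: "\<xi> \<in> rel v" and \<eta>: "\<eta> \<in> rel v" for \<xi> \<eta>
    proof -
      obtain k where k: "\<xi> \<in> carrier F.S" "k \<in> I" "supp_below v k \<xi>" "push v k \<xi> = \<zero>\<^bsub>mod_at (X k) v\<^esub>"
        using \<xi> by (auto simp: rel_def)
      obtain k' where k': "\<eta> \<in> carrier F.S" "k' \<in> I" "supp_below v k' \<eta>" "push v k' \<eta> = \<zero>\<^bsub>mod_at (X k') v\<^esub>"
        using \<eta> by (auto simp: rel_def)
      \<comment> \<open>The two families vanish at possibly different stages; directedness supplies
        one at which both vanish and which bounds both supports.\<close>
      obtain l where l: "l \<in> I" "(k, l) \<in> r" "(k', l) \<in> r" using r_bound[OF k(2) k'(2)] by blast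
      have "push v l \<xi> = \<zero>\<^bsub>mod_at (X l) v\<^esub>" "push v l \<eta> = \<zero>\<^bsub>mod_at (X l) v\<^esub>"
        using push_push[OF v l(2) k(1,3)] push_push[OF v l(3) k'(1,3)] k(4) k'(4)
          cmp_zero[OF \<phi>[OF l(2)] v] cmp_zero[OF \<phi>[OF l(3)] v] by simp_all
      then have "push v l (\<xi> \<oplus>\<^bsub>F.S\<^esub> \<eta>) = \<zero>\<^bsub>mod_at (X l) v\<^esub>"
        using mod_hom_add[OF push_hom[OF l(1) v] k(1) k'(1)] F.X_simps(4)[OF l(1) F.X_simps(1)[OF l(1)]] by simp
      moreover have "supp_below v l (\<xi> \<oplus>\<^bsub>F.S\<^esub> \<eta>)"
        using supp_below_mono[OF k(3) l(2)] supp_below_mono[OF k'(3) l(3)]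
        unfolding supp_below_def
      proof (intro subsetI, elim CollectE conjE)
        fix i assume b: "{i \<in> I. \<xi> i \<noteq> \<zero>\<^bsub>mod_at (X i) v\<^esub>} \<subseteq> below l"
            "{i \<in> I. \<eta> i \<noteq> \<zero>\<^bsub>mod_at (X i) v\<^esub>} \<subseteq> below l"
          and i: "i \<in> I" "(\<xi> \<oplus>\<^bsub>F.S\<^esub> \<eta>) i \<noteq> \<zero>\<^bsub>mod_at (X i) v\<^esub>"
        have "\<xi> i \<noteq> \<zero>\<^bsub>mod_at (X i) v\<^esub> \<or> \<eta> i \<noteq> \<zero>\<^bsub>mod_at (X i) v\<^esub>"
          using i by (auto simp: dsum_simps(3) F.X_simps)
        then show "i \<in> below l" using b i(1) by auto
      qed
      ultimately show ?thesis using l(1) k(1) k'(1) by (auto simp: rel_def)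
    qed
  qed (rule smult)
qed

text \<open>Transition maps are natural, so summation at stage \<open>k\<close> commutes with
  restriction and the witness \<open>k\<close> can be kept.\<close>

lemma rel_res:
  assumes a: "a \<in> Arr C" and \<xi>: "\<xi> \<in> rel (Cod C a)"
  shows "(\<lambda>i\<in>I. mod_res (X i) a (\<xi> i)) \<in> rel (Dom C a)"
proof -
  have v: "Dom C a \<in> Obj C" and w: "Cod C a \<in> Obj C" using a by auto
  interpret V: module_family "ring_at R (Dom C a)" I "\<lambda>i. mod_at (X i) (Dom C a)" by (rule fam[OF v])
  interpret W: module_family "ring_at R (Cod C a)" I "\<lambda>i. mod_at (X i) (Cod C a)" by (rule fam[OF w])
  obtain k where k: "\<xi> \<in> carrier W.S" "k \<in> I" "supp_below (Cod C a) k \<xi>"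
    "push (Cod C a) k \<xi> = \<zero>\<^bsub>mod_at (X k) (Cod C a)\<^esub>"
    using \<xi> by (auto simp: rel_def)
  note rS = dsum_res_hom[OF X' a]
  have "push (Dom C a) k (\<lambda>i\<in>I. mod_res (X i) a (\<xi> i)) = mod_res (X k) a (push (Cod C a) k \<xi>)"
  proof (rule W.dsum_hom_eqI[OF k(1) module_restrict_scalars[OF cring_at[OF w] ring_res_hom[OF a] V.module_X[OF k(2)]]
        mod_hom_comp[OF rS mod_hom_restrict_scalars[OF ring_res_hom[OF a] push_hom[OF k(2) v]]]
        mod_hom_comp[OF push_hom[OF k(2) w] res_hom[OF X'[OF k(2)] a]]])
    fix i x assume i: "i \<in> I" and x: "x \<in> carrier (mod_at (X i) (Cod C a))"
    show "push (Dom C a) k (\<lambda>ka\<in>I. mod_res (X ka) a (dsum_in_at I X (Cod C a) i x ka)) =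
        mod_res (X k) a (push (Cod C a) k (dsum_in_at I X (Cod C a) i x))"
      using cmp_nat[OF \<phi> a x, of k]
      by (simp add: res_in[OF a i x] push_in[OF k(2) v i res_closed[OF X'[OF i] a x]]
          push_in[OF k(2) w i x] res_zero[OF X'[OF k(2)] a])
  qed
  moreover have "supp_below (Dom C a) k (\<lambda>i\<in>I. mod_res (X i) a (\<xi> i))"
    using k(3) by (auto simp: supp_below_def res_zero[OF X' a])
  moreover have "(\<lambda>i\<in>I. mod_res (X i) a (\<xi> i)) \<in> carrier V.S"
    using mod_hom_closed[OF rS k(1)] by simp
  ultimately show ?thesis using k(2,4) res_zero[OF X'[OF k(2)] a] by (auto simp: rel_def)
qed

text \<open>The classical generator of the relations: \<open>x\<close> at stage \<open>i\<close>
  minus its image at stage \<open>j\<close>. Killing it amounts to compatibility with the transition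
  from \<open>i\<close> to \<open>j\<close>, and in this way compatibility is extracted from maps
  that kill \<open>rel\<close>.\<close>

definition rel_gen :: "'o \<Rightarrow> 'i \<Rightarrow> 'i \<Rightarrow> 'u \<Rightarrow> 'i \<Rightarrow> 'u" where
  "rel_gen v i j x = dsum_in_at I X v i x \<oplus>\<^bsub>dsum_at I X v\<^esub>
    dsum_in_at I X v j (\<ominus>\<^bsub>mod_at (X j) v\<^esub> cmp (\<phi> i j) v x)"

lemma rel_gen:
  assumes v: "v \<in> Obj C" and ij: "(i, j) \<in> r" and x: "x \<in> carrier (mod_at (X i) v)"
  shows "rel_gen v i j x \<in> rel v"
    and "\<And>P h. module (ring_at R v) P \<Longrightarrow> (\<And>i. i \<in> I \<Longrightarrow> h i \<in> mod_hom (ring_at R v) (mod_at (X i) v) P) \<Longrightarrow>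
      dsum_lift_at I X v P h (rel_gen v i j x) = \<zero>\<^bsub>P\<^esub> \<longleftrightarrow> h j (cmp (\<phi> i j) v x) = h i x"
proof -
  have i: "i \<in> I" and j: "j \<in> I" using r_sub[OF ij] by auto
  interpret F: module_family "ring_at R v" I "\<lambda>i. mod_at (X i) v" by (rule fam[OF v])
  interpret Xj: module "ring_at R v" "mod_at (X j) v" by (rule F.module_X[OF j])
  have y: "cmp (\<phi> i j) v x \<in> carrier (mod_at (X j) v)" by (rule cmp_closed[OF \<phi>[OF ij] v x])
  then have y': "\<ominus>\<^bsub>mod_at (X j) v\<^esub> cmp (\<phi> i j) v x \<in> carrier (mod_at (X j) v)" by simp
  note c1 = F.dsum_in_closed[OF i x] and c2 = F.dsum_in_closed[OF j y']
  have S: "rel_gen v i j x \<in> carrier F.S" unfolding rel_gen_def by (rule F.dsum_add_closed[OF c1 c2])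
  have "push v j (rel_gen v i j x) = \<zero>\<^bsub>mod_at (X j) v\<^esub>"
    unfolding rel_gen_def mod_hom_add[OF push_hom[OF j v] c1 c2] push_in[OF j v i x] push_in[OF j v j y']
    using ij r_refl[OF j] y by (simp add: \<phi>_refl[OF j v] Xj.M.r_neg)
  moreover have "supp_below v j (rel_gen v i j x)"
    using ij r_refl[OF j] by (auto simp: supp_below_def below_def rel_gen_def dsum_simps(3) dsum_in_def F.X_simps
        split: if_splits)
  ultimately show "rel_gen v i j x \<in> rel v" using j S by (auto simp: rel_def)
  fix P :: "('r, 'x) module" and h
  assume P: "module (ring_at R v) P" and h: "\<And>i. i \<in> I \<Longrightarrow> h i \<in> mod_hom (ring_at R v) (mod_at (X i) v) P"
  interpret P: module "ring_at R v" P by (rule P)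
  have "dsum_lift_at I X v P h (rel_gen v i j x) = h i x \<ominus>\<^bsub>P\<^esub> h j (cmp (\<phi> i j) v x)"
  proof -
    have "dsum_lift_at I X v P h \<in> mod_hom (ring_at R v) F.S P" by (rule F.dsum_lift_hom[OF P h])
    from mod_hom_add[OF this c1 c2]
    have "dsum_lift_at I X v P h (rel_gen v i j x) = dsum_lift_at I X v P h (dsum_in_at I X v i x) \<oplus>\<^bsub>P\<^esub>
      dsum_lift_at I X v P h (dsum_in_at I X v j (\<ominus>\<^bsub>mod_at (X j) v\<^esub> cmp (\<phi> i j) v x))"
      by (simp only: rel_gen_def)
    also have "dsum_lift_at I X v P h (dsum_in_at I X v i x) = h i x" by (rule F.dsum_lift_in[OF P h i x])
    also have "dsum_lift_at I X v P h (dsum_in_at I X v j (\<ominus>\<^bsub>mod_at (X j) v\<^esub> cmp (\<phi> i j) v x)) =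
      h j (\<ominus>\<^bsub>mod_at (X j) v\<^esub> cmp (\<phi> i j) v x)" by (rule F.dsum_lift_in[OF P h j y'])
    also have "\<dots> = \<ominus>\<^bsub>P\<^esub> h j (cmp (\<phi> i j) v x)" by (rule mod_hom_neg[OF F.module_X[OF j] P h[OF j] y])
    finally show ?thesis by (simp add: a_minus_def)
  qed
  then show "dsum_lift_at I X v P h (rel_gen v i j x) = \<zero>\<^bsub>P\<^esub> \<longleftrightarrow> h j (cmp (\<phi> i j) v x) = h i x"
    using module_diff_zero_iff[OF P mod_hom_closed[OF h[OF i] x] mod_hom_closed[OF h[OF j] y]] by auto
qed

text \<open>By \<open>lift_push\<close> the value is \<open>h k\<close> of a sum that is already
  zero at stage \<open>k\<close>.\<close>

lemma lift_rel:
  assumes v: "v \<in> Obj C" and P: "module (ring_at R v) P"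
    and h: "\<And>i. i \<in> I \<Longrightarrow> h i \<in> mod_hom (ring_at R v) (mod_at (X i) v) P"
    and compat: "\<And>i j x. (i, j) \<in> r \<Longrightarrow> x \<in> carrier (mod_at (X i) v) \<Longrightarrow> h j (cmp (\<phi> i j) v x) = h i x"
    and \<xi>: "\<xi> \<in> rel v"
  shows "dsum_lift_at I X v P h \<xi> = \<zero>\<^bsub>P\<^esub>"
proof -
  obtain k where k: "\<xi> \<in> carrier (dsum_at I X v)" "k \<in> I" "supp_below v k \<xi>"
    "push v k \<xi> = \<zero>\<^bsub>mod_at (X k) v\<^esub>"
    using \<xi> by (auto simp: rel_def)
  have "dsum_lift_at I X v P h \<xi> = h k (push v k \<xi>)"
    by (rule lift_push[OF v P k(2) h compat k(1,3)])
  then show ?thesis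
    using k(4) mod_hom_zero[OF module_at[OF X'[OF k(2)] v] P h[OF k(2)]] by simp
qed

lemma direct_limit_exists:
  obtains L \<iota> where "is_direct_limit D I r X \<phi> L \<iota>"
    "\<And>v y. v \<in> Obj C \<Longrightarrow> y \<in> carrier (mod_at L v) \<Longrightarrow>
      \<exists>i \<in> I. \<exists>x \<in> carrier (mod_at (X i) v). y = cmp (\<iota> i) v x"
    "\<And>v i x. v \<in> Obj C \<Longrightarrow> i \<in> I \<Longrightarrow> x \<in> carrier (mod_at (X i) v) \<Longrightarrow>
      cmp (\<iota> i) v x = \<zero>\<^bsub>mod_at L v\<^esub> \<Longrightarrow> \<exists>k. (i, k) \<in> r \<and> cmp (\<phi> i k) v x = \<zero>\<^bsub>mod_at (X k) v\<^esub>"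
proof -
  obtain L \<iota> where L: "cart_mod L" and \<iota>: "\<And>i. i \<in> I \<Longrightarrow> \<iota> i \<in> Hom D (X i) L"
    and surj: "\<And>v. v \<in> Obj C \<Longrightarrow>
      dsum_lift_at I X v (mod_at L v) (\<lambda>i. cmp (\<iota> i) v) ` carrier (dsum_at I X v) = carrier (mod_at L v)"
    and ker: "\<And>v \<xi>. v \<in> Obj C \<Longrightarrow> \<xi> \<in> carrier (dsum_at I X v) \<Longrightarrow>
      dsum_lift_at I X v (mod_at L v) (\<lambda>i. cmp (\<iota> i) v) \<xi> = \<zero>\<^bsub>mod_at L v\<^esub> \<longleftrightarrow> \<xi> \<in> rel v"
  proof (rule colimit_exists[OF small_I X rel_submodule rel_res])
    fix a h \<xi> and P :: "('r, 'u) module"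
    assume a: "a \<in> Arr C" and P: "module (ring_at R (Dom C a)) P"
      and h: "\<And>i. i \<in> I \<Longrightarrow> h i \<in> mod_hom (ring_at R (Dom C a)) (mod_at (X i) (Dom C a)) P"
      and kill: "\<And>\<xi>. \<xi> \<in> rel (Cod C a) \<Longrightarrow>
        dsum_lift_at I X (Dom C a) P h (\<lambda>i\<in>I. mod_res (X i) a (\<xi> i)) = \<zero>\<^bsub>P\<^esub>"
      and \<xi>: "\<xi> \<in> rel (Dom C a)"
    have v: "Dom C a \<in> Obj C" and w: "Cod C a \<in> Obj C" using a by auto
    interpret V: module_family "ring_at R (Dom C a)" I "\<lambda>i. mod_at (X i) (Dom C a)" by (rule fam[OF v])
    interpret W: module_family "ring_at R (Cod C a)" I "\<lambda>i. mod_at (X i) (Cod C a)" by (rule fam[OF w])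
    have rP: "module (ring_at R (Cod C a)) (restrict_scalars (ring_res R a) P)"
      by (rule module_restrict_scalars[OF cring_at[OF w] ring_res_hom[OF a] P])
    have hr: "(\<lambda>x. h i (mod_res (X i) a x)) \<in> mod_hom (ring_at R (Cod C a)) (mod_at (X i) (Cod C a))
        (restrict_scalars (ring_res R a) P)" if "i \<in> I" for i
      by (rule mod_hom_comp[OF res_hom[OF X'[OF that] a] mod_hom_restrict_scalars[OF ring_res_hom[OF a] h[OF that]]])
    have lift_res: "dsum_lift_at I X (Dom C a) P h (\<lambda>i\<in>I. mod_res (X i) a (\<zeta> i)) =
        dsum_lift_at I X (Cod C a) (restrict_scalars (ring_res R a) P) (\<lambda>i x. h i (mod_res (X i) a x)) \<zeta>"
      if \<zeta>: "\<zeta> \<in> carrier W.S" for \<zeta>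
    proof (rule W.dsum_hom_eqI[OF \<zeta> rP mod_hom_comp[OF dsum_res_hom[OF X' a]
            mod_hom_restrict_scalars[OF ring_res_hom[OF a] V.dsum_lift_hom[OF P h]]] W.dsum_lift_hom[OF rP hr]])
      fix i x assume i: "i \<in> I" and x: "x \<in> carrier (mod_at (X i) (Cod C a))"
      show "dsum_lift_at I X (Dom C a) P h (\<lambda>k\<in>I. mod_res (X k) a (dsum_in_at I X (Cod C a) i x k)) =
        dsum_lift_at I X (Cod C a) (restrict_scalars (ring_res R a) P) (\<lambda>i x. h i (mod_res (X i) a x))
          (dsum_in_at I X (Cod C a) i x)"
        using V.dsum_lift_in[OF P h i res_closed[OF X'[OF i] a x]] W.dsum_lift_in[OF rP hr i x]
        by (simp only: res_in[OF a i x])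
    qed
    \<comment> \<open>The relations over the codomain of \<open>a\<close> give compatibility of the
      \<open>h i\<close> on restrictions. Since \<open>X i\<close> is cartesian, it holds on all of
      \<open>X i\<close> over the domain, and then \<open>h\<close> kills all of \<open>rel\<close>
      there.\<close>
    have compat: "h j (cmp (\<phi> i j) (Dom C a) x) = h i x" if ij: "(i, j) \<in> r" and x: "x \<in> carrier (mod_at (X i) (Dom C a))" for i j x
    proof (rule cartesian_extension_unique[OF X a mod_hom_comp[OF cmp_hom[OF \<phi>[OF ij] v] h] h _ x])
      fix m assume m: "m \<in> carrier (mod_at (X i) (Cod C a))"
      have "rel_gen (Cod C a) i j m \<in> rel (Cod C a)" by (rule rel_gen(1)[OF w ij m])
      then have "h j (mod_res (X j) a (cmp (\<phi> i j) (Cod C a) m)) = h i (mod_res (X i) a m)"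
        using kill[of "rel_gen (Cod C a) i j m"] lift_res[of "rel_gen (Cod C a) i j m"] rel_gen(2)[OF w ij m rP hr]
        by (simp add: rel_def)
      then show "h j (cmp (\<phi> i j) (Dom C a) (mod_res (X i) a m)) = h i (mod_res (X i) a m)"
        by (simp add: cmp_nat[OF \<phi>[OF ij] a m])
    qed (use r_sub[OF ij] in auto)
    show "dsum_lift_at I X (Dom C a) P h \<xi> = \<zero>\<^bsub>P\<^esub>"
      by (rule lift_rel[OF v P h compat \<xi>])
  qed (assumption | rule that)+
  have L': "psh_mod L" using L by simp
  have \<iota>\<phi>: "cmp (\<iota> j) v (cmp (\<phi> i j) v x) = cmp (\<iota> i) v x"
    if v: "v \<in> Obj C" and ij: "(i, j) \<in> r" and x: "x \<in> carrier (mod_at (X i) v)" for v i j x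
  proof -
    have R: "rel_gen v i j x \<in> rel v" by (rule rel_gen(1)[OF v ij x])
    then have "dsum_lift_at I X v (mod_at L v) (\<lambda>i. cmp (\<iota> i) v) (rel_gen v i j x) = \<zero>\<^bsub>mod_at L v\<^esub>"
      using ker[OF v] by (simp add: rel_def)
    then show ?thesis
      using rel_gen(2)[OF v ij x module_at[OF L' v], of "\<lambda>i. cmp (\<iota> i) v"] cmp_hom[OF \<iota> v] by simp
  qed
  show thesis
  proof (rule that)
    show "is_direct_limit D I r X \<phi> L \<iota>"
      unfolding is_direct_limit_def
    proof (intro conjI allI impI)
      have "Comp D (\<iota> j) (\<phi> i j) = \<iota> i" if ij: "(i, j) \<in> r" for i j
      proof -
        have i: "i \<in> I" and j: "j \<in> I" using r_sub[OF ij] by auto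
        show ?thesis
          by (rule Hom_eqI[OF Comp_in_Hom[OF \<phi>[OF ij] \<iota>[OF j]] \<iota>[OF i]])
            (simp add: cmp_Comp[OF \<phi>[OF ij]] \<iota>\<phi>[OF _ ij])
      qed
      then show "cocone D I r X \<phi> L \<iota>"
        using L \<iota> by (simp add: cocone_def D_simps(1))
      fix Y f assume coc: "cocone D I r X \<phi> Y f"
      then have Y: "cart_mod Y" and f: "\<And>i. i \<in> I \<Longrightarrow> f i \<in> Hom D (X i) Y"
        and f\<phi>: "\<And>i j. (i, j) \<in> r \<Longrightarrow> Comp D (f j) (\<phi> i j) = f i"
        by (simp_all add: cocone_def D_simps(1))
      have Y': "psh_mod Y" using Y by simp
      show "\<exists>!u. u \<in> Hom D L Y \<and> (\<forall>i \<in> I. Comp D u (\<iota> i) = f i)"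
      proof (rule colimit_universal[OF X L \<iota> surj Y f])
        fix v \<xi> assume v: "v \<in> Obj C" and \<xi>: "\<xi> \<in> carrier (dsum_at I X v)"
          and "dsum_lift_at I X v (mod_at L v) (\<lambda>i. cmp (\<iota> i) v) \<xi> = \<zero>\<^bsub>mod_at L v\<^esub>"
        then have R: "\<xi> \<in> rel v" using ker[OF v \<xi>] by simp
        show "dsum_lift_at I X v (mod_at Y v) (\<lambda>i. cmp (f i) v) \<xi> = \<zero>\<^bsub>mod_at Y v\<^esub>"
        proof (rule lift_rel[OF v module_at[OF Y' v] cmp_hom[OF f v] _ R])
          fix i j x assume ij: "(i, j) \<in> r" and x: "x \<in> carrier (mod_at (X i) v)"
          show "cmp (f j) v (cmp (\<phi> i j) v x) = cmp (f i) v x"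
            using cmp_Comp[OF \<phi>[OF ij] v x, of "f j"] f\<phi>[OF ij] by simp
        qed
      qed
    qed
  next
    fix v y assume v: "v \<in> Obj C" and "y \<in> carrier (mod_at L v)"
    then obtain \<xi> where \<xi>: "\<xi> \<in> carrier (dsum_at I X v)"
      "y = dsum_lift_at I X v (mod_at L v) (\<lambda>i. cmp (\<iota> i) v) \<xi>"
      unfolding surj[OF v, symmetric] by auto
    \<comment> \<open>The support is finite, so some stage lies above all of it and the whole family
      can be added up there.\<close>
    obtain k where k: "k \<in> I" "\<forall>i \<in> {i \<in> I. \<xi> i \<noteq> \<zero>\<^bsub>mod_at (X i) v\<^esub>}. (i, k) \<in> r"
      using directed_finite_bound[OF dir module_family.dsum_finite[OF fam[OF v] \<xi>(1)]] by auto
    then have "supp_below v k \<xi>" by (auto simp: supp_below_def below_def)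
    then have "y = cmp (\<iota> k) v (push v k \<xi>)"
      unfolding \<xi>(2) using lift_push[OF v module_at[OF L' v] k(1) cmp_hom[OF \<iota> v] \<iota>\<phi>[OF v] \<xi>(1)] by simp
    then show "\<exists>i \<in> I. \<exists>x \<in> carrier (mod_at (X i) v). y = cmp (\<iota> i) v x"
      using k(1) mod_hom_closed[OF push_hom[OF k(1) v] \<xi>(1)] by blast
  next
    fix v i x assume v: "v \<in> Obj C" and i: "i \<in> I" and x: "x \<in> carrier (mod_at (X i) v)"
      and 0: "cmp (\<iota> i) v x = \<zero>\<^bsub>mod_at L v\<^esub>"
    interpret F: module_family "ring_at R v" I "\<lambda>i. mod_at (X i) v" by (rule fam[OF v])
    have S: "dsum_in_at I X v i x \<in> carrier F.S" by (rule F.dsum_in_closed[OF i x])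
    have "dsum_lift_at I X v (mod_at L v) (\<lambda>i. cmp (\<iota> i) v) (dsum_in_at I X v i x) = \<zero>\<^bsub>mod_at L v\<^esub>"
      using F.dsum_lift_in[OF module_at[OF L' v] cmp_hom[OF \<iota> v] i x] 0 by simp
    then have "dsum_in_at I X v i x \<in> rel v" using ker[OF v S] by simp
    then obtain k where k: "k \<in> I" "supp_below v k (dsum_in_at I X v i x)"
      "push v k (dsum_in_at I X v i x) = \<zero>\<^bsub>mod_at (X k) v\<^esub>"
      by (auto simp: rel_def)
    show "\<exists>k. (i, k) \<in> r \<and> cmp (\<phi> i k) v x = \<zero>\<^bsub>mod_at (X k) v\<^esub>"
    \<comment> \<open>For \<open>x = 0\<close> the support is empty and \<open>k\<close> need not
      lie above \<open>i\<close>; otherwise \<open>i\<close> belongs to the support, which forces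
      \<open>(i, k) \<in> r\<close>.\<close>
    proof (cases "x = \<zero>\<^bsub>mod_at (X i) v\<^esub>")
      case True
      then show ?thesis using r_refl[OF i] \<phi>_refl[OF i v x] by auto
    next
      case False
      then have ik: "(i, k) \<in> r" using k(2) i by (auto simp: supp_below_def below_def dsum_in_def)
      then show ?thesis using k(3) push_in[OF k(1) v i x] by auto
    qed
  qed
qed

text \<open>Exactness is demanded for arbitrary choices of direct limits, so the elementwise
  description is carried from the constructed limit to any other along the comparison maps.\<close>

lemma direct_limit_pointwise:
  assumes lim: "is_direct_limit D I r X \<phi> L \<iota>"
  shows direct_limit_elem: "\<And>v y. v \<in> Obj C \<Longrightarrow> y \<in> carrier (mod_at L v) \<Longrightarrow>
      \<exists>i \<in> I. \<exists>x \<in> carrier (mod_at (X i) v). y = cmp (\<iota> i) v x"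
    and direct_limit_zero: "\<And>v i x. v \<in> Obj C \<Longrightarrow> i \<in> I \<Longrightarrow> x \<in> carrier (mod_at (X i) v) \<Longrightarrow>
      cmp (\<iota> i) v x = \<zero>\<^bsub>mod_at L v\<^esub> \<Longrightarrow> \<exists>k. (i, k) \<in> r \<and> cmp (\<phi> i k) v x = \<zero>\<^bsub>mod_at (X k) v\<^esub>"
proof -
  obtain L' \<iota>' where lim': "is_direct_limit D I r X \<phi> L' \<iota>'"
    and elem: "\<And>v y. v \<in> Obj C \<Longrightarrow> y \<in> carrier (mod_at L' v) \<Longrightarrow>
      \<exists>i \<in> I. \<exists>x \<in> carrier (mod_at (X i) v). y = cmp (\<iota>' i) v x"
    and zero: "\<And>v i x. v \<in> Obj C \<Longrightarrow> i \<in> I \<Longrightarrow> x \<in> carrier (mod_at (X i) v) \<Longrightarrow>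
      cmp (\<iota>' i) v x = \<zero>\<^bsub>mod_at L' v\<^esub> \<Longrightarrow> \<exists>k. (i, k) \<in> r \<and> cmp (\<phi> i k) v x = \<zero>\<^bsub>mod_at (X k) v\<^esub>"
    by (rule direct_limit_exists) (rule that)
  have coc: "cocone D I r X \<phi> L \<iota>" and coc': "cocone D I r X \<phi> L' \<iota>'"
    using lim lim' by (simp_all add: is_direct_limit_def)
  have Lc: "cart_mod L" and \<iota>: "\<And>i. i \<in> I \<Longrightarrow> \<iota> i \<in> Hom D (X i) L"
    using coc by (simp_all add: cocone_def D_simps(1))
  have \<iota>': "\<And>i. i \<in> I \<Longrightarrow> \<iota>' i \<in> Hom D (X i) L'" using coc' by (simp add: cocone_def)
  have "\<exists>!u. u \<in> Hom D L L' \<and> (\<forall>i \<in> I. Comp D u (\<iota> i) = \<iota>' i)"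
    using lim coc' unfolding is_direct_limit_def by (elim conjE allE impE)
  then obtain u where u: "u \<in> Hom D L L'" "\<And>i. i \<in> I \<Longrightarrow> Comp D u (\<iota> i) = \<iota>' i" by blast
  have "\<exists>!u. u \<in> Hom D L' L \<and> (\<forall>i \<in> I. Comp D u (\<iota>' i) = \<iota> i)"
    using lim' coc unfolding is_direct_limit_def by (elim conjE allE impE)
  then obtain u' where u': "u' \<in> Hom D L' L" "\<And>i. i \<in> I \<Longrightarrow> Comp D u' (\<iota>' i) = \<iota> i" by blast
  have "\<exists>!w. w \<in> Hom D L L \<and> (\<forall>i \<in> I. Comp D w (\<iota> i) = \<iota> i)"
    using lim coc unfolding is_direct_limit_def by (elim conjE allE impE)
  moreover have "Comp D u' u \<in> Hom D L L \<and> (\<forall>i \<in> I. Comp D (Comp D u' u) (\<iota> i) = \<iota> i)"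
    using category.Comp_assoc[OF category_D \<iota> u(1) u'(1)] u u' Comp_in_Hom[OF u(1) u'(1)] by simp
  moreover have "Ident D L \<in> Hom D L L \<and> (\<forall>i \<in> I. Comp D (Ident D L) (\<iota> i) = \<iota> i)"
    using Ident_in_Hom[OF Lc] category.Ident_left[OF category_D \<iota>] by simp
  ultimately have id: "Comp D u' u = Ident D L" by (elim ex1E) metis
  have u\<iota>: "cmp u v (cmp (\<iota> i) v x) = cmp (\<iota>' i) v x" and u'\<iota>: "cmp u' v (cmp (\<iota>' i) v x) = cmp (\<iota> i) v x"
    if "v \<in> Obj C" "i \<in> I" "x \<in> carrier (mod_at (X i) v)" for v i x
    using cmp_Comp[OF \<iota>[OF that(2)] that(1,3), of u] cmp_Comp[OF \<iota>'[OF that(2)] that(1,3), of u'] u(2) u'(2) that(2)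
    by simp_all
  show "\<exists>i \<in> I. \<exists>x \<in> carrier (mod_at (X i) v). y = cmp (\<iota> i) v x"
    if v: "v \<in> Obj C" and y: "y \<in> carrier (mod_at L v)" for v y
  proof -
    obtain i x where ix: "i \<in> I" "x \<in> carrier (mod_at (X i) v)" "cmp u v y = cmp (\<iota>' i) v x"
      using elem[OF v cmp_closed[OF u(1) v y]] by auto
    have "y = cmp u' v (cmp u v y)"
      using cmp_Comp[OF u(1) v y, of u'] cmp_Ident[OF v y] by (simp add: id)
    then have "y = cmp (\<iota> i) v x" using ix u'\<iota>[OF v ix(1,2)] by simp
    then show ?thesis using ix by blast
  qed
  show "\<exists>k. (i, k) \<in> r \<and> cmp (\<phi> i k) v x = \<zero>\<^bsub>mod_at (X k) v\<^esub>"
    if v: "v \<in> Obj C" and i: "i \<in> I" and x: "x \<in> carrier (mod_at (X i) v)"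
      and 0: "cmp (\<iota> i) v x = \<zero>\<^bsub>mod_at L v\<^esub>" for v i x
    by (rule zero[OF v i x]) (use u\<iota>[OF v i x] 0 cmp_zero[OF u(1) v] in simp)
qed

end

context flat_presheaf_data
begin

lemma cartesian_direct_systemI:
  "small \<kappa> I \<Longrightarrow> directed_set I r \<Longrightarrow> direct_system D I r X \<phi> \<Longrightarrow> cartesian_direct_system \<kappa> C R I r X \<phi>"
  by (intro cartesian_direct_system.intro cartesian_direct_system_axioms.intro flat_presheaf_data_axioms)

lemma has_direct_limits_D: "has_direct_limits \<kappa> D"
  unfolding has_direct_limits_def
proof (intro allI impI)
  fix I :: "'u set" and r X \<phi>
  assume "small \<kappa> I \<and> directed_set I r \<and> direct_system D I r X \<phi>"
  then interpret cartesian_direct_system \<kappa> C R I r X \<phi> by (intro cartesian_direct_systemI) auto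
  show "\<exists>l \<iota>. is_direct_limit D I r X \<phi> l \<iota>" by (rule direct_limit_exists) (intro exI)
qed

text \<open>An element of a limit comes from some stage, and one that vanishes in the limit vanishes
  at a later stage. The usual chase follows, with short exactness applied at the later stage
  whenever a vanishing is used.\<close>

lemma direct_limits_exact_D: "direct_limits_exact \<kappa> D"
  unfolding direct_limits_exact_def
proof (intro allI impI, elim conjE)
  fix I :: "'u set" and r X \<phi> Y \<psi> Z \<chi> \<alpha> \<beta> x \<iota>x y \<iota>y z \<iota>z a b
  assume I: "small \<kappa> I" and dir: "directed_set I r"
    and sX: "direct_system D I r X \<phi>" and sY: "direct_system D I r Y \<psi>" and sZ: "direct_system D I r Z \<chi>"
    and \<alpha>: "direct_system_hom D I r X \<phi> Y \<psi> \<alpha>" and \<beta>: "direct_system_hom D I r Y \<psi> Z \<chi> \<beta>"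
    and ex: "\<forall>i \<in> I. short_exact D (\<alpha> i) (\<beta> i)"
    and lx: "is_direct_limit D I r X \<phi> x \<iota>x" and ly: "is_direct_limit D I r Y \<psi> y \<iota>y"
    and lz: "is_direct_limit D I r Z \<chi> z \<iota>z"
    and a: "a \<in> Hom D x y" "\<forall>i \<in> I. Comp D a (\<iota>x i) = Comp D (\<iota>y i) (\<alpha> i)"
    and b: "b \<in> Hom D y z" "\<forall>i \<in> I. Comp D b (\<iota>y i) = Comp D (\<iota>z i) (\<beta> i)"
  interpret X: cartesian_direct_system \<kappa> C R I r X \<phi> by (rule cartesian_direct_systemI[OF I dir sX])
  interpret Y: cartesian_direct_system \<kappa> C R I r Y \<psi> by (rule cartesian_direct_systemI[OF I dir sY])
  interpret Z: cartesian_direct_system \<kappa> C R I r Z \<chi> by (rule cartesian_direct_systemI[OF I dir sZ])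
  have \<iota>x: "\<iota>x i \<in> Hom D (X i) x" and \<iota>y: "\<iota>y i \<in> Hom D (Y i) y" and \<iota>z: "\<iota>z i \<in> Hom D (Z i) z"
    if "i \<in> I" for i
    using lx ly lz that by (simp_all add: is_direct_limit_def cocone_def)
  have xc: "psh_mod x" and yc: "psh_mod y" and zc: "psh_mod z" using Hom_cart[OF a(1)] Hom_cart[OF b(1)] by auto
  have \<alpha>H: "\<alpha> i \<in> Hom D (X i) (Y i)" and \<beta>H: "\<beta> i \<in> Hom D (Y i) (Z i)" if "i \<in> I" for i
    using \<alpha> \<beta> that by (simp_all add: direct_system_hom_def)
  have \<alpha>n: "cmp (\<alpha> j) v (cmp (\<phi> i j) v s) = cmp (\<psi> i j) v (cmp (\<alpha> i) v s)"
    if ij: "(i, j) \<in> r" and s: "v \<in> Obj C" "s \<in> carrier (mod_at (X i) v)" for i j v s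
  proof -
    have "Comp D (\<alpha> j) (\<phi> i j) = Comp D (\<psi> i j) (\<alpha> i)" using \<alpha> ij by (simp add: direct_system_hom_def)
    then show ?thesis
      using cmp_Comp[OF X.\<phi>[OF ij] s, of "\<alpha> j"] cmp_Comp[OF \<alpha>H s, of "\<psi> i j"] X.r_sub[OF ij] by simp
  qed
  have \<beta>n: "cmp (\<beta> j) v (cmp (\<psi> i j) v s) = cmp (\<chi> i j) v (cmp (\<beta> i) v s)"
    if ij: "(i, j) \<in> r" and s: "v \<in> Obj C" "s \<in> carrier (mod_at (Y i) v)" for i j v s
  proof -
    have "Comp D (\<beta> j) (\<psi> i j) = Comp D (\<chi> i j) (\<beta> i)" using \<beta> ij by (simp add: direct_system_hom_def)
    then show ?thesis
      using cmp_Comp[OF Y.\<phi>[OF ij] s, of "\<beta> j"] cmp_Comp[OF \<beta>H s, of "\<chi> i j"] X.r_sub[OF ij] by simp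
  qed
  have an: "cmp a v (cmp (\<iota>x i) v s) = cmp (\<iota>y i) v (cmp (\<alpha> i) v s)"
    if i: "i \<in> I" and s: "v \<in> Obj C" "s \<in> carrier (mod_at (X i) v)" for i v s
    using cmp_Comp[OF \<iota>x[OF i] s, of a] cmp_Comp[OF \<alpha>H[OF i] s, of "\<iota>y i"] a(2) i by simp
  have bn: "cmp b v (cmp (\<iota>y i) v s) = cmp (\<iota>z i) v (cmp (\<beta> i) v s)"
    if i: "i \<in> I" and s: "v \<in> Obj C" "s \<in> carrier (mod_at (Y i) v)" for i v s
    using cmp_Comp[OF \<iota>y[OF i] s, of b] cmp_Comp[OF \<beta>H[OF i] s, of "\<iota>z i"] b(2) i by simp
  have \<iota>xn: "cmp (\<iota>x j) v (cmp (\<phi> i j) v s) = cmp (\<iota>x i) v s"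
    if ij: "(i, j) \<in> r" and s: "v \<in> Obj C" "s \<in> carrier (mod_at (X i) v)" for i j v s
  proof -
    have "Comp D (\<iota>x j) (\<phi> i j) = \<iota>x i" using lx ij by (simp add: is_direct_limit_def cocone_def)
    then show ?thesis using cmp_Comp[OF X.\<phi>[OF ij] s, of "\<iota>x j"] by simp
  qed
  have \<iota>yn: "cmp (\<iota>y j) v (cmp (\<psi> i j) v s) = cmp (\<iota>y i) v s"
    if ij: "(i, j) \<in> r" and s: "v \<in> Obj C" "s \<in> carrier (mod_at (Y i) v)" for i j v s
  proof -
    have "Comp D (\<iota>y j) (\<psi> i j) = \<iota>y i" using ly ij by (simp add: is_direct_limit_def cocone_def)
    then show ?thesis using cmp_Comp[OF Y.\<phi>[OF ij] s, of "\<iota>y j"] by simp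
  qed
  have inj_\<alpha>: "inj_on (cmp (\<alpha> i) v) (carrier (mod_at (X i) v))"
    and img_\<alpha>: "img_at (\<alpha> i) v = ker_at (\<beta> i) v" and img_\<beta>: "img_at (\<beta> i) v = carrier (mod_at (Z i) v)"
    if "i \<in> I" "v \<in> Obj C" for i v
    using ex that short_exact_iff[OF \<alpha>H \<beta>H] by auto
  show "short_exact D a b"
    unfolding short_exact_iff[OF a(1) b(1)]
  proof (intro ballI conjI)
    fix v assume v: "v \<in> Obj C"
    show "inj_on (cmp a v) (carrier (mod_at x v))"
      unfolding mod_hom_inj_iff[OF module_at[OF xc v] module_at[OF yc v] cmp_hom[OF a(1) v]]
    proof (intro ballI impI)
      fix e assume e: "e \<in> carrier (mod_at x v)" "cmp a v e = \<zero>\<^bsub>mod_at y v\<^esub>"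
      obtain i s where s: "i \<in> I" "s \<in> carrier (mod_at (X i) v)" "e = cmp (\<iota>x i) v s"
        using X.direct_limit_elem[OF lx v e(1)] by auto
      then have "cmp (\<iota>y i) v (cmp (\<alpha> i) v s) = \<zero>\<^bsub>mod_at y v\<^esub>" using e(2) an[OF s(1) v s(2)] by simp
      \<comment> \<open>The image of \<open>s\<close> in \<open>Y i\<close> need not be zero; it
        becomes zero at a later stage \<open>k\<close>, and injectivity is applied there.\<close>
      then obtain k where k: "(i, k) \<in> r" "cmp (\<psi> i k) v (cmp (\<alpha> i) v s) = \<zero>\<^bsub>mod_at (Y k) v\<^esub>"
        using Y.direct_limit_zero[OF ly v s(1) cmp_closed[OF \<alpha>H[OF s(1)] v s(2)]] by auto
      have kI: "k \<in> I" using X.r_sub[OF k(1)] by simp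
      have "cmp (\<alpha> k) v (cmp (\<phi> i k) v s) = \<zero>\<^bsub>mod_at (Y k) v\<^esub>" using k(2) \<alpha>n[OF k(1) v s(2)] by simp
      then have "cmp (\<phi> i k) v s = \<zero>\<^bsub>mod_at (X k) v\<^esub>"
        using inj_\<alpha>[OF kI v] cmp_closed[OF X.\<phi>[OF k(1)] v s(2)]
        unfolding mod_hom_inj_iff[OF module_at[OF X.X'[OF kI] v] module_at[OF Y.X'[OF kI] v] cmp_hom[OF \<alpha>H[OF kI] v]]
        by blast
      then show "e = \<zero>\<^bsub>mod_at x v\<^esub>"
        using \<iota>xn[OF k(1) v s(2)] cmp_zero[OF \<iota>x[OF kI] v] s(3) by simp
    qed
    have "img_at a v \<subseteq> ker_at b v"
      unfolding img_at_def ker_at_def Hom_fst[OF a(1)] Hom_fst[OF b(1)]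
    proof (rule image_subsetI, rule CollectI, rule conjI)
      fix e assume e: "e \<in> carrier (mod_at x v)"
      show "cmp a v e \<in> carrier (mod_at y v)" by (rule cmp_closed[OF a(1) v e])
      obtain i s where s: "i \<in> I" "s \<in> carrier (mod_at (X i) v)" "e = cmp (\<iota>x i) v s"
        using X.direct_limit_elem[OF lx v e] by auto
      have "cmp (\<alpha> i) v s \<in> img_at (\<alpha> i) v" using s by (simp add: img_at_def Hom_fst[OF \<alpha>H])
      then have "cmp (\<beta> i) v (cmp (\<alpha> i) v s) = \<zero>\<^bsub>mod_at (Z i) v\<^esub>"
        using s(1) v by (simp add: img_\<alpha> ker_at_def Hom_fst[OF \<beta>H])
      then show "cmp b v (cmp a v e) = \<zero>\<^bsub>mod_at z v\<^esub>"
        using s an[OF s(1) v s(2)] bn[OF s(1) v cmp_closed[OF \<alpha>H[OF s(1)] v s(2)]] cmp_zero[OF \<iota>z[OF s(1)] v]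
        by simp
    qed
    moreover have "ker_at b v \<subseteq> img_at a v"
    proof
      fix e assume "e \<in> ker_at b v"
      then have e: "e \<in> carrier (mod_at y v)" "cmp b v e = \<zero>\<^bsub>mod_at z v\<^esub>"
        by (auto simp: ker_at_def Hom_fst[OF b(1)])
      obtain i t where t: "i \<in> I" "t \<in> carrier (mod_at (Y i) v)" "e = cmp (\<iota>y i) v t"
        using Y.direct_limit_elem[OF ly v e(1)] by auto
      then have "cmp (\<iota>z i) v (cmp (\<beta> i) v t) = \<zero>\<^bsub>mod_at z v\<^esub>" using e(2) bn[OF t(1) v t(2)] by simp
      \<comment> \<open>The image of \<open>t\<close> dies only at a later stage \<open>k\<close>,
        so the preimage under \<alpha> is taken at \<open>k\<close> and not at
        \<open>i\<close>.\<close>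
      then obtain k where k: "(i, k) \<in> r" "cmp (\<chi> i k) v (cmp (\<beta> i) v t) = \<zero>\<^bsub>mod_at (Z k) v\<^esub>"
        using Z.direct_limit_zero[OF lz v t(1) cmp_closed[OF \<beta>H[OF t(1)] v t(2)]] by auto
      have kI: "k \<in> I" using X.r_sub[OF k(1)] by simp
      have "cmp (\<psi> i k) v t \<in> ker_at (\<beta> k) v"
        using k(2) \<beta>n[OF k(1) v t(2)] cmp_closed[OF Y.\<phi>[OF k(1)] v t(2)]
        by (simp add: ker_at_def Hom_fst[OF \<beta>H[OF kI]])
      then obtain s where s: "s \<in> carrier (mod_at (X k) v)" "cmp (\<psi> i k) v t = cmp (\<alpha> k) v s"
        unfolding img_\<alpha>[OF kI v, symmetric] by (auto simp: img_at_def Hom_fst[OF \<alpha>H[OF kI]])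
      have "e = cmp a v (cmp (\<iota>x k) v s)"
        using t(3) \<iota>yn[OF k(1) v t(2)] s(2) an[OF kI v s(1)] by simp
      then show "e \<in> img_at a v"
        using cmp_closed[OF \<iota>x[OF kI] v s(1)] by (simp add: img_at_def Hom_fst[OF a(1)])
    qed
    ultimately show "img_at a v = ker_at b v" by (rule subset_antisym)
    have "carrier (mod_at z v) \<subseteq> img_at b v"
    proof
      fix e assume e: "e \<in> carrier (mod_at z v)"
      obtain i t where t: "i \<in> I" "t \<in> carrier (mod_at (Z i) v)" "e = cmp (\<iota>z i) v t"
        using Z.direct_limit_elem[OF lz v e] by auto
      then obtain s where s: "s \<in> carrier (mod_at (Y i) v)" "t = cmp (\<beta> i) v s"
        unfolding img_\<beta>[OF t(1) v, symmetric] by (auto simp: img_at_def Hom_fst[OF \<beta>H[OF t(1)]])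
      have "e = cmp b v (cmp (\<iota>y i) v s)" using t(3) s bn[OF t(1) v s(1)] by simp
      then show "e \<in> img_at b v"
        using cmp_closed[OF \<iota>y[OF t(1)] v s(1)] by (simp add: img_at_def Hom_fst[OF b(1)])
    qed
    moreover have "img_at b v \<subseteq> carrier (mod_at z v)"
      using cmp_closed[OF b(1) v] by (auto simp: img_at_def Hom_fst[OF b(1)])
    ultimately show "img_at b v = carrier (mod_at z v)" by (rule subset_antisym[rotated])
  qed
qed

end

section \<open>A generator\<close>

context flat_presheaf_data
begin

lemma infinite_data_set: "infinite data_set"
  by (simp add: finite_Plus_iff)

lemma card_data_set_Times:
  "|A| \<le>o |data_set| \<Longrightarrow> |B| \<le>o |data_set| \<Longrightarrow> |A \<times> B| \<le>o |data_set|"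
  using card_of_Sigma_ordLeq_infinite[OF infinite_data_set, of A "\<lambda>_. B"] by simp

text \<open>Finitely many elements would do; a sequence is easier to choose and to index.\<close>

definition spanning :: "('o, 'a, 'r, 'u) mod_psh \<Rightarrow> 'a \<Rightarrow> 'u \<Rightarrow> (nat \<Rightarrow> 'u) \<Rightarrow> bool" where
  "spanning M a y f \<longleftrightarrow> range f \<subseteq> carrier (mod_at M (Cod C a)) \<and>
    (\<forall>Z. submodule Z (ring_at R (Dom C a)) (mod_at M (Dom C a)) \<longrightarrow> (\<forall>n. mod_res M a (f n) \<in> Z) \<longrightarrow> y \<in> Z)"

text \<open>\<open>y\<close> is the image of a tensor. For a pure tensor a single restriction
  suffices, taken as a constant sequence; for a sum the sequences of the two summands are
  interleaved.\<close>

lemma spanning_exists: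
  assumes M: "cart_mod M" and a: "a \<in> Arr C" and y: "y \<in> carrier (mod_at M (Dom C a))"
  shows "\<exists>f. spanning M a y f"
proof -
  have M': "psh_mod M" using M by simp
  have v: "Dom C a \<in> Obj C" and w: "Cod C a \<in> Obj C" using a by auto
  note Mv = module_at[OF M' v] and Mw = module_at[OF M' w]
  interpret S: scalar_extension "ring_at R (Cod C a)" "ring_at R (Dom C a)" "ring_res R a" "mod_at M (Cod C a)"
    by (rule scalar_extension_at[OF a Mw])
  interpret Mv: module "ring_at R (Dom C a)" "mod_at M (Dom C a)" by (rule Mv)
  note j = res_hom[OF M' a]
  have "\<exists>f. spanning M a (adj (mod_at M (Dom C a)) (mod_res M a) t) f"
    if "t \<in> carrier (tensor_at a (mod_at M (Cod C a)))" for t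
    using that
  proof (induction t rule: S.ext_induct)
    case (pure x m)
    have "x \<odot>\<^bsub>mod_at M (Dom C a)\<^esub> mod_res M a m \<in> Z"
      if "submodule Z (ring_at R (Dom C a)) (mod_at M (Dom C a))" "mod_res M a m \<in> Z" for Z
      using Mv.submoduleE(4)[OF that(1) pure(1) that(2)] .
    then show ?case
      using pure by (intro exI[of _ "\<lambda>_. m"]) (simp add: spanning_def S.adjoint_pure[OF Mv j])
  next
    case (add s t)
    then obtain f g where f: "spanning M a (adj (mod_at M (Dom C a)) (mod_res M a) s) f"
      and g: "spanning M a (adj (mod_at M (Dom C a)) (mod_res M a) t) g" by blast
    define h where "h n = (if even n then f (n div 2) else g (n div 2))" for n :: nat
    have h: "h (2 * n) = f n" "h (Suc (2 * n)) = g n" for n by (simp_all add: h_def)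
    have "spanning M a (adj (mod_at M (Dom C a)) (mod_res M a) s \<oplus>\<^bsub>mod_at M (Dom C a)\<^esub>
        adj (mod_at M (Dom C a)) (mod_res M a) t) h"
      unfolding spanning_def
    proof (intro conjI allI impI)
      show "range h \<subseteq> carrier (mod_at M (Cod C a))"
        using f g by (auto simp: spanning_def h_def)
      fix Z assume Z: "submodule Z (ring_at R (Dom C a)) (mod_at M (Dom C a))"
        and hZ: "\<forall>n. mod_res M a (h n) \<in> Z"
      have "mod_res M a (f n) \<in> Z" "mod_res M a (g n) \<in> Z" for n
        using hZ[rule_format, of "2 * n"] hZ[rule_format, of "Suc (2 * n)"] by (simp_all add: h)
      then show "adj (mod_at M (Dom C a)) (mod_res M a) s \<oplus>\<^bsub>mod_at M (Dom C a)\<^esub>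
          adj (mod_at M (Dom C a)) (mod_res M a) t \<in> Z"
        using f g Z by (intro Mv.submoduleE(5)[OF Z]) (simp_all add: spanning_def)
    qed
    then show ?case using add by (auto simp: S.adjoint_add[OF Mv j])
  qed
  moreover obtain t where "t \<in> carrier (tensor_at a (mod_at M (Cod C a)))"
    "y = adj (mod_at M (Dom C a)) (mod_res M a) t"
  proof -
    have "adj (mod_at M (Dom C a)) (mod_res M a) ` carrier (tensor_at a (mod_at M (Cod C a))) =
        carrier (mod_at M (Dom C a))"
      using M a cartesian_iff[OF M'] by (auto simp: bij_betw_def)
    then have "y \<in> adj (mod_at M (Dom C a)) (mod_res M a) ` carrier (tensor_at a (mod_at M (Cod C a)))"
      using y by simp
    then show thesis by (elim imageE) (rule that)
  qed
  ultimately show ?thesis by simp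
qed

text \<open>
  The operations under which the elements of a cartesian submodule must be closed: restriction
  (\<open>n = 0\<close>), passing to a spanning sequence (\<open>n > 0\<close>), and linear combination.
\<close>

fun sub_op where
  "sub_op M (Inl a, Inr (Inr n)) p q =
    (if n = 0 then if fst p = Cod C a then (Dom C a, mod_res M a (snd p)) else p
     else if fst p = Dom C a then (Cod C a, (SOME f. spanning M a (snd p) f) (n - 1)) else p)"
| "sub_op M (Inr (Inl (v, s)), _) p q =
    (if fst p = v \<and> fst q = v then (v, s \<odot>\<^bsub>mod_at M v\<^esub> snd p \<oplus>\<^bsub>mod_at M v\<^esub> snd q) else p)"
| "sub_op M _ p q = p"

text \<open>A Loewenheim-Skolem argument. Restrictions and spanning sequences lead from one object
  to another, so a single closure is formed on pairs of an object and an element, and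
  \<open>H\<close> collects its fibres.\<close>

lemma small_cartesian_submodule:
  assumes M: "cart_mod M" and v0: "v0 \<in> Obj C" and x0: "x0 \<in> carrier (mod_at M v0)"
  obtains H where "\<And>v. v \<in> Obj C \<Longrightarrow> H v \<subseteq> carrier (mod_at M v)" "cart_mod (sub_psh M H)" "x0 \<in> H v0"
    "\<And>v. |H v| \<le>o |data_set|"
proof -
  have M': "psh_mod M" using M by simp
  define K where "K = data_set \<times> data_set"
  \<comment> \<open>With a zero over every object, scalar multiples are special linear combinations,
    so one kind of operation makes all fibres submodules.\<close>
  define G where "G = insert (v0, x0) ((\<lambda>v. (v, \<zero>\<^bsub>mod_at M v\<^esub>)) ` Obj C)"
  define cl where "cl = op_closure K (sub_op M) G"
  define H where "H v = {y. (v, y) \<in> cl}" for v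
  have sp: "spanning M a y (SOME f. spanning M a y f)" if "a \<in> Arr C" "y \<in> carrier (mod_at M (Dom C a))" for a y
    using someI_ex[OF spanning_exists[OF M that]] .
  have inv: "fst p \<in> Obj C \<and> snd p \<in> carrier (mod_at M (fst p))" if "p \<in> cl" for p
    using that unfolding cl_def
  proof (induction rule: op_closure.induct)
    case (base p)
    then show ?case
    proof (cases "p = (v0, x0)")
      case False
      then obtain v where v: "v \<in> Obj C" "p = (v, \<zero>\<^bsub>mod_at M v\<^esub>)" using base by (auto simp: G_def)
      interpret module "ring_at R v" "mod_at M v" by (rule module_at[OF M' v(1)])
      show ?thesis using v by simp
    qed (use v0 x0 in simp)
  next
    case (op k p q)
    show ?case
    proof (cases "(M, k, p, q)" rule: sub_op.cases)
      case (1 M0 a n p0 q0)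
      then have k: "k = (Inl a, Inr (Inr n))" and a: "a \<in> Arr C" using op(1) by (auto simp: K_def)
      show ?thesis
      proof (cases "n = 0")
        case True
        then show ?thesis using op a by (auto simp: k intro!: res_closed[OF M'])
      next
        case False
        have "(SOME f. spanning M a (snd p) f) (n - 1) \<in> carrier (mod_at M (Cod C a))" if "fst p = Dom C a"
        proof -
          have "snd p \<in> carrier (mod_at M (Dom C a))" using op(4) that by simp
          from sp[OF a this] show ?thesis unfolding spanning_def by blast
        qed
        then show ?thesis using op(4) a False by (simp add: k)
      qed
    next
      case (2 M0 v s d p0 q0)
      then have k: "k = (Inr (Inl (v, s)), d)" and v: "v \<in> Obj C" "s \<in> carrier (ring_at R v)"
        using op(1) by (auto simp: K_def)
      interpret module "ring_at R v" "mod_at M v" by (rule module_at[OF M' v(1)])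
      show ?thesis
      proof (cases "fst p = v \<and> fst q = v")
        case True
        then have "snd p \<in> carrier (mod_at M v)" "snd q \<in> carrier (mod_at M v)" using op by auto
        then show ?thesis using True v by (simp add: k)
      qed (use op in \<open>auto simp: k\<close>)
    qed (use op in simp_all)
  qed
  have HM: "H v \<subseteq> carrier (mod_at M v)" for v
    using inv by (fastforce simp: H_def)
  have zero: "\<zero>\<^bsub>mod_at M v\<^esub> \<in> H v" if "v \<in> Obj C" for v
    unfolding H_def cl_def by (rule CollectI, rule op_closure.base) (use that in \<open>simp add: G_def\<close>)
  have lin: "s \<odot>\<^bsub>mod_at M v\<^esub> y \<oplus>\<^bsub>mod_at M v\<^esub> z \<in> H v"
    if "v \<in> Obj C" "s \<in> carrier (ring_at R v)" "y \<in> H v" "z \<in> H v" for v s y z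
    using op_closure.op[of "(Inr (Inl (v, s)), Inr (Inr 0))" K "(v, y)" "sub_op M" G "(v, z)"] that
    by (auto simp: H_def cl_def K_def)
  have sub: "submodule (H v) (ring_at R v) (mod_at M v)" if v: "v \<in> Obj C" for v
  proof -
    interpret module "ring_at R v" "mod_at M v" by (rule module_at[OF M' v])
    have smult: "s \<odot>\<^bsub>mod_at M v\<^esub> y \<in> H v" if "s \<in> carrier (ring_at R v)" "y \<in> H v" for s y
      using lin[OF v that zero[OF v]] that HM[of v] by auto
    show ?thesis
    proof (rule submoduleI[OF HM zero[OF v]])
      show "\<ominus>\<^bsub>mod_at M v\<^esub> y \<in> H v" if y: "y \<in> H v" for y
        using smult[OF _ y, of "\<ominus>\<^bsub>ring_at R v\<^esub> \<one>\<^bsub>ring_at R v\<^esub>"] smult_l_minus[OF R.one_closed, of y] y HM[of v]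
        by auto
      show "y \<oplus>\<^bsub>mod_at M v\<^esub> z \<in> H v" if y: "y \<in> H v" and z: "z \<in> H v" for y z
        using lin[OF v R.one_closed y z] y HM[of v] by auto
    qed (rule smult)
  qed
  have res: "mod_res M a m \<in> H (Dom C a)" if "a \<in> Arr C" "m \<in> H (Cod C a)" for a m
    using op_closure.op[of "(Inl a, Inr (Inr 0))" K "(Cod C a, m)" "sub_op M" G "(Cod C a, m)"] that
    by (auto simp: H_def cl_def K_def)
  \<comment> \<open>Index 0 stands for restriction, so the member number \<open>n\<close> of the
    spanning sequence is reached with \<open>Suc n\<close>.\<close>
  have wit: "(SOME f. spanning M a y f) n \<in> H (Cod C a)" if "a \<in> Arr C" "y \<in> H (Dom C a)" for a y n
    using op_closure.op[of "(Inl a, Inr (Inr (Suc n)))" K "(Dom C a, y)" "sub_op M" G "(Dom C a, y)"] that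
    by (auto simp: H_def cl_def K_def)
  have cart: "cart_mod (sub_psh M H)"
  proof (rule sub_psh_cartesian[OF M sub res])
    fix a y Z assume a: "a \<in> Arr C" and y: "y \<in> H (Dom C a)"
      and Z: "submodule Z (ring_at R (Dom C a)) (mod_at M (Dom C a))" and img: "mod_res M a ` H (Cod C a) \<subseteq> Z"
    have "mod_res M a ((SOME f. spanning M a y f) n) \<in> Z" for n
      using img wit[OF a y, of n] by (rule subsetD[OF _ imageI])
    then show "y \<in> Z" using sp[OF a subsetD[OF HM y]] Z unfolding spanning_def by blast
  qed
  have "|cl| \<le>o |data_set|"
    unfolding cl_def
  proof (rule card_of_op_closure[OF infinite_data_set])
    show "|K| \<le>o |data_set|" unfolding K_def by (intro card_data_set_Times ordLeq_refl card_of_Card_order)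
    \<comment> \<open>Objects do not occur in \<open>data_set\<close> by themselves; the object
      \<open>v\<close> is represented there by the zero of \<open>R(v)\<close>.\<close>
    let ?g = "\<lambda>d. case d of Inr (Inl (v, s)) \<Rightarrow> (v, \<zero>\<^bsub>mod_at M v\<^esub>) | _ \<Rightarrow> (v0, x0)"
    have "G \<subseteq> ?g ` data_set"
    proof
      fix p assume "p \<in> G"
      then consider "p = (v0, x0)" | v where "v \<in> Obj C" "p = (v, \<zero>\<^bsub>mod_at M v\<^esub>)" by (auto simp: G_def)
      then show "p \<in> ?g ` data_set"
      proof cases
        case 1
        then show ?thesis by (intro image_eqI[of _ _ "Inr (Inr 0)"]) auto
      next
        case 2
        interpret cring "ring_at R v" by (rule cring_at[OF 2(1)])
        show ?thesis using 2 by (intro image_eqI[of _ _ "Inr (Inl (v, \<zero>\<^bsub>ring_at R v\<^esub>))"]) auto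
      qed
    qed
    then show "|G| \<le>o |data_set|" by (rule surj_imp_ordLeq)
  qed
  moreover have "|H v| \<le>o |cl|" for v
    by (rule surj_imp_ordLeq[of _ snd]) (force simp: H_def)
  ultimately have card: "|H v| \<le>o |data_set|" for v using ordLeq_transitive by blast
  have "x0 \<in> H v0" unfolding H_def cl_def by (rule CollectI, rule op_closure.base) (simp add: G_def)
  then show thesis by (rule that[OF HM cart _ card])
qed

section \<open>Counting bounded cartesian modules\<close>

definition bounded :: "('o, 'a, 'r, 'u) mod_psh set" where
  "bounded = {M. cart_mod M \<and> (\<forall>v \<in> Obj C. |carrier (mod_at M v)| \<le>o |data_set| )}"

text \<open>An arbitrary numbering of the elements by members of \<open>data_set\<close>, available
  for bounded modules. Structure transported along it can be compared inside one fixed set, whatever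
  elements of \<open>'u\<close> the modules consist of.\<close>

definition enc :: "('o, 'a, 'r, 'u) mod_psh \<Rightarrow> 'o \<Rightarrow> 'u \<Rightarrow> 'a + ('o \<times> 'r) + nat" where
  "enc M v = (SOME e. inj_on e (carrier (mod_at M v)) \<and> e ` carrier (mod_at M v) \<subseteq> data_set)"

lemma enc:
  assumes "M \<in> bounded" "v \<in> Obj C"
  shows "inj_on (enc M v) (carrier (mod_at M v))" "\<And>x. x \<in> carrier (mod_at M v) \<Longrightarrow> enc M v x \<in> data_set"
proof -
  have "|carrier (mod_at M v)| \<le>o |data_set|" using assms by (simp add: bounded_def)
  then have "\<exists>e. inj_on e (carrier (mod_at M v)) \<and> e ` carrier (mod_at M v) \<subseteq> data_set"
    unfolding card_of_ordLeq .
  from someI_ex[OF this] have "inj_on (enc M v) (carrier (mod_at M v)) \<and> enc M v ` carrier (mod_at M v) \<subseteq> data_set"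
    unfolding enc_def .
  then show "inj_on (enc M v) (carrier (mod_at M v))"
    "\<And>x. x \<in> carrier (mod_at M v) \<Longrightarrow> enc M v x \<in> data_set" by auto
qed

text \<open>
  Bounded modules with the same code are isomorphic, and the codes are subsets of one fixed set. The
  second copy in \<open>code_res\<close> only pads the tuples to a common length.
\<close>

definition code_lin :: "('o, 'a, 'r, 'u) mod_psh \<Rightarrow> (('a + ('o \<times> 'r) + nat) \<times> ('a + ('o \<times> 'r) + nat) \<times>
    ('a + ('o \<times> 'r) + nat) \<times> ('a + ('o \<times> 'r) + nat)) set" where
  "code_lin M = {(Inr (Inl (v, s)), enc M v y, enc M v z, enc M v (s \<odot>\<^bsub>mod_at M v\<^esub> y \<oplus>\<^bsub>mod_at M v\<^esub> z)) |v s y z.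
    v \<in> Obj C \<and> s \<in> carrier (ring_at R v) \<and> y \<in> carrier (mod_at M v) \<and> z \<in> carrier (mod_at M v)}"

definition code_res :: "('o, 'a, 'r, 'u) mod_psh \<Rightarrow> (('a + ('o \<times> 'r) + nat) \<times> ('a + ('o \<times> 'r) + nat) \<times>
    ('a + ('o \<times> 'r) + nat) \<times> ('a + ('o \<times> 'r) + nat)) set" where
  "code_res M = {(Inl a, enc M (Cod C a) y, enc M (Cod C a) y, enc M (Dom C a) (mod_res M a y)) |a y.
    a \<in> Arr C \<and> y \<in> carrier (mod_at M (Cod C a))}"

definition code where "code M = code_lin M \<union> code_res M"

lemma code_subset:
  assumes "M \<in> bounded"
  shows "code M \<subseteq> data_set \<times> data_set \<times> data_set \<times> data_set"
proof -
  have M: "psh_mod M" using assms by (simp add: bounded_def)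
  have "s \<odot>\<^bsub>mod_at M v\<^esub> y \<oplus>\<^bsub>mod_at M v\<^esub> z \<in> carrier (mod_at M v)"
    if "v \<in> Obj C" "s \<in> carrier (ring_at R v)" "y \<in> carrier (mod_at M v)" "z \<in> carrier (mod_at M v)" for v s y z
  proof -
    interpret module "ring_at R v" "mod_at M v" by (rule module_at[OF M that(1)])
    show ?thesis using that by simp
  qed
  then have "code_lin M \<subseteq> data_set \<times> data_set \<times> data_set \<times> data_set"
    unfolding code_lin_def by (auto intro!: enc(2)[OF assms] simp del: Plus_def)
  moreover have "code_res M \<subseteq> data_set \<times> data_set \<times> data_set \<times> data_set"
    unfolding code_res_def by (auto intro!: enc(2)[OF assms] res_closed[OF M])
  ultimately show ?thesis by (simp add: code_def)
qed

text \<open>The arrow decodes in \<open>N\<close> what was encoded in \<open>M\<close>. Equal codes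
  mean equal graphs of the operations, so it is linear and natural; surjectivity is what the
  generator relies on.\<close>

lemma code_iso:
  assumes M: "M \<in> bounded" and N: "N \<in> bounded" and code: "code M = code N"
  shows "\<exists>\<theta> \<in> Hom D M N. \<forall>v \<in> Obj C. img_at \<theta> v = carrier (mod_at N v)"
proof -
  have Mc: "cart_mod M" and Nc: "cart_mod N" and M': "psh_mod M" and N': "psh_mod N"
    using M N by (auto simp: bounded_def)
  have lin: "code_lin M = code_lin N" and res: "code_res M = code_res N"
  proof -
    \<comment> \<open>The tag of the first entry, an arrow or a scalar, separates the two halves of
      a code.\<close>
    have "code_lin M = {p \<in> code M. \<exists>b. fst p = Inr b}" for M by (auto simp: code_def code_lin_def code_res_def)
    then show "code_lin M = code_lin N" using code by simp
    have "code_res M = {p \<in> code M. \<exists>b. fst p = Inl b}" for M by (auto simp: code_def code_lin_def code_res_def)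
    then show "code_res M = code_res N" using code by simp
  qed
  define \<theta> where "\<theta> v x = inv_into (carrier (mod_at N v)) (enc N v) (enc M v x)" for v x
  have \<theta>_eq: "\<theta> v x = y" if "v \<in> Obj C" "y \<in> carrier (mod_at N v)" "enc N v y = enc M v x" for v x y
    unfolding \<theta>_def using inv_into_f_eq[OF enc(1)[OF N that(1)] that(2,3)] .
  \<comment> \<open>Stated for arbitrary \<open>A\<close> and \<open>B\<close> because surjectivity
    reads the codes in the opposite direction, from \<open>N\<close> to \<open>M\<close>.\<close>
  have dec_lin: "\<exists>y' z'. y' \<in> carrier (mod_at B v) \<and> z' \<in> carrier (mod_at B v) \<and> enc B v y' = enc A v y \<and>
      enc B v z' = enc A v z \<and> enc B v (s \<odot>\<^bsub>mod_at B v\<^esub> y' \<oplus>\<^bsub>mod_at B v\<^esub> z') =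
        enc A v (s \<odot>\<^bsub>mod_at A v\<^esub> y \<oplus>\<^bsub>mod_at A v\<^esub> z)"
    if AB: "code_lin A = code_lin B" and syz: "v \<in> Obj C" "s \<in> carrier (ring_at R v)" "y \<in> carrier (mod_at A v)"
      "z \<in> carrier (mod_at A v)" for A B v s y z
  proof -
    have "(Inr (Inl (v, s)), enc A v y, enc A v z, enc A v (s \<odot>\<^bsub>mod_at A v\<^esub> y \<oplus>\<^bsub>mod_at A v\<^esub> z)) \<in> code_lin A"
      using syz unfolding code_lin_def by blast
    then obtain y' z' where "y' \<in> carrier (mod_at B v)" "z' \<in> carrier (mod_at B v)" "enc A v y = enc B v y'"
      "enc A v z = enc B v z'" "enc A v (s \<odot>\<^bsub>mod_at A v\<^esub> y \<oplus>\<^bsub>mod_at A v\<^esub> z) =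
        enc B v (s \<odot>\<^bsub>mod_at B v\<^esub> y' \<oplus>\<^bsub>mod_at B v\<^esub> z')"
      unfolding AB unfolding code_lin_def by auto
    then show ?thesis by (intro exI[of _ y'] exI[of _ z'] conjI) simp_all
  qed
  have dec_res: "\<exists>y'. y' \<in> carrier (mod_at N (Cod C a)) \<and> enc N (Cod C a) y' = enc M (Cod C a) y \<and>
      enc N (Dom C a) (mod_res N a y') = enc M (Dom C a) (mod_res M a y)"
    if "a \<in> Arr C" "y \<in> carrier (mod_at M (Cod C a))" for a y
  proof -
    have "(Inl a, enc M (Cod C a) y, enc M (Cod C a) y, enc M (Dom C a) (mod_res M a y)) \<in> code_res M"
      using that unfolding code_res_def by blast
    then show ?thesis unfolding res unfolding code_res_def by auto
  qed
  have nat: "nat_hom M N \<theta>"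
  proof (rule nat_homI)
    fix v assume v: "v \<in> Obj C"
    interpret M: module "ring_at R v" "mod_at M v" by (rule module_at[OF M' v])
    interpret N: module "ring_at R v" "mod_at N v" by (rule module_at[OF N' v])
    have *: "\<theta> v y \<in> carrier (mod_at N v) \<and> \<theta> v z \<in> carrier (mod_at N v) \<and>
        \<theta> v (s \<odot>\<^bsub>mod_at M v\<^esub> y \<oplus>\<^bsub>mod_at M v\<^esub> z) = s \<odot>\<^bsub>mod_at N v\<^esub> \<theta> v y \<oplus>\<^bsub>mod_at N v\<^esub> \<theta> v z"
      if syz: "s \<in> carrier (ring_at R v)" "y \<in> carrier (mod_at M v)" "z \<in> carrier (mod_at M v)" for s y z
    proof -
      obtain y' z' where y': "y' \<in> carrier (mod_at N v)" "enc N v y' = enc M v y"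
        and z': "z' \<in> carrier (mod_at N v)" "enc N v z' = enc M v z"
        and yz: "enc N v (s \<odot>\<^bsub>mod_at N v\<^esub> y' \<oplus>\<^bsub>mod_at N v\<^esub> z') = enc M v (s \<odot>\<^bsub>mod_at M v\<^esub> y \<oplus>\<^bsub>mod_at M v\<^esub> z)"
        using dec_lin[OF lin v syz] by blast
      have c: "s \<odot>\<^bsub>mod_at N v\<^esub> y' \<oplus>\<^bsub>mod_at N v\<^esub> z' \<in> carrier (mod_at N v)" using syz y' z' by simp
      show ?thesis using \<theta>_eq[OF v y'] \<theta>_eq[OF v z'] \<theta>_eq[OF v c yz] y' z' by simp
    qed
    have add: "\<theta> v (y \<oplus>\<^bsub>mod_at M v\<^esub> z) = \<theta> v y \<oplus>\<^bsub>mod_at N v\<^esub> \<theta> v z" and cl: "\<theta> v y \<in> carrier (mod_at N v)"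
      if "y \<in> carrier (mod_at M v)" "z \<in> carrier (mod_at M v)" for y z
      using *[OF M.R.one_closed that] that by simp_all
    \<comment> \<open>Scalar multiples are encoded only within linear combinations, so they become
      accessible once zero is known to go to zero.\<close>
    have 0: "\<theta> v \<zero>\<^bsub>mod_at M v\<^esub> = \<zero>\<^bsub>mod_at N v\<^esub>"
      using add[of "\<zero>\<^bsub>mod_at M v\<^esub>" "\<zero>\<^bsub>mod_at M v\<^esub>"] cl[of "\<zero>\<^bsub>mod_at M v\<^esub>" "\<zero>\<^bsub>mod_at M v\<^esub>"]
      by (simp add: N.M.add.r_cancel_one')
    show "\<theta> v \<in> mod_hom (ring_at R v) (mod_at M v) (mod_at N v)"
    proof (rule mod_homI)
      fix s y assume "s \<in> carrier (ring_at R v)" "y \<in> carrier (mod_at M v)"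
      then show "\<theta> v (s \<odot>\<^bsub>mod_at M v\<^esub> y) = s \<odot>\<^bsub>mod_at N v\<^esub> \<theta> v y"
        using *[of s y "\<zero>\<^bsub>mod_at M v\<^esub>"] by (simp add: 0)
    qed (use add cl in auto)
  next
    fix a y assume a: "a \<in> Arr C" and y: "y \<in> carrier (mod_at M (Cod C a))"
    then obtain y' where y': "y' \<in> carrier (mod_at N (Cod C a))" "enc N (Cod C a) y' = enc M (Cod C a) y"
      "enc N (Dom C a) (mod_res N a y') = enc M (Dom C a) (mod_res M a y)"
      using dec_res by blast
    show "\<theta> (Dom C a) (mod_res M a y) = mod_res N a (\<theta> (Cod C a) y)"
      using \<theta>_eq[OF _ y'(1,2)] \<theta>_eq[OF _ res_closed[OF N' a y'(1)] y'(3)] a by simp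
  qed
  have \<theta>: "arrow M N \<theta> \<in> Hom D M N" by (rule arrow_Hom[OF Mc Nc nat])
  show ?thesis
  proof (rule bexI[OF _ \<theta>], rule ballI)
    fix v assume v: "v \<in> Obj C"
    interpret N: module "ring_at R v" "mod_at N v" by (rule module_at[OF N' v])
    have "carrier (mod_at N v) \<subseteq> img_at (arrow M N \<theta>) v"
    proof
      fix y assume y: "y \<in> carrier (mod_at N v)"
      \<comment> \<open>A linear combination involving \<open>y\<close> is part of the code, so the
        number of \<open>y\<close> is also the number of an element of \<open>M\<close>.\<close>
      obtain x where x: "x \<in> carrier (mod_at M v)" "enc M v x = enc N v y"
        using dec_lin[OF lin[symmetric] v N.R.one_closed y y] by blast
      then have "cmp (arrow M N \<theta>) v x = y" using \<theta>_eq[OF v y] v by simp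
      then show "y \<in> img_at (arrow M N \<theta>) v" 
        using x(1) unfolding img_at_def Hom_fst(1)[OF \<theta>] by auto
    qed
    moreover have "img_at (arrow M N \<theta>) v \<subseteq> carrier (mod_at N v)"
      using cmp_closed[OF \<theta> v] by (auto simp: img_at_def Hom_fst(1)[OF \<theta>])
    ultimately show "img_at (arrow M N \<theta>) v = carrier (mod_at N v)" by (rule subset_antisym[rotated])
  qed
qed

text \<open>Codes are subsets of a fourfold product of \<open>data_set\<close>, which is no larger
  than \<open>data_set\<close>; this is the step that requires the power set of
  \<open>data_set\<close> to be small.\<close>

lemma small_codes: "small \<kappa> (code ` bounded)"
proof -
  have "|data_set \<times> data_set \<times> data_set \<times> data_set| \<le>o |data_set|"
    by (intro card_data_set_Times ordLeq_refl card_of_Card_order)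
  then have "|Pow (data_set \<times> data_set \<times> data_set \<times> data_set)| \<le>o |Pow data_set|"
    by (rule card_of_Pow_mono)
  moreover have "|code ` bounded| \<le>o |Pow (data_set \<times> data_set \<times> data_set \<times> data_set)|"
    by (rule card_of_mono1) (use code_subset in blast)
  ultimately have "|code ` bounded| \<le>o |Pow data_set|" by (rule ordLeq_transitive[rotated])
  then show ?thesis using small_ordLeq small_data unfolding small_data_def by blast
qed

text \<open>The coproduct runs over codes because \<open>bounded\<close> itself need not be small.
  One representative per code suffices: arrows that differ at \<open>x\<close> already differ on a
  bounded submodule containing \<open>x\<close>, and a representative maps onto that
  submodule.\<close>

lemma generator_exists: "\<exists>G. is_generator D G"
proof -
  define rep where "rep c = (SOME M. M \<in> bounded \<and> code M = c)" for c
  have rep: "rep c \<in> bounded" "code (rep c) = c" if "c \<in> code ` bounded" for c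
  proof -
    have "\<exists>M. M \<in> bounded \<and> code M = c" using that by auto
    from someI_ex[OF this] show "rep c \<in> bounded" "code (rep c) = c" by (simp_all add: rep_def)
  qed
  have repc: "cart_mod (rep c)" if "c \<in> code ` bounded" for c using rep[OF that] by (simp add: bounded_def)
  have "\<exists>G \<iota>. is_coproduct D (code ` bounded) rep G \<iota>"
    by (rule coproduct_exists[OF small_codes repc])
  then obtain G \<iota> where cop: "is_coproduct D (code ` bounded) rep G \<iota>" by (elim exE)
  have Gc: "cart_mod G" using cop by (simp add: is_coproduct_def D_simps(1))
  have \<iota>: "\<iota> c \<in> Hom D (rep c) G" if "c \<in> code ` bounded" for c
    using cop that unfolding is_coproduct_def by (elim conjE bspec)
  have "\<exists>h \<in> Hom D G M. Comp D f h \<noteq> Comp D g h"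
    if f: "f \<in> Hom D M N" and g: "g \<in> Hom D M N" and "f \<noteq> g" for M N f g
  proof -
    have Mc: "cart_mod M" by (rule Hom_cart(1)[OF f])
    obtain v x where v: "v \<in> Obj C" and x: "x \<in> carrier (mod_at M v)" and neq: "cmp f v x \<noteq> cmp g v x"
      using Hom_eqI[OF f g] \<open>f \<noteq> g\<close> by metis
    obtain H where HM: "\<And>v. v \<in> Obj C \<Longrightarrow> H v \<subseteq> carrier (mod_at M v)" and Y: "cart_mod (sub_psh M H)"
      and xH: "x \<in> H v" and card: "\<And>v. |H v| \<le>o |data_set|"
      by (rule small_cartesian_submodule[OF Mc v x]) (rule that)
    define Y where "Y = sub_psh M H"
    have Yb: "Y \<in> bounded" using Y card by (simp add: bounded_def Y_def)
    have "nat_hom Y M (\<lambda>v x. x)"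
    proof (rule nat_homI)
      show "(\<lambda>x. x) \<in> mod_hom (ring_at R v) (mod_at Y v) (mod_at M v)" if "v \<in> Obj C" for v
        using HM[OF that] by (auto simp: Y_def mod_hom_def)
    qed (simp add: Y_def)
    then have inc: "arrow Y M (\<lambda>v x. x) \<in> Hom D Y M" by (rule arrow_Hom[OF Y[folded Y_def] Mc])
    define c where "c = code Y"
    have c: "c \<in> code ` bounded" using Yb by (simp add: c_def)
    obtain \<theta> where \<theta>: "\<theta> \<in> Hom D (rep c) Y" and \<theta>_surj: "\<forall>v \<in> Obj C. img_at \<theta> v = carrier (mod_at Y v)"
      using code_iso[OF rep(1)[OF c] Yb] rep(2)[OF c] c_def by blast
    \<comment> \<open>On the summand of \<open>c\<close> the arrow reaches \<open>x\<close>; on the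
      others it is filled up with zero so that the universal property of the coproduct
      applies.\<close>
    define k where "k i = (if i = c then Comp D (arrow Y M (\<lambda>v x. x)) \<theta> else hzero (rep i) M)" for i
    have k: "\<forall>i \<in> code ` bounded. k i \<in> Hom D (rep i) M"
      using Comp_in_Hom[OF \<theta> inc] hzero_Hom[OF repc Mc] by (simp add: k_def)
    have M: "M \<in> Obj D" using Mc by (simp add: D_simps(1))
    have "\<forall>y \<in> Obj D. \<forall>f. (\<forall>i \<in> code ` bounded. f i \<in> Hom D (rep i) y) \<longrightarrow>
        (\<exists>!u. u \<in> Hom D G y \<and> (\<forall>i \<in> code ` bounded. Comp D u (\<iota> i) = f i))"
      using cop unfolding is_coproduct_def by (elim conjE)
    from spec[OF bspec[OF this M], of k, THEN mp, OF k, THEN ex1_implies_ex]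
    obtain h where h: "h \<in> Hom D G M" and hk: "\<forall>i \<in> code ` bounded. Comp D h (\<iota> i) = k i" by (elim exE conjE)
    obtain z where z: "z \<in> carrier (mod_at (rep c) v)" "cmp \<theta> v z = x"
    proof -
      have "x \<in> img_at \<theta> v" using \<theta>_surj v xH by (simp add: Y_def)
      then show thesis using that by (auto simp: img_at_def Hom_fst[OF \<theta>])
    qed
    have hz: "cmp h v (cmp (\<iota> c) v z) = x"
    proof -
      have "Comp D h (\<iota> c) = Comp D (arrow Y M (\<lambda>v x. x)) \<theta>" using bspec[OF hk c] by (simp add: k_def)
      then have "cmp h v (cmp (\<iota> c) v z) = cmp (arrow Y M (\<lambda>v x. x)) v (cmp \<theta> v z)"
        using cmp_Comp[OF \<iota>[OF c] v z(1), of h] cmp_Comp[OF \<theta> v z(1), of "arrow Y M (\<lambda>v x. x)"] by simp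
      then show ?thesis using z cmp_closed[OF \<theta> v z(1)] v by simp
    qed
    have "Comp D f h \<noteq> Comp D g h"
    proof
      assume "Comp D f h = Comp D g h"
      then have "cmp f v x = cmp g v x"
        using cmp_Comp[OF h v cmp_closed[OF \<iota>[OF c] v z(1)], of f]
          cmp_Comp[OF h v cmp_closed[OF \<iota>[OF c] v z(1)], of g] hz by simp
      then show False using neq by simp
    qed
    then show ?thesis using h by blast
  qed
  then have "is_generator D G" using Gc by (simp add: is_generator_def D_simps(1))
  then show ?thesis by blast
qed

end

theorem mainTheorem3:
  fixes \<kappa> :: "'u rel"
    and C :: "('o, 'a) cat"
    and R :: "('o, 'a, 'r) ring_psh"
  assumes "universe \<kappa>"
    and "category C"
    and "cring_presheaf C R"
    and "small_data \<kappa> C R"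
    and "flat_presheaf \<kappa> C R"
  shows "grothendieck_category \<kappa> (Mod_cart \<kappa> C R)"
proof -
  interpret flat_presheaf_data \<kappa> C R
    using assms by (rule flat_presheaf_data.intro)
  show ?thesis
    unfolding grothendieck_category_def
    using abelian_D has_coproducts_D has_direct_limits_D direct_limits_exact_D generator_exists by blast
qed

end
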